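(* For each fixed $z$ with $0<|z|<1$, the function $u(\tau,\gamma,x)=U_{\rm per}(\tau,\gamma,x):=\partial_{xx}\log\det(\mathbf I-\mathbf K_z)$, on the open set of $(\tau,\gamma,x)$, $\tau>0$, where $\det(\mathbf I-\mathbf K_z)\neq0$, and the function $u(\tau,\gamma,x)=U_{\rm KPZ}(\tau,\gamma,x):=\partial_{xx}\log\det(\mathbf I-\mathbf K_{\rm KPZ})$, for $\tau>0$ and $\gamma,x\in\mathbb R$, are solutions of the KP-II equation $$12u_{\gamma\gamma}+\left(12u_\tau+12uu_x+u_{xxx}\right)_x=0 .$$
   Context: Roots and logarithms are principal. $\mathrm{Li}_s(z)=\sum_{k\ge1}z^k/k^s$ for $|z|<1$, continued analytically to $\mathbb C\setminus[1,\infty)$. For $0<|z|<1$, $\mathcal S_-=\{\xi\in\mathbb C:e^{-\xi^2/2}=z,\ \mathrm{Re}\,\xi<0\}$, a subset of the sector $3\pi/4<\arg\xi<5\pi/4$; in that sector $Q(\xi)=\sqrt{2/\pi}\int_{-\infty}^\xi\mathrm{Li}_{1/2}(e^{-s^2/2})ds$ (path in the sector) and $\Phi(\xi)=-\frac13\tau\xi^3+x\xi-Q(\xi)$. $\mathbf K_z$ is the trace class operator on $\ell^2(\mathcal S_-)$ with kernel $$\mathbf K_z(\xi_1,\xi_2)=\sum_{\eta\in\mathcal S_-}\frac{e^{\frac12\Phi(\xi_1)+\Phi(\eta)+\frac12\Phi(\xi_2)+\frac\gamma4(\xi_1^2-2\eta^2+\xi_2^2)}}{\sqrt{-\xi_1}(-\eta)(\xi_1+\eta)(\eta+\xi_2)\sqrt{-\xi_2}}.$$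 $\mathbf K_{\rm KPZ}=\mathbf A_{-\gamma}\mathbf A_\gamma$ on $L^2(0,\infty)$, where $\mathbf A_\gamma$ has kernel $\mathcal A_\gamma(s+x+t)$, $\mathcal A_\gamma(s)=\frac1{2\pi i}\int_{\Lambda_-}e^{-\frac\tau3u^3+\frac\gamma2u^2+su}du$, with $\Lambda_-$ an unbounded contour from $e^{-i\theta_1}\infty$ to $e^{i\theta_2}\infty$, $\theta_1,\theta_2\in(\pi/2,5\pi/6)$; equivalently $\det(\mathbf I-\mathbf K_{\rm KPZ})=F_{\rm GUE}(x\tau^{-1/3}+\gamma^2/(4\tau^{4/3}))$ with $F_{\rm GUE}$ the GUE Tracy–Widom distribution. *)

theory Defs
  imports "HOL-Complex_Analysis.Complex_Analysis" "Jordan_Normal_Form.Determinant"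
begin

text \<open>
  The Fredholm determinant of the identity minus the integral operator on \<open>L\<^sup>2(M)\<close> with
  kernel \<open>K\<close>, given by the Fredholm series.  With \<open>M = count_space S\<close> the integrals are sums over
  \<open>S\<^sup>n\<close>, so this also covers operators on \<open>\<ell>\<^sup>2(S)\<close>.
\<close>

definition fredholm_det :: "'a measure \<Rightarrow> ('a \<Rightarrow> 'a \<Rightarrow> complex) \<Rightarrow> complex" where
  "fredholm_det M K =
     (\<Sum>n. (-1) ^ n / fact n *
        (LINT p|PiM {..<n} (\<lambda>_. M). Determinant.det (Matrix.mat n n (\<lambda>(i, j). K (p i) (p j)))))"

definition kernel_comp ::
  "'a measure \<Rightarrow> ('a \<Rightarrow> 'a \<Rightarrow> complex) \<Rightarrow> ('a \<Rightarrow> 'a \<Rightarrow> complex) \<Rightarrow> 'a \<Rightarrow> 'a \<Rightarrow> complex" where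
  "kernel_comp M A B s t = (LINT r|M. A s r * B r t)"

text \<open>
  Only the defining series of \<open>Li\<^sub>s\<close>, valid in the open unit disc, is needed: see
  \<open>norm_exp_less_1_in_sector\<close> below.
\<close>

definition polylog :: "real \<Rightarrow> complex \<Rightarrow> complex" where
  "polylog s w = (\<Sum>k. w ^ Suc k / of_real (real (Suc k) powr s))"

text \<open>The sector \<open>3\<pi>/4 < arg \<xi> < 5\<pi>/4\<close>.\<close>

definition left_sector :: "complex set" where
  "left_sector = {\<xi>. \<bar>Im \<xi>\<bar> < - Re \<xi>}"

definition S_minus :: "complex \<Rightarrow> complex set" where
  "S_minus z = {\<xi>. exp (- (\<xi>\<^sup>2) / 2) = z \<and> Re \<xi> < 0}"

text \<open>
  The path from \<open>-\<infinity>\<close> to \<open>\<xi>\<close> is taken to be the horizontal ray ending in \<open>\<xi>\<close>, which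
  lies in the sector; the integral does not depend on the path chosen in the sector.
\<close>

definition Q_fun :: "complex \<Rightarrow> complex" where
  "Q_fun \<xi> = of_real (sqrt (2 / pi)) *
     Lim at_top (\<lambda>R::real. contour_integral (linepath (\<xi> - of_real R) \<xi>)
                             (\<lambda>s. polylog (1/2) (exp (- (s\<^sup>2) / 2))))"

lemma norm_exp_less_1_in_sector:
  assumes "s \<in> left_sector"
  shows "norm (exp (- (s\<^sup>2) / 2)) < 1"
proof -
  have "(Im s)\<^sup>2 < (Re s)\<^sup>2"
    using assms power_strict_mono[of "\<bar>Im s\<bar>" "- Re s" 2] by (simp add: left_sector_def)
  then show ?thesis by (simp add: Re_power2)
qed

lemma S_minus_subset_sector:
  assumes "norm z < 1"
  shows "S_minus z \<subseteq> left_sector"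
proof
  fix \<xi> assume \<xi>: "\<xi> \<in> S_minus z"
  then have "norm (exp (- (\<xi>\<^sup>2) / 2)) < 1" and re: "Re \<xi> < 0"
    using assms by (auto simp: S_minus_def)
  then have "(Im \<xi>)\<^sup>2 < (- Re \<xi>)\<^sup>2" by (simp add: Re_power2)
  then have "\<bar>Im \<xi>\<bar> < \<bar>- Re \<xi>\<bar>" by (simp add: abs_square_less_1 power2_less_imp_less abs_le_square_iff flip: not_le)
  then show "\<xi> \<in> left_sector" using re by (simp add: left_sector_def)
qed

lemma ray_in_sector:
  assumes "\<xi> \<in> left_sector" "0 \<le> R"
  shows "closed_segment (\<xi> - of_real R) \<xi> \<subseteq> left_sector"
proof
  fix s assume "s \<in> closed_segment (\<xi> - of_real R) \<xi>"
  then obtain u where "0 \<le> u" "u \<le> 1" "s = (1 - u) *\<^sub>R (\<xi> - of_real R) + u *\<^sub>R \<xi>"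
    by (auto simp: in_segment)
  then have "s = \<xi> - of_real ((1 - u) * R)" "0 \<le> (1 - u) * R"
    using assms(2) by (simp_all add: scaleR_conv_of_real algebra_simps mult_left_le)
  then show "s \<in> left_sector" using assms(1) by (simp add: left_sector_def)
qed

definition Phi :: "real \<Rightarrow> real \<Rightarrow> complex \<Rightarrow> complex" where
  "Phi \<tau> x \<xi> = - (1/3) * of_real \<tau> * \<xi> ^ 3 + of_real x * \<xi> - Q_fun \<xi>"

definition K_per :: "complex \<Rightarrow> real \<Rightarrow> real \<Rightarrow> real \<Rightarrow> complex \<Rightarrow> complex \<Rightarrow> complex" where
  "K_per z \<tau> \<gamma> x \<xi>1 \<xi>2 =
     (\<Sum>\<^sub>\<infinity>\<eta>\<in>S_minus z.
        exp (Phi \<tau> x \<xi>1 / 2 + Phi \<tau> x \<eta> + Phi \<tau> x \<xi>2 / 2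
             + of_real (\<gamma> / 4) * (\<xi>1\<^sup>2 - 2 * \<eta>\<^sup>2 + \<xi>2\<^sup>2)) /
        (csqrt (- \<xi>1) * (- \<eta>) * (\<xi>1 + \<eta>) * (\<eta> + \<xi>2) * csqrt (- \<xi>2)))"

definition D_per :: "complex \<Rightarrow> real \<Rightarrow> real \<Rightarrow> real \<Rightarrow> complex" where
  "D_per z \<tau> \<gamma> x = fredholm_det (count_space (S_minus z)) (K_per z \<tau> \<gamma> x)"

text \<open>
  The contour is made of two rays: it comes from infinity in direction \<open>cis (- \<theta>1)\<close> to the
  origin and leaves to infinity in direction \<open>cis \<theta>2\<close>.  For \<open>\<pi>/2 < \<theta>1, \<theta>2 < 5\<pi>/6\<close> the real part
  of \<open>u\<^sup>3\<close> is positive along both rays.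
\<close>

definition Airy_gamma :: "real \<Rightarrow> real \<Rightarrow> real \<Rightarrow> real \<Rightarrow> real \<Rightarrow> complex" where
  "Airy_gamma \<theta>1 \<theta>2 \<tau> \<gamma> s = 1 / (2 * of_real pi * \<i>) *
     Lim at_top (\<lambda>R::real.
       contour_integral
         (linepath (of_real R * cis (- \<theta>1)) 0 +++ linepath 0 (of_real R * cis \<theta>2))
         (\<lambda>u. exp (- of_real (\<tau> / 3) * u ^ 3 + of_real (\<gamma> / 2) * u\<^sup>2 + of_real s * u)))"

abbreviation pos_half_line :: "real measure" where
  "pos_half_line \<equiv> restrict_space lborel {0<..}"

definition A_kernel ::
  "real \<Rightarrow> real \<Rightarrow> real \<Rightarrow> real \<Rightarrow> real \<Rightarrow> real \<Rightarrow> real \<Rightarrow> complex" where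
  "A_kernel \<theta>1 \<theta>2 \<tau> \<gamma> x s t = Airy_gamma \<theta>1 \<theta>2 \<tau> \<gamma> (s + x + t)"

definition K_KPZ ::
  "real \<Rightarrow> real \<Rightarrow> real \<Rightarrow> real \<Rightarrow> real \<Rightarrow> real \<Rightarrow> real \<Rightarrow> complex" where
  "K_KPZ \<theta>1 \<theta>2 \<tau> \<gamma> x =
     kernel_comp pos_half_line (A_kernel \<theta>1 \<theta>2 \<tau> (- \<gamma>) x) (A_kernel \<theta>1 \<theta>2 \<tau> \<gamma> x)"

definition D_KPZ :: "real \<Rightarrow> real \<Rightarrow> real \<Rightarrow> real \<Rightarrow> real \<Rightarrow> complex" where
  "D_KPZ \<theta>1 \<theta>2 \<tau> \<gamma> x = fredholm_det pos_half_line (K_KPZ \<theta>1 \<theta>2 \<tau> \<gamma> x)"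

text \<open>
  \<open>has_dxx_log f u x\<close>: near \<open>x\<close> there is a differentiable branch \<open>L\<close> of \<open>log f\<close>
  whose second derivative at \<open>x\<close> exists and equals \<open>u\<close>.  The principal logarithm of \<open>f\<close>
  would fail to be differentiable where \<open>f\<close> crosses the negative real axis; the value \<open>u\<close> does
  not depend on the branch.
\<close>

definition has_dxx_log :: "(real \<Rightarrow> complex) \<Rightarrow> complex \<Rightarrow> real \<Rightarrow> bool" where
  "has_dxx_log f u x \<longleftrightarrow>
     (\<exists>L L'. (\<forall>\<^sub>F t in nhds x. exp (L t) = f t \<and> (L has_vector_derivative L' t) (at t)) \<and>
             (L' has_vector_derivative u) (at x))"

definition dxx_log :: "(real \<Rightarrow> complex) \<Rightarrow> real \<Rightarrow> complex" where
  "dxx_log f x = (THE u. has_dxx_log f u x)"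

lemma has_dxx_log_unique:
  assumes "has_dxx_log f u x" "has_dxx_log f v x"
  shows "u = v"
proof -
  have deriv: "\<forall>\<^sub>F t in nhds x. M' t = vector_derivative f (at t) / f t"
    if M: "\<forall>\<^sub>F t in nhds x. exp (M t) = f t \<and> (M has_vector_derivative M' t) (at t)" for M M'
  proof -
    have "\<forall>\<^sub>F t in nhds x. \<forall>\<^sub>F s in nhds t. exp (M s) = f s \<and> (M has_vector_derivative M' s) (at s)"
      using M by (simp add: eventually_eventually)
    then show ?thesis
    proof eventually_elim
      case (elim t)
      have eq: "exp (M t) = f t" and der: "(M has_vector_derivative M' t) (at t)"
        using eventually_nhds_x_imp_x[OF elim] by auto
      have "((\<lambda>s. exp (M s)) has_vector_derivative M' t * exp (M t)) (at t)"
        using field_vector_diff_chain_at[OF der, of exp "exp (M t)"]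
        by (auto simp: o_def intro: DERIV_exp)
      moreover have "\<forall>\<^sub>F s in nhds t. exp (M s) = f s"
        using elim by eventually_elim simp
      ultimately have "(f has_vector_derivative M' t * exp (M t)) (at t)"
        using has_vector_derivative_cong_ev[of UNIV "\<lambda>s. exp (M s)" f t] eq
        by (auto elim: eventually_mono)
      then have "vector_derivative f (at t) = M' t * f t"
        using eq vector_derivative_at by metis
      moreover have "f t \<noteq> 0" using eq exp_not_eq_zero by metis
      ultimately show ?case by simp
    qed
  qed
  obtain L L' where L: "\<forall>\<^sub>F t in nhds x. exp (L t) = f t \<and> (L has_vector_derivative L' t) (at t)"
    "(L' has_vector_derivative u) (at x)" using assms(1) by (auto simp: has_dxx_log_def)
  obtain M M' where M: "\<forall>\<^sub>F t in nhds x. exp (M t) = f t \<and> (M has_vector_derivative M' t) (at t)"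
    "(M' has_vector_derivative v) (at x)" using assms(2) by (auto simp: has_dxx_log_def)
  have ev: "\<forall>\<^sub>F t in nhds x. L' t = M' t"
    using deriv[OF L(1)] deriv[OF M(1)] by eventually_elim simp
  have "(M' has_vector_derivative u) (at x)"
    using has_vector_derivative_cong_ev[of UNIV L' M' x] L(2) ev eventually_nhds_x_imp_x[OF ev]
    by (auto elim: eventually_mono)
  then show ?thesis using M(2) vector_derivative_unique_at by blast
qed

lemma dxx_log_eqI: "has_dxx_log f u x \<Longrightarrow> dxx_log f x = u"
  unfolding dxx_log_def using has_dxx_log_unique by blast

definition U_per :: "complex \<Rightarrow> real \<Rightarrow> real \<Rightarrow> real \<Rightarrow> complex" where
  "U_per z \<tau> \<gamma> x = dxx_log (D_per z \<tau> \<gamma>) x"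

definition U_KPZ :: "real \<Rightarrow> real \<Rightarrow> real \<Rightarrow> real \<Rightarrow> real \<Rightarrow> complex" where
  "U_KPZ \<theta>1 \<theta>2 \<tau> \<gamma> x = dxx_log (D_KPZ \<theta>1 \<theta>2 \<tau> \<gamma>) x"

definition d_tau :: "(real \<Rightarrow> real \<Rightarrow> real \<Rightarrow> complex) \<Rightarrow> real \<Rightarrow> real \<Rightarrow> real \<Rightarrow> complex" where
  "d_tau u \<tau> \<gamma> x = vector_derivative (\<lambda>t. u t \<gamma> x) (at \<tau>)"

definition d_gamma :: "(real \<Rightarrow> real \<Rightarrow> real \<Rightarrow> complex) \<Rightarrow> real \<Rightarrow> real \<Rightarrow> real \<Rightarrow> complex" where
  "d_gamma u \<tau> \<gamma> x = vector_derivative (\<lambda>g. u \<tau> g x) (at \<gamma>)"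

definition d_x :: "(real \<Rightarrow> real \<Rightarrow> real \<Rightarrow> complex) \<Rightarrow> real \<Rightarrow> real \<Rightarrow> real \<Rightarrow> complex" where
  "d_x u \<tau> \<gamma> x = vector_derivative (\<lambda>y. u \<tau> \<gamma> y) (at x)"

text \<open>
  Classical solutions on an open set: all partial derivatives occurring in the equation are
  required to exist, since \<^const>\<open>vector_derivative\<close> is unspecified where there is no derivative.
\<close>

definition KPII_solution_on ::
  "(real \<times> real \<times> real) set \<Rightarrow> (real \<Rightarrow> real \<Rightarrow> real \<Rightarrow> complex) \<Rightarrow> bool" where
  "KPII_solution_on \<Omega> u \<longleftrightarrow> open \<Omega> \<and>
     (\<forall>(\<tau>, \<gamma>, x) \<in> \<Omega>.
        (\<lambda>g. u \<tau> g x) differentiable (at \<gamma>) \<and>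
        (\<lambda>g. d_gamma u \<tau> g x) differentiable (at \<gamma>) \<and>
        (\<lambda>t. u t \<gamma> x) differentiable (at \<tau>) \<and>
        (\<lambda>y. d_tau u \<tau> \<gamma> y) differentiable (at x) \<and>
        (\<lambda>y. u \<tau> \<gamma> y) differentiable (at x) \<and>
        (\<lambda>y. d_x u \<tau> \<gamma> y) differentiable (at x) \<and>
        (\<lambda>y. d_x (d_x u) \<tau> \<gamma> y) differentiable (at x) \<and>
        (\<lambda>y. d_x (d_x (d_x u)) \<tau> \<gamma> y) differentiable (at x) \<and>
        12 * d_gamma (d_gamma u) \<tau> \<gamma> x +
        d_x (\<lambda>t g y. 12 * d_tau u t g y + 12 * u t g y * d_x u t g y
                     + d_x (d_x (d_x u)) t g y) \<tau> \<gamma> x = 0)"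

end

theory Submission
  imports Defs "HOL-Probability.Probability" "HOL-Real_Asymp.Real_Asymp"
begin

text \<open>
  Both determinants are Fredholm series whose kernels factor through exponentials: by the cyclic symmetry
  of the series they take the form of a soliton gas
  \<open>F = \<Sum>n (-1)^n / n! \<integral> \<Prod>j c(p_j) exp (k_j x + l_j \<gamma> + w_j \<tau>) det (1 / (u_i + v_j))\<close> with wave numbers
  \<open>k = u + v\<close>, \<open>l = (v^2 - u^2) / 2\<close>, \<open>w = - (u^3 + v^3) / 3\<close>, where the points \<open>p = (u, v)\<close> range over pairs of
  elements of \<open>S_minus z\<close>, respectively over pairs of points on a vertical line.  Since the determinants are
  Cauchy determinants, the Cauchy product of two such series satisfies the bilinear form of KP-II because of
  Hirota's identity for \<open>N\<close>-soliton solutions; the series converge by Hadamard's inequality.  Dividing by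
  \<open>F^2\<close> gives the equation for \<open>u = (log F)_{xx}\<close>.

  The KPZ determinant has no zeros: a conjugation reduces to \<open>\<gamma> = 0\<close>, where the operator is the square
  of \<open>A\<close> with kernel \<open>Ai(s + x + t)\<close>.  A zero produces, by Fredholm's minors, an eigenfunction of \<open>A\<close> with
  eigenvalue \<open>1\<close> or \<open>- 1\<close>.  As the Airy transform on the whole line is a contraction, its image vanishes on
  the negative half line, and it is entire, hence zero.
\<close>

text \<open>The wave numbers are chosen on the dispersion relation k^4 + 12 k w + 12 l^2 = 0, which
  u and v parametrise. Hirota's identity is an induction on the number of solitons: after clearing
  denominators, the sum with one distinguished soliton (s, t) and m others is a polynomial in s of
  degree at most m + 2, because the quartic and cubic terms of the symbol cancel. It vanishes at 2 m
  + 1 points, since there the distinguished soliton fuses with another one or disappears, which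
  leads back to a smaller instance. Convergence rests on one geometric fact: all points satisfy Re
  \<le> - \<delta>, so the entries 1 / (u + v) are bounded and the n^(n/2) of Hadamard is beaten by
  n!. For the Airy kernel this half plane is gained by moving the contour to a vertical line. How
  far it must move depends on \<tau> and \<gamma>, and so does the box of parameters in which the
  gas converges; hence KP-II is proved locally, with one gas for each base point, and the open set
  has to be covered by such boxes.\<close>

abbreviation mdet :: "nat \<Rightarrow> (nat \<Rightarrow> nat \<Rightarrow> 'a::comm_ring_1) \<Rightarrow> 'a" where
  "mdet n f \<equiv> Determinant.det (Matrix.mat n n (\<lambda>(i, j). f i j))"

lemmas lint_cong = Bochner_Integration.integral_cong[OF refl]
lemmas lint_bound = Bochner_Integration.integrable_bound
lemmas lint_cmult = Bochner_Integration.integral_mult_right_zero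

section \<open>Hirota's bilinear identity\<close>

text \<open>The symbol of Hirota's operator D_x^4 + 12 D_x D_\<tau> + 12 D_\<gamma>^2: on a product
  of two exponentials this operator acts as this polynomial in the differences of their wave
  numbers.\<close>

definition kp_symbol :: "complex \<Rightarrow> complex \<Rightarrow> complex \<Rightarrow> complex" where
  "kp_symbol k l w = k ^ 4 + 12 * k * w + 12 * l ^ 2"

definition wave_k :: "complex \<Rightarrow> complex \<Rightarrow> complex" where "wave_k u v = u + v"
definition wave_l :: "complex \<Rightarrow> complex \<Rightarrow> complex" where "wave_l u v = (v\<^sup>2 - u\<^sup>2) / 2"
definition wave_w :: "complex \<Rightarrow> complex \<Rightarrow> complex" where "wave_w u v = - (u ^ 3 + v ^ 3) / 3"

lemmas wave_defs = wave_k_def wave_l_def wave_w_def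

text \<open>The two-by-two Cauchy determinant divided by the product of its diagonal entries, that
  is, the exponentiated phase shift of two solitons.\<close>

definition soliton_int :: "complex \<Rightarrow> complex \<Rightarrow> complex \<Rightarrow> complex \<Rightarrow> complex" where
  "soliton_int u v u' v' = (u - u') * (v - v') / ((u + v') * (u' + v))"

definition cauchy_prod :: "(nat \<Rightarrow> complex) \<Rightarrow> (nat \<Rightarrow> complex) \<Rightarrow> nat set \<Rightarrow> complex" where
  "cauchy_prod u v I = (\<Prod>i\<in>I. 1 / (u i + v i)) *
     (\<Prod>(i, j)\<in>{(i, j). i \<in> I \<and> j \<in> I \<and> i < j}. soliton_int (u i) (v i) (u j) (v j))"

lemma soliton_int_commute: "soliton_int u v u' v' = soliton_int u' v' u v"
proof -
  have "(u - u') * (v - v') = (u' - u) * (v' - v)" by (simp add: algebra_simps)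
  then show ?thesis by (simp add: soliton_int_def mult.commute)
qed

lemma cauchy_prod_empty [simp]: "cauchy_prod u v {} = 1"
  by (simp add: cauchy_prod_def)

lemma cauchy_prod_insert:
  assumes "finite I" "a \<notin> I"
  shows "cauchy_prod u v (insert a I) =
    cauchy_prod u v I / (u a + v a) * (\<Prod>i\<in>I. soliton_int (u a) (v a) (u i) (v i))"
proof -
  let ?A = "\<lambda>(i, j). soliton_int (u i) (v i) (u j) (v j)"
  let ?P = "{(i, j). i \<in> I \<and> j \<in> I \<and> i < j}"
  let ?f = "\<lambda>i. if a < i then (a, i) else (i, a)"
  have eq: "{(i, j). i \<in> insert a I \<and> j \<in> insert a I \<and> i < j} = ?P \<union> ?f ` I"
    using assms(2) by (auto simp: image_iff split: if_splits) (metis linorder_neqE_nat)+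
  have disj: "?P \<inter> ?f ` I = {}" using assms(2) by (auto split: if_splits)
  have fin: "finite ?P" using finite_subset[of ?P "I \<times> I"] assms(1) by auto
  have inj: "inj_on ?f I" using assms(2) by (auto simp: inj_on_def split: if_splits)
  have "(\<Prod>x\<in>?f ` I. ?A x) = (\<Prod>i\<in>I. ?A (?f i))"
    by (subst prod.reindex[OF inj]) simp
  also have "\<dots> = (\<Prod>i\<in>I. soliton_int (u a) (v a) (u i) (v i))"
    by (intro prod.cong refl) (auto simp: soliton_int_commute)
  finally have "(\<Prod>x\<in>{(i, j). i \<in> insert a I \<and> j \<in> insert a I \<and> i < j}. ?A x) =
     (\<Prod>x\<in>?P. ?A x) * (\<Prod>i\<in>I. soliton_int (u a) (v a) (u i) (v i))"
    unfolding eq using fin assms(1) disj by (subst prod.union_disjoint) auto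
  then show ?thesis using assms by (simp add: cauchy_prod_def)
qed

abbreviation "wsum f u v I \<equiv> \<Sum>i\<in>I. f (u i) (v i)"
abbreviation "kp_ext u v s t I J \<equiv> kp_symbol (wave_k s t + wsum wave_k u v I - wsum wave_k u v J)
  (wave_l s t + wsum wave_l u v I - wsum wave_l u v J) (wave_w s t + wsum wave_w u v I - wsum wave_w u v J)"

text \<open>The solitons in \<open>M\<close> are shared out between the two factors of the bilinear
  form in all possible ways; the symbol sees the difference of the two total wave numbers.\<close>

definition hirota_sum :: "(nat \<Rightarrow> complex) \<Rightarrow> (nat \<Rightarrow> complex) \<Rightarrow> nat set \<Rightarrow> complex" where
  "hirota_sum u v M = (\<Sum>I\<in>Pow M.
     kp_symbol (wsum wave_k u v I - wsum wave_k u v (M - I))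
               (wsum wave_l u v I - wsum wave_l u v (M - I))
               (wsum wave_w u v I - wsum wave_w u v (M - I)) *
     cauchy_prod u v I * cauchy_prod u v (M - I))"

text \<open>The part of a Hirota sum in which one more soliton (s, t) sits in the first factor,
  without its own weight 1 / (s + t). It is kept apart from \<open>u\<close> and \<open>v\<close> so
  that s can vary freely.\<close>

definition hirota_half :: "complex \<Rightarrow> complex \<Rightarrow> (nat \<Rightarrow> complex) \<Rightarrow> (nat \<Rightarrow> complex) \<Rightarrow> nat set \<Rightarrow> complex" where
  "hirota_half s t u v M = (\<Sum>I\<in>Pow M.
     kp_ext u v s t I (M - I) *
     (\<Prod>i\<in>I. soliton_int s t (u i) (v i)) * cauchy_prod u v I * cauchy_prod u v (M - I))"

text \<open>\<open>hirota_half\<close> multiplied by all s + v i: this removes the poles in s, and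
  each term becomes a polynomial in s.\<close>

definition hirota_numer :: "complex \<Rightarrow> complex \<Rightarrow> (nat \<Rightarrow> complex) \<Rightarrow> (nat \<Rightarrow> complex) \<Rightarrow> nat set \<Rightarrow> complex" where
  "hirota_numer s t u v M = (\<Sum>I\<in>Pow M.
     kp_ext u v s t I (M - I) *
     (\<Prod>i\<in>I. (t - v i) / (u i + t) * (s - u i)) * (\<Prod>i\<in>M - I. s + v i) *
     cauchy_prod u v I * cauchy_prod u v (M - I))"

lemma kp_symbol_uminus: "kp_symbol (- k) (- l) (- w) = kp_symbol k l w"
  by (simp add: kp_symbol_def)

lemma hirota_numer_eq:
  assumes "finite M" "\<And>i. i \<in> M \<Longrightarrow> s + v i \<noteq> 0"
  shows "hirota_numer s t u v M = (\<Prod>i\<in>M. s + v i) * hirota_half s t u v M"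
proof -
  have "(\<Prod>i\<in>I. (t - v i) / (u i + t) * (s - u i)) * (\<Prod>i\<in>M - I. s + v i)
     = (\<Prod>i\<in>M. s + v i) * (\<Prod>i\<in>I. soliton_int s t (u i) (v i))" if "I \<subseteq> M" for I
  proof -
    have "(\<Prod>i\<in>M. s + v i) = (\<Prod>i\<in>I. s + v i) * (\<Prod>i\<in>M - I. s + v i)"
      by (subst prod.subset_diff[OF that assms(1)]) (rule mult.commute)
    moreover have "(\<Prod>i\<in>I. (t - v i) / (u i + t) * (s - u i)) = (\<Prod>i\<in>I. (s + v i) * soliton_int s t (u i) (v i))"
    proof (intro prod.cong refl)
      fix i assume "i \<in> I"
      then have "s + v i \<noteq> 0" using assms(2) that by auto
      then show "(t - v i) / (u i + t) * (s - u i) = (s + v i) * soliton_int s t (u i) (v i)"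
        by (simp add: soliton_int_def mult_ac)
    qed
    ultimately show ?thesis by (simp add: prod.distrib mult_ac)
  qed
  then show ?thesis
    unfolding hirota_numer_def hirota_half_def sum_distrib_left
    by (intro sum.cong refl) (auto simp: mult_ac)
qed

lemma sum_Pow_insert:
  assumes "finite M" "a \<notin> M"
  shows "(\<Sum>I\<in>Pow (insert a M). f I) = (\<Sum>I\<in>Pow M. f (insert a I)) + (\<Sum>I\<in>Pow M. f I)"
proof -
  have inj: "inj_on (insert a) (Pow M)" using assms(2) by (auto simp: inj_on_def)
  have "(\<Sum>I\<in>Pow (insert a M). f I) = (\<Sum>I\<in>Pow M. f I) + (\<Sum>I\<in>insert a ` Pow M. f I)"
    unfolding Pow_insert using assms by (intro sum.union_disjoint) auto
  then show ?thesis by (simp add: sum.reindex[OF inj] add.commute)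
qed

text \<open>The symbol is even, so exchanging I with its complement matches the terms that contain a
  with those that do not; hence the factor 2.\<close>

lemma hirota_sum_insert:
  assumes M: "finite M" "a \<notin> M"
  shows "hirota_sum u v (insert a M) = 2 / (u a + v a) * hirota_half (u a) (v a) u v M"
proof -
  let ?H = "\<lambda>I J. kp_symbol (wsum wave_k u v I - wsum wave_k u v J)
               (wsum wave_l u v I - wsum wave_l u v J)
               (wsum wave_w u v I - wsum wave_w u v J) *
     cauchy_prod u v I * cauchy_prod u v J"
  have sym: "?H I J = ?H J I" for I J
    using kp_symbol_uminus[of "wsum wave_k u v I - wsum wave_k u v J"
        "wsum wave_l u v I - wsum wave_l u v J"
        "wsum wave_w u v I - wsum wave_w u v J"] by (simp add: mult_ac)
  have "(\<Sum>I\<in>Pow M. ?H I (insert a M - I)) = (\<Sum>I\<in>Pow M. ?H (insert a M - (M - I)) (M - I))"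
    by (rule sum.reindex_bij_witness[of _ "\<lambda>I. M - I" "\<lambda>I. M - I"])
       (use assms(2) in \<open>auto simp: double_diff sym insert_Diff_if\<close>)
  also have "\<dots> = (\<Sum>I\<in>Pow M. ?H (insert a I) (M - I))"
    by (intro sum.cong refl, rule arg_cong2[where f = ?H]) (use assms(2) in auto)
  finally have 1: "(\<Sum>I\<in>Pow M. ?H I (insert a M - I)) = (\<Sum>I\<in>Pow M. ?H (insert a I) (M - I))" .
  have 2: "(\<Sum>I\<in>Pow M. ?H (insert a I) (insert a M - insert a I)) = (\<Sum>I\<in>Pow M. ?H (insert a I) (M - I))"
    using assms(2) by (intro sum.cong refl, intro arg_cong2[where f = ?H]) auto
  have 3: "?H (insert a I) (M - I) = 1 / (u a + v a) * (
     kp_ext u v (u a) (v a) I (M - I) *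
     (\<Prod>i\<in>I. soliton_int (u a) (v a) (u i) (v i)) * cauchy_prod u v I * cauchy_prod u v (M - I))"
    if "I \<in> Pow M" for I
  proof -
    have "finite I" "a \<notin> I" using that assms finite_subset by auto
    then show ?thesis by (simp add: cauchy_prod_insert mult_ac)
  qed
  have "hirota_sum u v (insert a M) = 2 * (\<Sum>I\<in>Pow M. ?H (insert a I) (M - I))"
    unfolding hirota_sum_def sum_Pow_insert[OF M] 1 2 by simp
  also have "\<dots> = 2 / (u a + v a) * hirota_half (u a) (v a) u v M"
  proof -
    have "(\<Sum>I\<in>Pow M. ?H (insert a I) (M - I)) = 1 / (u a + v a) * hirota_half (u a) (v a) u v M"
      unfolding hirota_half_def sum_distrib_left by (rule sum.cong[OF refl 3])
    then show ?thesis by (simp only: mult.assoc[symmetric]) simp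
  qed
  finally show ?thesis .
qed

text \<open>Genericity keeps the denominators nonzero and the prospective roots u i, - v i and - t
  of \<open>hirota_numer\<close> pairwise different.\<close>

definition wave_generic :: "complex \<Rightarrow> complex \<Rightarrow> (nat \<Rightarrow> complex) \<Rightarrow> (nat \<Rightarrow> complex) \<Rightarrow> nat set \<Rightarrow> bool" where
  "wave_generic s t u v M \<longleftrightarrow> inj_on u M \<and> inj_on v M \<and> s \<notin> u ` M \<and> t \<notin> v ` M \<and>
     (\<forall>i\<in>M. \<forall>j\<in>M. u i + v j \<noteq> 0) \<and> (\<forall>i\<in>M. s + v i \<noteq> 0 \<and> u i + t \<noteq> 0)"

section \<open>Fusion of solitons at the roots in s\<close>

lemma wave_generic_uminus_left:
  assumes "wave_generic s t u v (insert j M)" "j \<notin> M"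
  shows "wave_generic (- v j) t u v M" "wave_generic (u j) t u v M" "wave_generic (u j) (v j) u v M"
proof -
  have *: "- v j \<notin> u ` M" "u j \<notin> u ` M" "v j \<notin> v ` M"
    using assms by (auto simp: wave_generic_def inj_on_def add_eq_0_iff2)
  have **: "- v j + v i \<noteq> 0" if "i \<in> M" for i
    using assms that by (auto simp: wave_generic_def inj_on_def)
  show "wave_generic (- v j) t u v M" "wave_generic (u j) t u v M" "wave_generic (u j) (v j) u v M"
    using assms * ** by (auto simp: wave_generic_def inj_on_insert)
qed

text \<open>At s = u j the factor s - u j removes every I that contains j. In the other terms (u j,
  t) and the soliton j stand in opposite factors of the bilinear form, so u j cancels from the
  difference of their waves and they fuse to (- v j, t).\<close>

lemma hirota_numer_at_u:
  assumes M: "finite M" "j \<notin> M" and gen: "wave_generic s t u v (insert j M)"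
  shows "\<exists>c. hirota_numer (u j) t u v (insert j M) = c * hirota_half (- v j) t u v M"
proof -
  have nz: "u i + v j \<noteq> 0" "u j + v i \<noteq> 0" "u i + t \<noteq> 0" "v j \<noteq> v i" "u j + v j \<noteq> 0" if "i \<in> M" for i
    using gen M(2) that unfolding wave_generic_def by (auto simp: inj_on_def)
  let ?c = "(\<Prod>i\<in>M. (u j - u i) * (v j - v i) / (u i + v j))"
  have "hirota_numer (u j) t u v (insert j M) = ?c * hirota_half (- v j) t u v M"
  proof -
    let ?T = "\<lambda>I J.
     kp_ext u v (u j) t I J *
     (\<Prod>i\<in>I. (t - v i) / (u i + t) * (u j - u i)) * (\<Prod>i\<in>J. u j + v i) *
     cauchy_prod u v I * cauchy_prod u v J"
    have z: "?T (insert j I) J = 0" if "I \<in> Pow M" for I J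
    proof -
      have "finite (insert j I)" using that M finite_subset by auto
      then have "(\<Prod>i\<in>insert j I. (t - v i) / (u i + t) * (u j - u i)) = 0"
        by (intro prod_zero) auto
      then show ?thesis by (simp only: mult_zero_left mult_zero_right)
    qed
    have s: "?T I (insert j M - I) = ?c * (
       kp_ext u v (- v j) t I (M - I) *
       (\<Prod>i\<in>I. soliton_int (- v j) t (u i) (v i)) * cauchy_prod u v I * cauchy_prod u v (M - I))"
      if I: "I \<in> Pow M" for I
    proof -
      have IM: "I \<subseteq> M" "finite I" "finite (M - I)" using I M finite_subset by auto
      have eq: "insert j M - I = insert j (M - I)" "j \<notin> M - I" using IM M(2) by auto
      have p1: "(\<Prod>i\<in>I. (t - v i) / (u i + t) * (u j - u i)) =
         (\<Prod>i\<in>I. soliton_int (- v j) t (u i) (v i) * ((u j - u i) * (v j - v i) / (u i + v j)))"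
      proof (intro prod.cong refl)
        fix i assume "i \<in> I"
        then have i: "i \<in> M" using IM by auto
        have "v i - v j \<noteq> 0" "v j - v i \<noteq> 0" using nz(4)[OF i] by auto
        then have "soliton_int (- v j) t (u i) (v i) = (u i + v j) * (t - v i) / ((v j - v i) * (u i + t))"
          unfolding soliton_int_def using nz[OF i] by (simp add: divide_simps) (simp add: algebra_simps)
        then show "(t - v i) / (u i + t) * (u j - u i) =
          soliton_int (- v j) t (u i) (v i) * ((u j - u i) * (v j - v i) / (u i + v j))"
          using nz[OF i] \<open>v j - v i \<noteq> 0\<close> by (simp add: mult_ac)
      qed
      have p2: "(\<Prod>i\<in>M - I. soliton_int (u j) (v j) (u i) (v i)) * (\<Prod>i\<in>M - I. u j + v i) =
        (\<Prod>i\<in>M - I. (u j - u i) * (v j - v i) / (u i + v j))"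
        unfolding prod.distrib[symmetric]
        by (intro prod.cong refl) (use nz in \<open>auto simp: soliton_int_def\<close>)
      have c: "?c = (\<Prod>i\<in>I. (u j - u i) * (v j - v i) / (u i + v j)) * (\<Prod>i\<in>M - I. (u j - u i) * (v j - v i) / (u i + v j))"
        by (subst prod.subset_diff[OF IM(1) M(1)]) (rule mult.commute)
      have p3: "(\<Prod>i\<in>insert j (M - I). u j + v i) * cauchy_prod u v (insert j (M - I)) =
        (\<Prod>i\<in>M - I. (u j - u i) * (v j - v i) / (u i + v j)) * cauchy_prod u v (M - I)"
        using IM eq gen by (simp add: cauchy_prod_insert wave_generic_def p2[symmetric])
      have kk: "wave_k (u j) t + x - (wave_k (u j) (v j) + y) = wave_k (- v j) t + x - y"
        "wave_l (u j) t + x - (wave_l (u j) (v j) + y) = wave_l (- v j) t + x - y"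
        "wave_w (u j) t + x - (wave_w (u j) (v j) + y) = wave_w (- v j) t + x - y" for x y
        by (simp_all add: wave_defs add_divide_distrib diff_divide_distrib power3_eq_cube)
      have "?T I (insert j M - I) = 
        kp_ext u v (- v j) t I (M - I) *
        (\<Prod>i\<in>I. (t - v i) / (u i + t) * (u j - u i)) * cauchy_prod u v I *
        ((\<Prod>i\<in>insert j (M - I). u j + v i) * cauchy_prod u v (insert j (M - I)))"
        unfolding eq(1) sum.insert[OF IM(3) eq(2)] kk by (simp only: mult_ac)
      also have "\<dots> = ?c * (
       kp_ext u v (- v j) t I (M - I) *
       (\<Prod>i\<in>I. soliton_int (- v j) t (u i) (v i)) * cauchy_prod u v I * cauchy_prod u v (M - I))"
        unfolding p1 p3 c prod.distrib[of "\<lambda>i. soliton_int (- v j) t (u i) (v i)"] by (simp only: mult_ac)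
      finally show ?thesis .
    qed
    have z': "(\<Sum>I\<in>Pow M. ?T (insert j I) (insert j M - insert j I)) = 0"
      by (rule sum.neutral, rule ballI, rule z)
    show ?thesis
      unfolding hirota_numer_def sum_Pow_insert[OF M] z' hirota_half_def sum_distrib_left add_0_left
      by (rule sum.cong[OF refl s])
  qed
  then show ?thesis ..
qed

text \<open>At s = - v j the factor s + v j forces j into I. There (- v j, t) and (u j, v j) stand
  on the same side, v j cancels from the sum of their waves, and they fuse to (u j, t).\<close>

lemma hirota_numer_at_uminus_v:
  assumes M: "finite M" "j \<notin> M" and gen: "wave_generic s t u v (insert j M)"
  shows "\<exists>c. hirota_numer (- v j) t u v (insert j M) = c * hirota_half (u j) t u v M"
proof -
  have nz: "u i + v j \<noteq> 0" "u j + v i \<noteq> 0" "u i + t \<noteq> 0" "v j \<noteq> v i" if "i \<in> M" for i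
    using gen M(2) that unfolding wave_generic_def by (auto simp: inj_on_def)
  have nzj: "u j + v j \<noteq> 0" using gen by (auto simp: wave_generic_def)
  let ?c = "- (t - v j) / (u j + t) * (\<Prod>i\<in>M. v i - v j)"
  let ?T = "\<lambda>I J.
   kp_ext u v (- v j) t I J *
   (\<Prod>i\<in>I. (t - v i) / (u i + t) * (- v j - u i)) * (\<Prod>i\<in>J. - v j + v i) *
   cauchy_prod u v I * cauchy_prod u v J"
  have z: "?T I (insert j M - I) = 0" if "I \<in> Pow M" for I
  proof -
    have "j \<in> insert j M - I" using that M by auto
    then have "(\<Prod>i\<in>insert j M - I. - v j + v i) = 0"
      using M(1) by (intro prod_zero) auto
    then show ?thesis by simp
  qed
  have s: "?T (insert j I) (insert j M - insert j I) = ?c * (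
     kp_ext u v (u j) t I (M - I) *
     (\<Prod>i\<in>I. soliton_int (u j) t (u i) (v i)) * cauchy_prod u v I * cauchy_prod u v (M - I))"
    if I: "I \<in> Pow M" for I
  proof -
    have IM: "I \<subseteq> M" "finite I" "finite (M - I)" "j \<notin> I" using I M finite_subset by auto
    have eq: "insert j M - insert j I = M - I" using IM M(2) by auto
    have p1: "(\<Prod>i\<in>I. (t - v i) / (u i + t) * (- v j - u i)) * (\<Prod>i\<in>I. soliton_int (u j) (v j) (u i) (v i)) =
       (\<Prod>i\<in>I. soliton_int (u j) t (u i) (v i)) * (\<Prod>i\<in>I. v i - v j)"
      unfolding prod.distrib[symmetric]
    proof (intro prod.cong refl)
      fix i assume "i \<in> I"
      then have i: "i \<in> M" using IM by auto
      show "(t - v i) / (u i + t) * (- v j - u i) * soliton_int (u j) (v j) (u i) (v i) =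
        soliton_int (u j) t (u i) (v i) * (v i - v j)"
        unfolding soliton_int_def using nz[OF i] by (simp add: divide_simps) (simp add: algebra_simps)
    qed
    have c: "(\<Prod>i\<in>M. v i - v j) = (\<Prod>i\<in>I. v i - v j) * (\<Prod>i\<in>M - I. v i - v j)"
      by (subst prod.subset_diff[OF IM(1) M(1)]) (rule mult.commute)
    have kk: "wave_k (- v j) t + (wave_k (u j) (v j) + x) - y = wave_k (u j) t + x - y"
      "wave_l (- v j) t + (wave_l (u j) (v j) + x) - y = wave_l (u j) t + x - y"
      "wave_w (- v j) t + (wave_w (u j) (v j) + x) - y = wave_w (u j) t + x - y" for x y
      by (simp_all add: wave_defs add_divide_distrib diff_divide_distrib power3_eq_cube)
    have m: "- v j + v i = v i - v j" for i by simp
    have "x * - w * (1 / w) = - x" if "w \<noteq> 0" for x w :: complex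
      using that by simp
    from this[OF nzj, of "(t - v j) / (u j + t)"]
    have f: "(t - v j) / (u j + t) * (- v j - u j) * (1 / (u j + v j)) = - (t - v j) / (u j + t)"
      by (simp only: minus_add_distrib add_uminus_conv_diff minus_divide_left) (simp add: algebra_simps)
    let ?K = "kp_ext u v (u j) t I (M - I)"
    have "?T (insert j I) (insert j M - insert j I) = 
      ?K * ((t - v j) / (u j + t) * (- v j - u j) * (1 / (u j + v j))) *
      ((\<Prod>i\<in>I. (t - v i) / (u i + t) * (- v j - u i)) * (\<Prod>i\<in>I. soliton_int (u j) (v j) (u i) (v i))) *
      (\<Prod>i\<in>M - I. v i - v j) * cauchy_prod u v I * cauchy_prod u v (M - I)"
      unfolding eq(1) sum.insert[OF IM(2,4)] prod.insert[OF IM(2,4)] cauchy_prod_insert[OF IM(2,4)] kk m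
      by (simp only: divide_inverse mult_ac mult_1)
    also have "\<dots> = ?c * (?K * (\<Prod>i\<in>I. soliton_int (u j) t (u i) (v i)) * cauchy_prod u v I * cauchy_prod u v (M - I))"
      unfolding p1 f c by (simp only: mult_ac)
    finally show ?thesis .
  qed
  have z': "(\<Sum>I\<in>Pow M. ?T I (insert j M - I)) = 0"
    by (rule sum.neutral, rule ballI, rule z)
  have "hirota_numer (- v j) t u v (insert j M) = ?c * hirota_half (u j) t u v M"
    unfolding hirota_numer_def sum_Pow_insert[OF M] z' hirota_half_def sum_distrib_left add_0_right
    by (rule sum.cong[OF refl s])
  then show ?thesis ..
qed

text \<open>At s = - t the distinguished soliton has wave numbers 0, and its interactions multiply
  to the same constant for every I; the full sum over \<open>M\<close> remains.\<close>

lemma hirota_numer_at_uminus_t: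
  assumes M: "finite M" and gen: "wave_generic s t u v M"
  shows "\<exists>c. hirota_numer (- t) t u v M = c * hirota_sum u v M"
proof -
  let ?c = "\<Prod>i\<in>M. v i - t"
  have "(\<Prod>i\<in>I. (t - v i) / (u i + t) * (- t - u i)) * (\<Prod>i\<in>M - I. - t + v i) = ?c" if "I \<subseteq> M" for I
  proof -
    have "(\<Prod>i\<in>I. (t - v i) / (u i + t) * (- t - u i)) = (\<Prod>i\<in>I. v i - t)"
    proof (intro prod.cong refl)
      fix i assume "i \<in> I"
      then have "u i + t \<noteq> 0" using gen that by (auto simp: wave_generic_def)
      then show "(t - v i) / (u i + t) * (- t - u i) = v i - t" by (simp add: divide_simps) (simp add: algebra_simps)
    qed
    moreover have "?c = (\<Prod>i\<in>I. v i - t) * (\<Prod>i\<in>M - I. v i - t)"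
      by (subst prod.subset_diff[OF that M(1)]) (rule mult.commute)
    ultimately show ?thesis by simp
  qed
  moreover have "wave_k (- t) t = 0" "wave_l (- t) t = 0" "wave_w (- t) t = 0" by (simp_all add: wave_defs)
  ultimately have "hirota_numer (- t) t u v M = ?c * hirota_sum u v M"
    unfolding hirota_numer_def hirota_sum_def sum_distrib_left
    by (intro sum.cong refl) (auto simp: mult_ac)
  then show ?thesis ..
qed

text \<open>With A = t + a, the coefficients of s^4 (1 - 4 + 3) and of s^3 (4 A - 4 A) cancel. This
  drop from degree 4 to degree 2 is what makes the count of roots in
  \<open>hirota_half_generic_eq_0\<close> succeed.\<close>

lemma kp_symbol_wave_quadratic:
  "kp_symbol (wave_k s t + a) (wave_l s t + b) (wave_w s t + c) =
   poly [:(t + a) ^ 4 + 12 * (t + a) * (c - t ^ 3 / 3) + 12 * (t\<^sup>2 / 2 + b)\<^sup>2,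
          4 * (t + a) ^ 3 + 12 * (c - t ^ 3 / 3),
          6 * (t + a)\<^sup>2 - 12 * (t\<^sup>2 / 2 + b):] s"
proof -
  have *: "(s + A) ^ 4 + 12 * (s + A) * (C - s ^ 3 / 3) + 12 * (B - s\<^sup>2 / 2)\<^sup>2 =
    poly [:A ^ 4 + 12 * A * C + 12 * B\<^sup>2, 4 * A ^ 3 + 12 * C, 6 * A\<^sup>2 - 12 * B:] s" for A B C
    by (simp add: power4_eq_xxxx power3_eq_cube power2_eq_square algebra_simps)
  have "wave_k s t + a = s + (t + a)" "wave_l s t + b = (t\<^sup>2 / 2 + b) - s\<^sup>2 / 2"
    "wave_w s t + c = (c - t ^ 3 / 3) - s ^ 3 / 3"
    by (simp_all add: wave_defs diff_divide_distrib add_divide_distrib)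
  then show ?thesis unfolding kp_symbol_def using * by metis
qed

lemma hirota_numer_is_poly:
  assumes "finite M"
  shows "\<exists>p. degree p \<le> 2 + card M \<and> (\<forall>s. hirota_numer s t u v M = poly p s)"
proof -
  have "\<exists>p. degree p \<le> 2 + card M \<and> (\<forall>s.
     kp_symbol (wave_k s t + a - a') (wave_l s t + b - b') (wave_w s t + c - c') *
     (\<Prod>i\<in>I. (t - v i) / (u i + t) * (s - u i)) * (\<Prod>i\<in>M - I. s + v i) * d * e = poly p s)"
    if I: "I \<subseteq> M" for I a b c a' b' c' d e
  proof -
    let ?q = "[:(t + (a - a')) ^ 4 + 12 * (t + (a - a')) * ((c - c') - t ^ 3 / 3) + 12 * (t\<^sup>2 / 2 + (b - b'))\<^sup>2,
          4 * (t + (a - a')) ^ 3 + 12 * ((c - c') - t ^ 3 / 3),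
          6 * (t + (a - a'))\<^sup>2 - 12 * (t\<^sup>2 / 2 + (b - b')):]"
    let ?p1 = "\<Prod>i\<in>I. Polynomial.smult ((t - v i) / (u i + t)) [:- u i, 1:]"
    let ?p2 = "\<Prod>i\<in>M - I. [:v i, 1:]"
    let ?p = "Polynomial.smult (d * e) (?q * ?p1 * ?p2)"
    have deg: "degree (\<Prod>i\<in>J. f i) \<le> card J" if "J \<subseteq> M" "\<And>i. degree (f i) \<le> 1" for J and f :: "nat \<Rightarrow> complex poly"
    proof -
      have "degree (\<Prod>i\<in>J. f i) \<le> (\<Sum>i\<in>J. degree (f i))"
        using degree_prod_sum_le[of J f] finite_subset[OF that(1) assms] by (simp add: o_def)
      also have "\<dots> \<le> card J" using sum_bounded_above[of J "\<lambda>i. degree (f i)" 1] that(2) by simp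
      finally show ?thesis .
    qed
    have "degree ?p1 \<le> card I" by (rule deg[OF I]) (rule order_trans[OF Polynomial.degree_smult_le], simp)
    moreover have "degree ?p2 \<le> card (M - I)" by (rule deg) auto
    moreover have "degree ?q \<le> 2" by (rule degree_le) (auto simp: coeff_pCons split: nat.splits)
    moreover have "card M = card I + card (M - I)"
      using I assms by (metis card_Diff_subset card_mono finite_subset le_add_diff_inverse)
    ultimately have D: "degree ?p \<le> 2 + card M"
      using Polynomial.degree_smult_le[of "d * e" "?q * ?p1 * ?p2"] degree_mult_le[of "?q * ?p1" ?p2] degree_mult_le[of ?q ?p1] by linarith
    have E: "poly ?p s = kp_symbol (wave_k s t + a - a') (wave_l s t + b - b') (wave_w s t + c - c') *
     (\<Prod>i\<in>I. (t - v i) / (u i + t) * (s - u i)) * (\<Prod>i\<in>M - I. s + v i) * d * e" for s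
    proof -
      have "poly ?q s = kp_symbol (wave_k s t + a - a') (wave_l s t + b - b') (wave_w s t + c - c')"
        using kp_symbol_wave_quadratic[of s t "a - a'" "b - b'" "c - c'"] by (simp only: add_diff_eq)
      moreover have "poly ?p1 s = (\<Prod>i\<in>I. (t - v i) / (u i + t) * (s - u i))"
      proof -
        have "poly (Polynomial.smult c [:- d, 1:]) s = c * (s - d)" for c d :: complex
          by (simp add: algebra_simps)
        then show ?thesis unfolding poly_prod by (simp only:)
      qed
      moreover have "poly ?p2 s = (\<Prod>i\<in>M - I. s + v i)"
        unfolding poly_prod by (intro prod.cong refl) simp
      ultimately show ?thesis by (simp only: poly_smult poly_mult mult_ac)
    qed
    show ?thesis by (rule exI[of _ ?p], intro conjI allI D E[symmetric])
  qed
  then have "\<forall>I\<in>Pow M. \<exists>p. degree p \<le> 2 + card M \<and> (\<forall>s. 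
     kp_ext u v s t I (M - I) *
     (\<Prod>i\<in>I. (t - v i) / (u i + t) * (s - u i)) * (\<Prod>i\<in>M - I. s + v i) *
     cauchy_prod u v I * cauchy_prod u v (M - I) = poly p s)" by blast
  then obtain P where P: "\<forall>I\<in>Pow M. degree (P I) \<le> 2 + card M \<and> (\<forall>s. 
     kp_ext u v s t I (M - I) *
     (\<Prod>i\<in>I. (t - v i) / (u i + t) * (s - u i)) * (\<Prod>i\<in>M - I. s + v i) *
     cauchy_prod u v I * cauchy_prod u v (M - I) = poly (P I) s)"
    by (rule bchoice[THEN exE])
  show ?thesis
  proof (intro exI[of _ "\<Sum>I\<in>Pow M. P I"] conjI allI)
    show "degree (\<Sum>I\<in>Pow M. P I) \<le> 2 + card M" using P by (intro degree_sum_le) (use assms in auto)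
    show "hirota_numer s t u v M = poly (\<Sum>I\<in>Pow M. P I) s" for s
      unfolding hirota_numer_def poly_sum using P by (intro sum.cong) auto
  qed
qed

text \<open>The dispersion relation of a single soliton.\<close>

lemma hirota_numer_empty: "hirota_numer s t u v {} = 0"
  by (simp add: hirota_numer_def kp_symbol_def wave_defs field_simps power4_eq_xxxx power2_eq_square power3_eq_cube)

lemma hirota_half_generic_eq_0:
  assumes "finite M" "wave_generic s t u v M"
  shows "hirota_half s t u v M = 0"
  using assms
proof (induction "card M" arbitrary: s t M rule: less_induct)
  case less
  note M = less.prems(1) and gen = less.prems(2)
  have IH: "hirota_half s' t' u v (M - {j}) = 0" if "j \<in> M" "wave_generic s' t' u v (M - {j})" for j s' t'
    using less.hyps[of "M - {j}" s' t'] that M card_Diff1_less[of M j] by simp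
  have gj: "wave_generic s t u v (insert j (M - {j}))" if "j \<in> M" for j
    using gen that by (simp add: insert_absorb)
  have zu: "hirota_numer (u j) t u v M = 0" if "j \<in> M" for j
    using hirota_numer_at_u[OF _ _ gj[OF that]] M IH[OF that wave_generic_uminus_left(1)[OF gj[OF that]]] that
    by (auto simp: insert_absorb)
  have zv: "hirota_numer (- v j) t u v M = 0" if "j \<in> M" for j
    using hirota_numer_at_uminus_v[OF _ _ gj[OF that]] M IH[OF that wave_generic_uminus_left(2)[OF gj[OF that]]] that
    by (auto simp: insert_absorb)
  have zt: "hirota_numer (- t) t u v M = 0" if "j \<in> M" for j
  proof -
    have "hirota_sum u v (insert j (M - {j})) = 0"
      using hirota_sum_insert[of "M - {j}" j u v] M IH[OF that wave_generic_uminus_left(3)[OF gj[OF that]]] by simp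
    then show ?thesis using hirota_numer_at_uminus_t[OF M gen] that by (auto simp: insert_absorb)
  qed
  \<comment> \<open>Degree at most |M| + 2 against 2 |M| + 1 roots is decisive only for |M| \<ge> 2;
    the sizes 0 and 1 are computed by hand.\<close>
  have "hirota_numer s t u v M = 0"
  proof (cases "card M \<le> 1")
    case False
    obtain p where p: "degree p \<le> 2 + card M" "\<And>s. hirota_numer s t u v M = poly p s"
      using hirota_numer_is_poly[OF M] by metis
    have "p = 0"
    proof (rule ccontr)
      assume "p \<noteq> 0"
      let ?Z = "insert (- t) (u ` M \<union> (\<lambda>i. - v i) ` M)"
      have "M \<noteq> {}" using False by auto
      then have sub: "?Z \<subseteq> {x. poly p x = 0}" using zu zv zt by (auto simp: p(2)[symmetric])
      have "inj_on (\<lambda>i. - v i) M" "inj_on u M" using gen by (auto simp: wave_generic_def inj_on_def)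
      moreover have "u ` M \<inter> (\<lambda>i. - v i) ` M = {}"
        using gen by (force simp: wave_generic_def)
      ultimately have c2: "card (u ` M \<union> (\<lambda>i. - v i) ` M) = 2 * card M"
        using M by (simp add: card_Un_disjoint card_image)
      have "u i \<noteq> - t" "v i \<noteq> t" if "i \<in> M" for i
        using gen that unfolding wave_generic_def by (auto simp del: add_eq_0_iff)
      then have "- t \<notin> u ` M \<union> (\<lambda>i. - v i) ` M" by force
      then have c3: "card ?Z = Suc (2 * card M)" using M c2 by simp
      have "card ?Z \<le> card {x. poly p x = 0}"
        using sub poly_roots_finite[OF \<open>p \<noteq> 0\<close>] by (rule card_mono[rotated])
      also have "\<dots> \<le> degree p" using \<open>p \<noteq> 0\<close> by (rule card_poly_roots_bound)
      finally have "card ?Z \<le> degree p" .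
      then show False using p(1) False c3 by linarith
    qed
    then show ?thesis using p(2) by simp
  next
    case True
    show ?thesis
    proof (cases "M = {}")
      case False
      then obtain j where j: "M = {j}" using True M by (auto simp: le_Suc_eq card_1_singleton_iff)
      have nz: "s + v j \<noteq> 0" "u j + t \<noteq> 0" "u j + v j \<noteq> 0" using gen j by (auto simp: wave_generic_def)
      define a where "a = 1 / (u j + v j)"
      have "(u j + t) * hirota_numer s t u v {j} = 
        (kp_symbol (wave_k s t + wave_k (u j) (v j)) (wave_l s t + wave_l (u j) (v j)) (wave_w s t + wave_w (u j) (v j)) * ((t - v j) * (s - u j)) +
         kp_symbol (wave_k s t - wave_k (u j) (v j)) (wave_l s t - wave_l (u j) (v j)) (wave_w s t - wave_w (u j) (v j)) * ((s + v j) * (u j + t))) * a"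
      proof -
        have r: "x * (k * (d / x * e) * a + k' * f * a) = (k * (d * e) + k' * (f * x)) * a" if "x \<noteq> 0"
          for x k d e k' f :: complex
          using that by (simp add: ring_distribs mult_ac)
        have "hirota_numer s t u v {j} = 
          kp_symbol (wave_k s t + wave_k (u j) (v j)) (wave_l s t + wave_l (u j) (v j)) (wave_w s t + wave_w (u j) (v j)) * ((t - v j) / (u j + t) * (s - u j)) * a +
          kp_symbol (wave_k s t - wave_k (u j) (v j)) (wave_l s t - wave_l (u j) (v j)) (wave_w s t - wave_w (u j) (v j)) * (s + v j) * a"
          unfolding hirota_numer_def by (simp add: Pow_insert cauchy_prod_insert a_def add.commute)
        then show ?thesis using r[OF nz(2)] by (simp only:)
      qed
      also have "kp_symbol (wave_k s t + wave_k (u j) (v j)) (wave_l s t + wave_l (u j) (v j)) (wave_w s t + wave_w (u j) (v j)) * ((t - v j) * (s - u j)) +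
         kp_symbol (wave_k s t - wave_k (u j) (v j)) (wave_l s t - wave_l (u j) (v j)) (wave_w s t - wave_w (u j) (v j)) * ((s + v j) * (u j + t)) = 0"
      proof -
        have 1: "kp_symbol (s + t + (x + y)) ((t\<^sup>2 - s\<^sup>2) / 2 + (y\<^sup>2 - x\<^sup>2) / 2) (- (s ^ 3 + t ^ 3) / 3 + - (x ^ 3 + y ^ 3) / 3) =
           (s + t + x + y) ^ 4 - 4 * (s + t + x + y) * (s ^ 3 + t ^ 3 + x ^ 3 + y ^ 3) + 3 * (t\<^sup>2 - s\<^sup>2 + y\<^sup>2 - x\<^sup>2)\<^sup>2" for x y
          unfolding kp_symbol_def by (simp add: power2_eq_square field_simps)
        have 2: "kp_symbol (s + t - (x + y)) ((t\<^sup>2 - s\<^sup>2) / 2 - (y\<^sup>2 - x\<^sup>2) / 2) (- (s ^ 3 + t ^ 3) / 3 - - (x ^ 3 + y ^ 3) / 3) =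
           (s + t - x - y) ^ 4 - 4 * (s + t - x - y) * (s ^ 3 + t ^ 3 - x ^ 3 - y ^ 3) + 3 * (t\<^sup>2 - s\<^sup>2 - y\<^sup>2 + x\<^sup>2)\<^sup>2" for x y
          unfolding kp_symbol_def by (simp add: power2_eq_square field_simps)
        \<comment> \<open>For two solitons the symbol factors completely, both at the sum and at the
          difference of the waves; the two products then cancel against the interaction
          factors.\<close>
        have 3: "(s + t + x + y) ^ 4 - 4 * (s + t + x + y) * (s ^ 3 + t ^ 3 + x ^ 3 + y ^ 3) + 3 * (t\<^sup>2 - s\<^sup>2 + y\<^sup>2 - x\<^sup>2)\<^sup>2
            = 12 * (s + y) * (x + t) * (s + t) * (x + y)" for x y
          by (simp add: power4_eq_xxxx power3_eq_cube power2_eq_square algebra_simps)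
        have 4: "(s + t - x - y) ^ 4 - 4 * (s + t - x - y) * (s ^ 3 + t ^ 3 - x ^ 3 - y ^ 3) + 3 * (t\<^sup>2 - s\<^sup>2 - y\<^sup>2 + x\<^sup>2)\<^sup>2
            = - 12 * (s - x) * (t - y) * (s + t) * (x + y)" for x y
          by (simp add: power4_eq_xxxx power3_eq_cube power2_eq_square algebra_simps)
        have 5: "12 * p * q * r * w * (b * a) + - 12 * a * b * r * w * (p * q) = 0" for p q r w a b :: complex
          by (simp add: mult_ac)
        show ?thesis unfolding wave_defs 1 2 3 4 by (rule 5)
      qed
      finally show ?thesis using nz j by simp
    qed (simp add: hirota_numer_empty)
  qed
  moreover have "(\<Prod>i\<in>M. s + v i) \<noteq> 0" using gen M by (auto simp: wave_generic_def)
  moreover have "hirota_numer s t u v M = (\<Prod>i\<in>M. s + v i) * hirota_half s t u v M"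
    using gen by (intro hirota_numer_eq[OF M]) (auto simp: wave_generic_def)
  ultimately show ?case by simp
qed

lemma kp_symbol_0: "kp_symbol 0 0 0 = 0" by (simp add: kp_symbol_def)

lemma hirota_sum_generic_eq_0:
  assumes M: "finite M" and "inj_on u M" "inj_on v M" "\<And>i j. i \<in> M \<Longrightarrow> j \<in> M \<Longrightarrow> u i + v j \<noteq> 0"
  shows "hirota_sum u v M = 0"
proof (cases "M = {}")
  case True
  then show ?thesis by (simp add: hirota_sum_def kp_symbol_0)
next
  case False
  then obtain j where j: "j \<in> M" by auto
  have "wave_generic (u j) (v j) u v (M - {j})"
    using assms j by (auto simp: wave_generic_def inj_on_def)
  then have "hirota_half (u j) (v j) u v (M - {j}) = 0"
    using M by (intro hirota_half_generic_eq_0) auto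
  then show ?thesis using hirota_sum_insert[of "M - {j}" j u v] M j by (simp add: insert_absorb)
qed

text \<open>Moving the parameters along a line makes them distinct, so the generic case extends by continuity.\<close>

theorem hirota_sum_eq_0:
  assumes M: "finite M" and nz: "\<And>i j. i \<in> M \<Longrightarrow> j \<in> M \<Longrightarrow> u i + v j \<noteq> 0"
  shows "hirota_sum u v M = 0"
proof -
  \<comment> \<open>The slope depends on the index, so coinciding parameters separate as soon as e
    \<noteq> 0.\<close>
  define U where "U e i = u i + e * of_nat i" for e :: complex and i :: nat
  define V where "V e i = v i + e * of_nat i" for e :: complex and i :: nat
  have lim: "((\<lambda>e. U e i) \<longlongrightarrow> u i) (at 0)" "((\<lambda>e. V e i) \<longlongrightarrow> v i) (at 0)" for i
    unfolding U_def V_def by (auto intro!: tendsto_eq_intros)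
  have lim_cauchy: "((\<lambda>e. cauchy_prod (U e) (V e) I) \<longlongrightarrow> cauchy_prod u v I) (at 0)" if "I \<subseteq> M" for I
    unfolding cauchy_prod_def soliton_int_def
    by (intro tendsto_mult tendsto_prod) (use that nz in \<open>auto intro!: tendsto_intros lim simp: case_prod_beta subset_iff\<close>)
  have "((\<lambda>e. hirota_sum (U e) (V e) M) \<longlongrightarrow> hirota_sum u v M) (at 0)"
    unfolding hirota_sum_def kp_symbol_def wave_defs
    by (intro tendsto_intros lim lim_cauchy) auto
  moreover have ev: "eventually (\<lambda>e. hirota_sum (U e) (V e) M = 0) (at 0)"
  proof -
    have 1: "eventually (\<lambda>e. f i + e * of_nat i \<noteq> f j + e * of_nat j) (at 0)" if "i \<noteq> j" for f :: "nat \<Rightarrow> complex" and i j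
    proof (cases "f i = f j")
      case True
      then show ?thesis using that by (auto simp: eventually_at_filter)
    next
      case False
      have "((\<lambda>e. f i + e * of_nat i - (f j + e * of_nat j)) \<longlongrightarrow> f i - f j) (at 0)"
        by (auto intro!: tendsto_eq_intros)
      from tendsto_imp_eventually_ne[OF this, of 0] show ?thesis using False by simp
    qed
    have 2: "eventually (\<lambda>e. U e i + V e j \<noteq> 0) (at 0)" if "i \<in> M" "j \<in> M" for i j
    proof -
      have "((\<lambda>e. U e i + V e j) \<longlongrightarrow> u i + v j) (at 0)" by (intro tendsto_intros lim)
      then show ?thesis using nz[OF that] by (rule tendsto_imp_eventually_ne)
    qed
    have "eventually (\<lambda>e. \<forall>i\<in>M. \<forall>j\<in>M. (i \<noteq> j \<longrightarrow> U e i \<noteq> U e j \<and> V e i \<noteq> V e j) \<and> U e i + V e j \<noteq> 0) (at 0)"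
      using 1[of _ _ u] 1[of _ _ v] 2 M
      by (auto simp: eventually_ball_finite_distrib eventually_conj_iff U_def V_def)
    then show ?thesis
      by eventually_elim (rule hirota_sum_generic_eq_0[OF M], auto simp: inj_on_def)
  qed
  ultimately show ?thesis
    using tendsto_unique[OF at_neq_bot] tendsto_eventually[OF ev] by blast
qed

section \<open>Cauchy determinants and Hadamard's inequality\<close>

lemma det_schur_complement:
  fixes f :: "nat \<Rightarrow> nat \<Rightarrow> 'a::field"
  assumes "f n n \<noteq> 0"
  shows "mdet (Suc n) (\<lambda>i j. f i j) =
     f n n * mdet n (\<lambda>i j. f i j - f i n * f n j / f n n)"
proof -
  let ?S = "Matrix.mat n n (\<lambda>(i, j). f i j - f i n * f n j / f n n)"
  let ?b = "Matrix.mat n 1 (\<lambda>(i, j). f i n)"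
  let ?c = "Matrix.mat 1 n (\<lambda>(i, j). f n j / f n n)"
  let ?d = "Matrix.mat 1 1 (\<lambda>(i, j). f n n)"
  let ?P = "four_block_mat ?S ?b (0\<^sub>m 1 n) ?d"
  let ?Q = "four_block_mat (1\<^sub>m n) (0\<^sub>m n 1) ?c (1\<^sub>m 1)"
  have "Matrix.mat (Suc n) (Suc n) (\<lambda>(i, j). f i j) = ?P * ?Q"
  proof -
    have "?P * ?Q = four_block_mat (?S * 1\<^sub>m n + ?b * ?c) (?S * 0\<^sub>m n 1 + ?b * 1\<^sub>m 1)
        (0\<^sub>m 1 n * 1\<^sub>m n + ?d * ?c) (0\<^sub>m 1 n * 0\<^sub>m n 1 + ?d * 1\<^sub>m 1)"
      by (rule mult_four_block_mat) auto
    also have "\<dots> = Matrix.mat (Suc n) (Suc n) (\<lambda>(i, j). f i j)"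
      by (rule eq_matI) (use assms in \<open>auto simp: scalar_prod_def less_Suc_eq\<close>)
    finally show ?thesis by simp
  qed
  moreover have "Determinant.det (?P * ?Q) = Determinant.det ?P * Determinant.det ?Q"
    by (rule det_mult[of _ "n + 1"]) auto
  moreover have "Determinant.det ?P = Determinant.det ?S * Determinant.det ?d"
    by (rule det_four_block_mat_lower_left_zero) auto
  moreover have "Determinant.det ?Q = Determinant.det (1\<^sub>m n :: 'a mat) * Determinant.det (1\<^sub>m 1 :: 'a mat)"
    by (rule det_four_block_mat_upper_right_zero) auto
  moreover have "Determinant.det ?d = f n n"
    by (simp add: Determinant.det_def)
  ultimately show ?thesis by (simp add: mult.commute)
qed

lemma det_mat_leibniz:
  "mdet n (\<lambda>i j. f i j) =
     (\<Sum>p | p permutes {..<n}. of_int (sign p) * (\<Prod>i<n. f i (p i)))"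
  unfolding det_def'[OF mat_carrier] atLeast0LessThan
proof (intro sum.cong refl)
  fix p assume "p \<in> {p. p permutes {..<n}}"
  then have "p i < n" if "i < n" for i using permutes_in_image[of p "{..<n}" i] that by auto
  then show "signof p * (\<Prod>i<n. Matrix.mat n n (\<lambda>(i, j). f i j) $$ (i, p i)) =
      of_int (sign p) * (\<Prod>i<n. f i (p i))"
    by simp
qed

lemma det_mat_cong:
  "(\<And>i j. i < n \<Longrightarrow> j < n \<Longrightarrow> f i j = g i j) \<Longrightarrow>
     mdet n (\<lambda>i j. f i j) = mdet n (\<lambda>i j. g i j)"
  by (rule arg_cong[of _ _ Determinant.det], rule cong_mat) auto

lemma det_mat_transpose:
  "mdet n (\<lambda>i j. f j i) = mdet n (\<lambda>i j. f i j)"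
proof -
  have "Matrix.mat n n (\<lambda>(i, j). f j i) = transpose_mat (Matrix.mat n n (\<lambda>(i, j). f i j))" by auto
  then show ?thesis by (simp add: Determinant.det_transpose[OF mat_carrier])
qed

lemma det_scale_rows_cols:
  fixes f :: "nat \<Rightarrow> nat \<Rightarrow> 'a::comm_ring_1"
  shows "mdet n (\<lambda>i j. a i * f i j * b j) =
    (\<Prod>i<n. a i) * (\<Prod>j<n. b j) * mdet n (\<lambda>i j. f i j)"
  unfolding det_mat_leibniz sum_distrib_left
proof (intro sum.cong refl)
  fix p assume "p \<in> {p. p permutes {..<n}}"
  then have p: "p permutes {..<n}" by simp
  show "of_int (sign p) * (\<Prod>i<n. a i * f i (p i) * b (p i)) =
    (\<Prod>i<n. a i) * (\<Prod>j<n. b j) * (of_int (sign p) * (\<Prod>i<n. f i (p i)))"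
    by (subst (2) prod.permute[OF p]) (simp add: prod.distrib o_def mult_ac)
qed

theorem det_cauchy:
  assumes "\<And>i j. i < n \<Longrightarrow> j < n \<Longrightarrow> u i + v j \<noteq> 0"
  shows "mdet n (\<lambda>i j. 1 / (u i + v j)) = cauchy_prod u v {..<n}"
  using assms
proof (induction n)
  case 0
  then show ?case by (simp add: Determinant.det_def)
next
  case (Suc n)
  \<comment> \<open>The Schur complement of a Cauchy matrix is the smaller Cauchy matrix with
    rescaled rows and columns; the scalings supply the interactions with the last index.\<close>
  have *: "1 / (u i + v j) - 1 / (u i + v n) * (1 / (u n + v j)) / (1 / (u n + v n)) =
      ((u n - u i) / (u i + v n)) * (1 / (u i + v j)) * ((v n - v j) / (u n + v j))" if "i < n" "j < n" for i j
  proof -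
    have "u i + v j \<noteq> 0" "u i + v n \<noteq> 0" "u n + v j \<noteq> 0" "u n + v n \<noteq> 0" using Suc.prems that by auto
    then show ?thesis by (simp add: divide_simps) (simp add: algebra_simps)
  qed
  have "mdet (Suc n) (\<lambda>i j. 1 / (u i + v j)) = 1 / (u n + v n) *
    mdet n (\<lambda>i j. 1 / (u i + v j) - 1 / (u i + v n) * (1 / (u n + v j)) / (1 / (u n + v n)))"
    using Suc.prems by (intro det_schur_complement) auto
  also have "mdet n (\<lambda>i j. 1 / (u i + v j) - 1 / (u i + v n) * (1 / (u n + v j)) / (1 / (u n + v n))) =
    mdet n (\<lambda>i j. ((u n - u i) / (u i + v n)) * (1 / (u i + v j)) * ((v n - v j) / (u n + v j)))"
    by (rule det_mat_cong) (rule *)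
  also have "\<dots> = (\<Prod>i<n. (u n - u i) / (u i + v n)) * (\<Prod>j<n. (v n - v j) / (u n + v j)) * cauchy_prod u v {..<n}"
    unfolding det_scale_rows_cols using Suc by simp
  also have "1 / (u n + v n) * ((\<Prod>i<n. (u n - u i) / (u i + v n)) * (\<Prod>j<n. (v n - v j) / (u n + v j)) *
      cauchy_prod u v {..<n}) = cauchy_prod u v (insert n {..<n})"
    by (subst cauchy_prod_insert) (simp_all add: soliton_int_def prod.distrib prod_dividef mult_ac)
  finally show ?case by (simp add: lessThan_Suc)
qed

section \<open>Hadamard's inequality through Gram matrices\<close>

definition psd_form :: "nat \<Rightarrow> (nat \<Rightarrow> nat \<Rightarrow> complex) \<Rightarrow> bool" where
  "psd_form n h \<longleftrightarrow> (\<forall>i<n. \<forall>j<n. h j i = cnj (h i j)) \<and>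
     (\<forall>c. 0 \<le> Re (\<Sum>i<n. \<Sum>j<n. cnj (c i) * h i j * c j))"

lemma psd_form_hermitian: "psd_form n h \<Longrightarrow> i < n \<Longrightarrow> j < n \<Longrightarrow> h j i = cnj (h i j)"
  unfolding psd_form_def by blast

lemma psd_form_diag:
  assumes "psd_form n h" "i < n"
  shows "0 \<le> Re (h i i)" "h i i = of_real (Re (h i i))"
proof -
  have "0 \<le> Re (\<Sum>k<n. \<Sum>j<n. cnj (if k = i then 1 else 0) * h k j * (if j = i then 1 else 0))"
    using assms by (simp only: psd_form_def)
  also have "\<dots> = Re (h i i)"
    using assms(2) by (simp add: if_distrib[of cnj] if_distribR mult_delta_left mult_delta_right sum.delta cong: if_cong)
  finally show "0 \<le> Re (h i i)" .
  have "h i i = cnj (h i i)" using psd_form_hermitian assms by blast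
  then show "h i i = of_real (Re (h i i))" by (simp add: complex_eq_iff)
qed

text \<open>The value of the reduced form at c is the value of the original form at c extended by
  the last coordinate - s / d, which completes the square.\<close>

lemma psd_form_schur_complement:
  assumes h: "psd_form (Suc n) h" and nz: "h n n \<noteq> 0"
  shows "psd_form n (\<lambda>i j. h i j - h i n * h n j / h n n)"
  unfolding psd_form_def
proof (intro conjI allI impI)
  have herm: "h j i = cnj (h i j)" if "i \<le> n" "j \<le> n" for i j by (rule psd_form_hermitian[OF h]) (use that in auto)
  show "h j i - h j n * h n i / h n n = cnj (h i j - h i n * h n j / h n n)" if "i < n" "j < n" for i j
  proof -
    have "cnj (h i j) = h j i" "cnj (h i n) = h n i" "cnj (h n j) = h j n" "cnj (h n n) = h n n"
      using that by (simp_all add: herm[symmetric])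
    then show ?thesis by (simp add: mult.commute)
  qed
  fix c :: "nat \<Rightarrow> complex"
  define s where "s = (\<Sum>j<n. h n j * c j)"
  define d where "d = h n n"
  have dd: "cnj d = d" "d \<noteq> 0" using herm[of n n] nz by (auto simp: d_def)
  have cs: "(\<Sum>i<n. cnj (c i) * h i n) = cnj s"
    unfolding s_def cnj_sum by (intro sum.cong refl) (simp add: herm[symmetric] mult.commute)
  let ?e = "c(n := - s / d)"
  have "0 \<le> Re (\<Sum>i<Suc n. \<Sum>j<Suc n. cnj (?e i) * h i j * ?e j)" using h by (simp only: psd_form_def)
  also have "(\<Sum>i<Suc n. \<Sum>j<Suc n. cnj (?e i) * h i j * ?e j) =
     (\<Sum>i<n. \<Sum>j<n. cnj (c i) * h i j * c j) + (\<Sum>i<n. cnj (c i) * h i n) * (- s / d) +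
     cnj (- s / d) * (\<Sum>j<n. h n j * c j) + cnj (- s / d) * h n n * (- s / d)"
    by (simp add: sum.distrib sum_distrib_left sum_distrib_right sum_subtractf sum_divide_distrib mult.assoc)
  also have "\<dots> = (\<Sum>i<n. \<Sum>j<n. cnj (c i) * h i j * c j) - cnj s * s / d"
    unfolding cs s_def[symmetric] d_def[symmetric] using dd by (simp add: field_simps)
  also have "cnj s * s / d = (\<Sum>i<n. \<Sum>j<n. cnj (c i) * (h i n * h n j / h n n) * c j)"
    unfolding cs[symmetric] unfolding s_def d_def sum_product sum_divide_distrib by (simp add: mult_ac)
  finally show "0 \<le> Re (\<Sum>i<n. \<Sum>j<n. cnj (c i) * (h i j - h i n * h n j / h n n) * c j)"
    by (simp add: algebra_simps sum_subtractf)
qed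

lemma psd_form_zero_diag:
  assumes h: "psd_form (Suc n) h" and z: "h n n = 0" and j: "j \<le> n"
  shows "h n j = 0"
proof (rule ccontr)
  assume nz: "h n j \<noteq> 0"
  with z j have jn: "j < n" by (metis le_neq_implies_less)
  have herm: "h j n = cnj (h n j)" using psd_form_hermitian[OF h, of n j] j by simp
  define r where "r = Re (h j j)"
  \<comment> \<open>On the vector e_j - t h(n, j) e_n the form takes the value r - 2 t |h(n, j)|^2,
    and this t makes it - 1.\<close>
  define t where "t = (r + 1) / (2 * (cmod (h n j))\<^sup>2)"
  let ?c = "\<lambda>i. if i = j then 1 else if i = n then - of_real t * h n j else 0"
  have sum2: "(\<Sum>i<Suc n. f i) = f j + f n" if "\<And>i. i \<noteq> j \<Longrightarrow> i \<noteq> n \<Longrightarrow> f i = 0" for f :: "nat \<Rightarrow> complex"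
  proof -
    have "(\<Sum>i<Suc n. f i) = (\<Sum>i\<in>{j, n}. f i)" using that jn by (intro sum.mono_neutral_right) auto
    then show ?thesis using jn by simp
  qed
  have "0 \<le> Re (\<Sum>i<Suc n. \<Sum>k<Suc n. cnj (?c i) * h i k * ?c k)" using h by (simp only: psd_form_def)
  also have "(\<Sum>i<Suc n. \<Sum>k<Suc n. cnj (?c i) * h i k * ?c k) =
      (\<Sum>i<Suc n. cnj (?c i) * h i j * ?c j + cnj (?c i) * h i n * ?c n)"
    by (intro sum.cong refl sum2) simp
  also have "\<dots> = (cnj (?c j) * h j j * ?c j + cnj (?c j) * h j n * ?c n) +
      (cnj (?c n) * h n j * ?c j + cnj (?c n) * h n n * ?c n)"
    by (rule sum2) simp
  also have "\<dots> = h j j - 2 * of_real t * (h n j * cnj (h n j))"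
    using jn z herm by (simp add: algebra_simps)
  also have "h n j * cnj (h n j) = of_real ((cmod (h n j))\<^sup>2)" by (rule complex_norm_square[symmetric])
  also have "Re (h j j - 2 * of_real t * of_real ((cmod (h n j))\<^sup>2)) = r - 2 * t * (cmod (h n j))\<^sup>2"
    by (simp add: r_def)
  also have "\<dots> = - 1" using nz by (simp add: t_def field_simps)
  finally show False by simp
qed

text \<open>Eliminating the last pivot leaves a positive semidefinite Schur complement whose
  diagonal entries have not grown, so the bound follows by induction; a zero pivot kills its whole
  row.\<close>

lemma det_psd_form_le:
  assumes "psd_form n h"
  shows "norm (mdet n (\<lambda>i j. h i j)) \<le> (\<Prod>i<n. Re (h i i))"
  using assms
proof (induction n arbitrary: h)
  case 0
  then show ?case by (simp add: Determinant.det_def)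
next
  case (Suc n)
  show ?case
  proof (cases "h n n = 0")
    case True
    have "mdet (Suc n) (\<lambda>i j. h i j) = 0"
      unfolding det_mat_leibniz
    proof (intro sum.neutral ballI)
      fix p assume "p \<in> {p. p permutes {..<Suc n}}"
      then have "p n \<le> n" using permutes_in_image[of p "{..<Suc n}" n] by auto
      then have "h n (p n) = 0" by (rule psd_form_zero_diag[OF Suc.prems True])
      then have "(\<Prod>i<Suc n. h i (p i)) = 0" by (intro prod_zero) auto
      then show "of_int (sign p) * (\<Prod>i<Suc n. h i (p i)) = 0" by simp
    qed
    moreover have "0 \<le> (\<Prod>i<Suc n. Re (h i i))" using psd_form_diag[OF Suc.prems] by (intro prod_nonneg) auto
    ultimately show ?thesis by simp
  next
    case False
    let ?g = "\<lambda>i j. h i j - h i n * h n j / h n n"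
    have d: "0 \<le> Re (h n n)" "h n n = of_real (Re (h n n))" using psd_form_diag[OF Suc.prems] by auto
    have g: "psd_form n ?g" by (rule psd_form_schur_complement[OF Suc.prems False])
    have "Re (?g i i) \<le> Re (h i i)" if "i < n" for i
    proof -
      have "h n i = cnj (h i n)" using psd_form_hermitian[OF Suc.prems, of i n] that by simp
      then have "h i n * h n i / h n n = of_real ((cmod (h i n))\<^sup>2) / of_real (Re (h n n))"
        using d(2) complex_norm_square by metis
      also have "\<dots> = of_real ((cmod (h i n))\<^sup>2 / Re (h n n))" by simp
      finally have "Re (h i n * h n i / h n n) \<ge> 0" using d(1) by simp
      then show ?thesis by simp
    qed
    moreover have "0 \<le> Re (?g i i)" if "i < n" for i using psd_form_diag[OF g that] by simp
    ultimately have "(\<Prod>i<n. Re (?g i i)) \<le> (\<Prod>i<n. Re (h i i))" by (intro prod_mono) auto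
    then have "norm (mdet n (\<lambda>i j. ?g i j)) \<le> (\<Prod>i<n. Re (h i i))"
      using Suc.IH[OF g] by linarith
    moreover have "norm (h n n) = Re (h n n)" using d by (metis norm_of_real abs_of_nonneg)
    ultimately show ?thesis
      unfolding det_schur_complement[of h, OF False] norm_mult prod.lessThan_Suc
      using d(1) by (simp add: mult.commute mult_left_mono)
  qed
qed

lemma psd_form_gram:
  fixes m :: nat
  shows "psd_form n (\<lambda>i j. \<Sum>k<m. a i k * cnj (a j k))"
  unfolding psd_form_def
proof (intro conjI allI impI)
  show "(\<Sum>k<m. a j k * cnj (a i k)) = cnj (\<Sum>k<m. a i k * cnj (a j k))" for i j
    by (simp add: mult.commute)
  fix c :: "nat \<Rightarrow> complex"
  define e where "e k = (\<Sum>i<n. cnj (c i) * a i k)" for k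
  have "(\<Sum>i<n. \<Sum>j<n. cnj (c i) * (\<Sum>k<m. a i k * cnj (a j k)) * c j) = (\<Sum>k<m. e k * cnj (e k))"
  proof -
    have "(\<Sum>i<n. \<Sum>j<n. \<Sum>k<m. X i j k) = (\<Sum>k<m. \<Sum>i<n. \<Sum>j<n. X i j k)" for X :: "nat \<Rightarrow> nat \<Rightarrow> nat \<Rightarrow> complex"
    proof -
      have "(\<Sum>i<n. \<Sum>j<n. \<Sum>k<m. X i j k) = (\<Sum>i<n. \<Sum>k<m. \<Sum>j<n. X i j k)"
        by (intro sum.cong refl sum.swap)
      also have "\<dots> = (\<Sum>k<m. \<Sum>i<n. \<Sum>j<n. X i j k)" by (rule sum.swap)
      finally show ?thesis .
    qed
    from this[of "\<lambda>i j k. cnj (c i) * (a i k * cnj (a j k)) * c j"]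
    moreover have "(\<Sum>k<m. e k * cnj (e k)) = (\<Sum>k<m. \<Sum>i<n. \<Sum>j<n. cnj (c i) * (a i k * cnj (a j k)) * c j)"
      unfolding e_def cnj_sum sum_product by (intro sum.cong refl) (simp add: mult_ac)
    ultimately show ?thesis unfolding sum_distrib_left sum_distrib_right by simp
  qed
  also have "\<dots> = of_real (\<Sum>k<m. (cmod (e k))\<^sup>2)" by (simp add: complex_norm_square[symmetric])
  finally show "0 \<le> Re (\<Sum>i<n. \<Sum>j<n. cnj (c i) * (\<Sum>k<m. a i k * cnj (a j k)) * c j)"
    by (simp add: sum_nonneg)
qed

text \<open>Apply \<open>det_psd_form_le\<close> to A A^*: its determinant is |det A|^2, and its
  diagonal consists of squared row norms, at most C^2 n each.\<close>

theorem hadamard_det_bound: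
  fixes a :: "nat \<Rightarrow> nat \<Rightarrow> complex"
  assumes a: "\<And>i j. i < n \<Longrightarrow> j < n \<Longrightarrow> norm (a i j) \<le> C"
  shows "norm (mdet n (\<lambda>i j. a i j)) \<le> (C * sqrt (real n)) ^ n"
proof -
  let ?M = "Matrix.mat n n (\<lambda>(i, j). a i j)" and ?N = "Matrix.mat n n (\<lambda>(i, j). cnj (a j i))"
  have "Determinant.det ?N = cnj (Determinant.det ?M)"
  proof -
    have "?N = transpose_mat (Matrix.mat n n (\<lambda>(i, j). cnj (a i j)))" by (auto intro!: eq_matI)
    then have "Determinant.det ?N = mdet n (\<lambda>i j. cnj (a i j))"
      by (simp add: det_transpose[of _ n])
    also have "\<dots> = cnj (Determinant.det ?M)"
      by (simp add: det_mat_leibniz)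
    finally show ?thesis .
  qed
  then have "norm (Determinant.det (?M * ?N)) = (norm (Determinant.det ?M))\<^sup>2"
    by (subst det_mult[of _ n]) (auto simp: norm_mult power2_eq_square)
  moreover have "?M * ?N = Matrix.mat n n (\<lambda>(i, j). \<Sum>k<n. a i k * cnj (a j k))"
    by (rule eq_matI) (auto simp: scalar_prod_def atLeast0LessThan)
  ultimately have "(norm (Determinant.det ?M))\<^sup>2 \<le> (\<Prod>i<n. Re (\<Sum>k<n. a i k * cnj (a i k)))"
    using det_psd_form_le[OF psd_form_gram[where n = n and m = n and a = a]] by simp
  also have "\<dots> \<le> (\<Prod>i<n. C\<^sup>2 * real n)"
  proof (intro prod_mono conjI)
    fix i assume i: "i \<in> {..<n}"
    have e: "Re (\<Sum>k<n. a i k * cnj (a i k)) = (\<Sum>k<n. (cmod (a i k))\<^sup>2)"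
      unfolding Re_sum by (intro sum.cong refl) (simp add: complex_norm_square[symmetric])
    show "0 \<le> Re (\<Sum>k<n. a i k * cnj (a i k))" unfolding e by (simp add: sum_nonneg)
    have "(\<Sum>k<n. (cmod (a i k))\<^sup>2) \<le> (\<Sum>k<n. C\<^sup>2)" using a i by (intro sum_mono power_mono) auto
    then show "Re (\<Sum>k<n. a i k * cnj (a i k)) \<le> C\<^sup>2 * real n" unfolding e by (simp add: mult.commute)
  qed
  also have "\<dots> = ((C * sqrt (real n)) ^ n)\<^sup>2"
  proof -
    have "real n ^ n = (sqrt (real n) * sqrt (real n)) ^ n" by simp
    then show ?thesis by (simp only: prod_constant card_lessThan power2_eq_square power_mult_distrib mult_ac)
  qed
  finally have "norm (Determinant.det ?M) \<le> \<bar>(C * sqrt (real n)) ^ n\<bar>"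
    using abs_le_square_iff[of "norm (Determinant.det ?M)"] by simp
  moreover have "0 \<le> (C * sqrt (real n)) ^ n"
  proof (cases "n = 0")
    case False
    then have "0 \<le> C" using a[of 0 0] norm_ge_zero order_trans by blast
    then show ?thesis by simp
  qed simp
  ultimately show ?thesis by simp
qed

text \<open>From n^n / n! \<le> e^n follows n^(n/2) / n! \<le> e^(n/2) / sqrt (n!), and 1 / sqrt
  (n!) still beats any geometric growth.\<close>

lemma summable_hadamard:
  fixes C x :: real
  assumes "0 \<le> C" "0 \<le> x"
  shows "summable (\<lambda>n. (C * sqrt (real n)) ^ n / fact n * x ^ n)"
proof -
  define y where "y = C * sqrt (exp 1) * x"
  have y: "0 \<le> y" using assms by (simp add: y_def)
  have "summable (\<lambda>n. y ^ n / sqrt (fact n))"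
  proof -
    obtain N :: nat where N: "(2 * y)\<^sup>2 \<le> real N" using real_arch_simple by blast
    show ?thesis
    proof (rule summable_ratio_test[of "1 / 2" N])
      fix n assume "N \<le> n"
      then have "(2 * y)\<^sup>2 \<le> real (Suc n)" using N by linarith
      then have "2 * y \<le> sqrt (real (Suc n))" by (rule real_le_rsqrt)
      then have "y / sqrt (real (Suc n)) \<le> 1 / 2" by (simp add: field_simps)
      then have "y / sqrt (real (Suc n)) * (y ^ n / sqrt (fact n)) \<le> 1 / 2 * (y ^ n / sqrt (fact n))"
        using y by (intro mult_right_mono) auto
      moreover have "y ^ Suc n / sqrt (fact (Suc n)) = y / sqrt (real (Suc n)) * (y ^ n / sqrt (fact n))"
        by (simp only: fact_Suc real_sqrt_mult power_Suc times_divide_times_eq)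
      moreover have n: "norm (y ^ k / sqrt (fact k)) = y ^ k / sqrt (fact k)" for k using y by simp
      ultimately show "norm (y ^ Suc n / sqrt (fact (Suc n))) \<le> 1 / 2 * norm (y ^ n / sqrt (fact n))"
        unfolding n by linarith
    qed simp
  qed
  moreover have "norm ((C * sqrt (real n)) ^ n / fact n * x ^ n) \<le> y ^ n / sqrt (fact n)" for n
  proof -
    have "real n ^ n / fact n \<le> exp (real n)"
      using exp_ge_one_minus_x_over_n_power_n[of 0 1] sum_le_suminf[OF summable_exp_generic[of "real n"], of "{n}"]
      by (simp add: exp_def scaleR_conv_of_real field_simps)
    then have "sqrt (real n ^ n / fact n) \<le> sqrt (exp (real n))" by simp
    also have "exp (real n) = exp 1 ^ n" by (simp flip: exp_of_nat_mult)
    finally have "sqrt (real n) ^ n / sqrt (fact n) \<le> sqrt (exp 1) ^ n"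
      by (simp add: real_sqrt_divide real_sqrt_power)
    then have "C ^ n * x ^ n / sqrt (fact n) * (sqrt (real n) ^ n / sqrt (fact n)) \<le> C ^ n * x ^ n / sqrt (fact n) * sqrt (exp 1) ^ n"
      using assms by (intro mult_left_mono) auto
    moreover have "C ^ n * x ^ n / sqrt (fact n) * (sqrt (real n) ^ n / sqrt (fact n)) = (C * sqrt (real n)) ^ n / fact n * x ^ n"
      by (simp add: power_mult_distrib)
    ultimately show ?thesis using assms by (simp add: y_def power_mult_distrib mult_ac abs_mult)
  qed
  ultimately show ?thesis by (rule summable_comparison_test'[of _ 0])
qed

section \<open>Soliton gases\<close>

lemma cauchy_prod_reindex:
  assumes "finite I" "inj_on h I"
  shows "cauchy_prod (\<lambda>i. u (h i)) (\<lambda>i. v (h i)) I = cauchy_prod u v (h ` I)"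
  using assms
proof (induction I)
  case (insert a I)
  then have "h a \<notin> h ` I" by auto
  then show ?case using insert
    by (simp add: cauchy_prod_insert prod.reindex)
qed simp

lemma cauchy_prod_cong:
  assumes "\<And>i. i \<in> I \<Longrightarrow> u i = u' i" "\<And>i. i \<in> I \<Longrightarrow> v i = v' i"
  shows "cauchy_prod u v I = cauchy_prod u' v' I"
  using assms unfolding cauchy_prod_def by (intro arg_cong2[where f = "(*)"] prod.cong) auto

text \<open>A bound factor by factor would give a constant to a power quadratic in |I|. Reading the
  product as a Cauchy determinant brings Hadamard's inequality to bear.\<close>

lemma norm_cauchy_prod_le:
  assumes I: "finite I" and C: "\<And>i j. i \<in> I \<Longrightarrow> j \<in> I \<Longrightarrow> u i + v j \<noteq> 0 \<and> norm (1 / (u i + v j)) \<le> C"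
  shows "norm (cauchy_prod u v I) \<le> (C * sqrt (real (card I))) ^ card I"
proof -
  obtain h where h: "bij_betw h {..<card I} I"
    using ex_bij_betw_nat_finite[OF I] by (auto simp: atLeast0LessThan)
  then have im: "h i \<in> I" if "i < card I" for i using that by (auto simp: bij_betw_def)
  have "cauchy_prod u v I = cauchy_prod (\<lambda>i. u (h i)) (\<lambda>i. v (h i)) {..<card I}"
    using h by (subst cauchy_prod_reindex) (auto simp: bij_betw_def)
  also have "\<dots> = Determinant.det (Matrix.mat (card I) (card I) (\<lambda>(i, j). 1 / (u (h i) + v (h j))))"
    by (rule det_cauchy[symmetric]) (use C im in blast)
  finally show ?thesis using C im by (auto intro!: hadamard_det_bound)
qed

text \<open>Boxes determine a product measure, and the preimage of a box under relabelling is a box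
  with the same sides. This moves integrals from an arbitrary finite index set to {..<card I}, and
  later swaps two coordinates.\<close>

lemma (in product_sigma_finite) distr_PiM_reindex_finite:
  assumes h: "bij_betw h J I" and J: "finite J"
  shows "distr (PiM I M) (PiM J (\<lambda>j. M (h j))) (\<lambda>p. \<lambda>j\<in>J. p (h j)) = PiM J (\<lambda>j. M (h j))"
proof -
  interpret J: product_sigma_finite "\<lambda>j. M (h j)" by standard
  have I: "finite I" using h J by (simp add: bij_betw_finite)
  have hJ: "h j \<in> I" if "j \<in> J" for j using h that by (auto simp: bij_betw_def)
  have meas: "(\<lambda>p. \<lambda>j\<in>J. p (h j)) \<in> measurable (PiM I M) (PiM J (\<lambda>j. M (h j)))"
    using hJ by (intro measurable_restrict measurable_component_singleton)
  show ?thesis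
  proof (rule J.PiM_eqI[OF J])
    fix A assume A: "\<And>j. j \<in> J \<Longrightarrow> A j \<in> sets (M (h j))"
    define g where "g = the_inv_into J h"
    have g: "g i \<in> J" "h (g i) = i" if "i \<in> I" for i
      using h that by (auto simp: g_def bij_betw_def the_inv_into_into f_the_inv_into_f)
    have gh: "g (h j) = j" if "j \<in> J" for j using h that by (auto simp: g_def bij_betw_def the_inv_into_f_f)
    have sub: "A j \<subseteq> space (M (h j))" if "j \<in> J" for j using sets.sets_into_space[OF A[OF that]] .
    have "(\<lambda>p. \<lambda>j\<in>J. p (h j)) -` Pi\<^sub>E J A \<inter> space (PiM I M) = Pi\<^sub>E I (\<lambda>i. A (g i))"
    proof (intro equalityI subsetI)
      fix p assume p: "p \<in> (\<lambda>p. \<lambda>j\<in>J. p (h j)) -` Pi\<^sub>E J A \<inter> space (PiM I M)"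
      then have *: "p (h j) \<in> A j" if "j \<in> J" for j using that PiE_mem[of "\<lambda>j\<in>J. p (h j)" J A j] by simp
      have "p i \<in> A (g i)" if "i \<in> I" for i using *[OF g(1)[OF that]] g(2)[OF that] by simp
      moreover have "p \<in> extensional I" using p by (simp add: space_PiM PiE_iff)
      ultimately show "p \<in> Pi\<^sub>E I (\<lambda>i. A (g i))" by (simp add: PiE_iff)
    next
      fix p assume p: "p \<in> Pi\<^sub>E I (\<lambda>i. A (g i))"
      have "p i \<in> space (M i)" if "i \<in> I" for i
        using PiE_mem[OF p that] sub[OF g(1)[OF that]] unfolding g(2)[OF that] by (rule subsetD[rotated])
      moreover have "p (h j) \<in> A j" if "j \<in> J" for j
        using PiE_mem[OF p hJ[OF that]] unfolding gh[OF that] .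
      moreover have "p \<in> extensional I" using p by (simp add: PiE_iff)
      ultimately show "p \<in> (\<lambda>p. \<lambda>j\<in>J. p (h j)) -` Pi\<^sub>E J A \<inter> space (PiM I M)"
        by (simp add: space_PiM PiE_iff)
    qed
    moreover have "emeasure (PiM I M) (Pi\<^sub>E I (\<lambda>i. A (g i))) = (\<Prod>i\<in>I. emeasure (M i) (A (g i)))"
    proof (rule emeasure_PiM[OF I])
      show "A (g i) \<in> sets (M i)" if "i \<in> I" for i using A[OF g(1)[OF that]] g(2)[OF that] by simp
    qed
    moreover have "\<dots> = (\<Prod>j\<in>J. emeasure (M (h j)) (A j))"
      using prod.reindex_bij_betw[OF h, of "\<lambda>i. emeasure (M i) (A (g i))"] by (simp add: gh cong: prod.cong)
    moreover have "Pi\<^sub>E J A \<in> sets (PiM J (\<lambda>j. M (h j)))" using A J by (intro sets_PiM_I_finite)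
    ultimately show "emeasure (distr (PiM I M) (PiM J (\<lambda>j. M (h j))) (\<lambda>p. \<lambda>j\<in>J. p (h j))) (Pi\<^sub>E J A) =
        (\<Prod>j\<in>J. emeasure (M (h j)) (A j))"
      using meas by (simp add: emeasure_distr)
  qed simp
qed

text \<open>Lets a whole series of integrals be differentiated at once, by a quadratic bound for its
  Taylor remainder instead of an interchange of limits term by term.\<close>

lemma has_vector_derivative_quadratic_remainder:
  fixes f :: "real \<Rightarrow> complex"
  assumes "0 < e" and "\<And>h. \<bar>h\<bar> \<le> e \<Longrightarrow> norm (f (x + h) - f x - of_real h * D) \<le> C * h\<^sup>2"
  shows "(f has_vector_derivative D) (at x)"
proof -
  have C: "0 \<le> C"
    using assms(2)[of e] assms(1) norm_ge_zero order_trans[of 0 "norm (f (x + e) - f x - of_real e * D)" "C * e\<^sup>2"]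
    by (simp add: zero_le_mult_iff)
  have "((\<lambda>h. norm (f (x + h) - f x - of_real h * D) / norm h) \<longlongrightarrow> 0) (at 0)"
  proof (rule tendsto_sandwich[of "\<lambda>_. 0" _ _ "\<lambda>h. C * \<bar>h\<bar>"])
    show "\<forall>\<^sub>F h in at 0. norm (f (x + h) - f x - of_real h * D) / norm h \<le> C * \<bar>h\<bar>"
      unfolding eventually_at
    proof (intro exI[of _ e] conjI ballI impI assms(1))
      fix h :: real assume h: "h \<noteq> 0 \<and> dist h 0 < e"
      then have "norm (f (x + h) - f x - of_real h * D) \<le> C * \<bar>h\<bar> * \<bar>h\<bar>"
        using assms(2)[of h] by (simp add: power2_eq_square mult.assoc abs_mult_self_eq)
      then show "norm (f (x + h) - f x - of_real h * D) / norm h \<le> C * \<bar>h\<bar>"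
        using h by (simp add: divide_le_eq)
    qed
    show "((\<lambda>h. C * \<bar>h\<bar>) \<longlongrightarrow> 0) (at (0::real))" by (auto intro!: tendsto_eq_intros)
  qed auto
  then show ?thesis
    unfolding has_vector_derivative_def has_derivative_at
    by (intro conjI bounded_linear_scaleR_left) (simp add: scaleR_conv_of_real)
qed

lemma norm_exp_minus_1_le: "norm (exp z - 1) \<le> norm z * exp \<bar>Re z\<bar>" for z :: complex
  using Taylor_exp[of z 0] by (simp add: mult.commute)

lemma norm_exp_minus_1_minus_le: "norm (exp z - 1 - z) \<le> (norm z)\<^sup>2 * exp \<bar>Re z\<bar>" for z :: complex
  using Taylor_exp[of z 1] by (simp add: mult.commute power2_eq_square diff_diff_eq)

text \<open>Replaces a polynomial factor in the total wave numbers by one factor per particle, so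
  that the dominating integral over n particles becomes an n-th power.\<close>

lemma one_plus_sum_le_prod:
  fixes a :: "'i \<Rightarrow> real"
  assumes "finite I" "\<And>i. i \<in> I \<Longrightarrow> 0 \<le> a i"
  shows "1 + (\<Sum>i\<in>I. a i) \<le> (\<Prod>i\<in>I. 1 + a i)"
  using assms
proof (induction I)
  case (insert j I)
  then have IH: "1 + (\<Sum>i\<in>I. a i) \<le> (\<Prod>i\<in>I. 1 + a i)" and p: "0 \<le> (\<Sum>i\<in>I. a i)" "0 \<le> a j"
    by (auto intro: sum_nonneg)
  have "1 + (\<Sum>i\<in>insert j I. a i) \<le> (1 + a j) * (1 + (\<Sum>i\<in>I. a i))"
    using insert p by (simp add: algebra_simps)
  also have "\<dots> \<le> (1 + a j) * (\<Prod>i\<in>I. 1 + a i)" using IH p by (intro mult_left_mono) auto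
  finally show ?case using insert by simp
qed simp

text \<open>
  Polynomial factors in the wave numbers are controlled by \<open>wave_size\<close>, exponentials with real
  parameters only by the real parts: on the vertical contours used for the Airy kernel the
  imaginary parts are not exponentially integrable.
\<close>

definition wave_size :: "complex \<Rightarrow> complex \<Rightarrow> complex \<Rightarrow> real" where
  "wave_size k l w = norm k + norm l + norm w"

definition wave_re :: "complex \<Rightarrow> complex \<Rightarrow> complex \<Rightarrow> real" where
  "wave_re k l w = \<bar>Re k\<bar> + \<bar>Re l\<bar> + \<bar>Re w\<bar>"

abbreviation "wsize u v \<equiv> wave_size (wave_k u v) (wave_l u v) (wave_w u v)"
abbreviation "wre u v \<equiv> wave_re (wave_k u v) (wave_l u v) (wave_w u v)"

lemma wave_size_nonneg [simp]: "0 \<le> wave_size k l w" and wave_re_nonneg [simp]: "0 \<le> wave_re k l w"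
  by (simp_all add: wave_size_def wave_re_def)

text \<open>The bounds on real parts keep u + v at distance at least 2 \<delta> from 0, also between
  different points. Moments of every order j leave room for any number of derivatives and for the
  interchange of sums; the exponential rate r opens a box of real parameters around the base
  point.\<close>

locale kp_gas =
  fixes M :: "'a measure" and c u v :: "'a \<Rightarrow> complex" and \<delta> r :: real
  assumes sigma_finite: "sigma_finite_measure M"
    and measurable_c [measurable]: "c \<in> borel_measurable M"
    and measurable_u [measurable]: "u \<in> borel_measurable M"
    and measurable_v [measurable]: "v \<in> borel_measurable M"
    and \<delta>_pos: "0 < \<delta>" and r_pos: "0 < r"
    and Re_u: "p \<in> space M \<Longrightarrow> Re (u p) \<le> - \<delta>" and Re_v: "p \<in> space M \<Longrightarrow> Re (v p) \<le> - \<delta>"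
    and integrable_c: "integrable M (\<lambda>p. norm (c p) *
      (1 + wsize (u p) (v p)) ^ j *
      exp (r * wre (u p) (v p)))"
begin

sublocale PM: product_sigma_finite "\<lambda>_::nat. M"
  using sigma_finite by (simp add: product_sigma_finite_def)

definition kk :: "'a \<Rightarrow> complex" where "kk p = wave_k (u p) (v p)"
definition ll :: "'a \<Rightarrow> complex" where "ll p = wave_l (u p) (v p)"
definition ww :: "'a \<Rightarrow> complex" where "ww p = wave_w (u p) (v p)"

lemma measurable_waves [measurable]:
  "kk \<in> borel_measurable M" "ll \<in> borel_measurable M" "ww \<in> borel_measurable M"
  unfolding kk_def[abs_def] ll_def[abs_def] ww_def[abs_def] wave_defs by measurable

definition K :: "nat set \<Rightarrow> (nat \<Rightarrow> 'a) \<Rightarrow> complex" where "K I p = (\<Sum>i\<in>I. kk (p i))"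
definition L :: "nat set \<Rightarrow> (nat \<Rightarrow> 'a) \<Rightarrow> complex" where "L I p = (\<Sum>i\<in>I. ll (p i))"
definition W :: "nat set \<Rightarrow> (nat \<Rightarrow> 'a) \<Rightarrow> complex" where "W I p = (\<Sum>i\<in>I. ww (p i))"

text \<open>The sign (-1)^n of the Fredholm series is absorbed into the weights - c.\<close>

definition dens :: "nat set \<Rightarrow> (nat \<Rightarrow> 'a) \<Rightarrow> complex" where
  "dens I p = (\<Prod>i\<in>I. - c (p i)) * cauchy_prod (\<lambda>i. u (p i)) (\<lambda>i. v (p i)) I"

definition weight :: "nat \<Rightarrow> 'a \<Rightarrow> real" where
  "weight j p = norm (c p) * (1 + wave_size (kk p) (ll p) (ww p)) ^ j * exp (r * wave_re (kk p) (ll p) (ww p))"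

definition hb :: "nat \<Rightarrow> real" where "hb n = (1 / (2 * \<delta>) * sqrt (real n)) ^ n"

lemma hb_nonneg: "0 \<le> hb n" using \<delta>_pos by (simp add: hb_def)

lemma integrable_weight: "integrable M (weight j)"
  using integrable_c[of j] by (simp add: weight_def[abs_def] kk_def ll_def ww_def)

lemma weight_nonneg: "0 \<le> weight j p"
  by (simp add: weight_def)

lemma measurable_KLW [measurable]:
  assumes "I \<subseteq> J"
  shows "K I \<in> borel_measurable (PiM J (\<lambda>_. M))" "L I \<in> borel_measurable (PiM J (\<lambda>_. M))"
    "W I \<in> borel_measurable (PiM J (\<lambda>_. M))"
proof -
  have m: "(\<lambda>p. f (p i)) \<in> borel_measurable (PiM J (\<lambda>_. M))"
    if "f \<in> borel_measurable M" "i \<in> I" for f :: "'a \<Rightarrow> complex" and i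
    by (rule measurable_compose[OF measurable_component_singleton[of i J "\<lambda>_. M"] that(1)]) (use that assms in auto)
  show "K I \<in> borel_measurable (PiM J (\<lambda>_. M))" "L I \<in> borel_measurable (PiM J (\<lambda>_. M))"
    "W I \<in> borel_measurable (PiM J (\<lambda>_. M))"
    unfolding K_def[abs_def] L_def[abs_def] W_def[abs_def]
    by (intro borel_measurable_sum m measurable_waves; assumption)+
qed

lemma measurable_dens [measurable]:
  assumes "I \<subseteq> J"
  shows "dens I \<in> borel_measurable (PiM J (\<lambda>_. M))"
proof -
  have m: "(\<lambda>p. f (p i)) \<in> borel_measurable (PiM J (\<lambda>_. M))" if "f \<in> borel_measurable M" "i \<in> I"
    for f :: "'a \<Rightarrow> complex" and i
    by (rule measurable_compose[OF measurable_component_singleton[of i J "\<lambda>_. M"] that(1)]) (use that assms in auto)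
  show ?thesis
    unfolding dens_def[abs_def] cauchy_prod_def soliton_int_def case_prod_beta
    by (intro borel_measurable_times borel_measurable_prod borel_measurable_uminus borel_measurable_divide
          borel_measurable_const borel_measurable_add borel_measurable_diff m) auto
qed

lemma norm_dens_le:
  assumes I: "finite I" and p: "p \<in> space (PiM J (\<lambda>_. M))" and IJ: "I \<subseteq> J"
  shows "norm (dens I p) \<le> hb (card I) * (\<Prod>i\<in>I. norm (c (p i)))"
proof -
  have "u (p i) + v (p j) \<noteq> 0 \<and> norm (1 / (u (p i) + v (p j))) \<le> 1 / (2 * \<delta>)" if "i \<in> I" "j \<in> I" for i j
  proof -
    have "p i \<in> space M" "p j \<in> space M" using p that IJ by (auto simp: space_PiM PiE_iff)
    then have "Re (u (p i) + v (p j)) \<le> - 2 * \<delta>" using Re_u[of "p i"] Re_v[of "p j"] by simp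
    then have ge: "2 * \<delta> \<le> norm (u (p i) + v (p j))" using abs_Re_le_cmod[of "u (p i) + v (p j)"] by linarith
    then have "u (p i) + v (p j) \<noteq> 0" using \<delta>_pos by auto
    moreover have "norm (1 / (u (p i) + v (p j))) \<le> 1 / (2 * \<delta>)"
      using ge \<delta>_pos by (simp add: norm_divide frac_le)
    ultimately show ?thesis by simp
  qed
  then have "norm (cauchy_prod (\<lambda>i. u (p i)) (\<lambda>i. v (p i)) I) \<le> hb (card I)"
    unfolding hb_def by (intro norm_cauchy_prod_le[OF I]) auto
  then show ?thesis
    unfolding dens_def norm_mult prod_norm[symmetric] norm_minus_cancel
    by (subst mult.commute, intro mult_right_mono prod_nonneg) auto
qed

text \<open>The insertions that the moments in \<open>integrable_c\<close> can pay for. The constant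
  C is tracked because Taylor remainders enter with C = h^2.\<close>

definition good :: "nat \<Rightarrow> real \<Rightarrow> (complex \<Rightarrow> complex \<Rightarrow> complex \<Rightarrow> complex) \<Rightarrow> bool" where
  "good j C \<phi> \<longleftrightarrow> (\<lambda>x. \<phi> (fst x) (fst (snd x)) (snd (snd x))) \<in> borel_measurable (borel \<Otimes>\<^sub>M borel \<Otimes>\<^sub>M borel) \<and>
     (\<forall>k l w. norm (\<phi> k l w) \<le> C * (1 + wave_size k l w) ^ j * exp (r * wave_re k l w))"

lemma good_nonneg: "good j C \<phi> \<Longrightarrow> 0 \<le> C"
proof -
  assume "good j C \<phi>"
  then have "norm (\<phi> 0 0 0) \<le> C * (1 + wave_size 0 0 0) ^ j * exp (r * wave_re 0 0 0)"
    unfolding good_def by blast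
  also have "\<dots> = C" by (simp add: wave_size_def wave_re_def)
  finally show ?thesis using norm_ge_zero order_trans by blast
qed

lemma good_mono:
  assumes "good j C \<phi>" "j \<le> j'"
  shows "good j' C \<phi>"
  unfolding good_def
proof (intro conjI allI)
  fix k l w
  have "norm (\<phi> k l w) \<le> C * (1 + wave_size k l w) ^ j * exp (r * wave_re k l w)"
    using assms by (simp add: good_def)
  also have "\<dots> \<le> C * (1 + wave_size k l w) ^ j' * exp (r * wave_re k l w)"
    using assms good_nonneg[OF assms(1)] by (intro mult_right_mono mult_left_mono power_increasing) auto
  finally show "norm (\<phi> k l w) \<le> C * (1 + wave_size k l w) ^ j' * exp (r * wave_re k l w)" .
qed (use assms in \<open>simp add: good_def\<close>)

lemma good_measurable:
  assumes "good j C \<phi>" "I \<subseteq> J"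
  shows "(\<lambda>p. \<phi> (K I p) (L I p) (W I p)) \<in> borel_measurable (PiM J (\<lambda>_. M))"
proof -
  note [measurable] = measurable_KLW[OF assms(2)]
  have "(\<lambda>p. (K I p, L I p, W I p)) \<in> measurable (PiM J (\<lambda>_. M)) (borel \<Otimes>\<^sub>M borel \<Otimes>\<^sub>M borel)"
    by measurable
  from measurable_compose[OF this, of "\<lambda>x. \<phi> (fst x) (fst (snd x)) (snd (snd x))" borel] assms(1) show ?thesis by (simp add: good_def)
qed

lemma norm_gterm_le:
  assumes \<phi>: "good j C \<phi>" and I: "finite I" and p: "p \<in> space (PiM J (\<lambda>_. M))" and IJ: "I \<subseteq> J"
  shows "norm (dens I p * \<phi> (K I p) (L I p) (W I p)) \<le> C * hb (card I) * (\<Prod>i\<in>I. weight j (p i))"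
proof -
  let ?s = "\<lambda>i. wave_size (kk (p i)) (ll (p i)) (ww (p i))" and ?e = "\<lambda>i. wave_re (kk (p i)) (ll (p i)) (ww (p i))"
  have C: "0 \<le> C" by (rule good_nonneg[OF \<phi>])
  have "wave_size (K I p) (L I p) (W I p) \<le> (\<Sum>i\<in>I. ?s i)"
    unfolding wave_size_def K_def L_def W_def sum.distrib by (intro add_mono norm_sum)
  then have "1 + wave_size (K I p) (L I p) (W I p) \<le> (\<Prod>i\<in>I. 1 + ?s i)"
    using one_plus_sum_le_prod[OF I, of ?s] by simp
  then have 1: "(1 + wave_size (K I p) (L I p) (W I p)) ^ j \<le> (\<Prod>i\<in>I. (1 + ?s i) ^ j)"
    unfolding prod_power_distrib[symmetric] by (intro power_mono) (auto intro: add_nonneg_nonneg)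
  have "wave_re (K I p) (L I p) (W I p) \<le> (\<Sum>i\<in>I. ?e i)"
    unfolding wave_re_def K_def L_def W_def sum.distrib Re_sum by (intro add_mono sum_abs)
  then have "exp (r * wave_re (K I p) (L I p) (W I p)) \<le> exp (\<Sum>i\<in>I. r * ?e i)"
    using r_pos by (simp add: sum_distrib_left[symmetric])
  then have 2: "exp (r * wave_re (K I p) (L I p) (W I p)) \<le> (\<Prod>i\<in>I. exp (r * ?e i))"
    by (simp add: exp_sum I)
  have "norm (\<phi> (K I p) (L I p) (W I p)) \<le>
      C * (1 + wave_size (K I p) (L I p) (W I p)) ^ j * exp (r * wave_re (K I p) (L I p) (W I p))"
    using \<phi> by (simp add: good_def)
  also have "\<dots> \<le> C * (\<Prod>i\<in>I. (1 + ?s i) ^ j) * (\<Prod>i\<in>I. exp (r * ?e i))"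
    using C 1 2 by (intro mult_mono mult_left_mono mult_nonneg_nonneg prod_nonneg) auto
  finally have 3: "norm (\<phi> (K I p) (L I p) (W I p)) \<le> C * (\<Prod>i\<in>I. (1 + ?s i) ^ j) * (\<Prod>i\<in>I. exp (r * ?e i))" .
  have "norm (dens I p * \<phi> (K I p) (L I p) (W I p)) \<le>
      (hb (card I) * (\<Prod>i\<in>I. norm (c (p i)))) * (C * (\<Prod>i\<in>I. (1 + ?s i) ^ j) * (\<Prod>i\<in>I. exp (r * ?e i)))"
    unfolding norm_mult using norm_dens_le[OF I p IJ] 3 hb_nonneg
    by (intro mult_mono) (auto intro!: mult_nonneg_nonneg prod_nonneg)
  also have "\<dots> = C * hb (card I) * (\<Prod>i\<in>I. weight j (p i))"
    unfolding weight_def prod.distrib by (simp add: mult_ac)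
  finally show ?thesis .
qed

lemma integrable_weights:
  fixes I :: "nat set"
  shows "finite I \<Longrightarrow> integrable (PiM I (\<lambda>_. M)) (\<lambda>p. \<Prod>i\<in>I. weight j (p i))"
  using PM.product_integrable_prod[of I "\<lambda>_. weight j"] integrable_weight by simp

lemma integrable_gterm:
  assumes \<phi>: "good j C \<phi>" and I: "finite I"
  shows "integrable (PiM I (\<lambda>_. M)) (\<lambda>p. dens I p * \<phi> (K I p) (L I p) (W I p))"
proof (rule lint_bound)
  show "integrable (PiM I (\<lambda>_. M)) (\<lambda>p. C * hb (card I) * (\<Prod>i\<in>I. weight j (p i)))"
    by (intro integrable_mult_right integrable_weights I)
  show "(\<lambda>p. dens I p * \<phi> (K I p) (L I p) (W I p)) \<in> borel_measurable (PiM I (\<lambda>_. M))"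
    by (intro borel_measurable_times measurable_dens good_measurable[OF \<phi>]) auto
  show "AE p in PiM I (\<lambda>_. M). norm (dens I p * \<phi> (K I p) (L I p) (W I p)) \<le> norm (C * hb (card I) * (\<Prod>i\<in>I. weight j (p i)))"
    using norm_gterm_le[OF \<phi> I _ subset_refl] by (intro AE_I2) (simp, smt (verit))
qed

definition gterm :: "nat set \<Rightarrow> (complex \<Rightarrow> complex \<Rightarrow> complex \<Rightarrow> complex) \<Rightarrow> complex" where
  "gterm I \<phi> = (LINT p|PiM I (\<lambda>_. M). dens I p * \<phi> (K I p) (L I p) (W I p))"

definition gasJ :: "nat \<Rightarrow> real" where "gasJ j = (LINT p|M. weight j p)"

lemma gasJ_nonneg: "0 \<le> gasJ j" unfolding gasJ_def by (rule Bochner_Integration.integral_nonneg) (rule weight_nonneg)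

lemma norm_gterm_integral_le:
  assumes \<phi>: "good j C \<phi>" and I: "finite I"
  shows "norm (gterm I \<phi>) \<le> C * hb (card I) * gasJ j ^ card I"
proof -
  have "norm (gterm I \<phi>) \<le> (LINT p|PiM I (\<lambda>_. M). C * hb (card I) * (\<Prod>i\<in>I. weight j (p i)))"
    unfolding gterm_def
  proof (rule order_trans[OF integral_norm_bound], rule Bochner_Integration.integral_mono)
    show "integrable (PiM I (\<lambda>_. M)) (\<lambda>p. norm (dens I p * \<phi> (K I p) (L I p) (W I p)))"
      using integrable_gterm[OF \<phi> I] by (rule integrable_norm)
    show "integrable (PiM I (\<lambda>_. M)) (\<lambda>p. C * hb (card I) * (\<Prod>i\<in>I. weight j (p i)))"
      by (intro integrable_mult_right integrable_weights I)
  qed (rule norm_gterm_le[OF \<phi> I _ subset_refl])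
  also have "\<dots> = C * hb (card I) * gasJ j ^ card I"
    using PM.product_integral_prod[OF I integrable_weight[of j]] by (simp add: gasJ_def)
  finally show ?thesis .
qed

text \<open>A grand canonical sum with an insertion depending on the total wave numbers: \<phi> = 1
  gives the Fredholm determinant at the base point, exponentials move the parameters, and powers of
  k, l, w give derivatives.\<close>

definition gas :: "(complex \<Rightarrow> complex \<Rightarrow> complex \<Rightarrow> complex) \<Rightarrow> complex" where
  "gas \<phi> = (\<Sum>n. gterm {..<n} \<phi> / fact n)"

definition gasC :: "nat \<Rightarrow> real" where "gasC j = (\<Sum>n. hb n * gasJ j ^ n / fact n)"

lemma summable_gasC: "summable (\<lambda>n. hb n * gasJ j ^ n / fact n)"
  using summable_hadamard[of "1 / (2 * \<delta>)" "gasJ j"] \<delta>_pos gasJ_nonneg by (simp add: hb_def)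

lemma norm_gterm_fact_le:
  assumes "good j C \<phi>"
  shows "norm (gterm {..<n} \<phi> / fact n) \<le> C * (hb n * gasJ j ^ n / fact n)"
  using norm_gterm_integral_le[OF assms, of "{..<n}"] by (simp add: norm_divide divide_right_mono mult.assoc)

lemma summable_norm_gterm: "good j C \<phi> \<Longrightarrow> summable (\<lambda>n. norm (gterm {..<n} \<phi> / fact n))"
  using norm_gterm_fact_le
  by (intro summable_comparison_test'[OF summable_mult[OF summable_gasC[of j], of C], of 0]) auto

lemma summable_gterm: "good j C \<phi> \<Longrightarrow> summable (\<lambda>n. gterm {..<n} \<phi> / fact n)"
  by (rule summable_norm_cancel) (rule summable_norm_gterm)

lemma norm_gas_le:
  assumes "good j C \<phi>"
  shows "norm (gas \<phi>) \<le> C * gasC j"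
proof -
  have "norm (gas \<phi>) \<le> (\<Sum>n. norm (gterm {..<n} \<phi> / fact n))"
    unfolding gas_def by (rule summable_norm[OF summable_norm_gterm[OF assms]])
  also have "\<dots> \<le> (\<Sum>n. C * (hb n * gasJ j ^ n / fact n))"
    by (intro suminf_le norm_gterm_fact_le[OF assms] summable_norm_gterm[OF assms] summable_mult summable_gasC)
  also have "\<dots> = C * gasC j" unfolding gasC_def by (rule suminf_mult[OF summable_gasC])
  finally show ?thesis .
qed

lemma gas_add:
  assumes "good j C \<phi>" "good j' C' \<psi>"
  shows "gas (\<lambda>k l w. \<phi> k l w + \<psi> k l w) = gas \<phi> + gas \<psi>"
proof -
  have "gterm {..<n} (\<lambda>k l w. \<phi> k l w + \<psi> k l w) = gterm {..<n} \<phi> + gterm {..<n} \<psi>" for n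
    unfolding gterm_def distrib_left
    by (intro Bochner_Integration.integral_add integrable_gterm[OF assms(1)] integrable_gterm[OF assms(2)]) auto
  then show ?thesis
    unfolding gas_def using suminf_add[OF summable_gterm[OF assms(1)] summable_gterm[OF assms(2)]]
    by (simp add: add_divide_distrib)
qed

lemma gas_cmult: "good j C \<phi> \<Longrightarrow> gas (\<lambda>k l w. a * \<phi> k l w) = a * gas \<phi>"
proof -
  assume g: "good j C \<phi>"
  have "gterm I (\<lambda>k l w. a * \<phi> k l w) = a * gterm I \<phi>" for I
    unfolding gterm_def mult.left_commute[of _ a] by (rule lint_cmult)
  then show ?thesis unfolding gas_def using suminf_mult[OF summable_gterm[OF g], of a] by simp
qed

lemma gterm_reindex:
  assumes I: "finite I" and \<phi>: "good j C \<phi>"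
  shows "gterm I \<phi> = gterm {..<card I} \<phi>"
proof -
  obtain h where h: "bij_betw h {..<card I} I"
    using ex_bij_betw_nat_finite[OF I] by (auto simp: atLeast0LessThan)
  have inj: "inj_on h {..<card I}" and im: "h ` {..<card I} = I" using h by (auto simp: bij_betw_def)
  let ?J = "{..<card I}"
  let ?R = "\<lambda>p. \<lambda>j\<in>?J. p (h j)"
  have R: "?R \<in> measurable (PiM I (\<lambda>_. M)) (PiM ?J (\<lambda>_. M))"
    using im by (intro measurable_restrict measurable_component_singleton) auto
  have sums: "K ?J (?R p) = K I p" "L ?J (?R p) = L I p" "W ?J (?R p) = W I p" for p
  proof -
    have "(\<Sum>i\<in>?J. f (?R p i)) = (\<Sum>i\<in>I. f (p i))" for f :: "'a \<Rightarrow> complex"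
    proof -
      have "(\<Sum>i\<in>?J. f (?R p i)) = (\<Sum>i\<in>?J. f (p (h i)))" by (rule sum.cong) auto
      also have "\<dots> = (\<Sum>i\<in>I. f (p i))" by (rule sum.reindex_bij_betw[OF h])
      finally show ?thesis .
    qed
    note s = this
    show "K ?J (?R p) = K I p" "L ?J (?R p) = L I p" "W ?J (?R p) = W I p"
      unfolding K_def L_def W_def by (rule s)+
  qed
  have d: "dens ?J (?R p) = dens I p" for p
  proof -
    have "(\<Prod>i\<in>?J. - c (?R p i)) = (\<Prod>i\<in>I. - c (p i))"
    proof -
      have "(\<Prod>i\<in>?J. - c (?R p i)) = (\<Prod>i\<in>?J. - c (p (h i)))" by (rule prod.cong) auto
      also have "\<dots> = (\<Prod>i\<in>I. - c (p i))" by (rule prod.reindex_bij_betw[OF h])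
      finally show ?thesis .
    qed
    moreover have "cauchy_prod (\<lambda>i. u (?R p i)) (\<lambda>i. v (?R p i)) ?J = cauchy_prod (\<lambda>i. u (p (h i))) (\<lambda>i. v (p (h i))) ?J"
      by (rule cauchy_prod_cong) auto
    moreover have "\<dots> = cauchy_prod (\<lambda>i. u (p i)) (\<lambda>i. v (p i)) I"
      using cauchy_prod_reindex[OF _ inj, of "\<lambda>i. u (p i)" "\<lambda>i. v (p i)"] im by simp
    ultimately show ?thesis by (simp add: dens_def)
  qed
  have "gterm ?J \<phi> = (LINT p|distr (PiM I (\<lambda>_. M)) (PiM ?J (\<lambda>_. M)) ?R. dens ?J p * \<phi> (K ?J p) (L ?J p) (W ?J p))"
    unfolding gterm_def using PM.distr_PiM_reindex_finite[OF h] by simp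
  also have "\<dots> = gterm I \<phi>"
    unfolding gterm_def using integrable_gterm[OF \<phi>, of ?J] R by (subst integral_distr) (auto simp: sums d)
  finally show ?thesis ..
qed

text \<open>Like \<open>good\<close>, but with the exponential rate as a parameter: a function that
  is to be differentiated must start strictly below the rate r.\<close>

definition wave_fun :: "nat \<Rightarrow> (complex \<Rightarrow> complex \<Rightarrow> complex \<Rightarrow> complex) \<Rightarrow> real \<Rightarrow> bool" where
  "wave_fun j \<psi> s \<longleftrightarrow> (\<lambda>x. \<psi> (fst x) (fst (snd x)) (snd (snd x))) \<in> borel_measurable (borel \<Otimes>\<^sub>M borel \<Otimes>\<^sub>M borel) \<and>
     (\<forall>k l w. norm (\<psi> k l w) \<le> (1 + wave_size k l w) ^ j * exp (s * wave_re k l w))"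

text \<open>\<psi> uses half of the exponential rate, and the increment exp (h d) with |h| \<le> r /
  2 uses the other half. The second order remainder costs two further powers of
  \<open>wave_size\<close> and leaves the factor h^2.\<close>

lemma gas_has_vector_derivative:
  assumes \<psi>: "wave_fun j \<psi> (r / 2)"
    and d: "(\<lambda>x. d (fst x) (fst (snd x)) (snd (snd x))) \<in> borel_measurable (borel \<Otimes>\<^sub>M borel \<Otimes>\<^sub>M borel)"
    and dS: "\<And>k l w. norm (d k l w) \<le> wave_size k l w" and dR: "\<And>k l w. \<bar>Re (d k l w)\<bar> \<le> wave_re k l w"
  shows "((\<lambda>h. gas (\<lambda>k l w. \<psi> k l w * exp (of_real h * d k l w))) has_vector_derivative
           gas (\<lambda>k l w. \<psi> k l w * d k l w)) (at 0)"
proof (rule has_vector_derivative_quadratic_remainder[of "r / 2"])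
  have \<psi>m [measurable]: "(\<lambda>x. \<psi> (fst x) (fst (snd x)) (snd (snd x))) \<in> borel_measurable (borel \<Otimes>\<^sub>M borel \<Otimes>\<^sub>M borel)"
    and \<psi>b: "norm (\<psi> k l w) \<le> (1 + wave_size k l w) ^ j * exp (r / 2 * wave_re k l w)" for k l w
    using \<psi> by (auto simp: wave_fun_def)
  note [measurable] = d
  have mono: "exp (r / 2 * wave_re k l w) \<le> exp (r * wave_re k l w)" for k l w
    using r_pos by (simp add: mult_right_mono)
  show "0 < r / 2" using r_pos by simp
  fix h :: real assume h: "\<bar>h\<bar> \<le> r / 2"
  let ?rem = "\<lambda>k l w. \<psi> k l w * (exp (of_real h * d k l w) - 1 - of_real h * d k l w)"
  have g1: "good j 1 \<psi>"
    unfolding good_def using order_trans[OF \<psi>b mult_left_mono[OF mono]] by auto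
  have g2: "good (Suc j) 1 (\<lambda>k l w. \<psi> k l w * d k l w)"
    unfolding good_def
  proof (intro conjI allI)
    fix k l w
    have "norm (\<psi> k l w * d k l w) \<le> ((1 + wave_size k l w) ^ j * exp (r * wave_re k l w)) * (1 + wave_size k l w)"
      unfolding norm_mult using order_trans[OF \<psi>b mult_left_mono[OF mono]] dS[of k l w]
      by (intro mult_mono) (auto intro: order_trans)
    then show "norm (\<psi> k l w * d k l w) \<le> 1 * (1 + wave_size k l w) ^ Suc j * exp (r * wave_re k l w)"
      by (simp add: mult_ac)
  qed measurable
  have g3: "good (j + 2) (h\<^sup>2) ?rem"
    unfolding good_def
  proof (intro conjI allI)
    fix k l w
    have e: "\<bar>Re (of_real h * d k l w)\<bar> \<le> r / 2 * wave_re k l w"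
      using mult_mono[OF h dR[of k l w]] r_pos by (simp add: abs_mult)
    have n: "norm (of_real h * d k l w) \<le> \<bar>h\<bar> * (1 + wave_size k l w)"
      unfolding norm_mult using dS[of k l w] by (auto intro!: mult_left_mono)
    have "norm (exp (of_real h * d k l w) - 1 - of_real h * d k l w) \<le>
        (\<bar>h\<bar> * (1 + wave_size k l w))\<^sup>2 * exp (r / 2 * wave_re k l w)"
      by (rule order_trans[OF norm_exp_minus_1_minus_le], intro mult_mono power_mono n) (use e in auto)
    then have "norm (?rem k l w) \<le> ((1 + wave_size k l w) ^ j * exp (r / 2 * wave_re k l w)) *
       ((\<bar>h\<bar> * (1 + wave_size k l w))\<^sup>2 * exp (r / 2 * wave_re k l w))"
      unfolding norm_mult by (intro mult_mono \<psi>b) auto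
    also have "\<dots> = h\<^sup>2 * (1 + wave_size k l w) ^ (j + 2) * (exp (r / 2 * wave_re k l w) * exp (r / 2 * wave_re k l w))"
      by (simp add: power_mult_distrib power_add power2_eq_square mult_ac)
    also have "exp (r / 2 * wave_re k l w) * exp (r / 2 * wave_re k l w) = exp (r * wave_re k l w)"
      by (simp flip: exp_add)
    finally show "norm (?rem k l w) \<le> h\<^sup>2 * (1 + wave_size k l w) ^ (j + 2) * exp (r * wave_re k l w)" .
  qed measurable
  have g4: "good (Suc j) \<bar>h\<bar> (\<lambda>k l w. of_real h * (\<psi> k l w * d k l w))"
    unfolding good_def
  proof (intro conjI allI)
    fix k l w
    show "norm (of_real h * (\<psi> k l w * d k l w)) \<le> \<bar>h\<bar> * (1 + wave_size k l w) ^ Suc j * exp (r * wave_re k l w)"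
      using g2 unfolding good_def norm_mult[of "of_real h"] by (simp add: mult_left_mono mult.assoc)
  qed measurable
  have g5: "good (j + 2) (1 + \<bar>h\<bar>) (\<lambda>k l w. \<psi> k l w + of_real h * (\<psi> k l w * d k l w))"
    unfolding good_def
  proof (intro conjI allI)
    fix k l w
    have "norm (\<psi> k l w) \<le> 1 * (1 + wave_size k l w) ^ (j + 2) * exp (r * wave_re k l w)"
      using good_mono[OF g1, of "j + 2"] unfolding good_def by (meson le_add1)
    moreover have "norm (of_real h * (\<psi> k l w * d k l w)) \<le> \<bar>h\<bar> * (1 + wave_size k l w) ^ (j + 2) * exp (r * wave_re k l w)"
      using good_mono[OF g4, of "j + 2"] unfolding good_def by simp
    ultimately show "norm (\<psi> k l w + of_real h * (\<psi> k l w * d k l w)) \<le>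
        (1 + \<bar>h\<bar>) * (1 + wave_size k l w) ^ (j + 2) * exp (r * wave_re k l w)"
      using norm_triangle_ineq[of "\<psi> k l w" "of_real h * (\<psi> k l w * d k l w)"] by (simp add: distrib_right)
  qed measurable
  have "gas (\<lambda>k l w. \<psi> k l w * exp (of_real h * d k l w)) =
      gas (\<lambda>k l w. (\<psi> k l w + of_real h * (\<psi> k l w * d k l w)) + ?rem k l w)"
    by (intro arg_cong[of _ _ gas] ext) (simp add: algebra_simps)
  also have "\<dots> = gas \<psi> + of_real h * gas (\<lambda>k l w. \<psi> k l w * d k l w) + gas ?rem"
    by (simp only: gas_add[OF g5 g3] gas_add[OF g1 g4] gas_cmult[OF g2])
  finally have "gas (\<lambda>k l w. \<psi> k l w * exp (of_real h * d k l w)) - gas \<psi> - of_real h * gas (\<lambda>k l w. \<psi> k l w * d k l w) = gas ?rem"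
    by simp
  then show "norm (gas (\<lambda>k l w. \<psi> k l w * exp (of_real (0 + h) * d k l w)) - gas (\<lambda>k l w. \<psi> k l w * exp (of_real 0 * d k l w)) -
      of_real h * gas (\<lambda>k l w. \<psi> k l w * d k l w)) \<le> gasC (j + 2) * h\<^sup>2"
    using norm_gas_le[OF g3] by (simp add: mult.commute)
qed

definition F :: "nat \<Rightarrow> nat \<Rightarrow> nat \<Rightarrow> real \<Rightarrow> real \<Rightarrow> real \<Rightarrow> complex" where
  "F a b d x y t = gas (\<lambda>k l w. k ^ a * l ^ b * w ^ d * exp (of_real x * k + of_real y * l + of_real t * w))"

lemma wave_fun_F:
  assumes "\<bar>x\<bar> \<le> s" "\<bar>y\<bar> \<le> s" "\<bar>t\<bar> \<le> s"
  shows "wave_fun (a + b + d) (\<lambda>k l w. k ^ a * l ^ b * w ^ d * exp (of_real x * k + of_real y * l + of_real t * w)) s"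
  unfolding wave_fun_def
proof (intro conjI allI)
  fix k l w :: complex
  have "norm k ^ a \<le> (1 + wave_size k l w) ^ a" "norm l ^ b \<le> (1 + wave_size k l w) ^ b"
    "norm w ^ d \<le> (1 + wave_size k l w) ^ d"
    by (intro power_mono; simp add: wave_size_def)+
  moreover have "x * Re k + y * Re l + t * Re w \<le> s * wave_re k l w"
  proof -
    have "a * b \<le> s * \<bar>b\<bar>" if "\<bar>a\<bar> \<le> s" for a b :: real
      using abs_ge_self[of "a * b"] mult_right_mono[OF that abs_ge_zero[of b]] by (simp add: abs_mult)
    from add_mono[OF add_mono[OF this[OF assms(1), of "Re k"] this[OF assms(2), of "Re l"]] this[OF assms(3), of "Re w"]]
    show ?thesis by (simp add: wave_re_def distrib_left)
  qed
  ultimately show "norm (k ^ a * l ^ b * w ^ d * exp (of_real x * k + of_real y * l + of_real t * w)) \<le>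
    (1 + wave_size k l w) ^ (a + b + d) * exp (s * wave_re k l w)"
    unfolding norm_mult norm_power norm_exp_eq_Re power_add by (intro mult_mono) auto
qed measurable

lemma good_F:
  assumes "\<bar>x\<bar> \<le> r" "\<bar>y\<bar> \<le> r" "\<bar>t\<bar> \<le> r"
  shows "good (a + b + d) 1 (\<lambda>k l w. k ^ a * l ^ b * w ^ d * exp (of_real x * k + of_real y * l + of_real t * w))"
  using wave_fun_F[OF assms] by (simp add: good_def wave_fun_def)

lemma has_vector_derivative_shift_0:
  "((\<lambda>h. f (x + h)) has_vector_derivative D) (at 0) \<Longrightarrow> (f has_vector_derivative D) (at x)" for x :: real
proof -
  assume h: "((\<lambda>h. f (x + h)) has_vector_derivative D) (at 0)"
  have "((\<lambda>t. t - x) has_vector_derivative 1) (at x)"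
    by (auto intro!: derivative_eq_intros)
  from vector_diff_chain_at[OF this, of "\<lambda>h. f (x + h)" D] h show ?thesis by (simp add: o_def)
qed

lemma F_has_vector_derivative:
  assumes "\<bar>x\<bar> \<le> r / 2" "\<bar>y\<bar> \<le> r / 2" "\<bar>t\<bar> \<le> r / 2"
  shows "((\<lambda>x. F a b d x y t) has_vector_derivative F (Suc a) b d x y t) (at x)"
    "((\<lambda>y. F a b d x y t) has_vector_derivative F a (Suc b) d x y t) (at y)"
    "((\<lambda>t. F a b d x y t) has_vector_derivative F a b (Suc d) x y t) (at t)"
proof -
  note w = wave_fun_F[OF assms, of a b d]
  have ex: "exp (of_real (x + h) * k + of_real y * l + of_real t * w) = exp (of_real x * k + of_real y * l + of_real t * w) * exp (of_real h * k)"
    "exp (of_real x * k + of_real (y + h) * l + of_real t * w) = exp (of_real x * k + of_real y * l + of_real t * w) * exp (of_real h * l)"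
    "exp (of_real x * k + of_real y * l + of_real (t + h) * w) = exp (of_real x * k + of_real y * l + of_real t * w) * exp (of_real h * w)"
    for h and k l w :: complex
    by (simp_all add: distrib_right exp_add[symmetric] add_ac)
  have A0: "(\<lambda>(k::complex) (l::complex) (w::complex). k ^ a * l ^ b * w ^ d * exp (of_real x * k + of_real y * l + of_real t * w) * exp (of_real h * k)) =
      (\<lambda>k l w. k ^ a * l ^ b * w ^ d * exp (of_real (x + h) * k + of_real y * l + of_real t * w))" for h
    by (intro ext) (simp only: ex mult.assoc)
  have B0: "(\<lambda>(k::complex) (l::complex) (w::complex). k ^ a * l ^ b * w ^ d * exp (of_real x * k + of_real y * l + of_real t * w) * k) =
      (\<lambda>k l w. k ^ (Suc a) * l ^ b * w ^ d * exp (of_real x * k + of_real y * l + of_real t * w))"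
    by (intro ext) (simp add: mult_ac)
  have "((\<lambda>h. F a b d (x + h) y t) has_vector_derivative F (Suc a) b d x y t) (at 0)"
    using gas_has_vector_derivative[OF w, of "\<lambda>k l w. k"] unfolding A0 B0 F_def
    by (simp add: wave_size_def wave_re_def)
  then show "((\<lambda>x. F a b d x y t) has_vector_derivative F (Suc a) b d x y t) (at x)"
    by (rule has_vector_derivative_shift_0)
  have A1: "(\<lambda>(k::complex) (l::complex) (w::complex). k ^ a * l ^ b * w ^ d * exp (of_real x * k + of_real y * l + of_real t * w) * exp (of_real h * l)) =
      (\<lambda>k l w. k ^ a * l ^ b * w ^ d * exp (of_real x * k + of_real (y + h) * l + of_real t * w))" for h
    by (intro ext) (simp only: ex mult.assoc)
  have B1: "(\<lambda>(k::complex) (l::complex) (w::complex). k ^ a * l ^ b * w ^ d * exp (of_real x * k + of_real y * l + of_real t * w) * l) =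
      (\<lambda>k l w. k ^ a * l ^ (Suc b) * w ^ d * exp (of_real x * k + of_real y * l + of_real t * w))"
    by (intro ext) (simp add: mult_ac)
  have "((\<lambda>h. F a b d x (y + h) t) has_vector_derivative F a (Suc b) d x y t) (at 0)"
    using gas_has_vector_derivative[OF w, of "\<lambda>k l w. l"] unfolding A1 B1 F_def
    by (simp add: wave_size_def wave_re_def)
  then show "((\<lambda>y. F a b d x y t) has_vector_derivative F a (Suc b) d x y t) (at y)"
    by (rule has_vector_derivative_shift_0)
  have A2: "(\<lambda>(k::complex) (l::complex) (w::complex). k ^ a * l ^ b * w ^ d * exp (of_real x * k + of_real y * l + of_real t * w) * exp (of_real h * w)) =
      (\<lambda>k l w. k ^ a * l ^ b * w ^ d * exp (of_real x * k + of_real y * l + of_real (t + h) * w))" for h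
    by (intro ext) (simp only: ex mult.assoc)
  have B2: "(\<lambda>(k::complex) (l::complex) (w::complex). k ^ a * l ^ b * w ^ d * exp (of_real x * k + of_real y * l + of_real t * w) * w) =
      (\<lambda>k l w. k ^ a * l ^ b * w ^ (Suc d) * exp (of_real x * k + of_real y * l + of_real t * w))"
    by (intro ext) (simp add: mult_ac)
  have "((\<lambda>h. F a b d x y (t + h)) has_vector_derivative F a b (Suc d) x y t) (at 0)"
    using gas_has_vector_derivative[OF w, of "\<lambda>k l w. w"] unfolding A2 B2 F_def
    by (simp add: wave_size_def wave_re_def)
  then show "((\<lambda>t. F a b d x y t) has_vector_derivative F a b (Suc d) x y t) (at t)"
    by (rule has_vector_derivative_shift_0)
qed

text \<open>Continuity at the base point jointly in the three parameters. Partial derivatives alone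
  would not show that the set where the determinant is nonzero is open.\<close>

lemma F_lipschitz_0:
  assumes "\<bar>x\<bar> \<le> r" "\<bar>y\<bar> \<le> r" "\<bar>t\<bar> \<le> r"
  shows "norm (F 0 0 0 x y t - F 0 0 0 0 0 0) \<le> (\<bar>x\<bar> + \<bar>y\<bar> + \<bar>t\<bar>) * gasC 1"
proof -
  let ?z = "\<lambda>k l w. of_real x * k + of_real y * l + of_real t * w"
  have g: "good 1 (\<bar>x\<bar> + \<bar>y\<bar> + \<bar>t\<bar>) (\<lambda>k l w. exp (?z k l w) - 1)"
    unfolding good_def
  proof (intro conjI allI)
    fix k l w :: complex
    have "norm (?z k l w) \<le> \<bar>x\<bar> * norm k + \<bar>y\<bar> * norm l + \<bar>t\<bar> * norm w"
      by (intro order_trans[OF norm_triangle_ineq] add_mono) (auto simp: norm_mult)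
    also have "\<dots> \<le> \<bar>x\<bar> * (1 + wave_size k l w) + \<bar>y\<bar> * (1 + wave_size k l w) + \<bar>t\<bar> * (1 + wave_size k l w)"
      by (intro add_mono mult_left_mono) (auto simp: wave_size_def)
    finally have 1: "norm (?z k l w) \<le> (\<bar>x\<bar> + \<bar>y\<bar> + \<bar>t\<bar>) * (1 + wave_size k l w)" by (simp add: distrib_right)
    have "\<bar>Re (?z k l w)\<bar> \<le> \<bar>x\<bar> * \<bar>Re k\<bar> + \<bar>y\<bar> * \<bar>Re l\<bar> + \<bar>t\<bar> * \<bar>Re w\<bar>"
      by (intro order_trans[OF abs_triangle_ineq] add_mono | simp add: abs_mult)+
    also have "\<dots> \<le> r * \<bar>Re k\<bar> + r * \<bar>Re l\<bar> + r * \<bar>Re w\<bar>"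
      using assms by (intro add_mono mult_right_mono) auto
    finally have 2: "\<bar>Re (?z k l w)\<bar> \<le> r * wave_re k l w" by (simp add: wave_re_def distrib_left)
    show "norm (exp (?z k l w) - 1) \<le> (\<bar>x\<bar> + \<bar>y\<bar> + \<bar>t\<bar>) * (1 + wave_size k l w) ^ 1 * exp (r * wave_re k l w)"
      unfolding power_one_right
      by (rule order_trans[OF norm_exp_minus_1_le], intro mult_mono 1) (use 2 in auto)
  qed measurable
  have g1: "good 0 1 (\<lambda>k l w. 1)" using good_F[of 0 0 0 0 0 0] r_pos by simp
  have "F 0 0 0 x y t = gas (\<lambda>k l w. 1 + (exp (?z k l w) - 1))" "F 0 0 0 0 0 0 = gas (\<lambda>k l w. 1)"
    by (simp_all add: F_def)
  then have "F 0 0 0 x y t - F 0 0 0 0 0 0 = gas (\<lambda>k l w. exp (?z k l w) - 1)"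
    by (simp only: gas_add[OF g1 g] add_diff_cancel_left')
  then show ?thesis using norm_gas_le[OF g] by (simp only:)
qed

section \<open>Products of two gas series\<close>

lemma KLW_cong:
  assumes "\<And>i. i \<in> I \<Longrightarrow> p i = q i"
  shows "K I p = K I q" "L I p = L I q" "W I p = W I q" "dens I p = dens I q"
proof -
  show "K I p = K I q" "L I p = L I q" "W I p = W I q"
    using assms by (auto simp: K_def L_def W_def)
  have "cauchy_prod (\<lambda>i. u (p i)) (\<lambda>i. v (p i)) I = cauchy_prod (\<lambda>i. u (q i)) (\<lambda>i. v (q i)) I"
    by (rule cauchy_prod_cong) (simp_all add: assms)
  then show "dens I p = dens I q" using assms by (simp add: dens_def)
qed

text \<open>The two insertions depend on disjoint sets of coordinates, so the integral over their
  union factors.\<close>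

lemma gterm_mult:
  assumes \<phi>: "good j C \<phi>" and \<psi>: "good j' C' \<psi>" and fin: "finite I" "finite J" and disj: "I \<inter> J = {}"
  shows "integrable (PiM (I \<union> J) (\<lambda>_. M)) (\<lambda>p. (dens I p * \<phi> (K I p) (L I p) (W I p)) * (dens J p * \<psi> (K J p) (L J p) (W J p)))"
      (is "integrable _ ?f")
    and "(LINT p|PiM (I \<union> J) (\<lambda>_. M). (dens I p * \<phi> (K I p) (L I p) (W I p)) * (dens J p * \<psi> (K J p) (L J p) (W J p))) =
      gterm I \<phi> * gterm J \<psi>"
proof -
  let ?w = "\<lambda>i. if i \<in> I then weight j else weight j'"
  have w: "(\<Prod>i\<in>I \<union> J. ?w i (p i)) = (\<Prod>i\<in>I. weight j (p i)) * (\<Prod>i\<in>J. weight j' (p i))" for p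
  proof -
    have "(\<Prod>i\<in>I \<union> J. ?w i (p i)) = (\<Prod>i\<in>I. ?w i (p i)) * (\<Prod>i\<in>J. ?w i (p i))"
      using fin disj by (rule prod.union_disjoint)
    also have "(\<Prod>i\<in>I. ?w i (p i)) = (\<Prod>i\<in>I. weight j (p i))" by (rule prod.cong) auto
    also have "(\<Prod>i\<in>J. ?w i (p i)) = (\<Prod>i\<in>J. weight j' (p i))" by (rule prod.cong) (use disj in auto)
    finally show ?thesis .
  qed
  show int: "integrable (PiM (I \<union> J) (\<lambda>_. M)) ?f"
  proof (rule lint_bound)
    have "integrable (PiM (I \<union> J) (\<lambda>_. M)) (\<lambda>p. \<Prod>i\<in>I \<union> J. ?w i (p i))"
      using fin integrable_weight by (intro PM.product_integrable_prod) auto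
    then show "integrable (PiM (I \<union> J) (\<lambda>_. M)) (\<lambda>p. (C * hb (card I) * (C' * hb (card J))) * (\<Prod>i\<in>I \<union> J. ?w i (p i)))"
      by (rule integrable_mult_right)
    show "?f \<in> borel_measurable (PiM (I \<union> J) (\<lambda>_. M))"
      by (intro borel_measurable_times measurable_dens good_measurable[OF \<phi>] good_measurable[OF \<psi>]) auto
    show "AE p in PiM (I \<union> J) (\<lambda>_. M). norm (?f p) \<le> norm ((C * hb (card I) * (C' * hb (card J))) * (\<Prod>i\<in>I \<union> J. ?w i (p i)))"
    proof (rule AE_I2)
      fix p assume p: "p \<in> space (PiM (I \<union> J) (\<lambda>_. M))"
      have "norm (?f p) \<le> (C * hb (card I) * (\<Prod>i\<in>I. weight j (p i))) * (C' * hb (card J) * (\<Prod>i\<in>J. weight j' (p i)))"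
        unfolding norm_mult[of "dens I p * _"]
        using good_nonneg[OF \<phi>] hb_nonneg weight_nonneg
        by (intro mult_mono norm_gterm_le[OF \<phi> fin(1) p] norm_gterm_le[OF \<psi> fin(2) p] mult_nonneg_nonneg prod_nonneg) auto
      also have "\<dots> = (C * hb (card I) * (C' * hb (card J))) * (\<Prod>i\<in>I \<union> J. ?w i (p i))"
        unfolding w by (simp add: mult_ac)
      finally show "norm (?f p) \<le> norm ((C * hb (card I) * (C' * hb (card J))) * (\<Prod>i\<in>I \<union> J. ?w i (p i)))"
        by (rule order_trans) simp
    qed
  qed
  have "(LINT p|PiM (I \<union> J) (\<lambda>_. M). ?f p) =
     (LINT x|PiM I (\<lambda>_. M). LINT y|PiM J (\<lambda>_. M). ?f (merge I J (x, y)))"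
    by (rule PM.product_integral_fold[OF disj fin int])
  also have "\<dots> = (LINT x|PiM I (\<lambda>_. M). LINT y|PiM J (\<lambda>_. M).
      (dens I x * \<phi> (K I x) (L I x) (W I x)) * (dens J y * \<psi> (K J y) (L J y) (W J y)))"
  proof -
    have I: "K I (merge I J (x, y)) = K I x" "L I (merge I J (x, y)) = L I x" "W I (merge I J (x, y)) = W I x"
       "dens I (merge I J (x, y)) = dens I x" for x y
      by (rule KLW_cong; simp add: merge_def)+
    have J: "K J (merge I J (x, y)) = K J y" "L J (merge I J (x, y)) = L J y" "W J (merge I J (x, y)) = W J y"
       "dens J (merge I J (x, y)) = dens J y" for x y
      by (rule KLW_cong; use disj in \<open>auto simp: merge_def\<close>)+
    show ?thesis unfolding I J ..
  qed
  also have "\<dots> = gterm I \<phi> * gterm J \<psi>"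
    unfolding gterm_def by simp
  finally show "(LINT p|PiM (I \<union> J) (\<lambda>_. M). ?f p) = gterm I \<phi> * gterm J \<psi>" .
qed

lemma sum_Pow_card:
  fixes g :: "nat \<Rightarrow> complex"
  shows "(\<Sum>I\<in>Pow {..<N::nat}. g (card I)) = (\<Sum>i\<le>N. of_nat (N choose i) * g i)"
proof -
  have "(\<Sum>I\<in>Pow {..<N}. g (card I)) = (\<Sum>i\<le>N. \<Sum>I\<in>{I \<in> Pow {..<N}. card I = i}. g (card I))"
    by (rule sum.group[symmetric]) (auto intro: subset_eq_atLeast0_lessThan_card simp: subset_eq_atLeast0_lessThan_card atLeast0LessThan[symmetric])
  also have "\<dots> = (\<Sum>i\<le>N. \<Sum>I\<in>{I \<in> Pow {..<N}. card I = i}. g i)"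
    by (intro sum.cong refl) auto
  also have "\<dots> = (\<Sum>i\<le>N. of_nat (N choose i) * g i)"
    using n_subsets[of "{..<N}"] by (simp add: Pow_def)
  finally show ?thesis .
qed

text \<open>The weight 1 / (i! (N - i)!) in the Cauchy product is (N choose i) / N!, that is, 1 / N!
  for every subset I of size i. Spreading the coefficient over the subsets puts both factors on one
  common configuration of N points, as Hirota's identity requires.\<close>

lemma gas_mult_sums:
  assumes \<phi>: "good j C \<phi>" and \<psi>: "good j' C' \<psi>"
  shows "(\<lambda>N. (\<Sum>I\<in>Pow {..<N}. LINT p|PiM {..<N} (\<lambda>_. M). (dens I p * \<phi> (K I p) (L I p) (W I p)) *
      (dens ({..<N} - I) p * \<psi> (K ({..<N} - I) p) (L ({..<N} - I) p) (W ({..<N} - I) p))) / fact N) sums (gas \<phi> * gas \<psi>)"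
proof -
  have "(\<lambda>N. \<Sum>i\<le>N. (gterm {..<i} \<phi> / fact i) * (gterm {..<N - i} \<psi> / fact (N - i))) sums (gas \<phi> * gas \<psi>)"
    unfolding gas_def by (intro Cauchy_product_sums summable_norm_gterm[OF \<phi>] summable_norm_gterm[OF \<psi>])
  moreover have "(\<Sum>i\<le>N. (gterm {..<i} \<phi> / fact i) * (gterm {..<N - i} \<psi> / fact (N - i))) =
     (\<Sum>I\<in>Pow {..<N}. LINT p|PiM {..<N} (\<lambda>_. M). (dens I p * \<phi> (K I p) (L I p) (W I p)) *
      (dens ({..<N} - I) p * \<psi> (K ({..<N} - I) p) (L ({..<N} - I) p) (W ({..<N} - I) p))) / fact N" for N
  proof -
    have "(LINT p|PiM {..<N} (\<lambda>_. M). (dens I p * \<phi> (K I p) (L I p) (W I p)) *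
      (dens ({..<N} - I) p * \<psi> (K ({..<N} - I) p) (L ({..<N} - I) p) (W ({..<N} - I) p))) =
      gterm {..<card I} \<phi> * gterm {..<N - card I} \<psi>" if I: "I \<in> Pow {..<N}" for I
    proof -
      have eq: "I \<union> ({..<N} - I) = {..<N}" and fin: "finite I" "finite ({..<N} - I)" and card: "card ({..<N} - I) = N - card I"
        using I by (auto simp: card_Diff_subset finite_subset)
      show ?thesis
        using gterm_mult(2)[OF \<phi> \<psi> fin] gterm_reindex[OF fin(1) \<phi>] gterm_reindex[OF fin(2) \<psi>]
        unfolding eq card by (simp add: Diff_disjoint)
    qed
    then have "(\<Sum>I\<in>Pow {..<N}. LINT p|PiM {..<N} (\<lambda>_. M). (dens I p * \<phi> (K I p) (L I p) (W I p)) *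
      (dens ({..<N} - I) p * \<psi> (K ({..<N} - I) p) (L ({..<N} - I) p) (W ({..<N} - I) p))) =
      (\<Sum>I\<in>Pow {..<N}. gterm {..<card I} \<phi> * gterm {..<N - card I} \<psi>)" by (intro sum.cong refl)
    also have "\<dots> = (\<Sum>i\<le>N. of_nat (N choose i) * (gterm {..<i} \<phi> * gterm {..<N - i} \<psi>))"
      by (rule sum_Pow_card)
    finally have "(\<Sum>I\<in>Pow {..<N}. LINT p|PiM {..<N} (\<lambda>_. M). (dens I p * \<phi> (K I p) (L I p) (W I p)) *
      (dens ({..<N} - I) p * \<psi> (K ({..<N} - I) p) (L ({..<N} - I) p) (W ({..<N} - I) p))) / fact N =
      (\<Sum>i\<le>N. of_nat (N choose i) * (gterm {..<i} \<phi> * gterm {..<N - i} \<psi>)) / fact N" by simp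
    also have "\<dots> = (\<Sum>i\<le>N. (gterm {..<i} \<phi> / fact i) * (gterm {..<N - i} \<psi> / fact (N - i)))"
      unfolding sum_divide_distrib
      by (intro sum.cong refl) (simp add: binomial_fact)
    finally show ?thesis ..
  qed
  ultimately show ?thesis by (simp only:)
qed

text \<open>For a fixed configuration the product of the weights and \<rho> do not depend on how the
  points are split, and leave the sum over I. What remains is \<open>hirota_sum\<close>, which
  vanishes pointwise.\<close>

lemma gas_bilinear_eq_0:
  assumes T: "finite T" and good: "\<And>t. t \<in> T \<Longrightarrow> good j C (\<phi> t)" "\<And>t. t \<in> T \<Longrightarrow> good j C (\<psi> t)"
    and eq: "\<And>k l w k' l' w'. (\<Sum>t\<in>T. \<phi> t k l w * \<psi> t k' l' w') =
      kp_symbol (k - k') (l - l') (w - w') * \<rho> (k + k') (l + l') (w + w')"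
  shows "(\<Sum>t\<in>T. gas (\<phi> t) * gas (\<psi> t)) = 0"
proof -
  let ?X = "\<lambda>N t I p. (dens I p * \<phi> t (K I p) (L I p) (W I p)) *
      (dens ({..<N} - I) p * \<psi> t (K ({..<N} - I) p) (L ({..<N} - I) p) (W ({..<N} - I) p))"
  have "(\<lambda>N. \<Sum>t\<in>T. (\<Sum>I\<in>Pow {..<N}. LINT p|PiM {..<N} (\<lambda>_. M). ?X N t I p) / fact N) sums (\<Sum>t\<in>T. gas (\<phi> t) * gas (\<psi> t))"
    by (intro sums_sum gas_mult_sums[OF good(1) good(2)])
  moreover have "(\<Sum>t\<in>T. (\<Sum>I\<in>Pow {..<N}. LINT p|PiM {..<N} (\<lambda>_. M). ?X N t I p) / fact N) = 0" for N
  proof -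
    have int: "integrable (PiM {..<N} (\<lambda>_. M)) (?X N t I)" if "I \<in> Pow {..<N}" "t \<in> T" for I t
    proof -
      have "I \<union> ({..<N} - I) = {..<N}" "finite I" using that by (auto simp: finite_subset)
      then show ?thesis using gterm_mult(1)[OF good(1) good(2), of t t I "{..<N} - I"] that by (simp add: Diff_disjoint)
    qed
    have "(\<Sum>t\<in>T. \<Sum>I\<in>Pow {..<N}. LINT p|PiM {..<N} (\<lambda>_. M). ?X N t I p) =
        (LINT p|PiM {..<N} (\<lambda>_. M). (\<Sum>t\<in>T. \<Sum>I\<in>Pow {..<N}. ?X N t I p))"
    proof -
      have "(LINT p|PiM {..<N} (\<lambda>_. M). (\<Sum>t\<in>T. \<Sum>I\<in>Pow {..<N}. ?X N t I p)) =
          (\<Sum>t\<in>T. LINT p|PiM {..<N} (\<lambda>_. M). (\<Sum>I\<in>Pow {..<N}. ?X N t I p))"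
        by (intro Bochner_Integration.integral_sum Bochner_Integration.integrable_sum int)
      also have "\<dots> = (\<Sum>t\<in>T. \<Sum>I\<in>Pow {..<N}. LINT p|PiM {..<N} (\<lambda>_. M). ?X N t I p)"
        by (intro sum.cong refl Bochner_Integration.integral_sum int)
      finally show ?thesis ..
    qed
    also have "\<dots> = (LINT p|PiM {..<N} (\<lambda>_. M). 0)"
    proof (rule lint_cong)
      fix p assume p: "p \<in> space (PiM {..<N} (\<lambda>_. M))"
      have nz: "u (p i) + v (p j) \<noteq> 0" if "i \<in> {..<N}" "j \<in> {..<N}" for i j
      proof -
        have "p i \<in> space M" "p j \<in> space M" using p that by (auto simp: space_PiM PiE_iff)
        then have "Re (u (p i) + v (p j)) < 0" using Re_u[of "p i"] Re_v[of "p j"] \<delta>_pos by simp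
        then show ?thesis by (metis less_irrefl zero_complex.sel(1))
      qed
      have "(\<Sum>t\<in>T. \<Sum>I\<in>Pow {..<N}. ?X N t I p) = (\<Sum>I\<in>Pow {..<N}. \<Sum>t\<in>T. ?X N t I p)" by (rule sum.swap)
      also have "\<dots> = (\<Sum>I\<in>Pow {..<N}. (\<Prod>i<N. - c (p i)) * \<rho> (K {..<N} p) (L {..<N} p) (W {..<N} p) *
        (kp_symbol (K I p - K ({..<N} - I) p) (L I p - L ({..<N} - I) p) (W I p - W ({..<N} - I) p) *
          cauchy_prod (\<lambda>i. u (p i)) (\<lambda>i. v (p i)) I * cauchy_prod (\<lambda>i. u (p i)) (\<lambda>i. v (p i)) ({..<N} - I)))"
      proof (intro sum.cong refl)
        fix I assume I: "I \<in> Pow {..<N}"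
        then have sub: "I \<subseteq> {..<N}" by simp
        have KK: "K I p + K ({..<N} - I) p = K {..<N} p" "L I p + L ({..<N} - I) p = L {..<N} p" "W I p + W ({..<N} - I) p = W {..<N} p"
          unfolding K_def L_def W_def by (simp_all add: sum.subset_diff[OF sub] add.commute)
        have cc: "(\<Prod>i<N. - c (p i)) = (\<Prod>i\<in>I. - c (p i)) * (\<Prod>i\<in>{..<N} - I. - c (p i))"
          by (subst prod.subset_diff[OF sub]) (simp_all only: finite_lessThan mult.commute)
        have "(\<Sum>t\<in>T. ?X N t I p) = dens I p * dens ({..<N} - I) p *
          (\<Sum>t\<in>T. \<phi> t (K I p) (L I p) (W I p) * \<psi> t (K ({..<N} - I) p) (L ({..<N} - I) p) (W ({..<N} - I) p))"
          unfolding sum_distrib_left by (intro sum.cong refl) (simp only: mult_ac)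
        then show "(\<Sum>t\<in>T. ?X N t I p) = (\<Prod>i<N. - c (p i)) * \<rho> (K {..<N} p) (L {..<N} p) (W {..<N} p) *
          (kp_symbol (K I p - K ({..<N} - I) p) (L I p - L ({..<N} - I) p) (W I p - W ({..<N} - I) p) *
            cauchy_prod (\<lambda>i. u (p i)) (\<lambda>i. v (p i)) I * cauchy_prod (\<lambda>i. u (p i)) (\<lambda>i. v (p i)) ({..<N} - I))"
          unfolding eq KK cc dens_def by (simp only: mult_ac)
      qed
      also have "\<dots> = (\<Prod>i<N. - c (p i)) * \<rho> (K {..<N} p) (L {..<N} p) (W {..<N} p) *
          hirota_sum (\<lambda>i. u (p i)) (\<lambda>i. v (p i)) {..<N}"
        unfolding hirota_sum_def K_def L_def W_def kk_def ll_def ww_def sum_distrib_left[symmetric] ..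
      also have "\<dots> = 0" using hirota_sum_eq_0[of "{..<N}" "\<lambda>i. u (p i)" "\<lambda>i. v (p i)"] nz by simp
      finally show "(\<Sum>t\<in>T. \<Sum>I\<in>Pow {..<N}. ?X N t I p) = 0" .
    qed
    finally show ?thesis by (simp add: sum_divide_distrib[symmetric])
  qed
  ultimately have "(\<lambda>N. 0) sums (\<Sum>t\<in>T. gas (\<phi> t) * gas (\<psi> t))" by (simp only:)
  then show ?thesis using sums_unique2 sums_zero by blast
qed

theorem F_bilinear:
  assumes "\<bar>x\<bar> \<le> r" "\<bar>y\<bar> \<le> r" "\<bar>t\<bar> \<le> r"
  shows "F 4 0 0 x y t * F 0 0 0 x y t - 4 * F 3 0 0 x y t * F 1 0 0 x y t + 3 * (F 2 0 0 x y t)\<^sup>2 +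
    12 * (F 1 0 1 x y t * F 0 0 0 x y t - F 1 0 0 x y t * F 0 0 1 x y t) +
    12 * (F 0 2 0 x y t * F 0 0 0 x y t - (F 0 1 0 x y t)\<^sup>2) = 0"
proof -
  let ?e = "\<lambda>k l w. exp (of_real x * k + of_real y * l + of_real t * w)"
  \<comment> \<open>The monomials of (k - k')^4 + 12 (k - k') (w - w') + 12 (l - l')^2: coefficient,
    exponents of k, l, w in the first factor, exponents of k', l', w' in the second. The largest
    coefficient has modulus 24, whence the constant in \<open>good_psi\<close> and
    \<open>good_phi\<close>.\<close>
  let ?T = "{(1::int, (4::nat, 0::nat, 0::nat), (0::nat, 0::nat, 0::nat)), (- 4, (3, 0, 0), (1, 0, 0)), (6, (2, 0, 0), (2, 0, 0)),
     (- 4, (1, 0, 0), (3, 0, 0)), (1, (0, 0, 0), (4, 0, 0)),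
     (12, (1, 0, 1), (0, 0, 0)), (- 12, (1, 0, 0), (0, 0, 1)), (- 12, (0, 0, 1), (1, 0, 0)), (12, (0, 0, 0), (1, 0, 1)),
     (12, (0, 2, 0), (0, 0, 0)), (- 24, (0, 1, 0), (0, 1, 0)), (12, (0, 0, 0), (0, 2, 0))}"
  let ?\<phi> = "\<lambda>(c0::int, (a::nat, b::nat, d::nat), _::nat \<times> nat \<times> nat) k l w. of_int c0 * (k ^ a * l ^ b * w ^ d * ?e k l w)"
  let ?\<psi> = "\<lambda>(_::int, _::nat \<times> nat \<times> nat, (a::nat, b::nat, d::nat)) k l w. k ^ a * l ^ b * w ^ d * ?e k l w"
  have good_psi: "good 4 24 (\<lambda>k l w. k ^ a * l ^ b * w ^ d * ?e k l w)" if "a + b + d \<le> 4" for a b d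
  proof -
    have g: "good 4 1 (\<lambda>k l w. k ^ a * l ^ b * w ^ d * ?e k l w)"
      by (rule good_mono[OF good_F[OF assms] that])
    show ?thesis unfolding good_def
    proof (intro conjI allI)
      fix k l w
      have "norm (k ^ a * l ^ b * w ^ d * ?e k l w) \<le> 1 * (1 + wave_size k l w) ^ 4 * exp (r * wave_re k l w)"
        using g unfolding good_def by blast
      also have "\<dots> \<le> 24 * (1 + wave_size k l w) ^ 4 * exp (r * wave_re k l w)" by (intro mult_right_mono) auto
      finally show "norm (k ^ a * l ^ b * w ^ d * ?e k l w) \<le> 24 * (1 + wave_size k l w) ^ 4 * exp (r * wave_re k l w)" .
    qed (use g in \<open>simp add: good_def\<close>)
  qed
  have good_phi: "good 4 24 (\<lambda>k l w. of_int c0 * (k ^ a * l ^ b * w ^ d * ?e k l w))"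
    if "a + b + d \<le> 4" "\<bar>c0\<bar> \<le> 24" for a b d c0
  proof -
    have g: "good 4 1 (\<lambda>k l w. k ^ a * l ^ b * w ^ d * ?e k l w)"
      by (rule good_mono[OF good_F[OF assms] that(1)])
    show ?thesis unfolding good_def
    proof (intro conjI allI)
      fix k l w
      have n: "norm (k ^ a * l ^ b * w ^ d * ?e k l w) \<le> 1 * (1 + wave_size k l w) ^ 4 * exp (r * wave_re k l w)"
        using g unfolding good_def by blast
      have c0: "norm (of_int c0 :: complex) \<le> 24" using that(2) by simp
      have "norm (of_int c0 * (k ^ a * l ^ b * w ^ d * ?e k l w)) \<le> 24 * (1 * (1 + wave_size k l w) ^ 4 * exp (r * wave_re k l w))"
        unfolding norm_mult[of "of_int c0"] by (intro mult_mono n c0) auto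
      then show "norm (of_int c0 * (k ^ a * l ^ b * w ^ d * ?e k l w)) \<le> 24 * (1 + wave_size k l w) ^ 4 * exp (r * wave_re k l w)"
        by simp
    next
      have [measurable]: "(\<lambda>q :: complex \<times> complex \<times> complex. (fst q) ^ a * (fst (snd q)) ^ b * (snd (snd q)) ^ d * ?e (fst q) (fst (snd q)) (snd (snd q)))
          \<in> borel_measurable (borel \<Otimes>\<^sub>M borel \<Otimes>\<^sub>M borel)"
        using g unfolding good_def by blast
      show "(\<lambda>q :: complex \<times> complex \<times> complex. of_int c0 * ((fst q) ^ a * (fst (snd q)) ^ b * (snd (snd q)) ^ d * ?e (fst q) (fst (snd q)) (snd (snd q))))
          \<in> borel_measurable (borel \<Otimes>\<^sub>M borel \<Otimes>\<^sub>M borel)" by measurable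
    qed
  qed
  have "(\<Sum>q\<in>?T. gas (?\<phi> q) * gas (?\<psi> q)) = 0"
  proof (rule gas_bilinear_eq_0[where j = 4 and C = 24 and \<rho> = ?e])
    have "case q of (c0, (a, b, d), (a', b', d')) \<Rightarrow> a + b + d \<le> 4 \<and> \<bar>c0\<bar> \<le> 24 \<and> a' + b' + d' \<le> 4" if "q \<in> ?T" for q
      using that by auto
    then have T: "a + b + d \<le> 4" "\<bar>c0\<bar> \<le> 24" "a' + b' + d' \<le> 4" if "(c0, (a, b, d), (a', b', d')) \<in> ?T" for c0 a b d a' b' d'
      using that by fastforce+
    show "good 4 24 (?\<phi> q)" if q: "q \<in> ?T" for q
    proof -
      obtain c0 a b d a' b' d' where eq: "q = (c0, (a, b, d), (a', b', d'))" by (metis prod.collapse)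
      show ?thesis using T[of c0 a b d a' b' d'] q unfolding eq prod.case by (intro good_phi) blast+
    qed
    show "good 4 24 (?\<psi> q)" if q: "q \<in> ?T" for q
    proof -
      obtain c0 a b d a' b' d' where eq: "q = (c0, (a, b, d), (a', b', d'))" by (metis prod.collapse)
      show ?thesis using T[of c0 a b d a' b' d'] q unfolding eq prod.case by (intro good_psi) blast
    qed
    fix k l w k' l' w' :: complex
    have e: "?e (k + k') (l + l') (w + w') = ?e k l w * ?e k' l' w'"
      by (simp add: exp_add[symmetric] distrib_left add_ac)
    have "(\<Sum>q\<in>?T. ?\<phi> q k l w * ?\<psi> q k' l' w') =
      (k ^ 4 - 4 * k ^ 3 * k' + 6 * k\<^sup>2 * k'\<^sup>2 - 4 * k * k' ^ 3 + k' ^ 4 + 12 * (k * w - k * w' - k' * w + k' * w') +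
       12 * (l\<^sup>2 - 2 * l * l' + l'\<^sup>2)) * (?e k l w * ?e k' l' w')"
      by (simp add: algebra_simps)
    also have "k ^ 4 - 4 * k ^ 3 * k' + 6 * k\<^sup>2 * k'\<^sup>2 - 4 * k * k' ^ 3 + k' ^ 4 + 12 * (k * w - k * w' - k' * w + k' * w') +
       12 * (l\<^sup>2 - 2 * l * l' + l'\<^sup>2) = kp_symbol (k - k') (l - l') (w - w')"
      by (simp add: kp_symbol_def power4_eq_xxxx power3_eq_cube power2_eq_square algebra_simps)
    finally show "(\<Sum>q\<in>?T. ?\<phi> q k l w * ?\<psi> q k' l' w') = kp_symbol (k - k') (l - l') (w - w') * ?e (k + k') (l + l') (w + w')"
      unfolding e .
  qed simp
  moreover have "gas (?\<phi> q) * gas (?\<psi> q) =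
      (case q of (c0, (a, b, d), (a', b', d')) \<Rightarrow> of_int c0 * F a b d x y t * F a' b' d' x y t)" for q
  proof -
    obtain c0 a b d a' b' d' where eq: "q = (c0, (a, b, d), (a', b', d'))" by (metis prod.collapse)
    show ?thesis unfolding eq prod.case using gas_cmult[OF good_F[OF assms], of "of_int c0" a b d] by (simp only: F_def)
  qed
  ultimately have "(\<Sum>q\<in>?T. case q of (c0, (a, b, d), (a', b', d')) \<Rightarrow> of_int c0 * F a b d x y t * F a' b' d' x y t) = 0"
    by (simp only:)
  \<comment> \<open>Monomials that differ by an exchange of the two factors contribute equally, so
    the sum is twice the asserted expression.\<close>
  then have "2 * (F 4 0 0 x y t * F 0 0 0 x y t - 4 * F 3 0 0 x y t * F 1 0 0 x y t + 3 * (F 2 0 0 x y t)\<^sup>2 +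
    12 * (F 1 0 1 x y t * F 0 0 0 x y t - F 1 0 0 x y t * F 0 0 1 x y t) +
    12 * (F 0 2 0 x y t * F 0 0 0 x y t - (F 0 1 0 x y t)\<^sup>2)) = 0"
    by (simp add: power2_eq_square del: mult_eq_0_iff) (simp add: algebra_simps)
  then show ?thesis by (simp only: mult_eq_0_iff zero_neq_numeral numeral_neq_zero simp_thms)
qed

end

section \<open>From the bilinear equation to KP-II\<close>

lemma has_vector_derivative_divide_complex:
  fixes f g :: "real \<Rightarrow> complex"
  assumes "(f has_vector_derivative f') (at x)" "(g has_vector_derivative g') (at x)" "g x \<noteq> 0"
  shows "((\<lambda>x. f x / g x) has_vector_derivative f' / g x - f x / g x * (g' / g x)) (at x)"
proof -
  have "(inverse has_field_derivative - (inverse (g x) * 1 * inverse (g x))) (at (g x))"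
    using assms(3) by (intro derivative_eq_intros) auto
  from field_vector_diff_chain_at[OF assms(2) this]
  have "((\<lambda>x. inverse (g x)) has_vector_derivative g' * (- (inverse (g x) * inverse (g x)))) (at x)"
    by (simp add: o_def)
  from has_vector_derivative_mult[OF assms(1) this] show ?thesis
    by (simp add: divide_inverse algebra_simps)
qed

lemma has_dxx_logI:
  assumes f: "eventually (\<lambda>t. (f has_vector_derivative f1 t) (at t)) (nhds x)"
    and f1: "(f1 has_vector_derivative f2) (at x)" and nz: "f x \<noteq> 0"
  shows "has_dxx_log f (f2 / f x - (f1 x / f x)\<^sup>2) x"
  unfolding has_dxx_log_def
proof (intro exI conjI)
  \<comment> \<open>Dividing by f x moves the nearby values close to 1, away from the branch cut of
    \<open>Ln\<close>.\<close>
  let ?L = "\<lambda>t. Ln (f t / f x) + Ln (f x)" and ?L' = "\<lambda>t. f1 t / f t"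
  have fx: "(f has_vector_derivative f1 x) (at x)" using eventually_nhds_x_imp_x[OF f] .
  then have "isCont f x" by (rule has_vector_derivative_continuous)
  then have "((\<lambda>t. f t / f x) \<longlongrightarrow> f x / f x) (nhds x)"
    using nz by (intro tendsto_intros) (simp_all add: isCont_def tendsto_nhds_iff)
  then have "((\<lambda>t. Re (f t / f x)) \<longlongrightarrow> 1) (nhds x)" using tendsto_Re nz by fastforce
  then have "eventually (\<lambda>t. 0 < Re (f t / f x)) (nhds x)"
    by (rule order_tendstoD(1)) simp
  then show "eventually (\<lambda>t. exp (?L t) = f t \<and> (?L has_vector_derivative ?L' t) (at t)) (nhds x)"
    using f
  proof eventually_elim
    case (elim t)
    have 1: "f t / f x \<noteq> 0" "f t / f x \<notin> \<real>\<^sub>\<le>\<^sub>0" using elim(1) by (auto simp: complex_nonpos_Reals_iff)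
    have ft: "f t \<noteq> 0" using 1 by auto
    have "((\<lambda>t. f t / f x) has_vector_derivative f1 t / f x) (at t)"
      using has_vector_derivative_divide_complex[OF elim(2) has_vector_derivative_const[of "f x"]] nz by simp
    from field_vector_diff_chain_at[OF this has_field_derivative_Ln[OF 1(2)]]
    have "((\<lambda>t. Ln (f t / f x)) has_vector_derivative f1 t / f x * inverse (f t / f x)) (at t)"
      by (simp only: o_def)
    moreover have "f1 t / f x * inverse (f t / f x) = f1 t / f t" using nz ft by simp
    ultimately have "((\<lambda>t. Ln (f t / f x)) has_vector_derivative f1 t / f t) (at t)" by (simp only:)
    from has_vector_derivative_add[OF this has_vector_derivative_const[of "Ln (f x)"]]
    have "(?L has_vector_derivative ?L' t) (at t)" by simp
    moreover have "exp (?L t) = f t" using 1 nz by (simp add: exp_add)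
    ultimately show ?case by simp
  qed
  show "(?L' has_vector_derivative f2 / f x - (f1 x / f x)\<^sup>2) (at x)"
    using has_vector_derivative_divide_complex[OF f1 fx nz] by (simp add: power2_eq_square)
qed

text \<open>The indices a, b, c count derivatives in x, \<gamma>, \<tau>, while the arguments come
  in the order \<tau>, \<gamma>, x. Indexing by these numbers builds the symmetry of mixed
  derivatives into the family.\<close>

locale kp_local =
  fixes B :: "(real \<times> real \<times> real) set" and G :: "nat \<Rightarrow> nat \<Rightarrow> nat \<Rightarrow> real \<Rightarrow> real \<Rightarrow> real \<Rightarrow> complex"
  assumes open_B: "open B"
    and nz: "(\<tau>, \<gamma>, x) \<in> B \<Longrightarrow> G 0 0 0 \<tau> \<gamma> x \<noteq> 0"
    and G_x: "(\<tau>, \<gamma>, x) \<in> B \<Longrightarrow> ((\<lambda>x. G a b c \<tau> \<gamma> x) has_vector_derivative G (Suc a) b c \<tau> \<gamma> x) (at x)"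
    and G_\<gamma>: "(\<tau>, \<gamma>, x) \<in> B \<Longrightarrow> ((\<lambda>\<gamma>. G a b c \<tau> \<gamma> x) has_vector_derivative G a (Suc b) c \<tau> \<gamma> x) (at \<gamma>)"
    and G_\<tau>: "(\<tau>, \<gamma>, x) \<in> B \<Longrightarrow> ((\<lambda>\<tau>. G a b c \<tau> \<gamma> x) has_vector_derivative G a b (Suc c) \<tau> \<gamma> x) (at \<tau>)"
    and bilinear: "(\<tau>, \<gamma>, x) \<in> B \<Longrightarrow>
      G 4 0 0 \<tau> \<gamma> x * G 0 0 0 \<tau> \<gamma> x - 4 * G 3 0 0 \<tau> \<gamma> x * G 1 0 0 \<tau> \<gamma> x + 3 * (G 2 0 0 \<tau> \<gamma> x)\<^sup>2 +
      12 * (G 1 0 1 \<tau> \<gamma> x * G 0 0 0 \<tau> \<gamma> x - G 1 0 0 \<tau> \<gamma> x * G 0 0 1 \<tau> \<gamma> x) +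
      12 * (G 0 2 0 \<tau> \<gamma> x * G 0 0 0 \<tau> \<gamma> x - (G 0 1 0 \<tau> \<gamma> x)\<^sup>2) = 0"
begin

text \<open>By the quotient rule a derivative raises an index and subtracts a product with a first
  order R. Polynomials in the R are therefore closed under differentiation, and the derivatives of
  log F lie among them.\<close>

definition R :: "nat \<Rightarrow> nat \<Rightarrow> nat \<Rightarrow> real \<Rightarrow> real \<Rightarrow> real \<Rightarrow> complex" where
  "R a b c \<tau> \<gamma> x = G a b c \<tau> \<gamma> x / G 0 0 0 \<tau> \<gamma> x"

lemma R_derivs:
  assumes "(\<tau>, \<gamma>, x) \<in> B"
  shows "((\<lambda>x. R a b c \<tau> \<gamma> x) has_vector_derivative R (Suc a) b c \<tau> \<gamma> x - R a b c \<tau> \<gamma> x * R (Suc 0) 0 0 \<tau> \<gamma> x) (at x)"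
    "((\<lambda>\<gamma>. R a b c \<tau> \<gamma> x) has_vector_derivative R a (Suc b) c \<tau> \<gamma> x - R a b c \<tau> \<gamma> x * R 0 (Suc 0) 0 \<tau> \<gamma> x) (at \<gamma>)"
    "((\<lambda>\<tau>. R a b c \<tau> \<gamma> x) has_vector_derivative R a b (Suc c) \<tau> \<gamma> x - R a b c \<tau> \<gamma> x * R 0 0 (Suc 0) \<tau> \<gamma> x) (at \<tau>)"
  unfolding R_def
  by (intro has_vector_derivative_divide_complex G_x G_\<gamma> G_\<tau> nz assms)+

lemma open_lines:
  "open {y. (\<tau>, \<gamma>, y) \<in> B}" "open {g. (\<tau>, g, x) \<in> B}" "open {t. (t, \<gamma>, x) \<in> B}"
proof -
  have "open ((\<lambda>y. (\<tau>, \<gamma>, y)) -` B)" "open ((\<lambda>g. (\<tau>, g, x)) -` B)" "open ((\<lambda>t. (t, \<gamma>, x)) -` B)"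
    by (intro open_vimage[OF open_B] continuous_intros)+
  then show "open {y. (\<tau>, \<gamma>, y) \<in> B}" "open {g. (\<tau>, g, x) \<in> B}" "open {t. (t, \<gamma>, x) \<in> B}"
    by (simp_all add: vimage_def)
qed

lemma transfer_x:
  assumes "\<And>\<tau> \<gamma> x. (\<tau>, \<gamma>, x) \<in> B \<Longrightarrow> f \<tau> \<gamma> x = g \<tau> \<gamma> x" "(\<tau>, \<gamma>, x) \<in> B"
    "((\<lambda>x. g \<tau> \<gamma> x) has_vector_derivative d) (at x)"
  shows "((\<lambda>x. f \<tau> \<gamma> x) has_vector_derivative d) (at x)"
  using assms by (intro has_vector_derivative_transform_within_open[OF assms(3) open_lines(1)[of \<tau> \<gamma>]]) auto

lemma transfer_\<gamma>:
  assumes "\<And>\<tau> \<gamma> x. (\<tau>, \<gamma>, x) \<in> B \<Longrightarrow> f \<tau> \<gamma> x = g \<tau> \<gamma> x" "(\<tau>, \<gamma>, x) \<in> B"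
    "((\<lambda>\<gamma>. g \<tau> \<gamma> x) has_vector_derivative d) (at \<gamma>)"
  shows "((\<lambda>\<gamma>. f \<tau> \<gamma> x) has_vector_derivative d) (at \<gamma>)"
  using assms by (intro has_vector_derivative_transform_within_open[OF assms(3) open_lines(2)[of \<tau> x]]) auto

lemma transfer_\<tau>:
  assumes "\<And>\<tau> \<gamma> x. (\<tau>, \<gamma>, x) \<in> B \<Longrightarrow> f \<tau> \<gamma> x = g \<tau> \<gamma> x" "(\<tau>, \<gamma>, x) \<in> B"
    "((\<lambda>\<tau>. g \<tau> \<gamma> x) has_vector_derivative d) (at \<tau>)"
  shows "((\<lambda>\<tau>. f \<tau> \<gamma> x) has_vector_derivative d) (at \<tau>)"
  using assms by (intro has_vector_derivative_transform_within_open[OF assms(3) open_lines(3)[of \<gamma> x]]) auto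

abbreviation (input) "r a \<equiv> R a 0 0"
abbreviation (input) "s a \<equiv> R a 0 (Suc 0)"
abbreviation (input) "g a \<equiv> R a (Suc 0) 0"
abbreviation (input) "h a \<equiv> R a (Suc (Suc 0)) 0"

text \<open>With the r a as moments, \<open>u\<close>, \<open>ux\<close>, \<open>uxx\<close> and
  \<open>uxxx\<close> are the cumulants of orders 2 to 5, that is, the x-derivatives of log F.
  \<open>v\<tau>\<close> and \<open>v\<gamma>\<close> stand for (log F)_{x \<tau>} and (log
  F)_{\<gamma> \<gamma>}.\<close>

definition u where "u \<tau> \<gamma> x = r 2 \<tau> \<gamma> x - r 1 \<tau> \<gamma> x * r 1 \<tau> \<gamma> x"
definition ux where "ux \<tau> \<gamma> x = r 3 \<tau> \<gamma> x - 3 * r 2 \<tau> \<gamma> x * r 1 \<tau> \<gamma> x + 2 * r 1 \<tau> \<gamma> x * r 1 \<tau> \<gamma> x * r 1 \<tau> \<gamma> x"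
definition uxx where "uxx \<tau> \<gamma> x = r 4 \<tau> \<gamma> x - 4 * r 3 \<tau> \<gamma> x * r 1 \<tau> \<gamma> x - 3 * r 2 \<tau> \<gamma> x * r 2 \<tau> \<gamma> x +
   12 * r 2 \<tau> \<gamma> x * r 1 \<tau> \<gamma> x * r 1 \<tau> \<gamma> x - 6 * r 1 \<tau> \<gamma> x * r 1 \<tau> \<gamma> x * r 1 \<tau> \<gamma> x * r 1 \<tau> \<gamma> x"
definition uxxx where "uxxx \<tau> \<gamma> x = r 5 \<tau> \<gamma> x - 5 * r 4 \<tau> \<gamma> x * r 1 \<tau> \<gamma> x - 10 * r 3 \<tau> \<gamma> x * r 2 \<tau> \<gamma> x +
   20 * r 3 \<tau> \<gamma> x * r 1 \<tau> \<gamma> x * r 1 \<tau> \<gamma> x + 30 * r 2 \<tau> \<gamma> x * r 2 \<tau> \<gamma> x * r 1 \<tau> \<gamma> x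
   - 60 * r 2 \<tau> \<gamma> x * r 1 \<tau> \<gamma> x * r 1 \<tau> \<gamma> x * r 1 \<tau> \<gamma> x
   + 24 * r 1 \<tau> \<gamma> x * r 1 \<tau> \<gamma> x * r 1 \<tau> \<gamma> x * r 1 \<tau> \<gamma> x * r 1 \<tau> \<gamma> x"
definition v\<tau> where "v\<tau> \<tau> \<gamma> x = s 1 \<tau> \<gamma> x - r 1 \<tau> \<gamma> x * s 0 \<tau> \<gamma> x"
definition u\<tau> where "u\<tau> \<tau> \<gamma> x = s 2 \<tau> \<gamma> x - 2 * r 1 \<tau> \<gamma> x * s 1 \<tau> \<gamma> x - r 2 \<tau> \<gamma> x * s 0 \<tau> \<gamma> x + 2 * r 1 \<tau> \<gamma> x * r 1 \<tau> \<gamma> x * s 0 \<tau> \<gamma> x"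
definition u\<gamma> where "u\<gamma> \<tau> \<gamma> x = g 2 \<tau> \<gamma> x - 2 * r 1 \<tau> \<gamma> x * g 1 \<tau> \<gamma> x - r 2 \<tau> \<gamma> x * g 0 \<tau> \<gamma> x + 2 * r 1 \<tau> \<gamma> x * r 1 \<tau> \<gamma> x * g 0 \<tau> \<gamma> x"
definition v\<gamma> where "v\<gamma> \<tau> \<gamma> x = h 0 \<tau> \<gamma> x - g 0 \<tau> \<gamma> x * g 0 \<tau> \<gamma> x"
definition v\<gamma>x where "v\<gamma>x \<tau> \<gamma> x = h 1 \<tau> \<gamma> x - h 0 \<tau> \<gamma> x * r 1 \<tau> \<gamma> x - 2 * g 0 \<tau> \<gamma> x * (g 1 \<tau> \<gamma> x - g 0 \<tau> \<gamma> x * r 1 \<tau> \<gamma> x)"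
definition u\<gamma>\<gamma> where "u\<gamma>\<gamma> \<tau> \<gamma> x = h 2 \<tau> \<gamma> x - h 1 \<tau> \<gamma> x * r 1 \<tau> \<gamma> x
   - ((h 1 \<tau> \<gamma> x - h 0 \<tau> \<gamma> x * r 1 \<tau> \<gamma> x) * r 1 \<tau> \<gamma> x + h 0 \<tau> \<gamma> x * (r 2 \<tau> \<gamma> x - r 1 \<tau> \<gamma> x * r 1 \<tau> \<gamma> x))
   - 2 * (g 1 \<tau> \<gamma> x - g 0 \<tau> \<gamma> x * r 1 \<tau> \<gamma> x) * (g 1 \<tau> \<gamma> x - g 0 \<tau> \<gamma> x * r 1 \<tau> \<gamma> x)
   - 2 * g 0 \<tau> \<gamma> x * (g 2 \<tau> \<gamma> x - g 1 \<tau> \<gamma> x * r 1 \<tau> \<gamma> x - (g 1 \<tau> \<gamma> x - g 0 \<tau> \<gamma> x * r 1 \<tau> \<gamma> x) * r 1 \<tau> \<gamma> x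
       - g 0 \<tau> \<gamma> x * (r 2 \<tau> \<gamma> x - r 1 \<tau> \<gamma> x * r 1 \<tau> \<gamma> x))"

lemmas R_eq_intros = R_derivs[THEN has_vector_derivative_eq_rhs]
  has_vector_derivative_mult[THEN has_vector_derivative_eq_rhs]
  has_vector_derivative_add[THEN has_vector_derivative_eq_rhs]
  has_vector_derivative_diff[THEN has_vector_derivative_eq_rhs]
  has_vector_derivative_const[THEN has_vector_derivative_eq_rhs]

text \<open>The single polynomial \<open>u\<gamma>\<gamma>\<close> is both the second
  \<gamma>-derivative of u and the second x-derivative of (log F)_{\<gamma> \<gamma>}; this
  agreement links the bilinear equation to KP-II.\<close>

lemma uderivs:
  assumes B: "(\<tau>, \<gamma>, x) \<in> B"
  shows "((\<lambda>x. u \<tau> \<gamma> x) has_vector_derivative ux \<tau> \<gamma> x) (at x)"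
    "((\<lambda>x. ux \<tau> \<gamma> x) has_vector_derivative uxx \<tau> \<gamma> x) (at x)"
    "((\<lambda>x. uxx \<tau> \<gamma> x) has_vector_derivative uxxx \<tau> \<gamma> x) (at x)"
    "((\<lambda>x. v\<tau> \<tau> \<gamma> x) has_vector_derivative u\<tau> \<tau> \<gamma> x) (at x)"
    "((\<lambda>\<tau>. u \<tau> \<gamma> x) has_vector_derivative u\<tau> \<tau> \<gamma> x) (at \<tau>)"
    "((\<lambda>\<gamma>. u \<tau> \<gamma> x) has_vector_derivative u\<gamma> \<tau> \<gamma> x) (at \<gamma>)"
    "((\<lambda>\<gamma>. u\<gamma> \<tau> \<gamma> x) has_vector_derivative u\<gamma>\<gamma> \<tau> \<gamma> x) (at \<gamma>)"
    "((\<lambda>x. v\<gamma> \<tau> \<gamma> x) has_vector_derivative v\<gamma>x \<tau> \<gamma> x) (at x)"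
    "((\<lambda>x. v\<gamma>x \<tau> \<gamma> x) has_vector_derivative u\<gamma>\<gamma> \<tau> \<gamma> x) (at x)"
    "\<exists>d. ((\<lambda>x. uxxx \<tau> \<gamma> x) has_vector_derivative d) (at x)"
    "\<exists>d. ((\<lambda>x. u\<tau> \<tau> \<gamma> x) has_vector_derivative d) (at x)"
  unfolding u_def ux_def uxx_def uxxx_def v\<tau>_def u\<tau>_def u\<gamma>_def v\<gamma>_def v\<gamma>x_def u\<gamma>\<gamma>_def
  by ((rule exI)?, (rule R_eq_intros B refl | (simp add: eval_nat_numeral algebra_simps; fail))+)+

text \<open>KP-II before two differentiations in x, obtained by dividing the bilinear equation by
  F^2.\<close>

lemma bilinear_R:
  assumes B: "(\<tau>, \<gamma>, x) \<in> B"
  shows "12 * v\<tau> \<tau> \<gamma> x + 12 * v\<gamma> \<tau> \<gamma> x + 6 * (u \<tau> \<gamma> x * u \<tau> \<gamma> x) + uxx \<tau> \<gamma> x = 0"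
proof -
  let ?N = "G 0 0 0 \<tau> \<gamma> x"
  have n: "?N \<noteq> 0" by (rule nz[OF B])
  have G: "G a b c \<tau> \<gamma> x = R a b c \<tau> \<gamma> x * ?N" for a b c using n by (simp add: R_def)
  have "?N\<^sup>2 * (12 * v\<tau> \<tau> \<gamma> x + 12 * v\<gamma> \<tau> \<gamma> x + 6 * (u \<tau> \<gamma> x * u \<tau> \<gamma> x) + uxx \<tau> \<gamma> x) =
      R 4 0 0 \<tau> \<gamma> x * ?N * ?N - 4 * (R 3 0 0 \<tau> \<gamma> x * ?N) * (R 1 0 0 \<tau> \<gamma> x * ?N) + 3 * (R 2 0 0 \<tau> \<gamma> x * ?N)\<^sup>2 +
      12 * (R 1 0 1 \<tau> \<gamma> x * ?N * ?N - R 1 0 0 \<tau> \<gamma> x * ?N * (R 0 0 1 \<tau> \<gamma> x * ?N)) +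
      12 * (R 0 2 0 \<tau> \<gamma> x * ?N * ?N - (R 0 1 0 \<tau> \<gamma> x * ?N)\<^sup>2)"
    unfolding v\<tau>_def v\<gamma>_def u_def uxx_def by (simp add: power2_eq_square eval_nat_numeral algebra_simps)
  also have "\<dots> = 0" using bilinear[OF B] by (simp only: G[symmetric])
  finally show ?thesis using n by simp
qed

lemma has_dxx_log_u:
  assumes B: "(\<tau>, \<gamma>, x) \<in> B"
  shows "has_dxx_log (G 0 0 0 \<tau> \<gamma>) (u \<tau> \<gamma> x) x"
proof -
  have "eventually (\<lambda>y. y \<in> {y. (\<tau>, \<gamma>, y) \<in> B}) (nhds x)"
    by (rule eventually_nhds_in_open[OF open_lines(1)]) (use B in simp)
  then have ev: "eventually (\<lambda>y. (G 0 0 0 \<tau> \<gamma> has_vector_derivative G 1 0 0 \<tau> \<gamma> y) (at y)) (nhds x)"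
    by eventually_elim (use G_x in auto)
  have "(G 1 0 0 \<tau> \<gamma> has_vector_derivative G 2 0 0 \<tau> \<gamma> x) (at x)"
    using G_x[OF B, of 1 0 0] by (simp add: eval_nat_numeral)
  from has_dxx_logI[OF ev this nz[OF B]] show ?thesis
    by (simp add: u_def R_def power2_eq_square)
qed

lemma KP_pointwise:
  fixes U :: "real \<Rightarrow> real \<Rightarrow> real \<Rightarrow> complex"
  assumes U: "\<And>\<tau> \<gamma> x. (\<tau>, \<gamma>, x) \<in> B \<Longrightarrow> U \<tau> \<gamma> x = u \<tau> \<gamma> x" and B: "(\<tau>, \<gamma>, x) \<in> B"
  shows "(\<lambda>g. U \<tau> g x) differentiable (at \<gamma>)" "(\<lambda>g. d_gamma U \<tau> g x) differentiable (at \<gamma>)"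
    "(\<lambda>t. U t \<gamma> x) differentiable (at \<tau>)" "(\<lambda>y. d_tau U \<tau> \<gamma> y) differentiable (at x)"
    "(\<lambda>y. U \<tau> \<gamma> y) differentiable (at x)" "(\<lambda>y. d_x U \<tau> \<gamma> y) differentiable (at x)"
    "(\<lambda>y. d_x (d_x U) \<tau> \<gamma> y) differentiable (at x)" "(\<lambda>y. d_x (d_x (d_x U)) \<tau> \<gamma> y) differentiable (at x)"
    "12 * d_gamma (d_gamma U) \<tau> \<gamma> x +
        d_x (\<lambda>t g y. 12 * d_tau U t g y + 12 * U t g y * d_x U t g y + d_x (d_x (d_x U)) t g y) \<tau> \<gamma> x = 0"
proof -
  have Ux: "((\<lambda>x. U \<tau> \<gamma> x) has_vector_derivative ux \<tau> \<gamma> x) (at x)" if "(\<tau>, \<gamma>, x) \<in> B" for \<tau> \<gamma> x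
    by (rule transfer_x[where f = "U" and g = "u", OF U that uderivs(1)[OF that]])
  have Ux': "d_x U \<tau> \<gamma> x = ux \<tau> \<gamma> x" if "(\<tau>, \<gamma>, x) \<in> B" for \<tau> \<gamma> x
    unfolding d_x_def by (rule vector_derivative_at[OF Ux[OF that]])
  have Uxx: "((\<lambda>x. d_x U \<tau> \<gamma> x) has_vector_derivative uxx \<tau> \<gamma> x) (at x)" if "(\<tau>, \<gamma>, x) \<in> B" for \<tau> \<gamma> x
    by (rule transfer_x[where f = "d_x U" and g = "ux", OF Ux' that uderivs(2)[OF that]])
  have Uxx': "d_x (d_x U) \<tau> \<gamma> x = uxx \<tau> \<gamma> x" if "(\<tau>, \<gamma>, x) \<in> B" for \<tau> \<gamma> x
    unfolding d_x_def[of "d_x U"] by (rule vector_derivative_at[OF Uxx[OF that]])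
  have Uxxx: "((\<lambda>x. d_x (d_x U) \<tau> \<gamma> x) has_vector_derivative uxxx \<tau> \<gamma> x) (at x)" if "(\<tau>, \<gamma>, x) \<in> B" for \<tau> \<gamma> x
    by (rule transfer_x[where f = "d_x (d_x U)" and g = "uxx", OF Uxx' that uderivs(3)[OF that]])
  have Uxxx': "d_x (d_x (d_x U)) \<tau> \<gamma> x = uxxx \<tau> \<gamma> x" if "(\<tau>, \<gamma>, x) \<in> B" for \<tau> \<gamma> x
    unfolding d_x_def[of "d_x (d_x U)"] by (rule vector_derivative_at[OF Uxxx[OF that]])
  have Ut: "((\<lambda>\<tau>. U \<tau> \<gamma> x) has_vector_derivative u\<tau> \<tau> \<gamma> x) (at \<tau>)" if "(\<tau>, \<gamma>, x) \<in> B" for \<tau> \<gamma> x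
    by (rule transfer_\<tau>[where f = "U" and g = "u", OF U that uderivs(5)[OF that]])
  have Ut': "d_tau U \<tau> \<gamma> x = u\<tau> \<tau> \<gamma> x" if "(\<tau>, \<gamma>, x) \<in> B" for \<tau> \<gamma> x
    unfolding d_tau_def by (rule vector_derivative_at[OF Ut[OF that]])
  have Ug: "((\<lambda>\<gamma>. U \<tau> \<gamma> x) has_vector_derivative u\<gamma> \<tau> \<gamma> x) (at \<gamma>)" if "(\<tau>, \<gamma>, x) \<in> B" for \<tau> \<gamma> x
    by (rule transfer_\<gamma>[where f = "U" and g = "u", OF U that uderivs(6)[OF that]])
  have Ug': "d_gamma U \<tau> \<gamma> x = u\<gamma> \<tau> \<gamma> x" if "(\<tau>, \<gamma>, x) \<in> B" for \<tau> \<gamma> x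
    unfolding d_gamma_def by (rule vector_derivative_at[OF Ug[OF that]])
  have Ugg: "((\<lambda>\<gamma>. d_gamma U \<tau> \<gamma> x) has_vector_derivative u\<gamma>\<gamma> \<tau> \<gamma> x) (at \<gamma>)" if "(\<tau>, \<gamma>, x) \<in> B" for \<tau> \<gamma> x
    by (rule transfer_\<gamma>[where f = "d_gamma U" and g = "u\<gamma>", OF Ug' that uderivs(7)[OF that]])
  have Ugg': "d_gamma (d_gamma U) \<tau> \<gamma> x = u\<gamma>\<gamma> \<tau> \<gamma> x"
    unfolding d_gamma_def[of "d_gamma U"] by (rule vector_derivative_at[OF Ugg[OF B]])
  \<comment> \<open>By the x-derivative of \<open>bilinear_R\<close>, the bracket of KP-II equals -
    12 (log F)_{x \<gamma> \<gamma>} on all of B, so its own x-derivative can be read off from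
    \<open>v\<gamma>x\<close> instead of term by term.\<close>
  have first: "12 * u\<tau> \<tau> \<gamma> x + 12 * u \<tau> \<gamma> x * ux \<tau> \<gamma> x + uxxx \<tau> \<gamma> x = - 12 * v\<gamma>x \<tau> \<gamma> x"
    if "(\<tau>, \<gamma>, x) \<in> B" for \<tau> \<gamma> x
  proof -
    have "((\<lambda>x. 12 * v\<tau> \<tau> \<gamma> x + 12 * v\<gamma> \<tau> \<gamma> x + 6 * (u \<tau> \<gamma> x * u \<tau> \<gamma> x) + uxx \<tau> \<gamma> x) has_vector_derivative
        12 * u\<tau> \<tau> \<gamma> x + 12 * v\<gamma>x \<tau> \<gamma> x + 6 * (u \<tau> \<gamma> x * ux \<tau> \<gamma> x + ux \<tau> \<gamma> x * u \<tau> \<gamma> x) + uxxx \<tau> \<gamma> x) (at x)"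
      by (intro has_vector_derivative_add has_vector_derivative_mult_right has_vector_derivative_mult uderivs that)
    moreover have "((\<lambda>x. 12 * v\<tau> \<tau> \<gamma> x + 12 * v\<gamma> \<tau> \<gamma> x + 6 * (u \<tau> \<gamma> x * u \<tau> \<gamma> x) + uxx \<tau> \<gamma> x) has_vector_derivative 0) (at x)"
      by (rule transfer_x[where g = "\<lambda>_ _ _. 0" and
            f = "\<lambda>\<tau> \<gamma> x. 12 * v\<tau> \<tau> \<gamma> x + 12 * v\<gamma> \<tau> \<gamma> x + 6 * (u \<tau> \<gamma> x * u \<tau> \<gamma> x) + uxx \<tau> \<gamma> x"])
         (erule bilinear_R, rule that, rule has_vector_derivative_const)
    ultimately have "12 * u\<tau> \<tau> \<gamma> x + 12 * v\<gamma>x \<tau> \<gamma> x + 6 * (u \<tau> \<gamma> x * ux \<tau> \<gamma> x + ux \<tau> \<gamma> x * u \<tau> \<gamma> x) + uxxx \<tau> \<gamma> x = 0"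
      by (rule vector_derivative_unique_at)
    moreover have "12 * a + 12 * c * d + e - (- 12 * b) = 12 * a + 12 * b + 6 * (c * d + d * c) + e" for a b c d e :: complex
      by (simp add: algebra_simps)
    ultimately have "12 * u\<tau> \<tau> \<gamma> x + 12 * u \<tau> \<gamma> x * ux \<tau> \<gamma> x + uxxx \<tau> \<gamma> x - (- 12 * v\<gamma>x \<tau> \<gamma> x) = 0"
      by (simp only:)
    then show ?thesis by (simp only: right_minus_eq)
  qed
  have "((\<lambda>y. 12 * d_tau U \<tau> \<gamma> y + 12 * U \<tau> \<gamma> y * d_x U \<tau> \<gamma> y + d_x (d_x (d_x U)) \<tau> \<gamma> y) has_vector_derivative - 12 * u\<gamma>\<gamma> \<tau> \<gamma> x) (at x)"
    by (rule transfer_x[where g = "\<lambda>\<tau> \<gamma> x. - 12 * v\<gamma>x \<tau> \<gamma> x"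
        and f = "\<lambda>\<tau> \<gamma> x. 12 * d_tau U \<tau> \<gamma> x + 12 * U \<tau> \<gamma> x * d_x U \<tau> \<gamma> x + d_x (d_x (d_x U)) \<tau> \<gamma> x"])
       (simp only: Ut' U Ux' Uxxx' first, rule B, intro has_vector_derivative_mult_right uderivs B)
  then have "d_x (\<lambda>t g y. 12 * d_tau U t g y + 12 * U t g y * d_x U t g y + d_x (d_x (d_x U)) t g y) \<tau> \<gamma> x = - 12 * u\<gamma>\<gamma> \<tau> \<gamma> x"
    unfolding d_x_def[of "\<lambda>t g y. 12 * d_tau U t g y + 12 * U t g y * d_x U t g y + d_x (d_x (d_x U)) t g y"]
    by (rule vector_derivative_at)
  then show "12 * d_gamma (d_gamma U) \<tau> \<gamma> x +
        d_x (\<lambda>t g y. 12 * d_tau U t g y + 12 * U t g y * d_x U t g y + d_x (d_x (d_x U)) t g y) \<tau> \<gamma> x = 0"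
    unfolding Ugg' by simp
  have diff: "f differentiable at x" if "(f has_vector_derivative d) (at x)" for f :: "real \<Rightarrow> complex" and d x
    using that by (rule differentiableI_vector)
  show "(\<lambda>g. U \<tau> g x) differentiable (at \<gamma>)" "(\<lambda>g. d_gamma U \<tau> g x) differentiable (at \<gamma>)"
    "(\<lambda>t. U t \<gamma> x) differentiable (at \<tau>)" "(\<lambda>y. U \<tau> \<gamma> y) differentiable (at x)" "(\<lambda>y. d_x U \<tau> \<gamma> y) differentiable (at x)"
    "(\<lambda>y. d_x (d_x U) \<tau> \<gamma> y) differentiable (at x)"
    by (rule diff[OF Ug[OF B]] diff[OF Ugg[OF B]] diff[OF Ut[OF B]] diff[OF Ux[OF B]] diff[OF Uxx[OF B]] diff[OF Uxxx[OF B]])+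
  obtain d where "((\<lambda>x. u\<tau> \<tau> \<gamma> x) has_vector_derivative d) (at x)" using uderivs(11)[OF B] by blast
  from diff[OF transfer_x[where f = "d_tau U" and g = "u\<tau>", OF Ut' B this]] show "(\<lambda>y. d_tau U \<tau> \<gamma> y) differentiable (at x)" .
  obtain d where "((\<lambda>x. uxxx \<tau> \<gamma> x) has_vector_derivative d) (at x)" using uderivs(10)[OF B] by blast
  from diff[OF transfer_x[where f = "d_x (d_x (d_x U))" and g = "uxxx", OF Uxxx' B this]] show "(\<lambda>y. d_x (d_x (d_x U)) \<tau> \<gamma> y) differentiable (at x)" .
qed

end

text \<open>Being a solution is a local property, and \<open>dxx_log\<close> only sees the function
  near a point, so different points may use different families G.\<close>

theorem KPII_solution_onI:
  fixes D :: "real \<Rightarrow> real \<Rightarrow> real \<Rightarrow> complex"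
  assumes \<Omega>: "open \<Omega>"
    and loc: "\<And>\<tau> \<gamma> x. (\<tau>, \<gamma>, x) \<in> \<Omega> \<Longrightarrow> \<exists>B G. (\<tau>, \<gamma>, x) \<in> B \<and> kp_local B G \<and>
       (\<forall>\<tau> \<gamma> x. (\<tau>, \<gamma>, x) \<in> B \<longrightarrow> G 0 0 0 \<tau> \<gamma> x = D \<tau> \<gamma> x)"
  shows "KPII_solution_on \<Omega> (\<lambda>\<tau> \<gamma> x. dxx_log (D \<tau> \<gamma>) x)"
    and "(\<tau>, \<gamma>, x) \<in> \<Omega> \<Longrightarrow> has_dxx_log (D \<tau> \<gamma>) (dxx_log (D \<tau> \<gamma>) x) x"
proof -
  have has: "has_dxx_log (D \<tau> \<gamma>) (kp_local.u G \<tau> \<gamma> x) x"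
    if B: "(\<tau>, \<gamma>, x) \<in> B" and loc: "kp_local B G" and GD: "\<And>\<tau> \<gamma> x. (\<tau>, \<gamma>, x) \<in> B \<Longrightarrow> G 0 0 0 \<tau> \<gamma> x = D \<tau> \<gamma> x"
    for \<tau> \<gamma> x B G
  proof -
    interpret kp_local B G by fact
    have o: "open {y. (\<tau>, \<gamma>, y) \<in> B}" by (rule open_lines)
    have "eventually (\<lambda>y. y \<in> {y. (\<tau>, \<gamma>, y) \<in> B}) (nhds x)"
      by (rule eventually_nhds_in_open[OF o]) (use B in simp)
    then have ev: "eventually (\<lambda>y. D \<tau> \<gamma> y = G 0 0 0 \<tau> \<gamma> y) (nhds x)"
      by eventually_elim (use GD in auto)
    obtain L L' where L: "eventually (\<lambda>t. exp (L t) = G 0 0 0 \<tau> \<gamma> t \<and> (L has_vector_derivative L' t) (at t)) (nhds x)"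
      and L': "(L' has_vector_derivative u \<tau> \<gamma> x) (at x)"
      using has_dxx_log_u[OF B] unfolding has_dxx_log_def by blast
    have "eventually (\<lambda>t. exp (L t) = D \<tau> \<gamma> t \<and> (L has_vector_derivative L' t) (at t)) (nhds x)"
      using L ev by eventually_elim simp
    then show ?thesis unfolding has_dxx_log_def using L' by blast
  qed
  show "has_dxx_log (D \<tau> \<gamma>) (dxx_log (D \<tau> \<gamma>) x) x" if \<Omega>': "(\<tau>, \<gamma>, x) \<in> \<Omega>" for \<tau> \<gamma> x
  proof -
    obtain B G where "(\<tau>, \<gamma>, x) \<in> B" "kp_local B G" "\<And>\<tau> \<gamma> x. (\<tau>, \<gamma>, x) \<in> B \<Longrightarrow> G 0 0 0 \<tau> \<gamma> x = D \<tau> \<gamma> x"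
      using loc[OF \<Omega>'] by blast
    from has[OF this] have h: "has_dxx_log (D \<tau> \<gamma>) (kp_local.u G \<tau> \<gamma> x) x" .
    show ?thesis using h unfolding dxx_log_eqI[OF h] .
  qed
  show "KPII_solution_on \<Omega> (\<lambda>\<tau> \<gamma> x. dxx_log (D \<tau> \<gamma>) x)"
    unfolding KPII_solution_on_def
  proof (rule conjI[OF \<Omega>], rule ballI, unfold split_paired_all, unfold prod.case)
    fix \<tau> \<gamma> x assume O: "(\<tau>, \<gamma>, x) \<in> \<Omega>"
    obtain B G where B: "(\<tau>, \<gamma>, x) \<in> B" and l: "kp_local B G"
      and GD: "\<And>\<tau> \<gamma> x. (\<tau>, \<gamma>, x) \<in> B \<Longrightarrow> G 0 0 0 \<tau> \<gamma> x = D \<tau> \<gamma> x"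
      using loc[OF O] by blast
    interpret kp_local B G by fact
    have eq: "dxx_log (D \<tau> \<gamma>) x = u \<tau> \<gamma> x" if "(\<tau>, \<gamma>, x) \<in> B" for \<tau> \<gamma> x
      by (rule dxx_log_eqI) (rule has[OF that l GD])
    note kp = KP_pointwise[where U = "\<lambda>\<tau> \<gamma> x. dxx_log (D \<tau> \<gamma>) x", OF eq B]
    show "(\<lambda>g. dxx_log (D \<tau> g) x) differentiable at \<gamma> \<and>
       (\<lambda>g. d_gamma (\<lambda>\<tau> \<gamma>. dxx_log (D \<tau> \<gamma>)) \<tau> g x) differentiable at \<gamma> \<and>
       (\<lambda>t. dxx_log (D t \<gamma>) x) differentiable at \<tau> \<and>
       d_tau (\<lambda>\<tau> \<gamma>. dxx_log (D \<tau> \<gamma>)) \<tau> \<gamma> differentiable at x \<and>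
       dxx_log (D \<tau> \<gamma>) differentiable at x \<and>
       d_x (\<lambda>\<tau> \<gamma>. dxx_log (D \<tau> \<gamma>)) \<tau> \<gamma> differentiable at x \<and>
       d_x (d_x (\<lambda>\<tau> \<gamma>. dxx_log (D \<tau> \<gamma>))) \<tau> \<gamma> differentiable at x \<and>
       d_x (d_x (d_x (\<lambda>\<tau> \<gamma>. dxx_log (D \<tau> \<gamma>)))) \<tau> \<gamma> differentiable at x \<and>
       12 * d_gamma (d_gamma (\<lambda>\<tau> \<gamma>. dxx_log (D \<tau> \<gamma>))) \<tau> \<gamma> x +
       d_x (\<lambda>t g y. 12 * d_tau (\<lambda>\<tau> \<gamma>. dxx_log (D \<tau> \<gamma>)) t g y +
              12 * dxx_log (D t g) y * d_x (\<lambda>\<tau> \<gamma>. dxx_log (D \<tau> \<gamma>)) t g y +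
              d_x (d_x (d_x (\<lambda>\<tau> \<gamma>. dxx_log (D \<tau> \<gamma>)))) t g y) \<tau> \<gamma> x = 0"
      by (intro conjI kp)
  qed
qed

section \<open>Fredholm series as soliton gases\<close>

text \<open>The identity det (1 - A B) = det (1 - B A), term by term in the Fredholm series: Leibniz
  expansion turns both sides into signed sums of the same double integrals, taken in the two orders.
  Integrability of a and boundedness of b make every such integral absolutely convergent.\<close>

lemma fredholm_term_cyclic:
  fixes S :: "'s measure" and Y :: "'y measure" and a :: "'s \<Rightarrow> 'y \<Rightarrow> complex" and b :: "'y \<Rightarrow> 's \<Rightarrow> complex"
  assumes S: "sigma_finite_measure S" and Y: "sigma_finite_measure Y"
    and a: "integrable (S \<Otimes>\<^sub>M Y) (\<lambda>(s, y). a s y)"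
    and aY: "\<And>s. s \<in> space S \<Longrightarrow> integrable Y (a s)" and aS: "\<And>y. y \<in> space Y \<Longrightarrow> integrable S (\<lambda>s. a s y)"
    and b: "(\<lambda>(y, s). b y s) \<in> borel_measurable (Y \<Otimes>\<^sub>M S)"
    and bb: "\<And>y s. y \<in> space Y \<Longrightarrow> s \<in> space S \<Longrightarrow> norm (b y s) \<le> \<beta>"
  shows "(LINT p|PiM {..<n} (\<lambda>_. S). mdet n (\<lambda>i j. LINT y|Y. a (p i) y * b y (p j))) =
    (LINT q|PiM {..<n} (\<lambda>_. Y). mdet n (\<lambda>i j. LINT s|S. b (q i) s * a s (q j)))"
proof -
  interpret S: sigma_finite_measure S by fact
  interpret Y: sigma_finite_measure Y by fact
  interpret PS: product_sigma_finite "\<lambda>_::nat. S" by standard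
  interpret PY: product_sigma_finite "\<lambda>_::nat. Y" by standard
  interpret SY: pair_sigma_finite S Y ..
  interpret PS': finite_product_sigma_finite "\<lambda>_::nat. S" "{..<n}" by standard simp
  interpret PY': finite_product_sigma_finite "\<lambda>_::nat. Y" "{..<n}" by standard simp
  interpret P: pair_sigma_finite "PiM {..<n} (\<lambda>_. S)" "PiM {..<n} (\<lambda>_. Y)" ..
  let ?PS = "PiM {..<n} (\<lambda>_. S)" and ?PY = "PiM {..<n} (\<lambda>_. Y)"
  have am [measurable]: "(\<lambda>(s, y). a s y) \<in> borel_measurable (S \<Otimes>\<^sub>M Y)" using a by auto
  note b [measurable]
  have ab_int: "integrable Y (\<lambda>y. a s y * b y t)" if "s \<in> space S" "t \<in> space S" for s t
  proof (rule lint_bound[OF integrable_mult_right[OF integrable_norm[OF aY[OF that(1)]], of \<beta>]])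
    have "(\<lambda>y. b y t) \<in> borel_measurable Y" "a s \<in> borel_measurable Y" using that by measurable
    then show "(\<lambda>y. a s y * b y t) \<in> borel_measurable Y" by simp
    show "AE y in Y. norm (a s y * b y t) \<le> norm (\<beta> * norm (a s y))"
    proof (rule AE_I2)
      fix y assume "y \<in> space Y"
      then have "norm (b y t) \<le> \<beta>" using bb that by blast
      then have "norm (a s y) * norm (b y t) \<le> norm (a s y) * \<bar>\<beta>\<bar>" by (intro mult_left_mono) auto
      then show "norm (a s y * b y t) \<le> norm (\<beta> * norm (a s y))" by (simp add: norm_mult abs_mult mult.commute)
    qed
  qed
  have ba_int: "integrable S (\<lambda>s. b z s * a s y)" if "y \<in> space Y" "z \<in> space Y" for z y
  proof (rule lint_bound[OF integrable_mult_right[OF integrable_norm[OF aS[OF that(1)]], of \<beta>]])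
    have "(\<lambda>s. b z s) \<in> borel_measurable S" "(\<lambda>s. a s y) \<in> borel_measurable S" using that by measurable
    then show "(\<lambda>s. b z s * a s y) \<in> borel_measurable S" by simp
    show "AE s in S. norm (b z s * a s y) \<le> norm (\<beta> * norm (a s y))"
    proof (rule AE_I2)
      fix s assume "s \<in> space S"
      then have "norm (b z s) \<le> \<beta>" using bb that by blast
      then have "norm (b z s) * norm (a s y) \<le> \<bar>\<beta>\<bar> * norm (a s y)" by (intro mult_right_mono) auto
      then show "norm (b z s * a s y) \<le> norm (\<beta> * norm (a s y))" by (simp add: norm_mult abs_mult)
    qed
  qed
  \<comment> \<open>The integrand that belongs to the permutation \<sigma> on both sides.\<close>
  let ?f = "\<lambda>\<sigma> p q. \<Prod>i<n. a (p i) (q i) * b (q i) (p (\<sigma> i))"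
  have perm: "\<sigma> i < n" if "\<sigma> permutes {..<n}" "i < n" for \<sigma> i
    using permutes_in_image[OF that(1), of i] that(2) by simp
  have pS: "p i \<in> space S" if "p \<in> space ?PS" "i < n" for p i using that by (auto simp: space_PiM PiE_iff)
  have pY: "q i \<in> space Y" if "q \<in> space ?PY" "i < n" for q i using that by (auto simp: space_PiM PiE_iff)
  have int: "integrable (?PS \<Otimes>\<^sub>M ?PY) (\<lambda>(p, q). ?f \<sigma> p q)" if \<sigma>: "\<sigma> permutes {..<n}" for \<sigma>
  proof (rule lint_bound)
    have cS: "(\<lambda>x. fst x i) \<in> measurable (?PS \<Otimes>\<^sub>M ?PY) S" if "i < n" for i
      by (rule measurable_compose[OF measurable_fst measurable_component_singleton[of i "{..<n}" "\<lambda>_. S"]]) (use that in simp)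
    have cY: "(\<lambda>x. snd x i) \<in> measurable (?PS \<Otimes>\<^sub>M ?PY) Y" if "i < n" for i
      by (rule measurable_compose[OF measurable_snd measurable_component_singleton[of i "{..<n}" "\<lambda>_. Y"]]) (use that in simp)
    have m1: "(\<lambda>x. a (fst x i) (snd x i)) \<in> borel_measurable (?PS \<Otimes>\<^sub>M ?PY)" if "i < n" for i
      using measurable_compose[OF measurable_Pair[OF cS[OF that] cY[OF that]] am] by simp
    have m2: "(\<lambda>x. b (snd x i) (fst x (\<sigma> i))) \<in> borel_measurable (?PS \<Otimes>\<^sub>M ?PY)" if "i < n" for i
      using measurable_compose[OF measurable_Pair[OF cY[OF that] cS[OF perm[OF \<sigma> that]]] b] by simp
    show "(\<lambda>(p, q). ?f \<sigma> p q) \<in> borel_measurable (?PS \<Otimes>\<^sub>M ?PY)"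
      unfolding case_prod_beta by (intro borel_measurable_prod borel_measurable_times m1 m2) auto
    show "integrable (?PS \<Otimes>\<^sub>M ?PY) (\<lambda>(p, q). \<beta> ^ n * (\<Prod>i<n. norm (a (p i) (q i))))"
      unfolding case_prod_beta
    proof (intro integrable_mult_right integrableI_bounded)
      show "(\<lambda>x. \<Prod>i<n. norm (a (fst x i) (snd x i))) \<in> borel_measurable (?PS \<Otimes>\<^sub>M ?PY)"
        by (intro borel_measurable_prod borel_measurable_norm m1) auto
      have m3: "(\<lambda>x. \<Prod>i<n. ennreal (norm (a (fst x i) (snd x i)))) \<in> borel_measurable (?PS \<Otimes>\<^sub>M ?PY)"
        by (intro borel_measurable_prod_ennreal measurable_compose[OF _ measurable_ennreal] borel_measurable_norm m1) auto
      have "(\<integral>\<^sup>+ x. ennreal (norm (\<Prod>i<n. norm (a (fst x i) (snd x i)))) \<partial>(?PS \<Otimes>\<^sub>M ?PY)) =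
          (\<integral>\<^sup>+ x. (\<Prod>i<n. ennreal (norm (a (fst x i) (snd x i)))) \<partial>(?PS \<Otimes>\<^sub>M ?PY))"
        by (simp add: prod_ennreal abs_prod)
      also have "\<dots> = (\<integral>\<^sup>+ p. \<integral>\<^sup>+ q. (\<Prod>i<n. ennreal (norm (a (p i) (q i)))) \<partial>?PY \<partial>?PS)"
        using PY'.nn_integral_fst[OF m3] by simp
      also have "\<dots> = (\<integral>\<^sup>+ p. (\<Prod>i<n. \<integral>\<^sup>+ y. ennreal (norm (a (p i) y)) \<partial>Y) \<partial>?PS)"
      proof (rule nn_integral_cong)
        fix p assume p: "p \<in> space ?PS"
        show "(\<integral>\<^sup>+ q. (\<Prod>i<n. ennreal (norm (a (p i) (q i)))) \<partial>?PY) = (\<Prod>i<n. \<integral>\<^sup>+ y. ennreal (norm (a (p i) y)) \<partial>Y)"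
          using pS[OF p] by (intro PY.product_nn_integral_prod) auto
      qed
      also have "\<dots> = (\<Prod>i<n. \<integral>\<^sup>+ s. \<integral>\<^sup>+ y. ennreal (norm (a s y)) \<partial>Y \<partial>S)"
        by (rule PS.product_nn_integral_prod) auto
      also have "(\<integral>\<^sup>+ s. \<integral>\<^sup>+ y. ennreal (norm (a s y)) \<partial>Y \<partial>S) = (\<integral>\<^sup>+ x. ennreal (norm (case x of (s, y) \<Rightarrow> a s y)) \<partial>(S \<Otimes>\<^sub>M Y))"
        by (subst Y.nn_integral_fst[symmetric]) auto
      also have "(\<Prod>i<n. \<integral>\<^sup>+ x. ennreal (norm (case x of (s, y) \<Rightarrow> a s y)) \<partial>(S \<Otimes>\<^sub>M Y)) < \<infinity>"
        using a by (simp add: less_top[symmetric] ennreal_prod_eq_top integrable_iff_bounded del: prod_constant)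
      finally show "(\<integral>\<^sup>+ x. ennreal (norm (\<Prod>i<n. norm (a (fst x i) (snd x i)))) \<partial>(?PS \<Otimes>\<^sub>M ?PY)) < \<infinity>" .
    qed
    show "AE x in ?PS \<Otimes>\<^sub>M ?PY. norm (case x of (p, q) \<Rightarrow> ?f \<sigma> p q) \<le>
        norm (case x of (p, q) \<Rightarrow> \<beta> ^ n * (\<Prod>i<n. norm (a (p i) (q i))))"
    proof (rule AE_I2)
      fix x assume "x \<in> space (?PS \<Otimes>\<^sub>M ?PY)"
      then obtain p q where x: "x = (p, q)" and p: "p \<in> space ?PS" and q: "q \<in> space ?PY" by (auto simp: space_pair_measure)
      have "norm (?f \<sigma> p q) = (\<Prod>i<n. norm (a (p i) (q i)) * norm (b (q i) (p (\<sigma> i))))"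
        by (simp add: prod_norm[symmetric] norm_mult)
      also have "\<dots> \<le> (\<Prod>i<n. norm (a (p i) (q i)) * \<beta>)"
        using bb pS[OF p] pY[OF q] perm[OF \<sigma>] by (intro prod_mono conjI mult_left_mono mult_nonneg_nonneg) auto
      also have "\<dots> = \<beta> ^ n * (\<Prod>i<n. norm (a (p i) (q i)))" by (simp add: prod.distrib mult.commute)
      also have "\<dots> \<le> norm (\<beta> ^ n * (\<Prod>i<n. norm (a (p i) (q i))))" by simp
      finally show "norm (case x of (p, q) \<Rightarrow> ?f \<sigma> p q) \<le>
        norm (case x of (p, q) \<Rightarrow> \<beta> ^ n * (\<Prod>i<n. norm (a (p i) (q i))))" by (simp add: x)
    qed
  qed
  let ?P = "{\<sigma>. \<sigma> permutes {..<n}}"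
  have "(LINT p|?PS. mdet n (\<lambda>i j. LINT y|Y. a (p i) y * b y (p j))) =
     (LINT p|?PS. (\<Sum>\<sigma>\<in>?P. of_int (sign \<sigma>) * (LINT q|?PY. ?f \<sigma> p q)))"
  proof (rule lint_cong)
    fix p assume p: "p \<in> space ?PS"
    show "mdet n (\<lambda>i j. LINT y|Y. a (p i) y * b y (p j)) =
      (\<Sum>\<sigma>\<in>?P. of_int (sign \<sigma>) * (LINT q|?PY. ?f \<sigma> p q))"
      unfolding det_mat_leibniz
    proof (intro sum.cong refl)
      fix \<sigma> assume "\<sigma> \<in> ?P"
      then have \<sigma>: "\<sigma> permutes {..<n}" by simp
      have "(\<Prod>i<n. LINT y|Y. a (p i) y * b y (p (\<sigma> i))) = (LINT q|?PY. ?f \<sigma> p q)"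
        using ab_int pS[OF p] perm[OF \<sigma>]
        by (intro PY.product_integral_prod[where f = "\<lambda>i y. a (p i) y * b y (p (\<sigma> i))", symmetric]) auto
      then show "of_int (sign \<sigma>) * (\<Prod>i<n. LINT y|Y. a (p i) y * b y (p (\<sigma> i))) = of_int (sign \<sigma>) * (LINT q|?PY. ?f \<sigma> p q)"
        by simp
    qed
  qed
  also have "\<dots> = (\<Sum>\<sigma>\<in>?P. of_int (sign \<sigma>) * (LINT p|?PS. LINT q|?PY. ?f \<sigma> p q))"
    using P.integrable_fst[OF int]
    by (subst Bochner_Integration.integral_sum) (auto intro!: integrable_mult_right)
  also have "\<dots> = (\<Sum>\<sigma>\<in>?P. of_int (sign \<sigma>) * (LINT q|?PY. LINT p|?PS. ?f \<sigma> p q))"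
    using P.Fubini_integral[OF int] by (intro sum.cong refl) auto
  also have "\<dots> = (LINT q|?PY. (\<Sum>\<sigma>\<in>?P. of_int (sign \<sigma>) * (LINT p|?PS. ?f \<sigma> p q)))"
    using P.integrable_snd[OF int]
    by (subst Bochner_Integration.integral_sum) (auto intro!: integrable_mult_right)
  also have "\<dots> = (LINT q|?PY. mdet n (\<lambda>i j. LINT s|S. b (q i) s * a s (q j)))"
  proof (rule lint_cong)
    fix q assume q: "q \<in> space ?PY"
    have "mdet n (\<lambda>i j. LINT s|S. b (q i) s * a s (q j)) =
      mdet n (\<lambda>i j. LINT s|S. b (q j) s * a s (q i))"
      by (rule det_mat_transpose[symmetric])
    also have "\<dots> = (\<Sum>\<sigma>\<in>?P. of_int (sign \<sigma>) * (\<Prod>i<n. LINT s|S. b (q (\<sigma> i)) s * a s (q i)))"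
      by (rule det_mat_leibniz)
    also have "\<dots> = (\<Sum>\<sigma>\<in>?P. of_int (sign \<sigma>) * (LINT p|?PS. (\<Prod>i<n. b (q (\<sigma> i)) (p i) * a (p i) (q i))))"
    proof (intro sum.cong refl)
      fix \<sigma> assume "\<sigma> \<in> ?P"
      then have \<sigma>: "\<sigma> permutes {..<n}" by simp
      have "(\<Prod>i<n. LINT s|S. b (q (\<sigma> i)) s * a s (q i)) = (LINT p|?PS. (\<Prod>i<n. b (q (\<sigma> i)) (p i) * a (p i) (q i)))"
        using ba_int pY[OF q] perm[OF \<sigma>]
        by (intro PS.product_integral_prod[where f = "\<lambda>i s. b (q (\<sigma> i)) s * a s (q i)", symmetric]) auto
      then show "of_int (sign \<sigma>) * (\<Prod>i<n. LINT s|S. b (q (\<sigma> i)) s * a s (q i)) =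
          of_int (sign \<sigma>) * (LINT p|?PS. (\<Prod>i<n. b (q (\<sigma> i)) (p i) * a (p i) (q i)))" by simp
    qed
    \<comment> \<open>So far \<sigma> acts on the Y-variables. Summing over inverses moves it to the
      S-variables, where \<open>?f\<close> has it, without changing the sign.\<close>
    also have "\<dots> = (\<Sum>\<sigma>\<in>?P. of_int (sign (inv_into UNIV \<sigma>)) * (LINT p|?PS. (\<Prod>i<n. b (q (inv_into UNIV \<sigma> i)) (p i) * a (p i) (q i))))"
      by (rule sum.reindex_bij_witness[of _ "inv_into UNIV" "inv_into UNIV"]) (auto simp: permutes_inv permutes_inv_inv)
    also have "\<dots> = (\<Sum>\<sigma>\<in>?P. of_int (sign \<sigma>) * (LINT p|?PS. ?f \<sigma> p q))"
    proof (intro sum.cong refl)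
      fix \<sigma> assume "\<sigma> \<in> ?P"
      then have \<sigma>: "\<sigma> permutes {..<n}" by simp
      have "(\<Prod>i<n. b (q (inv_into UNIV \<sigma> i)) (p i) * a (p i) (q i)) = ?f \<sigma> p q" for p
      proof -
        have "(\<Prod>i<n. b (q (inv_into UNIV \<sigma> i)) (p i)) = (\<Prod>i<n. b (q (inv_into UNIV \<sigma> (\<sigma> i))) (p (\<sigma> i)))"
          using prod.permute[OF \<sigma>, of "\<lambda>i. b (q (inv_into UNIV \<sigma> i)) (p i)"] by (simp add: o_def)
        then show ?thesis using permutes_inverses(2)[OF \<sigma>] by (simp add: prod.distrib mult.commute)
      qed
      moreover have "sign (inv_into UNIV \<sigma>) = sign \<sigma>"
        using \<sigma> by (intro sign_inverse) (auto intro: permutation_permutes[THEN iffD2])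
      ultimately show "of_int (sign (inv_into UNIV \<sigma>)) * (LINT p|?PS. (\<Prod>i<n. b (q (inv_into UNIV \<sigma> i)) (p i) * a (p i) (q i))) =
         of_int (sign \<sigma>) * (LINT p|?PS. ?f \<sigma> p q)" by simp
    qed
    finally show "(\<Sum>\<sigma>\<in>?P. of_int (sign \<sigma>) * (LINT p|?PS. ?f \<sigma> p q)) =
      mdet n (\<lambda>i j. LINT s|S. b (q i) s * a s (q j))" ..
  qed
  finally show ?thesis .
qed

context kp_gas begin

text \<open>\<open>det_cauchy\<close> read backwards. The weight and the exponential of q j are put
  into column j, the shape in which \<open>fredholm_term_cyclic\<close> delivers the two
  determinants.\<close>

lemma F_eq_series:
  "F 0 0 0 x y t = (\<Sum>n. (-1) ^ n / fact n * (LINT q|PiM {..<n} (\<lambda>_. M).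
     Determinant.det (Matrix.mat n n (\<lambda>(i, j).
       c (q j) * exp (of_real x * kk (q j) + of_real y * ll (q j) + of_real t * ww (q j)) / (u (q i) + v (q j))))))"
  unfolding F_def gas_def
proof (intro suminf_cong)
  fix n
  let ?e = "\<lambda>p. exp (of_real x * kk p + of_real y * ll p + of_real t * ww p)"
  have "gterm {..<n} (\<lambda>k l w. k ^ 0 * l ^ 0 * w ^ 0 * exp (of_real x * k + of_real y * l + of_real t * w)) =
    (LINT q|PiM {..<n} (\<lambda>_. M). (-1) ^ n *
     mdet n (\<lambda>i j. c (q j) * ?e (q j) / (u (q i) + v (q j))))"
    unfolding gterm_def
  proof (rule lint_cong)
    fix q assume q: "q \<in> space (PiM {..<n} (\<lambda>_. M))"
    have nz: "u (q i) + v (q j) \<noteq> 0" if "i < n" "j < n" for i j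
    proof -
      have "q i \<in> space M" "q j \<in> space M" using q that by (auto simp: space_PiM PiE_iff)
      then have "Re (u (q i) + v (q j)) < 0" using Re_u[of "q i"] Re_v[of "q j"] \<delta>_pos by simp
      then show ?thesis by (metis less_irrefl zero_complex.sel(1))
    qed
    have "mdet n (\<lambda>i j. c (q j) * ?e (q j) / (u (q i) + v (q j))) =
       mdet n (\<lambda>i j. 1 * (1 / (u (q i) + v (q j))) * (c (q j) * ?e (q j)))"
      by (rule det_mat_cong) simp
    also have "\<dots> = (\<Prod>j<n. c (q j) * ?e (q j)) * cauchy_prod (\<lambda>i. u (q i)) (\<lambda>i. v (q i)) {..<n}"
      using det_cauchy[of n "\<lambda>i. u (q i)" "\<lambda>i. v (q i)"] nz by (subst det_scale_rows_cols) simp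
    also have "(\<Prod>j<n. c (q j) * ?e (q j)) = (\<Prod>j<n. c (q j)) * exp (of_real x * K {..<n} q + of_real y * L {..<n} q + of_real t * W {..<n} q)"
      by (simp add: prod.distrib exp_sum[symmetric] K_def L_def W_def sum_distrib_left sum.distrib)
    finally have D: "mdet n (\<lambda>i j. c (q j) * ?e (q j) / (u (q i) + v (q j))) =
      (\<Prod>j<n. c (q j)) * exp (of_real x * K {..<n} q + of_real y * L {..<n} q + of_real t * W {..<n} q) * cauchy_prod (\<lambda>i. u (q i)) (\<lambda>i. v (q i)) {..<n}" .
    have "(\<Prod>j<n. - c (q j)) = (\<Prod>j<n. (-1) * c (q j))" by simp
    also have "\<dots> = (-1) ^ n * (\<Prod>j<n. c (q j))" by (simp only: prod.distrib prod_constant card_lessThan)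
    finally show "dens {..<n} q * (K {..<n} q ^ 0 * L {..<n} q ^ 0 * W {..<n} q ^ 0 *
        exp (of_real x * K {..<n} q + of_real y * L {..<n} q + of_real t * W {..<n} q)) =
      (-1) ^ n * mdet n (\<lambda>i j. c (q j) * ?e (q j) / (u (q i) + v (q j)))"
      unfolding D dens_def by (simp only: power_0 mult_1 mult_ac)
  qed
  also have "\<dots> = (-1) ^ n * (LINT q|PiM {..<n} (\<lambda>_. M).
     mdet n (\<lambda>i j. c (q j) * ?e (q j) / (u (q i) + v (q j))))"
    by (rule lint_cmult)
  finally show "gterm {..<n} (\<lambda>k l w. k ^ 0 * l ^ 0 * w ^ 0 * exp (of_real x * k + of_real y * l + of_real t * w)) / fact n =
    (-1) ^ n / fact n * (LINT q|PiM {..<n} (\<lambda>_. M).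
     mdet n (\<lambda>i j. c (q j) * ?e (q j) / (u (q i) + v (q j))))"
    by simp
qed

end

text \<open>The gas, and with it r, may change with the base point. The box has half width r / 2
  because F is differentiated only within that range.\<close>

theorem KPII_from_gas:
  fixes D :: "real \<Rightarrow> real \<Rightarrow> real \<Rightarrow> complex"
  assumes gas: "\<And>\<tau>0 \<gamma>0 x0. 0 < \<tau>0 \<Longrightarrow> \<exists>(M :: 'y measure) c u v \<delta> r. kp_gas M c u v \<delta> r \<and>
      (\<forall>\<tau> \<gamma> x. \<bar>\<tau> - \<tau>0\<bar> < r / 2 \<and> \<bar>\<gamma> - \<gamma>0\<bar> < r / 2 \<and> \<bar>x - x0\<bar> < r / 2 \<longrightarrow>
        D \<tau> \<gamma> x = kp_gas.F M c u v 0 0 0 (x - x0) (\<gamma> - \<gamma>0) (\<tau> - \<tau>0))"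
  shows "KPII_solution_on {(\<tau>, \<gamma>, x). 0 < \<tau> \<and> D \<tau> \<gamma> x \<noteq> 0} (\<lambda>\<tau> \<gamma> x. dxx_log (D \<tau> \<gamma>) x)"
    and "0 < \<tau> \<Longrightarrow> D \<tau> \<gamma> x \<noteq> 0 \<Longrightarrow> has_dxx_log (D \<tau> \<gamma>) (dxx_log (D \<tau> \<gamma>) x) x"
proof -
  let ?\<Omega> = "{(\<tau>, \<gamma>, x). 0 < \<tau> \<and> D \<tau> \<gamma> x \<noteq> 0}"
  let ?box = "\<lambda>e \<tau>0 \<gamma>0 x0. {(\<tau>, \<gamma>, x). \<bar>\<tau> - \<tau>0\<bar> < e \<and> \<bar>\<gamma> - \<gamma>0\<bar> < e \<and> \<bar>x - x0\<bar> < (e :: real)}"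
  have open_box: "open (?box e \<tau>0 \<gamma>0 x0)" for e \<tau>0 \<gamma>0 x0
  proof -
    have "?box e \<tau>0 \<gamma>0 x0 = {p. \<bar>fst p - \<tau>0\<bar> < e} \<inter> {p. \<bar>fst (snd p) - \<gamma>0\<bar> < e} \<inter> {p. \<bar>snd (snd p) - x0\<bar> < e}" by auto
    also have "open \<dots>" by (intro open_Int open_Collect_less continuous_intros)
    finally show ?thesis .
  qed
  have \<Omega>: "open ?\<Omega>"
  proof (subst open_subopen, rule ballI)
    fix p assume "p \<in> ?\<Omega>"
    then obtain \<tau>0 \<gamma>0 x0 where p: "p = (\<tau>0, \<gamma>0, x0)" and t0: "0 < \<tau>0" and D0: "D \<tau>0 \<gamma>0 x0 \<noteq> 0" by auto
    obtain M :: "'y measure" and c u v \<delta> r where g: "kp_gas M c u v \<delta> r"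
      and DF: "\<And>\<tau> \<gamma> x. \<bar>\<tau> - \<tau>0\<bar> < r / 2 \<Longrightarrow> \<bar>\<gamma> - \<gamma>0\<bar> < r / 2 \<Longrightarrow> \<bar>x - x0\<bar> < r / 2 \<Longrightarrow>
        D \<tau> \<gamma> x = kp_gas.F M c u v 0 0 0 (x - x0) (\<gamma> - \<gamma>0) (\<tau> - \<tau>0)"
      using gas[OF t0, of \<gamma>0 x0] by blast
    interpret kp_gas M c u v \<delta> r by fact
    define C where "C = \<bar>gasC 1\<bar> + 1"
    \<comment> \<open>C is a Lipschitz constant for each of the three parameters, so inside this box
      the determinant changes by less than its modulus at the base point.\<close>
    define e where "e = min (r / 2) (min \<tau>0 (norm (D \<tau>0 \<gamma>0 x0) / (3 * C)))"
    have C: "0 < C" by (simp add: C_def)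
    have e: "0 < e" using r_pos t0 D0 C by (simp add: e_def)
    have "?box e \<tau>0 \<gamma>0 x0 \<subseteq> ?\<Omega>"
    proof clarify
      fix \<tau> \<gamma> x assume b: "\<bar>\<tau> - \<tau>0\<bar> < e" "\<bar>\<gamma> - \<gamma>0\<bar> < e" "\<bar>x - x0\<bar> < e"
      then have br: "\<bar>\<tau> - \<tau>0\<bar> < r / 2" "\<bar>\<gamma> - \<gamma>0\<bar> < r / 2" "\<bar>x - x0\<bar> < r / 2" and bt: "\<bar>\<tau> - \<tau>0\<bar> < \<tau>0"
        and be: "e \<le> norm (D \<tau>0 \<gamma>0 x0) / (3 * C)"
        by (auto simp: e_def)
      have "norm (D \<tau> \<gamma> x - D \<tau>0 \<gamma>0 x0) \<le> (\<bar>x - x0\<bar> + \<bar>\<gamma> - \<gamma>0\<bar> + \<bar>\<tau> - \<tau>0\<bar>) * gasC 1"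
        using F_lipschitz_0[of "x - x0" "\<gamma> - \<gamma>0" "\<tau> - \<tau>0"] br r_pos DF[OF br] DF[of \<tau>0 \<gamma>0 x0] by simp
      also have "\<dots> \<le> (\<bar>x - x0\<bar> + \<bar>\<gamma> - \<gamma>0\<bar> + \<bar>\<tau> - \<tau>0\<bar>) * C"
        by (intro mult_left_mono) (auto simp: C_def)
      also have "\<dots> < (3 * e) * C" using b C by (intro mult_strict_right_mono) auto
      also have "\<dots> \<le> norm (D \<tau>0 \<gamma>0 x0)" using be C by (simp add: field_simps)
      finally have "D \<tau> \<gamma> x \<noteq> 0" by auto
      then show "0 < \<tau> \<and> D \<tau> \<gamma> x \<noteq> 0" using bt by auto
    qed
    moreover have "p \<in> ?box e \<tau>0 \<gamma>0 x0" using e by (simp add: p)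
    ultimately show "\<exists>T. open T \<and> p \<in> T \<and> T \<subseteq> ?\<Omega>"
      by (intro exI[of _ "?box e \<tau>0 \<gamma>0 x0"] conjI open_box)
  qed
  have loc: "\<exists>B G. (\<tau>0, \<gamma>0, x0) \<in> B \<and> kp_local B G \<and> (\<forall>\<tau> \<gamma> x. (\<tau>, \<gamma>, x) \<in> B \<longrightarrow> G 0 0 0 \<tau> \<gamma> x = D \<tau> \<gamma> x)"
    if "(\<tau>0, \<gamma>0, x0) \<in> ?\<Omega>" for \<tau>0 \<gamma>0 x0
  proof -
    have t0: "0 < \<tau>0" using that by simp
    obtain M :: "'y measure" and c u v \<delta> r where g: "kp_gas M c u v \<delta> r"
      and DF: "\<And>\<tau> \<gamma> x. \<bar>\<tau> - \<tau>0\<bar> < r / 2 \<Longrightarrow> \<bar>\<gamma> - \<gamma>0\<bar> < r / 2 \<Longrightarrow> \<bar>x - x0\<bar> < r / 2 \<Longrightarrow>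
        D \<tau> \<gamma> x = kp_gas.F M c u v 0 0 0 (x - x0) (\<gamma> - \<gamma>0) (\<tau> - \<tau>0)"
      using gas[OF t0, of \<gamma>0 x0] by blast
    interpret kp_gas M c u v \<delta> r by fact
    let ?B = "?\<Omega> \<inter> ?box (r / 2) \<tau>0 \<gamma>0 x0"
    let ?G = "\<lambda>a b d \<tau> \<gamma> x. F a b d (x - x0) (\<gamma> - \<gamma>0) (\<tau> - \<tau>0)"
    have shift: "((\<lambda>t. f (t - t0)) has_vector_derivative d) (at t)" if "(f has_vector_derivative d) (at (t - t0))"
      for f :: "real \<Rightarrow> complex" and t t0 d
    proof -
      have "((\<lambda>t. t - t0) has_vector_derivative 1) (at t)" by (auto intro!: derivative_eq_intros)
      from vector_diff_chain_at[OF this that] show ?thesis by (simp add: o_def)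
    qed
    have "kp_local ?B ?G"
    proof
      show "open ?B" by (intro open_Int \<Omega> open_box)
      fix \<tau> \<gamma> x assume B: "(\<tau>, \<gamma>, x) \<in> ?B"
      then have b: "\<bar>x - x0\<bar> < r / 2" "\<bar>\<gamma> - \<gamma>0\<bar> < r / 2" "\<bar>\<tau> - \<tau>0\<bar> < r / 2" by auto
      note b' = less_imp_le[OF b(1)] less_imp_le[OF b(2)] less_imp_le[OF b(3)]
      show "?G 0 0 0 \<tau> \<gamma> x \<noteq> 0" using DF[OF b(3,2,1)] B by simp
      show "((\<lambda>x. ?G a b c \<tau> \<gamma> x) has_vector_derivative ?G (Suc a) b c \<tau> \<gamma> x) (at x)"
        "((\<lambda>\<gamma>. ?G a b c \<tau> \<gamma> x) has_vector_derivative ?G a (Suc b) c \<tau> \<gamma> x) (at \<gamma>)"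
        "((\<lambda>\<tau>. ?G a b c \<tau> \<gamma> x) has_vector_derivative ?G a b (Suc c) \<tau> \<gamma> x) (at \<tau>)" for a b c
        by (rule shift, rule F_has_vector_derivative[OF b'])+
      have "\<bar>x - x0\<bar> \<le> r" "\<bar>\<gamma> - \<gamma>0\<bar> \<le> r" "\<bar>\<tau> - \<tau>0\<bar> \<le> r" using b' r_pos by auto
      from F_bilinear[OF this] show "?G 4 0 0 \<tau> \<gamma> x * ?G 0 0 0 \<tau> \<gamma> x - 4 * ?G 3 0 0 \<tau> \<gamma> x * ?G 1 0 0 \<tau> \<gamma> x + 3 * (?G 2 0 0 \<tau> \<gamma> x)\<^sup>2 +
        12 * (?G 1 0 1 \<tau> \<gamma> x * ?G 0 0 0 \<tau> \<gamma> x - ?G 1 0 0 \<tau> \<gamma> x * ?G 0 0 1 \<tau> \<gamma> x) +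
        12 * (?G 0 2 0 \<tau> \<gamma> x * ?G 0 0 0 \<tau> \<gamma> x - (?G 0 1 0 \<tau> \<gamma> x)\<^sup>2) = 0" .
    qed
    moreover have "(\<tau>0, \<gamma>0, x0) \<in> ?B" using that r_pos by simp
    moreover have "\<forall>\<tau> \<gamma> x. (\<tau>, \<gamma>, x) \<in> ?B \<longrightarrow> ?G 0 0 0 \<tau> \<gamma> x = D \<tau> \<gamma> x" using DF by auto
    ultimately show ?thesis by (intro exI[of _ ?B] exI[of _ ?G] conjI)
  qed
  show "KPII_solution_on ?\<Omega> (\<lambda>\<tau> \<gamma> x. dxx_log (D \<tau> \<gamma>) x)"
    by (rule KPII_solution_onI(1)[OF \<Omega> loc])
  show "has_dxx_log (D \<tau> \<gamma>) (dxx_log (D \<tau> \<gamma>) x) x" if "0 < \<tau>" "D \<tau> \<gamma> x \<noteq> 0"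
    by (rule KPII_solution_onI(2)[OF \<Omega> loc]) (use that in auto)
qed

section \<open>The periodic determinant\<close>

lemma norm_polylog_half_le:
  assumes "norm w < 1"
  shows "norm (polylog (1/2) w) \<le> norm w / (1 - norm w)"
proof -
  have g: "(\<lambda>k. norm w ^ Suc k) sums (norm w / (1 - norm w))"
    using sums_mult[OF geometric_sums[of "norm w"], of "norm w"] assms by (simp add: divide_inverse)
  have b: "norm (w ^ Suc k / of_real (real (Suc k) powr (1/2))) \<le> norm w ^ Suc k" for k
  proof -
    have "1 \<le> real (Suc k) powr (1/2)" by (rule ge_one_powr_ge_zero) auto
    then have "norm w ^ Suc k / real (Suc k) powr (1/2) \<le> norm w ^ Suc k / 1" by (intro divide_left_mono) auto
    then show ?thesis by (simp add: norm_divide norm_mult norm_power)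
  qed
  have s: "summable (\<lambda>k. norm (w ^ Suc k / of_real (real (Suc k) powr (1/2))))"
    using b by (intro summable_comparison_test'[OF sums_summable[OF g], of 0]) auto
  have "norm (polylog (1/2) w) \<le> (\<Sum>k. norm (w ^ Suc k / of_real (real (Suc k) powr (1/2))))"
    unfolding polylog_def by (rule summable_norm[OF s])
  also have "\<dots> \<le> (\<Sum>k. norm w ^ Suc k)" by (rule suminf_le[OF b s sums_summable[OF g]])
  also have "\<dots> = norm w / (1 - norm w)" using g by (rule sums_unique[symmetric])
  finally show ?thesis .
qed

lemma continuous_on_polylog_half: "continuous_on (ball 0 1) (polylog (1/2))"
proof -
  let ?a = "\<lambda>k. 1 / complex_of_real (real (Suc k) powr (1/2))"
  let ?P = "\<lambda>w. \<Sum>k. ?a k * (w - 0) ^ k"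
  have b: "norm (?a k) \<le> 1" for k
  proof -
    have "1 \<le> real (Suc k) powr (1/2)" by (rule ge_one_powr_ge_zero) auto
    then show ?thesis by (simp add: norm_divide divide_le_eq)
  qed
  have s: "summable (\<lambda>k. ?a k * (w - 0) ^ k)" if "w \<in> ball 0 1" for w
  proof (rule summable_norm_cancel, rule summable_comparison_test'[of "\<lambda>k. norm w ^ k" 0])
    show "summable (\<lambda>k. norm w ^ k)" using that by (intro summable_geometric) (simp add: dist_norm)
    show "norm (norm (?a k * (w - 0) ^ k)) \<le> norm w ^ k" for k
      using mult_right_mono[OF b[of k], of "norm w ^ k"] unfolding norm_mult[of "?a k"] norm_power diff_0_right by simp
  qed
  have "?P holomorphic_on ball 0 1"
    by (rule power_series_holomorphic[where a = ?a]) (rule summable_sums[OF s])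
  then have "continuous_on (ball 0 1) (\<lambda>w. w * ?P w)"
    by (intro continuous_intros holomorphic_on_imp_continuous_on)
  moreover have "w * ?P w = polylog (1/2) w" if "w \<in> ball 0 1" for w
    unfolding polylog_def using suminf_mult[OF s[OF that], of w] by (simp add: mult_ac)
  ultimately show ?thesis by (rule continuous_on_eq)
qed

lemma Re_square_minus_ge:
  assumes "Re \<xi> < 0" "0 \<le> t"
  shows "Re ((\<xi> - of_real t)\<^sup>2) \<ge> Re (\<xi>\<^sup>2) + t\<^sup>2"
  using mult_nonneg_nonpos[OF assms(2) less_imp_le[OF assms(1)]]
  by (simp add: Re_power2 power2_eq_square algebra_simps)

lemma S_minus_norm_exp:
  assumes "\<xi> \<in> S_minus z" "0 \<le> t"
  shows "norm (exp (- ((\<xi> - of_real t)\<^sup>2) / 2)) \<le> norm z * exp (- t\<^sup>2 / 2)"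
proof -
  have "norm (exp (- ((\<xi> - of_real t)\<^sup>2) / 2)) = exp (- Re ((\<xi> - of_real t)\<^sup>2) / 2)"
    by (simp only: norm_exp_eq_Re) simp
  also have "\<dots> \<le> exp (- Re (\<xi>\<^sup>2) / 2 + - t\<^sup>2 / 2)"
    using Re_square_minus_ge[of \<xi> t] assms by (simp add: S_minus_def)
  also have "\<dots> = norm (exp (- (\<xi>\<^sup>2) / 2)) * exp (- t\<^sup>2 / 2)"
    unfolding exp_add norm_exp_eq_Re by simp
  also have "exp (- (\<xi>\<^sup>2) / 2) = z" using assms(1) by (simp add: S_minus_def)
  finally show ?thesis .
qed

text \<open>On the ray \<xi> - t the argument of the polylogarithm has modulus at most |z| exp (-
  t^2 / 2), because |exp (- \<xi>^2 / 2)| = |z| at every point of \<open>S_minus z\<close>. The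
  Gaussian bound is therefore the same for all \<xi>.\<close>

lemma norm_Q_fun_le:
  assumes z: "0 < norm z" "norm z < 1"
  shows "\<exists>C. \<forall>\<xi>\<in>S_minus z. norm (Q_fun \<xi>) \<le> C"
proof -
  define A where "A = norm z / (1 - norm z)"
  define I where "I = (LINT t:{0..}|lborel. A * exp (- t\<^sup>2 / 2))"
  have A: "0 \<le> A" using z by (simp add: A_def)
  have gauss: "set_integrable lborel {0..} (\<lambda>t::real. A * exp (- t\<^sup>2 / 2))"
  proof -
    have "integrable lborel (\<lambda>t. A * sqrt (2 * pi) * std_normal_density t)"
      by (intro integrable_mult_right integrable_normal_density) simp
    then have "integrable lborel (\<lambda>t::real. A * exp (- t\<^sup>2 / 2))"
      by (simp add: std_normal_density_def)
    then show ?thesis unfolding set_integrable_def by (rule integrable_mult_indicator[rotated]) simp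
  qed
  have "norm (Q_fun \<xi>) \<le> sqrt (2 / pi) * I" if \<xi>: "\<xi> \<in> S_minus z" for \<xi>
  proof -
    let ?g = "\<lambda>s. polylog (1/2) (exp (- (s\<^sup>2) / 2))"
    have lt1: "norm (exp (- ((\<xi> - of_real t)\<^sup>2) / 2)) < 1" if "0 \<le> t" for t
    proof -
      have "norm z * exp (- t\<^sup>2 / 2) \<le> norm z * 1" by (intro mult_left_mono) auto
      then show ?thesis using S_minus_norm_exp[OF \<xi> that] z by linarith
    qed
    have bound: "norm (?g (\<xi> - of_real t)) \<le> A * exp (- t\<^sup>2 / 2)" if "0 \<le> t" for t
    proof -
      let ?w = "exp (- ((\<xi> - of_real t)\<^sup>2) / 2)"
      have w: "norm ?w \<le> norm z * exp (- t\<^sup>2 / 2)" by (rule S_minus_norm_exp[OF \<xi> that])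
      have "norm z * exp (- t\<^sup>2 / 2) \<le> norm z * 1" by (intro mult_left_mono) auto
      then have "norm ?w \<le> norm z" using w by linarith
      have "norm (?g (\<xi> - of_real t)) \<le> norm ?w / (1 - norm ?w)" by (rule norm_polylog_half_le[OF lt1[OF that]])
      also have "\<dots> \<le> (norm z * exp (- t\<^sup>2 / 2)) / (1 - norm z)"
        using w \<open>norm ?w \<le> norm z\<close> z by (intro frac_le) auto
      finally show ?thesis by (simp add: A_def)
    qed
    have cont: "continuous_on {0..} (\<lambda>t. ?g (\<xi> - of_real t))"
      by (rule continuous_on_compose2[OF continuous_on_polylog_half])
         (use lt1 in \<open>auto intro!: continuous_intros simp: dist_norm\<close>)
    have int: "set_integrable lborel {0..} (\<lambda>t. ?g (\<xi> - of_real t))"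
    proof -
      have "(\<lambda>t. indicator {0..} t *\<^sub>R ?g (\<xi> - of_real t)) \<in> borel_measurable borel"
        by (rule borel_measurable_continuous_on_indicator[OF _ cont]) simp
      then show ?thesis
        unfolding set_integrable_def
        by (intro lint_bound[OF gauss[unfolded set_integrable_def]])
           (use bound A in \<open>auto intro!: AE_I2 simp: indicator_def abs_mult\<close>)
    qed
    have ci: "contour_integral (linepath (\<xi> - of_real R) \<xi>) ?g = (LINT t:{0..R}|lborel. ?g (\<xi> - of_real t))"
      if R: "0 < R" for R :: real
    proof -
      have "contour_integral (linepath (\<xi> - of_real R) \<xi>) ?g = contour_integral (linepath (- of_real R) 0) (\<lambda>s. ?g (\<xi> + s))"
        unfolding contour_integral_integral
        by (intro integral_cong) (simp add: linepath_def algebra_simps scaleR_conv_of_real)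
      also have "\<dots> = integral {- R..0} (\<lambda>t. ?g (\<xi> + of_real t))"
        using contour_integral_linepath_Reals_eq[of "- of_real R" 0 "\<lambda>s. ?g (\<xi> + s)"] R by simp
      also have "\<dots> = integral {0..R} (\<lambda>t. ?g (\<xi> - of_real t))"
        using Henstock_Kurzweil_Integration.integral_reflect_real[of R 0 "\<lambda>t. ?g (\<xi> - of_real t)"] by simp
      also have "\<dots> = (LINT t:{0..R}|lborel. ?g (\<xi> - of_real t))"
        using set_integrable_subset[OF int, of "{0..R}"]
        by (intro set_borel_integral_eq_integral(2)[symmetric]) auto
      finally show ?thesis .
    qed
    have "((\<lambda>R. LINT t:{0..R}|lborel. ?g (\<xi> - of_real t)) \<longlongrightarrow> (LINT t:{0..}|lborel. ?g (\<xi> - of_real t))) at_top"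
      by (rule tendsto_set_lebesgue_integral_at_top[OF _ int]) simp
    then have "((\<lambda>R. contour_integral (linepath (\<xi> - of_real R) \<xi>) ?g) \<longlongrightarrow> (LINT t:{0..}|lborel. ?g (\<xi> - of_real t))) at_top"
      by (rule Lim_transform_eventually) (use ci in \<open>auto intro: eventually_mono[OF eventually_gt_at_top[of 0]]\<close>)
    then have "Q_fun \<xi> = of_real (sqrt (2 / pi)) * (LINT t:{0..}|lborel. ?g (\<xi> - of_real t))"
      unfolding Q_fun_def by (subst tendsto_Lim) auto
    moreover have "norm (LINT t:{0..}|lborel. ?g (\<xi> - of_real t)) \<le> I"
      unfolding I_def set_lebesgue_integral_def
    proof (rule order_trans[OF integral_norm_bound], rule Bochner_Integration.integral_mono)
      show "integrable lborel (\<lambda>t. norm (indicator {0..} t *\<^sub>R ?g (\<xi> - of_real t)))"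
        using int unfolding set_integrable_def by (rule integrable_norm)
      show "integrable lborel (\<lambda>t. indicator {0..} t *\<^sub>R (A * exp (- t\<^sup>2 / 2)))"
        using gauss unfolding set_integrable_def .
    qed (use bound in \<open>auto simp: indicator_def\<close>)
    ultimately show ?thesis by (simp add: norm_mult mult_left_mono)
  qed
  then show ?thesis by blast
qed

section \<open>Geometry of \<open>S_minus z\<close> and decay along it\<close>

lemma S_minus_Re_square:
  assumes "\<xi> \<in> S_minus z" "z \<noteq> 0"
  shows "Re (\<xi>\<^sup>2) = - 2 * ln (norm z)"
proof -
  have "norm z = norm (exp (- (\<xi>\<^sup>2) / 2))" using assms by (simp add: S_minus_def)
  also have "\<dots> = exp (- Re (\<xi>\<^sup>2) / 2)" by (simp only: norm_exp_eq_Re) simp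
  finally have "ln (norm z) = - Re (\<xi>\<^sup>2) / 2" by simp
  then show ?thesis by simp
qed

text \<open>The points are labelled by the branches of the logarithm: \<xi>^2 = - 2 Ln z + 4 pi i N,
  and the condition Re \<xi> < 0 selects one of the two square roots.\<close>

lemma S_minus_index:
  assumes z: "z \<noteq> 0"
  obtains N :: "complex \<Rightarrow> int" where "inj_on N (S_minus z)"
    "\<And>\<xi>. \<xi> \<in> S_minus z \<Longrightarrow> Im (\<xi>\<^sup>2) = - 2 * Im (Ln z) + 4 * pi * of_int (N \<xi>)"
proof -
  have "\<exists>n::int. Im (\<xi>\<^sup>2) = - 2 * Im (Ln z) + 4 * pi * of_int n" if "\<xi> \<in> S_minus z" for \<xi>
  proof -
    have "exp (- (\<xi>\<^sup>2) / 2) = exp (Ln z)" using that z by (simp add: S_minus_def)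
    then obtain n :: int where n: "- (\<xi>\<^sup>2) / 2 = Ln z + of_real (of_int (2 * n) * pi) * \<i>"
      unfolding exp_eq by blast
    then have "Im (- (\<xi>\<^sup>2) / 2) = Im (Ln z + of_real (of_int (2 * n) * pi) * \<i>)" by (rule arg_cong)
    then have "Im (\<xi>\<^sup>2) = - 2 * Im (Ln z) + 4 * pi * of_int (- n)" by (simp add: field_simps del: Im_power2)
    then show ?thesis ..
  qed
  then obtain N :: "complex \<Rightarrow> int" where N: "\<And>\<xi>. \<xi> \<in> S_minus z \<Longrightarrow> Im (\<xi>\<^sup>2) = - 2 * Im (Ln z) + 4 * pi * of_int (N \<xi>)"
    by metis
  moreover have "inj_on N (S_minus z)"
  proof (rule inj_onI)
    fix \<xi> \<eta> assume Sz: "\<xi> \<in> S_minus z" "\<eta> \<in> S_minus z" and eq: "N \<xi> = N \<eta>"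
    have "\<xi>\<^sup>2 = \<eta>\<^sup>2"
      using N[OF Sz(1)] N[OF Sz(2)] eq S_minus_Re_square[OF Sz(1) z] S_minus_Re_square[OF Sz(2) z]
      by (intro complex_eqI) (simp_all only:)
    then have "\<xi> = \<eta> \<or> \<xi> = - \<eta>" by (simp add: power2_eq_iff)
    moreover have "Re \<xi> < 0" "Re \<eta> < 0" using Sz by (auto simp: S_minus_def)
    ultimately show "\<xi> = \<eta>" by auto
  qed
  ultimately show ?thesis using that by blast
qed

lemma countable_S_minus: "z \<noteq> 0 \<Longrightarrow> countable (S_minus z)"
  by (rule S_minus_index) (auto intro: countable_image_inj_on[OF countableI_type])

lemma abs_summable_on_int_inverse_square: "Infinite_Set_Sum.abs_summable_on (\<lambda>n::int. 1 / (1 + (of_int n)\<^sup>2 :: real)) UNIV"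
proof -
  have s: "summable (\<lambda>n. 1 / (1 + (real n)\<^sup>2))"
  proof (rule summable_comparison_test'[of "\<lambda>n. inverse (real n ^ 2)" 1])
    show "summable (\<lambda>n. inverse (real n ^ 2))" by (rule inverse_power_summable) simp
    show "norm (1 / (1 + (real n)\<^sup>2)) \<le> inverse (real n ^ 2)" if "1 \<le> n" for n
    proof -
      have "0 < (real n)\<^sup>2" using that by simp
      then have "1 / (1 + (real n)\<^sup>2) \<le> 1 / (real n)\<^sup>2" by (intro divide_left_mono mult_pos_pos add_pos_nonneg) auto
      then show ?thesis by (simp add: divide_inverse)
    qed
  qed
  have "Infinite_Set_Sum.abs_summable_on (\<lambda>n::int. 1 / (1 + (of_int n)\<^sup>2 :: real)) (int ` UNIV \<union> (\<lambda>n. - int n) ` UNIV)"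
    using s by (intro Infinite_Set_Sum.abs_summable_on_union Infinite_Set_Sum.abs_summable_on_reindex) (simp_all add: Infinite_Set_Sum.abs_summable_on_nat_iff')
  moreover have "int ` UNIV \<union> (\<lambda>n. - int n) ` UNIV = UNIV"
    by (auto simp: image_iff) (metis int_cases2)
  ultimately show ?thesis by simp
qed

text \<open>|\<xi>|^4 = (Re \<xi>^2)^2 + (Im \<xi>^2)^2, where the first part is a positive constant
  and |Im \<xi>^2| is at least 2 pi |N| for N \<noteq> 0. So |\<xi>|^-4 is summable over
  \<open>S_minus z\<close>, which explains the exponent 4 below.\<close>

lemma S_minus_norm_square_ge:
  assumes "0 < norm z" "norm z < 1"
  shows "\<exists>N c. 0 < c \<and> inj_on N (S_minus z) \<and> (\<forall>\<xi>\<in>S_minus z. c * (1 + (of_int (N \<xi> :: int))\<^sup>2) \<le> norm \<xi> ^ 4)"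
proof -
  have z0: "z \<noteq> 0" using assms by auto
  obtain N :: "complex \<Rightarrow> int" where inj: "inj_on N (S_minus z)" and
    N: "\<And>\<xi>. \<xi> \<in> S_minus z \<Longrightarrow> Im (\<xi>\<^sup>2) = - 2 * Im (Ln z) + 4 * pi * of_int (N \<xi>)"
    using S_minus_index[OF z0] by blast
  define c where "c = min ((2 * ln (norm z))\<^sup>2) 1 / 2"
  have ln: "ln (norm z) < 0" using assms by simp
  have c: "0 < c" "2 * c \<le> (2 * ln (norm z))\<^sup>2" "2 * c \<le> 1" using ln by (auto simp: c_def)
  have "c * (1 + (of_int (N \<xi>))\<^sup>2) \<le> norm \<xi> ^ 4" if \<xi>: "\<xi> \<in> S_minus z" for \<xi>
  proof -
    have "norm \<xi> ^ 4 = (norm (\<xi>\<^sup>2))\<^sup>2" by (simp add: norm_power flip: power_mult)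
    also have "\<dots> = (Re (\<xi>\<^sup>2))\<^sup>2 + (Im (\<xi>\<^sup>2))\<^sup>2" by (rule cmod_power2)
    also have "(Re (\<xi>\<^sup>2))\<^sup>2 = (2 * ln (norm z))\<^sup>2"
      unfolding S_minus_Re_square[OF \<xi> z0] by (simp add: power2_eq_square)
    finally have n4: "norm \<xi> ^ 4 = (2 * ln (norm z))\<^sup>2 + (Im (\<xi>\<^sup>2))\<^sup>2" .
    have im: "(of_int (N \<xi>))\<^sup>2 \<le> (Im (\<xi>\<^sup>2))\<^sup>2"
    proof (cases "N \<xi> = 0")
      case False
      then have "1 \<le> \<bar>real_of_int (N \<xi>)\<bar>" by (metis of_int_abs of_int_1_le_iff zabs_less_one_iff not_le)
      then have 1: "2 * pi \<le> 2 * pi * \<bar>real_of_int (N \<xi>)\<bar>" by simp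
      have 2: "\<bar>Im (Ln z)\<bar> \<le> pi" using mpi_less_Im_Ln[OF z0] Im_Ln_le_pi[OF z0] by simp
      have 3: "\<bar>4 * pi * of_int (N \<xi>)\<bar> = 4 * pi * \<bar>real_of_int (N \<xi>)\<bar>" by (simp add: abs_mult)
      have "2 * pi * \<bar>real_of_int (N \<xi>)\<bar> \<le> \<bar>Im (\<xi>\<^sup>2)\<bar>" unfolding N[OF \<xi>] using 1 2 3 by linarith
      moreover have "\<bar>real_of_int (N \<xi>)\<bar> \<le> 2 * pi * \<bar>real_of_int (N \<xi>)\<bar>"
        using pi_gt3 by (simp add: mult_le_cancel_right1)
      ultimately have "\<bar>real_of_int (N \<xi>)\<bar> \<le> \<bar>Im (\<xi>\<^sup>2)\<bar>" by linarith
      then show ?thesis by (simp add: abs_le_square_iff del: Im_power2)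
    qed simp
    have "c * (1 + (of_int (N \<xi>))\<^sup>2) = c + c * (of_int (N \<xi>))\<^sup>2" by (simp add: distrib_left)
    also have "\<dots> \<le> (2 * ln (norm z))\<^sup>2 + 1 * (of_int (N \<xi>))\<^sup>2"
      using c by (intro add_mono mult_right_mono) auto
    also have "\<dots> \<le> norm \<xi> ^ 4" unfolding n4 using im by simp
    finally show ?thesis .
  qed
  then show ?thesis using c(1) inj by blast
qed

lemma abs_summable_on_S_minus:
  assumes z: "0 < norm z" "norm z < 1" and f: "\<And>\<xi>. \<xi> \<in> S_minus z \<Longrightarrow> norm (f \<xi>) \<le> C / norm \<xi> ^ 4"
  shows "Infinite_Set_Sum.abs_summable_on f (S_minus z)"
proof -
  obtain N c where c: "0 < c" and inj: "inj_on N (S_minus z)"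
    and N: "\<And>\<xi>. \<xi> \<in> S_minus z \<Longrightarrow> c * (1 + (of_int (N \<xi> :: int))\<^sup>2) \<le> norm \<xi> ^ 4"
    using S_minus_norm_square_ge[OF z] by blast
  have "Infinite_Set_Sum.abs_summable_on (\<lambda>n::int. 1 / (1 + (of_int n)\<^sup>2 :: real)) (N ` S_minus z)"
    by (rule Infinite_Set_Sum.abs_summable_on_subset[OF abs_summable_on_int_inverse_square]) simp
  then have "Infinite_Set_Sum.abs_summable_on (\<lambda>\<xi>. 1 / (1 + (of_int (N \<xi>))\<^sup>2 :: real)) (S_minus z)"
    using Infinite_Set_Sum.abs_summable_on_reindex_iff[OF inj, of "\<lambda>n. 1 / (1 + (of_int n)\<^sup>2 :: real)"] by simp
  then have "Infinite_Set_Sum.abs_summable_on (\<lambda>\<xi>. \<bar>C\<bar> / c * (1 / (1 + (of_int (N \<xi>))\<^sup>2 :: real))) (S_minus z)"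
    by (rule Infinite_Set_Sum.abs_summable_on_cmult_right)
  then show ?thesis
  proof (rule Infinite_Set_Sum.abs_summable_on_comparison_test')
    fix \<xi> assume \<xi>: "\<xi> \<in> S_minus z"
    have pos: "0 < c * (1 + (of_int (N \<xi>))\<^sup>2)" using c by (simp add: add_pos_nonneg)
    have "norm (f \<xi>) \<le> C / norm \<xi> ^ 4" by (rule f[OF \<xi>])
    also have "\<dots> \<le> \<bar>C\<bar> / norm \<xi> ^ 4" by (intro divide_right_mono) auto
    also have "\<dots> \<le> \<bar>C\<bar> / (c * (1 + (of_int (N \<xi>))\<^sup>2))" using N[OF \<xi>] pos by (intro divide_left_mono mult_pos_pos[of "norm \<xi> ^ 4"]) (auto simp del: zero_less_mult_iff)
    finally show "norm (f \<xi>) \<le> \<bar>C\<bar> / c * (1 / (1 + (of_int (N \<xi>))\<^sup>2))" by simp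
  qed
qed

lemma power_le_fact_exp:
  fixes s e :: real
  assumes "0 \<le> s" "0 < e"
  shows "s ^ j \<le> fact j / e ^ j * exp (e * s)"
proof -
  have "(e * s) ^ j / fact j \<le> exp (e * s)"
    using sum_le_suminf[OF summable_exp_generic[of "e * s"], of "{j}"] assms
    by (simp add: exp_def scaleR_conv_of_real field_simps)
  then show ?thesis using assms by (simp add: power_mult_distrib field_simps)
qed

lemma exp_linear_minus_cubic_le:
  fixes M b t :: real
  assumes "0 < b" "0 \<le> M" "0 \<le> t"
  shows "exp (M * t - b * t ^ 3) \<le> exp (M * (1 + M / b))"
proof -
  have "M * t - b * t ^ 3 \<le> M * (1 + M / b)"
  proof (cases "t \<le> 1 + M / b")
    case True
    then have "M * t \<le> M * (1 + M / b)" using assms by (intro mult_left_mono) auto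
    moreover have "0 \<le> b * t ^ 3" using assms by simp
    ultimately show ?thesis by linarith
  next
    case False
    have nn: "0 \<le> M / b" using assms by simp
    then have t1: "1 \<le> t" "M / b \<le> t" using False by auto
    have "M \<le> b * t" using t1(2) assms by (simp add: field_simps)
    then have "M * t \<le> b * t * t" using assms by (intro mult_right_mono) auto
    also have "\<dots> \<le> b * t * t * t" using mult_left_mono[OF t1(1), of "b * t * t"] t1 assms by simp
    finally have "M * t - b * t ^ 3 \<le> 0" by (simp add: power3_eq_cube mult.assoc)
    moreover have "0 \<le> M * (1 + M / b)" using assms nn by (intro mult_nonneg_nonneg) auto
    ultimately show ?thesis by linarith
  qed
  then show ?thesis by simp
qed

text \<open>With a = - Re \<xi> and b = Im \<xi>, Re (\<xi>^3) = a (3 b^2 - a^2), and the hyperbola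
  a^2 - b^2 = - 2 ln |z| turns the bracket into |\<xi>|^2 + 4 ln |z|. Since b^2 \<le> a^2, also a
  \<ge> |\<xi>| / 2.\<close>

lemma S_minus_Re_cube:
  assumes z: "0 < norm z" "norm z < 1" and \<xi>: "\<xi> \<in> S_minus z"
  shows "norm \<xi> ^ 3 / 2 + 4 * ln (norm z) * norm \<xi> \<le> Re (\<xi> ^ 3)"
proof -
  have z0: "z \<noteq> 0" using z by auto
  define a where "a = - Re \<xi>"
  define b where "b = Im \<xi>"
  define n where "n = norm \<xi>"
  have a: "0 < a" using \<xi> by (simp add: S_minus_def a_def)
  have \<xi>e: "\<xi> = Complex (- a) b" by (simp add: a_def b_def)
  have ab: "a\<^sup>2 - b\<^sup>2 = - 2 * ln (norm z)"
    using S_minus_Re_square[OF \<xi> z0] by (simp add: \<xi>e Re_power2)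
  have n2: "n\<^sup>2 = a\<^sup>2 + b\<^sup>2" unfolding n_def by (simp add: cmod_power2 a_def b_def)
  have ln: "ln (norm z) < 0" using z by simp
  have n: "0 \<le> n" by (simp add: n_def)
  have "b\<^sup>2 \<le> a\<^sup>2" using ab ln by linarith
  then have "n\<^sup>2 / 4 \<le> a\<^sup>2" using n2 zero_le_power2[of a] by linarith
  then have "(n / 2)\<^sup>2 \<le> a\<^sup>2" by (simp add: power_divide)
  then have an: "n / 2 \<le> a" using a n by (simp add: power2_le_iff_abs_le abs_le_square_iff[symmetric])
  have "a\<^sup>2 \<le> n\<^sup>2" using n2 by simp
  then have na: "a \<le> n" using a n by (simp add: abs_le_square_iff[symmetric])
  have "Re (\<xi> ^ 3) = a * (3 * b\<^sup>2 - a\<^sup>2)"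
    by (simp add: \<xi>e power3_eq_cube power2_eq_square algebra_simps)
  also have "3 * b\<^sup>2 - a\<^sup>2 = n\<^sup>2 + 4 * ln (norm z)" using ab n2 by simp
  finally have "Re (\<xi> ^ 3) = a * n\<^sup>2 + 4 * ln (norm z) * a" by (simp add: algebra_simps)
  moreover have "n / 2 * n\<^sup>2 \<le> a * n\<^sup>2" using an by (intro mult_right_mono) auto
  moreover have "4 * ln (norm z) * n \<le> 4 * ln (norm z) * a" using na ln by (intro mult_left_mono_neg) auto
  moreover have "n / 2 * n\<^sup>2 = n ^ 3 / 2" by (simp add: power3_eq_cube power2_eq_square)
  ultimately show ?thesis unfolding n_def[symmetric] by linarith
qed

text \<open>Re Phi falls like - \<tau> |\<xi>|^3 / 6. This decay is distributed: s \<tau> / 12 goes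
  to the exponential rate, which becomes the r of the gas, the rest to polynomial factors and the
  summable power |\<xi>|^-4.\<close>

lemma S_minus_exp_Phi_decay:
  assumes z: "0 < norm z" "norm z < 1" and \<tau>: "0 < \<tau>" and s: "0 < s"
  shows "\<exists>C. \<forall>\<xi>\<in>S_minus z. norm (exp (of_real s * Phi \<tau> x \<xi> + of_real g * \<xi>\<^sup>2)) *
     (1 + (norm \<xi> + norm \<xi> ^ 2 + norm \<xi> ^ 3)) ^ j * exp (s * \<tau> / 12 * (norm \<xi> + norm \<xi> ^ 3)) \<le> C / norm \<xi> ^ 4"
proof -
  have z0: "z \<noteq> 0" using z by auto
  obtain CQ where CQ: "\<And>\<xi>. \<xi> \<in> S_minus z \<Longrightarrow> norm (Q_fun \<xi>) \<le> CQ" using norm_Q_fun_le[OF z] by blast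
  \<comment> \<open>Cubic budget: of s \<tau> / 6 the exponential takes s \<tau> / 12, and the
    polynomial, through n^2 \<le> 1 + n^3, takes 2 e = s \<tau> / 24. The remaining s \<tau> / 24
    beats the linear terms collected in \<open>M\<close>, whose last summand 1 comes from n^4 \<le>
    24 exp n.\<close>
  define e where "e = s * \<tau> / 48"
  define M where "M = s * (4 * - ln (norm z) * \<tau> / 3 + \<bar>x\<bar>) + s * \<tau> / 12 + e + 1"
  define C0 where "C0 = s * CQ + \<bar>g * (2 * ln (norm z))\<bar> + 2 * e"
  define C where "C = exp C0 * (fact j / e ^ j) * 24 * exp (M * (1 + M / (s * \<tau> / 24)))"
  have ln: "ln (norm z) < 0" using z by simp
  have e: "0 < e" using s \<tau> by (simp add: e_def)
  have M: "0 \<le> M" using s \<tau> ln e unfolding M_def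
    by (intro add_nonneg_nonneg mult_nonneg_nonneg divide_nonneg_nonneg) (auto simp: mult_nonpos_nonneg)
  show ?thesis
  proof (intro exI[of _ C] ballI)
    fix \<xi> assume \<xi>: "\<xi> \<in> S_minus z"
    define n where "n = norm \<xi>"
    have n: "0 < n" using \<xi> by (auto simp: n_def S_minus_def)
    have re: "Re (of_real s * Phi \<tau> x \<xi> + of_real g * \<xi>\<^sup>2) \<le>
        s * (- (\<tau> / 6) * n ^ 3 + (4 * - ln (norm z) * \<tau> / 3 + \<bar>x\<bar>) * n) + (s * CQ + \<bar>g * (2 * ln (norm z))\<bar>)"
    proof -
      have "Re (Phi \<tau> x \<xi>) = - (\<tau> / 3) * Re (\<xi> ^ 3) + x * Re \<xi> - Re (Q_fun \<xi>)"
        by (simp add: Phi_def)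
      moreover have "- (\<tau> / 3) * Re (\<xi> ^ 3) \<le> - (\<tau> / 3) * (n ^ 3 / 2 + 4 * ln (norm z) * n)"
        using S_minus_Re_cube[OF z \<xi>] \<tau> by (intro mult_left_mono_neg) (auto simp: n_def)
      moreover have "x * Re \<xi> \<le> \<bar>x\<bar> * n"
        using abs_ge_self[of "x * Re \<xi>"] mult_left_mono[OF abs_Re_le_cmod[of \<xi>] abs_ge_zero[of x]] by (simp add: abs_mult n_def)
      moreover have "- Re (Q_fun \<xi>) \<le> CQ" using abs_Re_le_cmod[of "Q_fun \<xi>"] CQ[OF \<xi>] by linarith
      ultimately have "Re (Phi \<tau> x \<xi>) \<le> - (\<tau> / 3) * (n ^ 3 / 2 + 4 * ln (norm z) * n) + \<bar>x\<bar> * n + CQ" by linarith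
      also have "\<dots> = - (\<tau> / 6) * n ^ 3 + (4 * - ln (norm z) * \<tau> / 3 + \<bar>x\<bar>) * n + CQ" by (simp add: algebra_simps)
      finally have "s * Re (Phi \<tau> x \<xi>) \<le> s * (- (\<tau> / 6) * n ^ 3 + (4 * - ln (norm z) * \<tau> / 3 + \<bar>x\<bar>) * n + CQ)"
        using s by (intro mult_left_mono) auto
      moreover have "g * Re (\<xi>\<^sup>2) \<le> \<bar>g * (2 * ln (norm z))\<bar>"
        unfolding S_minus_Re_square[OF \<xi> z0] by simp
      moreover have "Re (of_real s * Phi \<tau> x \<xi> + of_real g * \<xi>\<^sup>2) = s * Re (Phi \<tau> x \<xi>) + g * Re (\<xi>\<^sup>2)"
        by (simp del: Re_power2)
      ultimately show ?thesis by (simp add: distrib_left)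
    qed
    have p: "(1 + (n + n ^ 2 + n ^ 3)) ^ j \<le> fact j / e ^ j * exp (e * (1 + (n + n ^ 2 + n ^ 3)))"
      using n e by (intro power_le_fact_exp) auto
    have n2: "n ^ 2 \<le> 1 + n ^ 3"
    proof (cases "n \<le> 1")
      case True
      then have "n ^ 2 \<le> 1" using n by (simp add: power_le_one)
      then show ?thesis using n by (simp add: add_increasing2)
    next
      case False
      then have "n ^ 2 \<le> n ^ 3" by (intro power_increasing) auto
      then show ?thesis by linarith
    qed
    have q: "n ^ 4 \<le> 24 * exp n"
      using power_le_fact_exp[of n 1 4] n by (simp add: fact_numeral)
    let ?E1 = "s * (- (\<tau> / 6) * n ^ 3 + (4 * - ln (norm z) * \<tau> / 3 + \<bar>x\<bar>) * n) + (s * CQ + \<bar>g * (2 * ln (norm z))\<bar>)"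
    let ?E2 = "e * (1 + (n + n ^ 2 + n ^ 3))" and ?E3 = "s * \<tau> / 12 * (n + n ^ 3)"
    have E: "?E1 + ?E2 + ?E3 + n \<le> C0 + (M * n - s * \<tau> / 24 * n ^ 3)"
    proof -
      have "?E2 \<le> e * (2 + n + 2 * n ^ 3)" using n2 e by (intro mult_left_mono) auto
      then have "?E1 + ?E2 + ?E3 + n \<le> ?E1 + e * (2 + n + 2 * n ^ 3) + ?E3 + n" by simp
      also have "\<dots> = C0 + (M * n - s * \<tau> / 24 * n ^ 3)"
        unfolding C0_def M_def e_def by (simp add: field_simps)
      finally show ?thesis .
    qed
    have "norm (exp (of_real s * Phi \<tau> x \<xi> + of_real g * \<xi>\<^sup>2)) * (1 + (n + n ^ 2 + n ^ 3)) ^ j * exp ?E3 * n ^ 4 \<le>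
      exp ?E1 * (fact j / e ^ j * exp ?E2) * exp ?E3 * (24 * exp n)"
      unfolding norm_exp_eq_Re using re p q n e by (intro mult_mono) (auto intro!: mult_nonneg_nonneg)
    also have "\<dots> = fact j / e ^ j * 24 * exp (?E1 + ?E2 + ?E3 + n)" by (simp add: exp_add)
    also have "\<dots> \<le> fact j / e ^ j * 24 * exp (C0 + (M * n - s * \<tau> / 24 * n ^ 3))"
      using E e by (intro mult_left_mono) auto
    also have "\<dots> \<le> fact j / e ^ j * 24 * (exp C0 * exp (M * (1 + M / (s * \<tau> / 24))))"
      unfolding exp_add using exp_linear_minus_cubic_le[of "s * \<tau> / 24" M n] s \<tau> M n e by (intro mult_left_mono) auto
    also have "\<dots> = C" by (simp add: C_def)
    finally show "norm (exp (of_real s * Phi \<tau> x \<xi> + of_real g * \<xi>\<^sup>2)) *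
     (1 + (norm \<xi> + norm \<xi> ^ 2 + norm \<xi> ^ 3)) ^ j * exp (s * \<tau> / 12 * (norm \<xi> + norm \<xi> ^ 3)) \<le> C / norm \<xi> ^ 4"
      using n by (simp add: n_def[symmetric] le_divide_eq)
  qed
qed

lemma S_minus_separated:
  assumes "0 < norm z" "norm z < 1"
  shows "\<exists>\<delta>>0. \<forall>\<xi>\<in>S_minus z. Re \<xi> \<le> - \<delta>"
proof (intro exI conjI ballI)
  let ?d = "sqrt (- 2 * ln (norm z))"
  show "0 < ?d" using assms by (simp add: mult_less_0_iff)
  fix \<xi> assume \<xi>: "\<xi> \<in> S_minus z"
  have "z \<noteq> 0" using assms by auto
  then have "(Re \<xi>)\<^sup>2 - (Im \<xi>)\<^sup>2 = - 2 * ln (norm z)"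
    using S_minus_Re_square[OF \<xi>] by (simp add: Re_power2)
  then have "- 2 * ln (norm z) \<le> (Re \<xi>)\<^sup>2" using zero_le_power2[of "Im \<xi>"] by linarith
  then have "- 2 * ln (norm z) \<le> (- Re \<xi>)\<^sup>2" by simp
  then have "?d \<le> \<bar>Re \<xi>\<bar>" using real_sqrt_le_mono by fastforce
  then show "Re \<xi> \<le> - ?d" using \<xi> by (simp add: S_minus_def)
qed

section \<open>The gas of the periodic kernel\<close>

lemma one_add_add_le: "1 + (a + b) \<le> (1 + a) * (1 + b)" if "0 \<le> a" "0 \<le> b" for a b :: real
  using mult_nonneg_nonneg[OF that] by (simp add: algebra_simps)

text \<open>The bounds separate u from v, so that sums over pairs become products of single sums. If
  Re (u^2) = Re (v^2), as within \<open>S_minus z\<close>, then l is purely imaginary and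
  contributes nothing to the real exponential rate.\<close>

lemma wave_bounds_norm:
  shows "1 + wsize u v \<le>
      (1 + (norm u + norm u ^ 2 + norm u ^ 3)) * (1 + (norm v + norm v ^ 2 + norm v ^ 3))"
    and "Re (u\<^sup>2) = Re (v\<^sup>2) \<Longrightarrow> wre u v \<le> (norm u + norm u ^ 3) + (norm v + norm v ^ 3)"
proof -
  have k: "norm (wave_k u v) \<le> norm u + norm v" by (simp add: wave_k_def norm_triangle_ineq)
  have l: "norm (wave_l u v) \<le> norm u ^ 2 + norm v ^ 2"
  proof -
    have "norm (v\<^sup>2 - u\<^sup>2) \<le> norm v ^ 2 + norm u ^ 2" using norm_triangle_ineq4[of "v\<^sup>2" "u\<^sup>2"] by (simp add: norm_power)
    then have "norm (wave_l u v) \<le> (norm v ^ 2 + norm u ^ 2) / 2" by (simp add: wave_l_def norm_divide)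
    also have "\<dots> \<le> norm u ^ 2 + norm v ^ 2" using zero_le_power2[of "norm u"] zero_le_power2[of "norm v"] by simp
    finally show ?thesis .
  qed
  have w: "norm (wave_w u v) \<le> norm u ^ 3 + norm v ^ 3"
  proof -
    have "norm (u ^ 3 + v ^ 3) \<le> norm u ^ 3 + norm v ^ 3" using norm_triangle_ineq[of "u ^ 3" "v ^ 3"] by (simp add: norm_power)
    then have "norm (wave_w u v) \<le> (norm u ^ 3 + norm v ^ 3) / 3" by (simp only: wave_w_def norm_divide norm_minus_cancel) simp
    also have "\<dots> \<le> norm u ^ 3 + norm v ^ 3" by simp
    finally show ?thesis .
  qed
  have "1 + wsize u v \<le>
      1 + ((norm u + norm u ^ 2 + norm u ^ 3) + (norm v + norm v ^ 2 + norm v ^ 3))"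
    unfolding wave_size_def using k l w by linarith
  also have "\<dots> \<le> (1 + (norm u + norm u ^ 2 + norm u ^ 3)) * (1 + (norm v + norm v ^ 2 + norm v ^ 3))"
    by (rule one_add_add_le) (auto intro!: add_nonneg_nonneg)
  finally show "1 + wsize u v \<le>
      (1 + (norm u + norm u ^ 2 + norm u ^ 3)) * (1 + (norm v + norm v ^ 2 + norm v ^ 3))" .
  assume eq: "Re (u\<^sup>2) = Re (v\<^sup>2)"
  have "Re (wave_l u v) = 0" using eq by (simp add: wave_l_def del: Re_power2)
  then show "wre u v \<le> (norm u + norm u ^ 3) + (norm v + norm v ^ 3)"
    unfolding wave_re_def using k w abs_Re_le_cmod[of "wave_k u v"] abs_Re_le_cmod[of "wave_w u v"] by linarith
qed

text \<open>The factor of the kernel at each end; \<open>per_q\<close> collects what belongs to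
  \<eta>, so that the kernel is the sum over \<eta> of p(\<xi>1) q(\<eta>) p(\<xi>2) / ((\<xi>1 +
  \<eta>) (\<eta> + \<xi>2)).\<close>

definition per_p :: "real \<Rightarrow> real \<Rightarrow> real \<Rightarrow> complex \<Rightarrow> complex" where
  "per_p \<tau> \<gamma> x \<xi> = exp (Phi \<tau> x \<xi> / 2 + of_real (\<gamma> / 4) * \<xi>\<^sup>2) / csqrt (- \<xi>)"

definition per_q :: "real \<Rightarrow> real \<Rightarrow> real \<Rightarrow> complex \<Rightarrow> complex" where
  "per_q \<tau> \<gamma> x \<eta> = exp (Phi \<tau> x \<eta> - of_real (\<gamma> / 2) * \<eta>\<^sup>2) / (- \<eta>)"

text \<open>The weight of the particle (\<eta>, \<xi>). In a cyclic product each \<xi> ends one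
  kernel and starts the next, which squares \<open>per_p\<close>; the Cauchy factor between \<eta>
  and its own \<xi> belongs to the weight, the others form the determinant.\<close>

definition per_c :: "real \<Rightarrow> real \<Rightarrow> real \<Rightarrow> complex \<times> complex \<Rightarrow> complex" where
  "per_c \<tau> \<gamma> x y = (per_p \<tau> \<gamma> x (snd y))\<^sup>2 * per_q \<tau> \<gamma> x (fst y) / (fst y + snd y)"

lemma per_p_square: "(per_p \<tau> \<gamma> x \<xi>)\<^sup>2 = exp (Phi \<tau> x \<xi> + of_real (\<gamma> / 2) * \<xi>\<^sup>2) / (- \<xi>)"
proof -
  have "(exp (Phi \<tau> x \<xi> / 2 + of_real (\<gamma> / 4) * \<xi>\<^sup>2))\<^sup>2 = exp (Phi \<tau> x \<xi> + of_real (\<gamma> / 2) * \<xi>\<^sup>2)"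
    unfolding power2_eq_square exp_add[symmetric] by (rule arg_cong[of _ _ exp]) (simp add: field_simps)
  then show ?thesis by (simp add: per_p_def power_divide)
qed

text \<open>\<open>Q_fun\<close> is independent of the parameters and drops out of the ratio. The
  rest of the exponent is linear in x, \<gamma>, \<tau>, with the wave numbers of u = \<eta>, v =
  \<xi> as coefficients.\<close>

lemma per_c_shift:
  "per_c \<tau> \<gamma> x y = per_c \<tau>0 \<gamma>0 x0 y * exp (of_real (x - x0) * wave_k (fst y) (snd y) +
     of_real (\<gamma> - \<gamma>0) * wave_l (fst y) (snd y) + of_real (\<tau> - \<tau>0) * wave_w (fst y) (snd y))"
proof -
  obtain \<eta> \<xi> where y: "y = (\<eta>, \<xi>)" by (cases y)
  have "(Phi \<tau> x \<xi> + of_real (\<gamma> / 2) * \<xi>\<^sup>2) + (Phi \<tau> x \<eta> - of_real (\<gamma> / 2) * \<eta>\<^sup>2) =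
    (Phi \<tau>0 x0 \<xi> + of_real (\<gamma>0 / 2) * \<xi>\<^sup>2) + (Phi \<tau>0 x0 \<eta> - of_real (\<gamma>0 / 2) * \<eta>\<^sup>2) +
    (of_real (x - x0) * wave_k \<eta> \<xi> + of_real (\<gamma> - \<gamma>0) * wave_l \<eta> \<xi> + of_real (\<tau> - \<tau>0) * wave_w \<eta> \<xi>)"
    by (simp add: Phi_def wave_defs field_simps)
  then have "exp (Phi \<tau> x \<xi> + of_real (\<gamma> / 2) * \<xi>\<^sup>2) * exp (Phi \<tau> x \<eta> - of_real (\<gamma> / 2) * \<eta>\<^sup>2) =
    exp (Phi \<tau>0 x0 \<xi> + of_real (\<gamma>0 / 2) * \<xi>\<^sup>2) * exp (Phi \<tau>0 x0 \<eta> - of_real (\<gamma>0 / 2) * \<eta>\<^sup>2) *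
    exp (of_real (x - x0) * wave_k \<eta> \<xi> + of_real (\<gamma> - \<gamma>0) * wave_l \<eta> \<xi> + of_real (\<tau> - \<tau>0) * wave_w \<eta> \<xi>)"
    by (simp only: exp_add[symmetric])
  then show ?thesis unfolding per_c_def per_p_square per_q_def y fst_conv snd_conv times_divide_times_eq
    by (simp only: times_divide_eq_left)
qed

context
  fixes z :: complex
  assumes z: "0 < norm z" "norm z < 1"
begin

abbreviation "Sz \<equiv> S_minus z"

lemma z_nonzero: "z \<noteq> 0" using z by auto

lemma countable_S: "countable Sz" by (rule countable_S_minus[OF z_nonzero])

lemma per_inverse_bounds:
  "\<exists>\<delta>>0. (\<forall>\<xi>\<in>Sz. Re \<xi> \<le> - \<delta>) \<and> (\<forall>\<xi>\<in>Sz. \<delta> \<le> norm \<xi>) \<and> (\<forall>\<xi>\<in>Sz. \<forall>\<eta>\<in>Sz. \<delta> \<le> norm (\<xi> + \<eta>))"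
proof -
  obtain \<delta> where d: "0 < \<delta>" "\<And>\<xi>. \<xi> \<in> Sz \<Longrightarrow> Re \<xi> \<le> - \<delta>" using S_minus_separated[OF z] by blast
  moreover have "\<delta> \<le> norm \<xi>" if "\<xi> \<in> Sz" for \<xi> using d(2)[OF that] abs_Re_le_cmod[of \<xi>] by linarith
  moreover have "\<delta> \<le> norm (\<xi> + \<eta>)" if "\<xi> \<in> Sz" "\<eta> \<in> Sz" for \<xi> \<eta>
    using d(2)[OF that(1)] d(2)[OF that(2)] d(1) abs_Re_le_cmod[of "\<xi> + \<eta>"] by simp
  ultimately show ?thesis by blast
qed

lemma per_p_bounded:
  assumes \<tau>: "0 < \<tau>"
  shows "\<exists>C. \<forall>\<xi>\<in>Sz. norm (per_p \<tau> \<gamma> x \<xi>) \<le> C / norm \<xi> ^ 4"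
    and "\<exists>C. \<forall>\<xi>\<in>Sz. norm (per_p \<tau> \<gamma> x \<xi>) \<le> C"
    and "\<exists>C. \<forall>\<xi>\<in>Sz. norm (per_q \<tau> \<gamma> x \<xi>) \<le> C / norm \<xi> ^ 4"
proof -
  obtain \<delta> where \<delta>: "0 < \<delta>" "\<And>\<xi>. \<xi> \<in> Sz \<Longrightarrow> \<delta> \<le> norm \<xi>" using per_inverse_bounds by blast
  have "\<exists>C\<ge>0. \<forall>\<xi>\<in>Sz. norm (exp (of_real s * Phi \<tau> x \<xi> + of_real g * \<xi>\<^sup>2)) \<le> C / norm \<xi> ^ 4" if s: "0 < s" for s g
  proof -
    obtain C where C: "\<And>\<xi>. \<xi> \<in> Sz \<Longrightarrow> norm (exp (of_real s * Phi \<tau> x \<xi> + of_real g * \<xi>\<^sup>2)) *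
     (1 + (norm \<xi> + norm \<xi> ^ 2 + norm \<xi> ^ 3)) ^ 0 * exp (s * \<tau> / 12 * (norm \<xi> + norm \<xi> ^ 3)) \<le> C / norm \<xi> ^ 4"
      using S_minus_exp_Phi_decay[OF z \<tau> s, of x g 0] by blast
    have "norm (exp (of_real s * Phi \<tau> x \<xi> + of_real g * \<xi>\<^sup>2)) \<le> \<bar>C\<bar> / norm \<xi> ^ 4" if \<xi>: "\<xi> \<in> Sz" for \<xi>
    proof -
      have "norm (exp (of_real s * Phi \<tau> x \<xi> + of_real g * \<xi>\<^sup>2)) * 1 \<le>
          norm (exp (of_real s * Phi \<tau> x \<xi> + of_real g * \<xi>\<^sup>2)) * exp (s * \<tau> / 12 * (norm \<xi> + norm \<xi> ^ 3))"
        using \<open>0 < s\<close> \<tau> by (intro mult_left_mono) auto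
      also have "\<dots> \<le> C / norm \<xi> ^ 4" using C[OF \<xi>] by simp
      also have "\<dots> \<le> \<bar>C\<bar> / norm \<xi> ^ 4" by (intro divide_right_mono) auto
      finally show ?thesis by simp
    qed
    then show ?thesis by (intro exI[of _ "\<bar>C\<bar>"]) auto
  qed
  note dec = this
  obtain C1 where C1: "0 \<le> C1" "\<And>\<xi>. \<xi> \<in> Sz \<Longrightarrow> norm (exp (of_real (1/2) * Phi \<tau> x \<xi> + of_real (\<gamma> / 4) * \<xi>\<^sup>2)) \<le> C1 / norm \<xi> ^ 4"
    using dec[of "1/2" "\<gamma> / 4"] by auto
  obtain C2 where C2: "0 \<le> C2" "\<And>\<xi>. \<xi> \<in> Sz \<Longrightarrow> norm (exp (of_real 1 * Phi \<tau> x \<xi> + of_real (- \<gamma> / 2) * \<xi>\<^sup>2)) \<le> C2 / norm \<xi> ^ 4"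
    using dec[of 1 "- \<gamma> / 2"] by auto
  have p: "norm (per_p \<tau> \<gamma> x \<xi>) \<le> (C1 / sqrt \<delta>) / norm \<xi> ^ 4" if \<xi>: "\<xi> \<in> Sz" for \<xi>
  proof -
    have "norm (csqrt (- \<xi>)) = sqrt (norm \<xi>)"
    proof -
      have "(norm (csqrt (- \<xi>)))\<^sup>2 = norm ((csqrt (- \<xi>))\<^sup>2)" by (rule norm_power[symmetric])
      then have "(norm (csqrt (- \<xi>)))\<^sup>2 = norm \<xi>" by simp
      from real_sqrt_unique[OF this norm_ge_zero] show ?thesis by simp
    qed
    then have "sqrt \<delta> \<le> norm (csqrt (- \<xi>))" using \<delta>(2)[OF \<xi>] by simp
    then have "norm (per_p \<tau> \<gamma> x \<xi>) \<le> (C1 / norm \<xi> ^ 4) / sqrt \<delta>"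
      unfolding per_p_def norm_divide using C1(2)[OF \<xi>] C1(1) \<delta>(1) by (intro frac_le) auto
    then show ?thesis by (simp add: mult.commute)
  qed
  then show "\<exists>C. \<forall>\<xi>\<in>Sz. norm (per_p \<tau> \<gamma> x \<xi>) \<le> C / norm \<xi> ^ 4" by blast
  have "norm (per_p \<tau> \<gamma> x \<xi>) \<le> (C1 / sqrt \<delta>) / \<delta> ^ 4" if \<xi>: "\<xi> \<in> Sz" for \<xi>
  proof -
    have "(C1 / sqrt \<delta>) / norm \<xi> ^ 4 \<le> (C1 / sqrt \<delta>) / \<delta> ^ 4"
      using \<delta>(1) \<delta>(2)[OF \<xi>] C1(1) by (intro frac_le power_mono divide_nonneg_nonneg) auto
    then show ?thesis using p[OF \<xi>] by linarith
  qed
  then show "\<exists>C. \<forall>\<xi>\<in>Sz. norm (per_p \<tau> \<gamma> x \<xi>) \<le> C" by blast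
  have "norm (per_q \<tau> \<gamma> x \<xi>) \<le> (C2 / \<delta>) / norm \<xi> ^ 4" if \<xi>: "\<xi> \<in> Sz" for \<xi>
  proof -
    have "norm (per_q \<tau> \<gamma> x \<xi>) \<le> (C2 / norm \<xi> ^ 4) / \<delta>"
      unfolding per_q_def norm_divide norm_minus_cancel
      using C2(2)[OF \<xi>] C2(1) \<delta>(1) \<delta>(2)[OF \<xi>] by (intro frac_le) auto
    then show ?thesis by (simp add: mult.commute)
  qed
  then show "\<exists>C. \<forall>\<xi>\<in>Sz. norm (per_q \<tau> \<gamma> x \<xi>) \<le> C / norm \<xi> ^ 4" by blast
qed

lemma kp_gas_per:
  assumes \<tau>: "0 < \<tau>"
  shows "\<exists>\<delta>. kp_gas (count_space (Sz \<times> Sz)) (per_c \<tau> \<gamma> x) fst snd \<delta> (\<tau> / 12)"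
proof -
  obtain \<delta> where \<delta>: "0 < \<delta>" "\<And>\<xi>. \<xi> \<in> Sz \<Longrightarrow> Re \<xi> \<le> - \<delta>" "\<And>\<xi>. \<xi> \<in> Sz \<Longrightarrow> \<delta> \<le> norm \<xi>"
    "\<And>\<xi> \<eta>. \<xi> \<in> Sz \<Longrightarrow> \<eta> \<in> Sz \<Longrightarrow> \<delta> \<le> norm (\<xi> + \<eta>)" using per_inverse_bounds by blast
  have "kp_gas (count_space (Sz \<times> Sz)) (per_c \<tau> \<gamma> x) fst snd \<delta> (\<tau> / 12)"
  proof (rule kp_gas.intro)
    show "sigma_finite_measure (count_space (Sz \<times> Sz))"
      by (intro sigma_finite_measure_count_space_countable countable_SIGMA countable_S)
    show "0 < \<delta>" "0 < \<tau> / 12" using \<delta>(1) \<tau> by auto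
    show "Re (fst p) \<le> - \<delta>" if "p \<in> space (count_space (Sz \<times> Sz))" for p
      using that \<delta>(2) by auto
    show "Re (snd p) \<le> - \<delta>" if "p \<in> space (count_space (Sz \<times> Sz))" for p
      using that \<delta>(2) by auto
    fix j :: nat
    let ?G = "\<lambda>g \<xi>. norm (exp (of_real 1 * Phi \<tau> x \<xi> + of_real g * \<xi>\<^sup>2)) *
     (1 + (norm \<xi> + norm \<xi> ^ 2 + norm \<xi> ^ 3)) ^ j * exp (1 * \<tau> / 12 * (norm \<xi> + norm \<xi> ^ 3))"
    have G: "Infinite_Set_Sum.abs_summable_on (?G g) Sz" for g
    proof -
      obtain C where "\<And>\<xi>. \<xi> \<in> Sz \<Longrightarrow> ?G g \<xi> \<le> C / norm \<xi> ^ 4"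
        using S_minus_exp_Phi_decay[OF z \<tau>, of 1 x g j] by auto
      then show ?thesis by (intro abs_summable_on_S_minus[OF z, of _ C]) (simp add: abs_mult)
    qed
    have "Infinite_Set_Sum.abs_summable_on (\<lambda>(\<eta>, \<xi>). ?G (- \<gamma> / 2) \<eta> * ?G (\<gamma> / 2) \<xi>) (Sz \<times> Sz)"
      by (intro Infinite_Set_Sum.abs_summable_on_product countable_S G)
    from Infinite_Set_Sum.abs_summable_on_cmult_right[OF this, of "1 / (\<delta> * \<delta> * \<delta>)"]
    show "integrable (count_space (Sz \<times> Sz)) (\<lambda>p. norm (per_c \<tau> \<gamma> x p) *
      (1 + wsize (fst p) (snd p)) ^ j *
      exp (\<tau> / 12 * wre (fst p) (snd p)))"
      unfolding Infinite_Set_Sum.abs_summable_on_def[symmetric]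
    proof (rule Infinite_Set_Sum.abs_summable_on_comparison_test')
      fix p assume "p \<in> Sz \<times> Sz"
      then obtain \<eta> \<xi> where p: "p = (\<eta>, \<xi>)" and Sz: "\<eta> \<in> Sz" "\<xi> \<in> Sz" by auto
      let ?s = "\<lambda>u. norm u + norm u ^ 2 + norm u ^ 3" and ?t = "\<lambda>u. norm u + norm u ^ 3"
      have c: "norm (per_c \<tau> \<gamma> x (\<eta>, \<xi>)) \<le> norm (exp (of_real 1 * Phi \<tau> x \<xi> + of_real (\<gamma> / 2) * \<xi>\<^sup>2)) *
         norm (exp (of_real 1 * Phi \<tau> x \<eta> + of_real (- \<gamma> / 2) * \<eta>\<^sup>2)) * (1 / (\<delta> * \<delta> * \<delta>))"
      proof -
        let ?A = "norm (exp (of_real 1 * Phi \<tau> x \<xi> + of_real (\<gamma> / 2) * \<xi>\<^sup>2))"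
        let ?B = "norm (exp (of_real 1 * Phi \<tau> x \<eta> + of_real (- \<gamma> / 2) * \<eta>\<^sup>2))"
        have "norm (per_c \<tau> \<gamma> x (\<eta>, \<xi>)) = ?A * ?B * (1 / (norm \<xi> * norm \<eta> * norm (\<eta> + \<xi>)))"
          unfolding per_c_def per_p_square per_q_def by (simp add: norm_divide norm_mult)
        also have "\<dots> \<le> ?A * ?B * (1 / (\<delta> * \<delta> * \<delta>))"
          using \<delta>(1) \<delta>(3)[OF Sz(1)] \<delta>(3)[OF Sz(2)] \<delta>(4)[OF Sz]
          by (intro mult_left_mono divide_left_mono mult_mono mult_pos_pos mult_nonneg_nonneg) auto
        finally show ?thesis .
      qed
      have s: "(1 + wsize \<eta> \<xi>) ^ j \<le> (1 + ?s \<eta>) ^ j * (1 + ?s \<xi>) ^ j"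
        unfolding power_mult_distrib[symmetric] by (intro power_mono wave_bounds_norm(1)) (simp add: add_nonneg_nonneg)
      have "wre \<eta> \<xi> \<le> ?t \<eta> + ?t \<xi>"
        \<comment> \<open>All points of \<open>S_minus z\<close> share the value of Re
          (\<xi>^2).\<close>
        by (rule wave_bounds_norm(2)) (simp only: S_minus_Re_square[OF Sz(1) z_nonzero] S_minus_Re_square[OF Sz(2) z_nonzero])
      then have "\<tau> / 12 * wre \<eta> \<xi> \<le> 1 * \<tau> / 12 * ?t \<eta> + 1 * \<tau> / 12 * ?t \<xi>"
        using \<tau> by (simp add: distrib_left[symmetric])
      then have e: "exp (\<tau> / 12 * wre \<eta> \<xi>) \<le> exp (1 * \<tau> / 12 * ?t \<eta>) * exp (1 * \<tau> / 12 * ?t \<xi>)"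
        by (simp only: exp_add[symmetric] exp_le_cancel_iff)
      have "norm (per_c \<tau> \<gamma> x (\<eta>, \<xi>)) * (1 + wsize \<eta> \<xi>) ^ j *
          exp (\<tau> / 12 * wre \<eta> \<xi>) \<le>
        (norm (exp (of_real 1 * Phi \<tau> x \<xi> + of_real (\<gamma> / 2) * \<xi>\<^sup>2)) *
         norm (exp (of_real 1 * Phi \<tau> x \<eta> + of_real (- \<gamma> / 2) * \<eta>\<^sup>2)) * (1 / (\<delta> * \<delta> * \<delta>))) * ((1 + ?s \<eta>) ^ j * (1 + ?s \<xi>) ^ j) *
        (exp (1 * \<tau> / 12 * ?t \<eta>) * exp (1 * \<tau> / 12 * ?t \<xi>))"
        using \<delta>(1) by (intro mult_mono c s e mult_nonneg_nonneg) (auto intro!: add_nonneg_nonneg)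
      also have "\<dots> = 1 / (\<delta> * \<delta> * \<delta>) * (?G (- \<gamma> / 2) \<eta> * ?G (\<gamma> / 2) \<xi>)" by (simp only: mult_ac)
      finally show "norm (norm (per_c \<tau> \<gamma> x p) *
        (1 + wsize (fst p) (snd p)) ^ j *
        exp (\<tau> / 12 * wre (fst p) (snd p))) \<le>
        1 / (\<delta> * \<delta> * \<delta>) * (case p of (\<eta>, \<xi>) \<Rightarrow> ?G (- \<gamma> / 2) \<eta> * ?G (\<gamma> / 2) \<xi>)"
        unfolding p prod.case fst_conv snd_conv by (subst real_norm_def, subst abs_of_nonneg) auto
    qed
  qed simp_all
  then show ?thesis ..
qed

lemma D_per_eq_series:
  assumes \<tau>: "0 < \<tau>"
  shows "D_per z \<tau> \<gamma> x = (\<Sum>n. (-1) ^ n / fact n * (LINT q|PiM {..<n} (\<lambda>_. count_space (Sz \<times> Sz)).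
     mdet n (\<lambda>i j. per_c \<tau> \<gamma> x (q j) / (fst (q i) + snd (q j)))))"
proof -
  obtain \<delta> where \<delta>: "0 < \<delta>" "\<And>\<xi> \<eta>. \<xi> \<in> Sz \<Longrightarrow> \<eta> \<in> Sz \<Longrightarrow> \<delta> \<le> norm (\<xi> + \<eta>)"
    using per_inverse_bounds by blast
  let ?p = "per_p \<tau> \<gamma> x" and ?q = "per_q \<tau> \<gamma> x"
  let ?g = "\<lambda>y. ?p (snd y) * ?q (fst y) / (snd y + fst y)"
  \<comment> \<open>The intermediate space consists of pairs (\<eta>, \<xi>), and \<open>?a\<close>
    ties \<xi> to the row index. Summing over pairs then reproduces the sum over \<eta>, while the
    composition in the other order is a matrix indexed by the particles of the gas.\<close>
  let ?a = "\<lambda>s y. if s = snd y then ?g y else 0"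
  let ?b = "\<lambda>y s. ?p s / (fst y + s)"
  obtain C1 where C1: "\<And>\<xi>. \<xi> \<in> Sz \<Longrightarrow> norm (?p \<xi>) \<le> C1 / norm \<xi> ^ 4" using per_p_bounded(1)[OF \<tau>, of \<gamma> x] by blast
  obtain C2 where C2: "\<And>\<xi>. \<xi> \<in> Sz \<Longrightarrow> norm (?p \<xi>) \<le> C2" using per_p_bounded(2)[OF \<tau>, of \<gamma> x] by blast
  obtain C3 where C3: "\<And>\<xi>. \<xi> \<in> Sz \<Longrightarrow> norm (?q \<xi>) \<le> C3 / norm \<xi> ^ 4" using per_p_bounded(3)[OF \<tau>, of \<gamma> x] by blast
  have psum: "Infinite_Set_Sum.abs_summable_on ?p Sz" by (rule abs_summable_on_S_minus[OF z C1])
  have qsum: "Infinite_Set_Sum.abs_summable_on ?q Sz" by (rule abs_summable_on_S_minus[OF z C3])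
  have div: "norm (w / (\<xi> + \<eta>)) \<le> norm (w / of_real \<delta>)" if "\<xi> \<in> Sz" "\<eta> \<in> Sz" for w \<xi> \<eta>
    unfolding norm_divide using \<delta>(1) \<delta>(2)[OF that] by (intro divide_left_mono mult_pos_pos) auto
  have g: "Infinite_Set_Sum.abs_summable_on ?g (Sz \<times> Sz)"
  proof (rule Infinite_Set_Sum.abs_summable_on_comparison_test)
    have "Infinite_Set_Sum.abs_summable_on (\<lambda>(\<eta>, \<xi>). ?q \<eta> * ?p \<xi>) (Sz \<times> Sz)"
      by (intro Infinite_Set_Sum.abs_summable_on_product countable_S psum qsum)
    then show "Infinite_Set_Sum.abs_summable_on (\<lambda>y. (case y of (\<eta>, \<xi>) \<Rightarrow> ?q \<eta> * ?p \<xi>) * (1 / of_real \<delta>)) (Sz \<times> Sz)"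
      by (rule Infinite_Set_Sum.abs_summable_on_cmult_left)
    show "norm (?g y) \<le> norm ((case y of (\<eta>, \<xi>) \<Rightarrow> ?q \<eta> * ?p \<xi>) * (1 / of_real \<delta>))" if "y \<in> Sz \<times> Sz" for y
      using div[of "snd y" "fst y" "?p (snd y) * ?q (fst y)"] that by (auto simp: mult.commute)
  qed
  have eta: "Infinite_Set_Sum.abs_summable_on (\<lambda>\<eta>. ?g (\<eta>, \<xi>1) * ?b (\<eta>, \<xi>1) \<xi>2) Sz" if "\<xi>1 \<in> Sz" "\<xi>2 \<in> Sz" for \<xi>1 \<xi>2
  proof (rule Infinite_Set_Sum.abs_summable_on_comparison_test)
    show "Infinite_Set_Sum.abs_summable_on (\<lambda>\<eta>. ?q \<eta> * (?p \<xi>1 * ?p \<xi>2 / (of_real \<delta> * of_real \<delta>))) Sz"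
      by (rule Infinite_Set_Sum.abs_summable_on_cmult_left[OF qsum])
    fix \<eta> assume \<eta>: "\<eta> \<in> Sz"
    have "norm (?g (\<eta>, \<xi>1) * ?b (\<eta>, \<xi>1) \<xi>2) \<le> norm (?p \<xi>1 * ?q \<eta> / of_real \<delta>) * norm (?p \<xi>2 / of_real \<delta>)"
      unfolding norm_mult fst_conv snd_conv using div[OF that(1) \<eta>, of "?p \<xi>1 * ?q \<eta>"] div[OF \<eta> that(2), of "?p \<xi>2"]
      by (intro mult_mono) (auto simp: norm_mult)
    then show "norm (?g (\<eta>, \<xi>1) * ?b (\<eta>, \<xi>1) \<xi>2) \<le> norm (?q \<eta> * (?p \<xi>1 * ?p \<xi>2 / (of_real \<delta> * of_real \<delta>)))"
      by (simp add: norm_mult norm_divide mult_ac)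
  qed
  have sf: "sigma_finite_measure (count_space Sz)" "sigma_finite_measure (count_space (Sz \<times> Sz))"
    by (intro sigma_finite_measure_count_space_countable countable_SIGMA countable_S)+
  have K: "K_per z \<tau> \<gamma> x \<xi>1 \<xi>2 = (LINT y|count_space (Sz \<times> Sz). ?a \<xi>1 y * ?b y \<xi>2)" if "\<xi>1 \<in> Sz" "\<xi>2 \<in> Sz" for \<xi>1 \<xi>2
  proof -
    have "(LINT y|count_space (Sz \<times> Sz). ?a \<xi>1 y * ?b y \<xi>2) = infsetsum (\<lambda>y. ?a \<xi>1 y * ?b y \<xi>2) (Sz \<times> Sz)"
      by (simp add: infsetsum_def)
    also have "\<dots> = infsetsum (\<lambda>y. ?g y * ?b y \<xi>2) ((\<lambda>\<eta>. (\<eta>, \<xi>1)) ` Sz)"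
      by (rule infsetsum_cong_neutral) (use that in auto)
    also have "\<dots> = infsetsum (\<lambda>\<eta>. ?g (\<eta>, \<xi>1) * ?b (\<eta>, \<xi>1) \<xi>2) Sz"
      by (subst infsetsum_reindex) (auto simp: inj_on_def)
    also have "\<dots> = infsum (\<lambda>\<eta>. ?g (\<eta>, \<xi>1) * ?b (\<eta>, \<xi>1) \<xi>2) Sz"
      by (rule infsetsum_infsum[OF eta[OF that]])
    also have "\<dots> = K_per z \<tau> \<gamma> x \<xi>1 \<xi>2"
      unfolding K_per_def
    proof (rule infsum_cong)
      fix \<eta> assume "\<eta> \<in> Sz"
      have "exp (Phi \<tau> x \<xi>1 / 2 + Phi \<tau> x \<eta> + Phi \<tau> x \<xi>2 / 2 + of_real (\<gamma> / 4) * (\<xi>1\<^sup>2 - 2 * \<eta>\<^sup>2 + \<xi>2\<^sup>2)) =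
        exp (Phi \<tau> x \<xi>1 / 2 + of_real (\<gamma> / 4) * \<xi>1\<^sup>2) * exp (Phi \<tau> x \<eta> - of_real (\<gamma> / 2) * \<eta>\<^sup>2) *
        exp (Phi \<tau> x \<xi>2 / 2 + of_real (\<gamma> / 4) * \<xi>2\<^sup>2)"
        unfolding exp_add[symmetric] by (rule arg_cong[of _ _ exp]) (simp add: field_simps)
      then show "?g (\<eta>, \<xi>1) * ?b (\<eta>, \<xi>1) \<xi>2 =
        exp (Phi \<tau> x \<xi>1 / 2 + Phi \<tau> x \<eta> + Phi \<tau> x \<xi>2 / 2 + of_real (\<gamma> / 4) * (\<xi>1\<^sup>2 - 2 * \<eta>\<^sup>2 + \<xi>2\<^sup>2)) /
        (csqrt (- \<xi>1) * (- \<eta>) * (\<xi>1 + \<eta>) * (\<eta> + \<xi>2) * csqrt (- \<xi>2))"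
        unfolding per_p_def per_q_def by (simp only: fst_conv snd_conv times_divide_times_eq divide_divide_eq_left mult_ac)
    qed
    finally show ?thesis ..
  qed
  have BA: "(LINT s|count_space Sz. ?b y s * ?a s y') = per_c \<tau> \<gamma> x y' / (fst y + snd y')" if "y \<in> Sz \<times> Sz" "y' \<in> Sz \<times> Sz" for y y'
  proof -
    have "(LINT s|count_space Sz. ?b y s * ?a s y') = infsetsum (\<lambda>s. ?b y s * ?a s y') Sz" by (simp add: infsetsum_def)
    also have "\<dots> = infsetsum (\<lambda>s. ?b y s * ?a s y') {snd y'}"
      by (rule infsetsum_cong_neutral) (use that in auto)
    also have "\<dots> = ?b y (snd y') * ?g y'" by simp
    also have "\<dots> = per_c \<tau> \<gamma> x y' / (fst y + snd y')"
      unfolding per_c_def by (simp add: power2_eq_square add.commute mult_ac)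
    finally show ?thesis .
  qed
  have "(LINT p|PiM {..<n} (\<lambda>_. count_space Sz). mdet n (\<lambda>i j. K_per z \<tau> \<gamma> x (p i) (p j))) =
     (LINT q|PiM {..<n} (\<lambda>_. count_space (Sz \<times> Sz)). mdet n (\<lambda>i j. per_c \<tau> \<gamma> x (q j) / (fst (q i) + snd (q j))))" for n
  proof -
    have "(LINT p|PiM {..<n} (\<lambda>_. count_space Sz). mdet n (\<lambda>i j. K_per z \<tau> \<gamma> x (p i) (p j))) =
      (LINT p|PiM {..<n} (\<lambda>_. count_space Sz). mdet n (\<lambda>i j. LINT y|count_space (Sz \<times> Sz). ?a (p i) y * ?b y (p j)))"
      by (intro lint_cong det_mat_cong K) (auto simp: space_PiM PiE_iff)
    also have "\<dots> = (LINT q|PiM {..<n} (\<lambda>_. count_space (Sz \<times> Sz)). mdet n (\<lambda>i j. LINT s|count_space Sz. ?b (q i) s * ?a s (q j)))"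
    proof (rule fredholm_term_cyclic[OF sf, where \<beta> = "C2 / \<delta>"])
      have "Infinite_Set_Sum.abs_summable_on (\<lambda>x. case x of (s, y) \<Rightarrow> ?a s y) ((\<lambda>y. (snd y, y)) ` (Sz \<times> Sz))"
        by (rule Infinite_Set_Sum.abs_summable_on_reindex) (use g in simp)
      moreover have "Infinite_Set_Sum.abs_summable_on (\<lambda>x. case x of (s, y) \<Rightarrow> ?a s y) ((\<lambda>y. (snd y, y)) ` (Sz \<times> Sz)) \<longleftrightarrow>
          Infinite_Set_Sum.abs_summable_on (\<lambda>x. case x of (s, y) \<Rightarrow> ?a s y) (Sz \<times> (Sz \<times> Sz))"
        by (rule Infinite_Set_Sum.abs_summable_on_cong_neutral) (auto simp: image_iff)
      ultimately have "integrable (count_space (Sz \<times> (Sz \<times> Sz))) (\<lambda>(s, y). ?a s y)"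
        by (simp add: Infinite_Set_Sum.abs_summable_on_def)
      then show "integrable (count_space Sz \<Otimes>\<^sub>M count_space (Sz \<times> Sz)) (\<lambda>(s, y). ?a s y)"
        by (subst pair_measure_countable) (auto intro: countable_S)
      show "integrable (count_space (Sz \<times> Sz)) (?a s)" for s
        unfolding Infinite_Set_Sum.abs_summable_on_def[symmetric]
        by (rule Infinite_Set_Sum.abs_summable_on_comparison_test[OF g]) auto
      show "integrable (count_space Sz) (\<lambda>s. ?a s y)" for y
      proof -
        have "Infinite_Set_Sum.abs_summable_on (\<lambda>s. ?a s y) {snd y}" by simp
        moreover have "Infinite_Set_Sum.abs_summable_on (\<lambda>s. ?a s y) (Sz \<inter> {snd y}) \<longleftrightarrow> Infinite_Set_Sum.abs_summable_on (\<lambda>s. ?a s y) Sz"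
          by (rule Infinite_Set_Sum.abs_summable_on_cong_neutral) auto
        moreover have "Infinite_Set_Sum.abs_summable_on (\<lambda>s. ?a s y) (Sz \<inter> {snd y})" by simp
        ultimately show ?thesis by (simp add: Infinite_Set_Sum.abs_summable_on_def)
      qed
      show "(\<lambda>(y, s). ?b y s) \<in> borel_measurable (count_space (Sz \<times> Sz) \<Otimes>\<^sub>M count_space Sz)"
        by (subst pair_measure_countable) (auto intro: countable_S)
      show "norm (?b y s) \<le> C2 / \<delta>" if "y \<in> space (count_space (Sz \<times> Sz))" "s \<in> space (count_space Sz)" for y s
      proof -
        have "norm (?b y s) \<le> norm (?p s / of_real \<delta>)" using that by (intro div) auto
        also have "\<dots> \<le> C2 / \<delta>" using C2[of s] that \<delta>(1) by (simp add: norm_divide divide_right_mono)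
        finally show ?thesis .
      qed
    qed
    also have "\<dots> = (LINT q|PiM {..<n} (\<lambda>_. count_space (Sz \<times> Sz)). mdet n (\<lambda>i j. per_c \<tau> \<gamma> x (q j) / (fst (q i) + snd (q j))))"
    proof (rule lint_cong, rule det_mat_cong)
      fix q i j assume "q \<in> space (PiM {..<n} (\<lambda>_. count_space (Sz \<times> Sz)))" "i < n" "j < n"
      then have "q i \<in> Sz \<times> Sz" "q j \<in> Sz \<times> Sz" by (auto simp only: space_PiM PiE_iff space_count_space lessThan_iff)
      then show "(LINT s|count_space Sz. ?b (q i) s * ?a s (q j)) = per_c \<tau> \<gamma> x (q j) / (fst (q i) + snd (q j))" by (rule BA)
    qed
    finally show ?thesis .
  qed
  then show ?thesis unfolding D_per_def fredholm_det_def by simp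
qed

theorem per_gas_representation:
  assumes \<tau>0: "0 < \<tau>0"
  shows "\<exists>(M :: (complex \<times> complex) measure) c u v \<delta> r. kp_gas M c u v \<delta> r \<and>
      (\<forall>\<tau> \<gamma> x. \<bar>\<tau> - \<tau>0\<bar> < r / 2 \<and> \<bar>\<gamma> - \<gamma>0\<bar> < r / 2 \<and> \<bar>x - x0\<bar> < r / 2 \<longrightarrow>
        D_per z \<tau> \<gamma> x = kp_gas.F M c u v 0 0 0 (x - x0) (\<gamma> - \<gamma>0) (\<tau> - \<tau>0))"
proof -
  obtain \<delta> where g: "kp_gas (count_space (Sz \<times> Sz)) (per_c \<tau>0 \<gamma>0 x0) fst snd \<delta> (\<tau>0 / 12)"
    using kp_gas_per[OF \<tau>0] by blast
  interpret kp_gas "count_space (Sz \<times> Sz)" "per_c \<tau>0 \<gamma>0 x0" fst snd \<delta> "\<tau>0 / 12" by (rule g)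
  have "D_per z \<tau> \<gamma> x = F 0 0 0 (x - x0) (\<gamma> - \<gamma>0) (\<tau> - \<tau>0)" if "\<bar>\<tau> - \<tau>0\<bar> < \<tau>0 / 12 / 2" for \<tau> \<gamma> x
  proof -
    \<comment> \<open>The box has half width r / 2 = \<tau>0 / 24.\<close>
    have "0 < \<tau>" using that \<tau>0 by linarith
    have shift: "per_c \<tau> \<gamma> x = (\<lambda>y. per_c \<tau>0 \<gamma>0 x0 y * exp (of_real (x - x0) * kk y +
        of_real (\<gamma> - \<gamma>0) * ll y + of_real (\<tau> - \<tau>0) * ww y))"
      unfolding kk_def ll_def ww_def by (rule ext) (rule per_c_shift)
    show ?thesis unfolding D_per_eq_series[OF \<open>0 < \<tau>\<close>] F_eq_series shift by (rule refl)
  qed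
  then show ?thesis using g by blast
qed

end

section \<open>Airy functions on a vertical line\<close>

definition vline :: "real \<Rightarrow> real \<Rightarrow> complex" where "vline \<delta> y = Complex (- \<delta>) y"

definition airy_phase :: "real \<Rightarrow> real \<Rightarrow> complex \<Rightarrow> complex" where
  "airy_phase \<tau> \<gamma> u = - of_real (\<tau> / 3) * u ^ 3 + of_real (\<gamma> / 2) * u\<^sup>2"

lemma vline_simps [simp]: "Re (vline \<delta> y) = - \<delta>" "Im (vline \<delta> y) = y"
  by (simp_all add: vline_def)

lemma vline_eq: "vline \<delta> y = - of_real \<delta> + \<i> * of_real y"
  by (simp add: complex_eq_iff)

lemma continuous_on_vline: "continuous_on A (vline \<delta>)"
  unfolding vline_eq[abs_def] by (intro continuous_intros)

lemma measurable_vline [measurable]: "vline \<delta> \<in> borel_measurable borel"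
  by (intro borel_measurable_continuous_onI continuous_on_vline)

lemma Re_airy_phase:
  "Re (airy_phase \<tau> \<gamma> u) = - (\<tau> / 3) * (Re u ^ 3 - 3 * Re u * (Im u)\<^sup>2) + \<gamma> / 2 * ((Re u)\<^sup>2 - (Im u)\<^sup>2)"
  by (simp add: airy_phase_def power3_eq_cube power2_eq_square field_simps)

lemma Re_airy_phase_vline:
  "Re (airy_phase \<tau> \<gamma> (vline \<delta> y)) = \<tau> * \<delta> ^ 3 / 3 + \<gamma> * \<delta>\<^sup>2 / 2 - (\<tau> * \<delta> + \<gamma> / 2) * y\<^sup>2"
  unfolding Re_airy_phase by (simp add: power3_eq_cube power2_eq_square field_simps)

lemma integrable_gaussian:
  assumes m: "0 < (m::real)"
  shows "integrable lborel (\<lambda>y. exp (- m * y\<^sup>2))"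
proof -
  define \<sigma> where "\<sigma> = 1 / sqrt (2 * m)"
  have \<sigma>: "0 < \<sigma>" "2 * \<sigma>\<^sup>2 = 1 / m" using m by (simp_all add: \<sigma>_def power_divide)
  have "integrable lborel (\<lambda>y. sqrt (2 * pi * \<sigma>\<^sup>2) * normal_density 0 \<sigma> y)"
    by (intro integrable_mult_right integrable_normal_density \<sigma>(1))
  moreover have "sqrt (2 * pi * \<sigma>\<^sup>2) * normal_density 0 \<sigma> y = exp (- m * y\<^sup>2)" for y
  proof -
    have "y\<^sup>2 / (2 * \<sigma>\<^sup>2) = m * y\<^sup>2" unfolding \<sigma>(2) by simp
    then show ?thesis using \<sigma>(1) by (simp add: normal_density_def)
  qed
  ultimately show ?thesis by simp
qed

lemma continuous_on_airy_line:
  "continuous_on A (\<lambda>y. exp (airy_phase \<tau> \<gamma> (vline \<delta> y) + of_real s * vline \<delta> y))"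
  unfolding airy_phase_def by (intro continuous_intros continuous_on_vline)

lemma integrable_airy_line:
  assumes "0 < \<tau> * \<delta> + \<gamma> / 2"
  shows "integrable lborel (\<lambda>y. exp (airy_phase \<tau> \<gamma> (vline \<delta> y) + of_real s * vline \<delta> y))"
proof (rule lint_bound)
  show "integrable lborel (\<lambda>y. exp (\<tau> * \<delta> ^ 3 / 3 + \<gamma> * \<delta>\<^sup>2 / 2 - s * \<delta>) * exp (- (\<tau> * \<delta> + \<gamma> / 2) * y\<^sup>2))"
    by (intro integrable_mult_right integrable_gaussian assms)
  show "(\<lambda>y. exp (airy_phase \<tau> \<gamma> (vline \<delta> y) + of_real s * vline \<delta> y)) \<in> borel_measurable lborel"
    using borel_measurable_continuous_onI[OF continuous_on_airy_line] by simp
  show "AE y in lborel. norm (exp (airy_phase \<tau> \<gamma> (vline \<delta> y) + of_real s * vline \<delta> y))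
      \<le> norm (exp (\<tau> * \<delta> ^ 3 / 3 + \<gamma> * \<delta>\<^sup>2 / 2 - s * \<delta>) * exp (- (\<tau> * \<delta> + \<gamma> / 2) * y\<^sup>2))"
    by (intro AE_I2) (simp add: Re_airy_phase_vline exp_add[symmetric] algebra_simps)
qed

text \<open>With an entire primitive, deforming the contour reduces to comparing values of the
  primitive at end points.\<close>

lemma airy_primitive:
  "\<exists>P. \<forall>u. (P has_field_derivative exp (airy_phase \<tau> \<gamma> u + of_real s * u)) (at u)"
proof -
  have "(\<lambda>u. exp (airy_phase \<tau> \<gamma> u + of_real s * u)) holomorphic_on UNIV"
    unfolding airy_phase_def by (intro holomorphic_intros)
  from convex_UNIV open_UNIV this
  show ?thesis by (rule holomorphic_convex_primitive') auto
qed

text \<open>On the segment at height \<sigma> Y between the ray and the vertical line, a = - Re u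
  lies between \<delta> and c Y, so Re (u^3) = a (3 Y^2 - a^2) \<ge> \<delta> \<kappa> Y^2. The
  hypothesis on \<gamma> lets this outweigh the quadratic term of the phase.\<close>

lemma airy_horizontal_tendsto_0:
  assumes P: "\<And>u. (P has_field_derivative exp (airy_phase \<tau> \<gamma> u + of_real s * u)) (at u)"
    and c: "0 < c" "c\<^sup>2 \<le> 3 - \<kappa>" and k: "0 < \<kappa>" and \<sigma>: "\<bar>\<sigma>\<bar> = 1" and \<tau>: "0 < \<tau>" "0 < \<delta>" "6 * \<bar>\<gamma>\<bar> < \<tau> * \<kappa> * \<delta>"
  shows "((\<lambda>Y. P (Complex (- c * Y) (\<sigma> * Y)) - P (Complex (- \<delta>) (\<sigma> * Y))) \<longlongrightarrow> 0) at_top"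
proof (rule Lim_null_comparison)
  define e where "e = \<tau> * \<kappa> * \<delta> / 3 - 2 * \<bar>\<gamma>\<bar>"
  have e: "0 < e" using \<tau> by (simp add: e_def)
  have c3: "c\<^sup>2 \<le> 3" using c k by linarith
  have c2: "c \<le> 2" using c3 power2_le_imp_le[of c 2] by simp
  show "((\<lambda>Y. exp (- e * Y\<^sup>2 + 2 * \<bar>s\<bar> * Y) * (2 * Y)) \<longlongrightarrow> 0) at_top"
    using e by real_asymp
  show "\<forall>\<^sub>F Y in at_top. norm (P (Complex (- c * Y) (\<sigma> * Y)) - P (Complex (- \<delta>) (\<sigma> * Y))) \<le> exp (- e * Y\<^sup>2 + 2 * \<bar>s\<bar> * Y) * (2 * Y)"
    using eventually_ge_at_top[of "\<delta> / c"] eventually_gt_at_top[of 0]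
  proof eventually_elim
    case (elim Y)
    have dY: "\<delta> \<le> c * Y" using elim(1) c by (simp add: field_simps)
    let ?S = "closed_segment (Complex (- c * Y) (\<sigma> * Y)) (Complex (- \<delta>) (\<sigma> * Y))"
    have n: "norm (P (Complex (- c * Y) (\<sigma> * Y)) - P (Complex (- \<delta>) (\<sigma> * Y))) \<le>
      exp (- e * Y\<^sup>2 + 2 * \<bar>s\<bar> * Y) * norm (Complex (- c * Y) (\<sigma> * Y) - Complex (- \<delta>) (\<sigma> * Y))"
    proof (rule field_differentiable_bound[of ?S])
      show "(P has_field_derivative exp (airy_phase \<tau> \<gamma> u + of_real s * u)) (at u within ?S)" for u
        using P by (rule has_field_derivative_at_within)
      fix u assume "u \<in> ?S"
      then obtain t where t: "0 \<le> t" "t \<le> 1" and u: "u = (1 - t) *\<^sub>R Complex (- c * Y) (\<sigma> * Y) + t *\<^sub>R Complex (- \<delta>) (\<sigma> * Y)"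
        by (auto simp: in_segment)
      define a where "a = - Re u"
      have Im: "Im u = \<sigma> * Y" by (simp add: u algebra_simps)
      have a: "a = (1 - t) * (c * Y) + t * \<delta>" by (simp add: a_def u algebra_simps)
      have "(1 - t) * \<delta> \<le> (1 - t) * (c * Y)" using dY t by (intro mult_left_mono) auto
      then have a1: "\<delta> \<le> a" unfolding a by (simp add: algebra_simps)
      have "t * \<delta> \<le> t * (c * Y)" using dY t by (intro mult_left_mono) auto
      then have a2: "a \<le> c * Y" unfolding a by (simp add: algebra_simps)
      have \<sigma>2: "\<sigma>\<^sup>2 = 1" using \<sigma> by (simp add: power2_eq_1_iff abs_if split: if_splits)
      have aa: "a\<^sup>2 \<le> (3 - \<kappa>) * Y\<^sup>2"
      proof -
        have "a\<^sup>2 \<le> (c * Y)\<^sup>2" using a1 a2 \<tau> by (intro power_mono) auto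
        also have "\<dots> \<le> (3 - \<kappa>) * Y\<^sup>2" using c by (simp add: power_mult_distrib mult_right_mono)
        finally show ?thesis .
      qed
      have "Re (airy_phase \<tau> \<gamma> u + of_real s * u) = - (\<tau> / 3) * (a * (3 * Y\<^sup>2 - a\<^sup>2)) + \<gamma> / 2 * (a\<^sup>2 - Y\<^sup>2) - s * a"
        using \<sigma>2 unfolding plus_complex.sel Re_airy_phase Im
        by (simp add: a_def power_mult_distrib power3_eq_cube power2_eq_square algebra_simps)
      also have "\<dots> \<le> - (\<tau> / 3) * (\<delta> * (\<kappa> * Y\<^sup>2)) + 2 * \<bar>\<gamma>\<bar> * Y\<^sup>2 + 2 * \<bar>s\<bar> * Y"
      proof -
        have "\<delta> * (\<kappa> * Y\<^sup>2) \<le> a * (3 * Y\<^sup>2 - a\<^sup>2)"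
          using a1 aa k \<tau> by (intro mult_mono) (auto simp: algebra_simps)
        then have "- (\<tau> / 3) * (a * (3 * Y\<^sup>2 - a\<^sup>2)) \<le> - (\<tau> / 3) * (\<delta> * (\<kappa> * Y\<^sup>2))"
          using \<tau> by (intro mult_left_mono_neg) auto
        moreover have "\<gamma> / 2 * (a\<^sup>2 - Y\<^sup>2) \<le> 2 * \<bar>\<gamma>\<bar> * Y\<^sup>2"
        proof -
          have "(3 - \<kappa>) * Y\<^sup>2 \<le> 3 * Y\<^sup>2" using k by (intro mult_right_mono) auto
          then have "\<bar>a\<^sup>2 - Y\<^sup>2\<bar> \<le> 4 * Y\<^sup>2" using aa zero_le_power2[of a] zero_le_power2[of Y] by linarith
          then have "\<bar>\<gamma> / 2\<bar> * \<bar>a\<^sup>2 - Y\<^sup>2\<bar> \<le> \<bar>\<gamma> / 2\<bar> * (4 * Y\<^sup>2)" by (intro mult_left_mono) auto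
          then show ?thesis using abs_ge_self[of "\<gamma> / 2 * (a\<^sup>2 - Y\<^sup>2)"] by (simp add: abs_mult)
        qed
        moreover have "- s * a \<le> 2 * \<bar>s\<bar> * Y"
        proof -
          have "c * Y \<le> 2 * Y" using c2 elim(2) by (intro mult_right_mono) auto
          then have "\<bar>s\<bar> * a \<le> \<bar>s\<bar> * (2 * Y)" using a2 by (intro mult_left_mono) auto
          moreover have "- s * a \<le> \<bar>s\<bar> * a" using a1 \<tau> by (intro mult_right_mono) auto
          ultimately show ?thesis by simp
        qed
        ultimately show ?thesis by linarith
      qed
      also have "\<dots> = - e * Y\<^sup>2 + 2 * \<bar>s\<bar> * Y" by (simp add: e_def algebra_simps)
      finally show "norm (exp (airy_phase \<tau> \<gamma> u + of_real s * u)) \<le> exp (- e * Y\<^sup>2 + 2 * \<bar>s\<bar> * Y)"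
        unfolding norm_exp_eq_Re by simp
    qed auto
    have "Complex (- c * Y) (\<sigma> * Y) - Complex (- \<delta>) (\<sigma> * Y) = of_real (\<delta> - c * Y)" by (simp add: complex_eq_iff)
    then have "norm (Complex (- c * Y) (\<sigma> * Y) - Complex (- \<delta>) (\<sigma> * Y)) = c * Y - \<delta>" using dY by (simp only: norm_of_real abs_of_nonpos diff_le_0_iff_le minus_diff_eq)
    also have "\<dots> \<le> 2 * Y" using c2 elim(2) \<tau> mult_right_mono[OF c2, of Y] by linarith
    finally show ?case using n by (meson exp_ge_zero mult_left_mono order_trans)
  qed
qed

text \<open>The ratio - cos \<theta> / sin \<theta> is |Re u| / |Im u| along the ray; the angle 5 pi
  / 6 corresponds to the ratio sqrt 3, at which Re (u^3) would vanish.\<close>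

lemma cis_as_cot:
  assumes "\<theta> \<in> {pi/2<..<5*pi/6}"
  shows "0 < sin \<theta>" "0 < - cos \<theta> / sin \<theta>" "(- cos \<theta> / sin \<theta>)\<^sup>2 < 3"
    "of_real R * cis \<theta> = Complex (- (- cos \<theta> / sin \<theta>) * (R * sin \<theta>)) (1 * (R * sin \<theta>))"
    "of_real R * cis (- \<theta>) = Complex (- (- cos \<theta> / sin \<theta>) * (R * sin \<theta>)) (- 1 * (R * sin \<theta>))"
proof -
  have t: "0 < \<theta>" "\<theta> < pi" using assms pi_gt_zero by auto
  show s: "0 < sin \<theta>" using t by (rule sin_gt_zero)
  have "cos \<theta> < cos (pi / 2)" using assms pi_gt_zero by (intro cos_monotone_0_pi) auto
  then have cneg: "cos \<theta> < 0" by simp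
  then show "0 < - cos \<theta> / sin \<theta>" using s by (simp add: divide_neg_pos)
  have "cos (5 * pi / 6) < cos \<theta>" using assms pi_gt_zero by (intro cos_monotone_0_pi) auto
  moreover have "cos (5 * pi / 6) = - (sqrt 3 / 2)"
  proof -
    have "cos (pi - pi / 6) = - cos (pi / 6)" by (rule cos_pi_minus)
    moreover have "pi - pi / 6 = 5 * pi / 6" by simp
    ultimately show ?thesis by (simp add: cos_30)
  qed
  ultimately have "- cos \<theta> < sqrt 3 / 2" by simp
  then have "(- cos \<theta>)\<^sup>2 < (sqrt 3 / 2)\<^sup>2" using cneg by (intro power_strict_mono) auto
  then have c2: "(cos \<theta>)\<^sup>2 < 3 / 4" by (simp add: power_divide)
  have "(- cos \<theta> / sin \<theta>)\<^sup>2 = (cos \<theta>)\<^sup>2 / (sin \<theta>)\<^sup>2" by (simp add: power_divide)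
  also have "\<dots> < 3" using c2 s by (simp add: divide_less_eq sin_squared_eq)
  finally show "(- cos \<theta> / sin \<theta>)\<^sup>2 < 3" .
  show "of_real R * cis \<theta> = Complex (- (- cos \<theta> / sin \<theta>) * (R * sin \<theta>)) (1 * (R * sin \<theta>))"
    "of_real R * cis (- \<theta>) = Complex (- (- cos \<theta> / sin \<theta>) * (R * sin \<theta>)) (- 1 * (R * sin \<theta>))"
    using s by (simp_all add: complex_eq_iff)
qed

text \<open>
  The two rays of the contour may be deformed into a vertical line, on which the integrand has
  Gaussian decay; \<open>\<delta>\<close> has to be large enough to control the quadratic term.
\<close>

theorem Airy_gamma_vline:
  assumes \<theta>: "\<theta>1 \<in> {pi/2<..<5*pi/6}" "\<theta>2 \<in> {pi/2<..<5*pi/6}"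
  shows "\<exists>\<kappa>>0. \<kappa> \<le> 3 \<and> (\<forall>\<tau> \<gamma> \<delta> s. 0 < \<tau> \<longrightarrow> 0 < \<delta> \<longrightarrow> 6 * \<bar>\<gamma>\<bar> < \<tau> * \<kappa> * \<delta> \<longrightarrow>
     Airy_gamma \<theta>1 \<theta>2 \<tau> \<gamma> s = of_real (1 / (2 * pi)) * (LINT y|lborel. exp (airy_phase \<tau> \<gamma> (vline \<delta> y) + of_real s * vline \<delta> y)))"
proof -
  define c1 where "c1 = - cos \<theta>1 / sin \<theta>1"
  define c2 where "c2 = - cos \<theta>2 / sin \<theta>2"
  \<comment> \<open>\<kappa> measures how far the steeper of the two conditions c^2 < 3 is from
    failing. It depends only on the angles, so one value serves all parameters.\<close>
  define \<kappa> where "\<kappa> = min (3 - c1\<^sup>2) (3 - c2\<^sup>2)"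
  have c: "0 < c1" "0 < c2" "c1\<^sup>2 \<le> 3 - \<kappa>" "c2\<^sup>2 \<le> 3 - \<kappa>" "0 < \<kappa>" "\<kappa> \<le> 3"
    using cis_as_cot(2,3)[OF \<theta>(1)] cis_as_cot(2,3)[OF \<theta>(2)] unfolding c1_def[symmetric] c2_def[symmetric]
    by (auto simp: \<kappa>_def min_def)
  have "Airy_gamma \<theta>1 \<theta>2 \<tau> \<gamma> s = of_real (1 / (2 * pi)) * (LINT y|lborel. exp (airy_phase \<tau> \<gamma> (vline \<delta> y) + of_real s * vline \<delta> y))"
    if \<tau>: "0 < \<tau>" "0 < \<delta>" "6 * \<bar>\<gamma>\<bar> < \<tau> * \<kappa> * \<delta>" for \<tau> \<gamma> \<delta> s
  proof -
    let ?f = "\<lambda>u. exp (airy_phase \<tau> \<gamma> u + of_real s * u)"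
    obtain P where P: "\<And>u. (P has_field_derivative ?f u) (at u)" using airy_primitive[of \<tau> \<gamma> s] by auto
    let ?I = "LINT y|lborel. ?f (vline \<delta> y)"
    have "\<tau> * \<kappa> * \<delta> \<le> \<tau> * 3 * \<delta>" using c \<tau> by (intro mult_right_mono mult_left_mono) auto
    then have m: "0 < \<tau> * \<delta> + \<gamma> / 2" using \<tau>(3) abs_ge_minus_self[of \<gamma>] by linarith
    have path: "contour_integral (linepath (of_real R * cis (- \<theta>1)) 0 +++ linepath 0 (of_real R * cis \<theta>2)) ?f =
       P (of_real R * cis \<theta>2) - P (of_real R * cis (- \<theta>1))" for R
    proof -
      have "(?f has_contour_integral (P (pathfinish (linepath (of_real R * cis (- \<theta>1)) 0 +++ linepath 0 (of_real R * cis \<theta>2))) -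
          P (pathstart (linepath (of_real R * cis (- \<theta>1)) 0 +++ linepath 0 (of_real R * cis \<theta>2)))))
          (linepath (of_real R * cis (- \<theta>1)) 0 +++ linepath 0 (of_real R * cis \<theta>2))"
        by (rule contour_integral_primitive[of UNIV]) (auto intro!: valid_path_join P)
      then show ?thesis by (simp add: contour_integral_unique)
    qed
    have tend: "filterlim (\<lambda>R. R * sin \<theta>) at_top at_top" if "0 < sin \<theta>" for \<theta> :: real
      using that by (intro filterlim_at_top_mult_tendsto_pos[OF tendsto_const _ filterlim_ident]) 
    note t1 = tend[OF cis_as_cot(1)[OF \<theta>(1)]] and t2 = tend[OF cis_as_cot(1)[OF \<theta>(2)]]
    have up: "((\<lambda>R. P (of_real R * cis \<theta>2) - P (Complex (- \<delta>) (1 * (R * sin \<theta>2)))) \<longlongrightarrow> 0) at_top"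
      unfolding cis_as_cot(4)[OF \<theta>(2)] c2_def[symmetric]
      by (rule filterlim_compose[OF airy_horizontal_tendsto_0[OF P c(2,4,5) _ \<tau>, of 1] t2]) simp
    have lo: "((\<lambda>R. P (of_real R * cis (- \<theta>1)) - P (Complex (- \<delta>) (- 1 * (R * sin \<theta>1)))) \<longlongrightarrow> 0) at_top"
      unfolding cis_as_cot(5)[OF \<theta>(1)] c1_def[symmetric]
      by (rule filterlim_compose[OF airy_horizontal_tendsto_0[OF P c(1,3,5) _ \<tau>, of "- 1"] t1]) simp
    have mid: "((\<lambda>R. P (Complex (- \<delta>) (1 * (R * sin \<theta>2))) - P (Complex (- \<delta>) (- 1 * (R * sin \<theta>1)))) \<longlongrightarrow> \<i> * ?I) at_top"
    proof -
      let ?A = "\<lambda>R. {- 1 * (R * sin \<theta>1)..1 * (R * sin \<theta>2)}"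
      have "((\<lambda>R. LINT y|lborel. indicator (?A R) y *\<^sub>R ?f (vline \<delta> y)) \<longlongrightarrow> ?I) at_top"
      proof (rule integral_dominated_convergence_at_top)
        show "(\<lambda>y. ?f (vline \<delta> y)) \<in> borel_measurable lborel" "\<And>R. (\<lambda>y. indicator (?A R) y *\<^sub>R ?f (vline \<delta> y)) \<in> borel_measurable lborel"
          using borel_measurable_continuous_onI[OF continuous_on_airy_line] by auto
        show "integrable lborel (\<lambda>y. norm (?f (vline \<delta> y)))" by (intro integrable_norm integrable_airy_line m)
        show "\<forall>\<^sub>F R in at_top. AE y in lborel. norm (indicator (?A R) y *\<^sub>R ?f (vline \<delta> y)) \<le> norm (?f (vline \<delta> y))"
          by (intro always_eventually allI AE_I2) (auto simp: indicator_def)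
        show "AE y in lborel. ((\<lambda>R. indicator (?A R) y *\<^sub>R ?f (vline \<delta> y)) \<longlongrightarrow> ?f (vline \<delta> y)) at_top"
        proof (rule AE_I2)
          fix y :: real
          have "\<forall>\<^sub>F R in at_top. - y \<le> R * sin \<theta>1" "\<forall>\<^sub>F R in at_top. y \<le> R * sin \<theta>2"
            using t1 t2 unfolding filterlim_at_top by blast+
          then have "\<forall>\<^sub>F R in at_top. indicator (?A R) y *\<^sub>R ?f (vline \<delta> y) = ?f (vline \<delta> y)"
            proof eventually_elim
            case (elim R)
            then have "y \<in> ?A R" by simp
            then show ?case by (simp only: indicator_simps(1) scaleR_one)
          qed
          then show "((\<lambda>R. indicator (?A R) y *\<^sub>R ?f (vline \<delta> y)) \<longlongrightarrow> ?f (vline \<delta> y)) at_top"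
            by (rule tendsto_eventually)
        qed
      qed
      then have "((\<lambda>R. \<i> * (LINT y|lborel. indicator (?A R) y *\<^sub>R ?f (vline \<delta> y))) \<longlongrightarrow> \<i> * ?I) at_top"
        by (intro tendsto_intros)
      then show ?thesis
      proof (rule Lim_transform_eventually, goal_cases)
        case 1
        show ?case using eventually_gt_at_top[of 0]
        proof eventually_elim
          case (elim R)
          let ?a = "- 1 * (R * sin \<theta>1)" and ?b = "1 * (R * sin \<theta>2)"
          have "0 \<le> R * sin \<theta>1" "0 \<le> R * sin \<theta>2" using elim cis_as_cot(1)[OF \<theta>(1)] cis_as_cot(1)[OF \<theta>(2)] by simp_all
          then have ab: "?a \<le> ?b" by linarith
          have "((\<lambda>y. P (vline \<delta> y)) has_vector_derivative \<i> * ?f (vline \<delta> y)) (at y within {?a..?b})" for y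
          proof -
            have "(vline \<delta> has_vector_derivative \<i>) (at y within {?a..?b})"
              unfolding vline_eq[abs_def] by (auto intro!: derivative_eq_intros)
            from field_vector_diff_chain_within[OF this has_field_derivative_at_within[OF P]]
            show ?thesis by (simp add: o_def)
          qed
          then have "((\<lambda>y. \<i> * ?f (vline \<delta> y)) has_integral P (vline \<delta> ?b) - P (vline \<delta> ?a)) {?a..?b}"
            by (intro fundamental_theorem_of_calculus ab)
          then have "integral {?a..?b} (\<lambda>y. \<i> * ?f (vline \<delta> y)) = P (vline \<delta> ?b) - P (vline \<delta> ?a)"
            by (rule integral_unique)
          moreover have "set_integrable lborel {?a..?b} (\<lambda>y. \<i> * ?f (vline \<delta> y))"
            unfolding set_integrable_def
            by (intro integrable_mult_indicator integrable_mult_right integrable_airy_line m) simp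
          then have "(LINT y:{?a..?b}|lborel. \<i> * ?f (vline \<delta> y)) = integral {?a..?b} (\<lambda>y. \<i> * ?f (vline \<delta> y))"
            by (rule set_borel_integral_eq_integral(2))
          moreover have "(LINT y:{?a..?b}|lborel. \<i> * ?f (vline \<delta> y)) = \<i> * (LINT y|lborel. indicator (?A R) y *\<^sub>R ?f (vline \<delta> y))"
            unfolding set_lebesgue_integral_def mult_scaleR_right[symmetric] by (rule lint_cmult)
          ultimately show ?case by (simp only: vline_def)
        qed
      qed
    qed
    have "((\<lambda>R. P (of_real R * cis \<theta>2) - P (of_real R * cis (- \<theta>1))) \<longlongrightarrow> \<i> * ?I) at_top"
      using tendsto_add[OF tendsto_diff[OF up lo] mid] by simp
    then have "Lim at_top (\<lambda>R. contour_integral (linepath (of_real R * cis (- \<theta>1)) 0 +++ linepath 0 (of_real R * cis \<theta>2)) ?f) = \<i> * ?I"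
      unfolding path by (intro tendsto_Lim) auto
    then show ?thesis unfolding Airy_gamma_def airy_phase_def by (simp add: field_simps)
  qed
  then show ?thesis using c(5,6) by (intro exI[of _ \<kappa>]) blast
qed

section \<open>The KPZ determinant\<close>

lemma integrable_pair_mult:
  fixes f :: "'a \<Rightarrow> 'c::{real_normed_field, banach, second_countable_topology}"
  assumes M: "sigma_finite_measure M1" "sigma_finite_measure M2"
    and f: "integrable M1 f" and g: "integrable M2 g"
  shows "integrable (M1 \<Otimes>\<^sub>M M2) (\<lambda>p. f (fst p) * g (snd p))"
    and "(LINT p|(M1 \<Otimes>\<^sub>M M2). f (fst p) * g (snd p)) = (LINT x|M1. f x) * (LINT y|M2. g y)"
proof -
  interpret M1: sigma_finite_measure M1 by fact
  interpret M2: sigma_finite_measure M2 by fact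
  interpret pair_sigma_finite M1 M2 ..
  have [measurable]: "f \<in> borel_measurable M1" "g \<in> borel_measurable M2" using f g by auto
  show i: "integrable (M1 \<Otimes>\<^sub>M M2) (\<lambda>p. f (fst p) * g (snd p))"
  proof (rule Fubini_integrable)
    show "(\<lambda>p. f (fst p) * g (snd p)) \<in> borel_measurable (M1 \<Otimes>\<^sub>M M2)" by measurable
    show "integrable M1 (\<lambda>x. LINT y|M2. norm (f (fst (x, y)) * g (snd (x, y))))"
      using f by (simp add: norm_mult)
    show "AE x in M1. integrable M2 (\<lambda>y. f (fst (x, y)) * g (snd (x, y)))"
      using g by simp
  qed
  show "(LINT p|(M1 \<Otimes>\<^sub>M M2). f (fst p) * g (snd p)) = (LINT x|M1. f x) * (LINT y|M2. g y)"
    using integral_fst'[OF i] by simp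
qed

lemma sigma_finite_pos_half_line: "sigma_finite_measure pos_half_line"
  by (rule sigma_finite_measure_restrict_space) (auto intro: sigma_finite_lborel)

lemma space_pos_half_line [simp]: "space pos_half_line = {0<..}"
  by (simp add: space_restrict_space)

lemma measurable_pos_half_line: "f \<in> borel_measurable borel \<Longrightarrow> f \<in> borel_measurable pos_half_line"
  by (rule measurable_restrict_space1) simp

lemma measurable_pos_half_line_id:
  "(\<lambda>x. x) \<in> borel_measurable pos_half_line"
  "fst \<in> borel_measurable (pos_half_line \<Otimes>\<^sub>M M)" "snd \<in> borel_measurable (M \<Otimes>\<^sub>M pos_half_line)"
proof -
  show i: "(\<lambda>x. x) \<in> borel_measurable pos_half_line" by (rule measurable_pos_half_line) simp
  show "fst \<in> borel_measurable (pos_half_line \<Otimes>\<^sub>M M)" "snd \<in> borel_measurable (M \<Otimes>\<^sub>M pos_half_line)"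
    using measurable_compose[OF measurable_fst i] measurable_compose[OF measurable_snd i] by auto
qed

lemma integrable_exp_pos_half_line:
  assumes "Re c < 0"
  shows "integrable pos_half_line (\<lambda>r. exp (of_real r * c))"
proof -
  define d where "d = - Re c"
  have d: "0 < d" using assms by (simp add: d_def)
  have r: "set_integrable lborel (einterval 0 \<infinity>) (\<lambda>r. exp (- d * r))"
  proof (rule interval_integral_FTC_nonneg(1)[where F = "\<lambda>r. - exp (- d * r) / d" and A = "- 1 / d" and B = 0])
    show "DERIV (\<lambda>r. - exp (- d * r) / d) x :> exp (- d * x)" for x
      using d by (auto intro!: derivative_eq_intros)
    have "((\<lambda>r. - exp (- d * r) / d) \<longlongrightarrow> - exp (- d * 0) / d) (at_right 0)"
      by (intro tendsto_intros) (use d in auto)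
    then show "(((\<lambda>r. - exp (- d * r) / d) \<circ> real_of_ereal) \<longlongrightarrow> - 1 / d) (at_right 0)"
      by (simp add: zero_ereal_def ereal_tendsto_simps1)
    show "(((\<lambda>r. - exp (- d * r) / d) \<circ> real_of_ereal) \<longlongrightarrow> 0) (at_left \<infinity>)"
      unfolding ereal_tendsto_simps1 using d by real_asymp
  qed auto
  have e: "einterval 0 \<infinity> = {0<..}" by (auto simp: einterval_def zero_ereal_def)
  have "integrable pos_half_line (\<lambda>r. exp (- d * r))"
    using r unfolding e set_integrable_def by (subst integrable_restrict_space) auto
  then show ?thesis
    by (rule lint_bound) (auto simp: d_def mult.commute intro!: measurable_pos_half_line)
qed

lemma integral_exp_pos_half_line:
  assumes c: "Re c < 0"
  shows "(LINT r|pos_half_line. exp (of_real r * c)) = - 1 / c"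
proof -
  have c0: "c \<noteq> 0" using c by auto
  have e: "einterval 0 \<infinity> = {0<..}" by (auto simp: einterval_def zero_ereal_def)
  have i: "set_integrable lborel (einterval 0 \<infinity>) (\<lambda>r. exp (of_real r * c))"
    using integrable_exp_pos_half_line[OF c] unfolding e set_integrable_def by (subst (asm) integrable_restrict_space) auto
  have "(LBINT r=0..\<infinity>. exp (of_real r * c)) = 0 - 1 / c"
  proof (rule interval_integral_FTC_integrable[where F = "\<lambda>r. exp (of_real r * c) / c"])
    show "((\<lambda>r. exp (of_real r * c) / c) has_vector_derivative exp (of_real x * c)) (at x)" for x
    proof -
      have "((\<lambda>r. of_real r * c) has_vector_derivative c) (at x)" by (auto intro!: derivative_eq_intros)
      from field_vector_diff_chain_at[OF this DERIV_exp]
      have "((\<lambda>r. exp (of_real r * c)) has_vector_derivative c * exp (of_real x * c)) (at x)" by (simp add: o_def)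
      from has_vector_derivative_divide[OF this, of c] show ?thesis using c0 by simp
    qed
    have "((\<lambda>r. exp (of_real r * c) / c) \<longlongrightarrow> exp (of_real 0 * c) / c) (at_right 0)"
      by (intro tendsto_intros) (use c0 in auto)
    then show "(((\<lambda>r. exp (of_real r * c) / c) \<circ> real_of_ereal) \<longlongrightarrow> 1 / c) (at_right 0)"
      by (simp add: zero_ereal_def ereal_tendsto_simps1)
    show "(((\<lambda>r. exp (of_real r * c) / c) \<circ> real_of_ereal) \<longlongrightarrow> 0) (at_left \<infinity>)"
      unfolding ereal_tendsto_simps1
    proof (rule tendsto_norm_zero_cancel)
      have "((\<lambda>r. exp (r * Re c) / norm c) \<longlongrightarrow> 0) at_top" using c c0 by real_asymp
      then show "((\<lambda>r. norm (exp (of_real r * c) / c)) \<longlongrightarrow> 0) at_top" by (simp add: norm_divide)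
    qed
  qed (use i in \<open>auto intro!: continuous_intros\<close>)
  then show ?thesis
    unfolding interval_lebesgue_integral_def e set_lebesgue_integral_def
    by (subst integral_restrict_space) auto
qed

text \<open>
  A product of two Laplace-type transforms on the half line is, through the cyclic symmetry of
  the Fredholm series, a soliton gas.
\<close>

theorem fredholm_det_laplace_product:
  fixes g h :: "real \<Rightarrow> complex"
  assumes \<delta>: "0 < \<delta>" and g: "integrable lborel g" and h: "integrable lborel h"
    and A: "\<And>s. A s = (LINT y|lborel. g y * exp (of_real s * vline \<delta> y))"
    and B: "\<And>s. B s = (LINT y|lborel. h y * exp (of_real s * vline \<delta> y))"
  shows "fredholm_det pos_half_line (\<lambda>s t. LINT r|pos_half_line. A (s + r) * B (r + t)) =
    (\<Sum>n. (-1) ^ n / fact n * (LINT q|PiM {..<n} (\<lambda>_. lborel \<Otimes>\<^sub>M lborel).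
     Determinant.det (Matrix.mat n n (\<lambda>(i, j).
       g (fst (q j)) * h (snd (q j)) / (vline \<delta> (fst (q j)) + vline \<delta> (snd (q j))) /
        (vline \<delta> (fst (q i)) + vline \<delta> (snd (q j)))))))"
proof -
  let ?Y = "lborel \<Otimes>\<^sub>M lborel :: (real \<times> real) measure" and ?S = "pos_half_line"
  let ?u = "\<lambda>y. vline \<delta> (fst y)" and ?v = "\<lambda>y. vline \<delta> (snd y)"
  define G where "G = (\<lambda>y::real\<times>real. g (fst y) * h (snd y))"
  define c where "c = (\<lambda>y. G y / (?u y + ?v y))"
  \<comment> \<open>The minus sign comes from - 1 / (u + v), the integral over r of the exponential;
    the integral over s in \<open>BA\<close> brings a second one.\<close>
  define a where "a = (\<lambda>s y. - c y * exp (of_real s * ?u y))"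
  define b where "b = (\<lambda>(y :: real \<times> real) t. exp (of_real t * ?v y))"
  note measurable_pos_half_line_id [measurable]
  interpret S: sigma_finite_measure ?S by (rule sigma_finite_pos_half_line)
  interpret Y: sigma_finite_measure ?Y by (rule sigma_finite_pair_measure[OF sigma_finite_lborel sigma_finite_lborel])
  interpret SY: pair_sigma_finite ?S ?Y ..
  have [measurable]: "g \<in> borel_measurable borel" "h \<in> borel_measurable borel" using g h by auto
  have Gm [measurable]: "G \<in> borel_measurable ?Y" unfolding G_def by measurable
  have um [measurable]: "?u \<in> borel_measurable ?Y" "?v \<in> borel_measurable ?Y" by measurable
  have cm [measurable]: "c \<in> borel_measurable ?Y" unfolding c_def by measurable
  have Gi: "integrable ?Y G" unfolding G_def
    by (rule integrable_pair_mult(1)[OF sigma_finite_lborel sigma_finite_lborel g h])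
  have uv: "2 * \<delta> \<le> norm (vline \<delta> y + vline \<delta> y')" for y y'
    using abs_Re_le_cmod[of "vline \<delta> y + vline \<delta> y'"] by simp
  have uv0: "vline \<delta> y + vline \<delta> y' \<noteq> 0" for y y' using uv[of y y'] \<delta> by auto
  have cb: "norm (c y) \<le> norm (G y / of_real (2 * \<delta>))" for y
    unfolding c_def norm_divide norm_of_real using uv[of "fst y" "snd y"] uv0[of "fst y" "snd y"] \<delta> by (intro divide_left_mono) auto
  have ci: "integrable ?Y c"
    by (rule lint_bound[OF integrable_divide_zero[OF Gi, of "of_real (2 * \<delta>)"]]) (use cb in auto)
  have ex: "integrable ?S (\<lambda>s. exp (of_real s * vline \<delta> y))" for y
    by (rule integrable_exp_pos_half_line) (simp add: \<delta>)
  have ek: "integrable ?S (\<lambda>s. exp (- of_real s * of_real k :: complex))" if "0 < k" for k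
    using integrable_exp_pos_half_line[of "- of_real k"] that by simp
  have K: "(LINT r|?S. A (s + r) * B (r + t)) = (LINT y|?Y. a s y * b y t)" if st: "0 < s" "0 < t" for s t
  proof -
    let ?E = "\<lambda>y. G y * exp (of_real s * ?u y) * exp (of_real t * ?v y)"
    have e1: "norm (exp (of_real s' * vline \<delta> y)) \<le> 1" if "0 < s'" for s' y using that \<delta> by simp
    have gi: "integrable lborel (\<lambda>y. f y * exp (of_real r * vline \<delta> y))" if "0 < r" "integrable lborel f" for f r
    proof (rule lint_bound[OF that(2)])
      show "(\<lambda>y. f y * exp (of_real r * vline \<delta> y)) \<in> borel_measurable lborel" using that(2) by simp
      show "AE y in lborel. norm (f y * exp (of_real r * vline \<delta> y)) \<le> norm (f y)"
        unfolding norm_mult using e1[OF that(1)] by (intro AE_I2 mult_left_le) auto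
    qed
    have "A (s + r) * B (r + t) = (LINT y|?Y. ?E y * exp (of_real r * (?u y + ?v y)))" if "0 < r" for r
    proof -
      have "A (s + r) * B (r + t) = (LINT p|?Y. (g (fst p) * exp (of_real (s + r) * vline \<delta> (fst p))) * (h (snd p) * exp (of_real (r + t) * vline \<delta> (snd p))))"
        unfolding A B using st that by (intro integrable_pair_mult(2)[symmetric] sigma_finite_lborel gi g h) auto
      also have "\<dots> = (LINT y|?Y. ?E y * exp (of_real r * (?u y + ?v y)))"
        by (intro lint_cong) (simp add: G_def exp_add distrib_left distrib_right mult_ac)
      finally show ?thesis .
    qed
    then have "(LINT r|?S. A (s + r) * B (r + t)) = (LINT r|?S. (LINT y|?Y. ?E y * exp (of_real r * (?u y + ?v y))))"
      by (intro lint_cong) simp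
    also have "\<dots> = (LINT y|?Y. (LINT r|?S. ?E y * exp (of_real r * (?u y + ?v y))))"
    proof (rule SY.Fubini_integral[symmetric])
      show "integrable (?S \<Otimes>\<^sub>M ?Y) (\<lambda>(r, y). ?E y * exp (of_real r * (?u y + ?v y)))"
      proof (rule lint_bound)
        show "integrable (?S \<Otimes>\<^sub>M ?Y) (\<lambda>p. exp (- of_real (fst p) * of_real (2 * \<delta>)) * G (snd p))"
          by (rule integrable_pair_mult(1)[OF sigma_finite_pos_half_line sigma_finite_pair_measure[OF sigma_finite_lborel sigma_finite_lborel] ek Gi]) (use \<delta> in simp)
        show "(\<lambda>(r, y). ?E y * exp (of_real r * (?u y + ?v y))) \<in> borel_measurable (?S \<Otimes>\<^sub>M ?Y)" by measurable
        show "AE p in ?S \<Otimes>\<^sub>M ?Y. norm (case p of (r, y) \<Rightarrow> ?E y * exp (of_real r * (?u y + ?v y))) \<le>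
          norm (exp (- of_real (fst p) * of_real (2 * \<delta>)) * G (snd p))"
        proof (rule AE_I2)
          fix p assume "p \<in> space (?S \<Otimes>\<^sub>M ?Y)"
          have "norm (G (snd p)) * norm (exp (of_real s * ?u (snd p))) * norm (exp (of_real t * ?v (snd p))) \<le> norm (G (snd p)) * 1 * 1"
            using st by (intro mult_mono e1) auto
          then have "norm (G (snd p)) * norm (exp (of_real s * ?u (snd p))) * norm (exp (of_real t * ?v (snd p))) * exp (- fst p * (2 * \<delta>))
             \<le> norm (G (snd p)) * exp (- fst p * (2 * \<delta>))" by (intro mult_right_mono) auto
          then show "norm (case p of (r, y) \<Rightarrow> ?E y * exp (of_real r * (?u y + ?v y))) \<le>
            norm (exp (- of_real (fst p) * of_real (2 * \<delta>)) * G (snd p))"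
            by (simp add: case_prod_beta norm_mult mult.commute algebra_simps)
        qed
      qed
    qed
    also have "\<dots> = (LINT y|?Y. a s y * b y t)"
    proof (intro lint_cong)
      fix y
      have "(LINT r|?S. ?E y * exp (of_real r * (?u y + ?v y))) = ?E y * (- 1 / (?u y + ?v y))"
        by (subst lint_cmult, subst integral_exp_pos_half_line) (use \<delta> in auto)
      then show "(LINT r|?S. ?E y * exp (of_real r * (?u y + ?v y))) = a s y * b y t"
        by (simp add: a_def b_def c_def)
    qed
    finally show ?thesis .
  qed
  have BA: "(LINT s|?S. b y s * a s y') = c y' / (?u y' + ?v y)" for y y'
  proof -
    have "(LINT s|?S. b y s * a s y') = (LINT s|?S. - c y' * exp (of_real s * (?u y' + ?v y)))"
      by (intro lint_cong) (simp add: a_def b_def distrib_left exp_add)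
    also have "\<dots> = - c y' * (- 1 / (?u y' + ?v y))"
      by (subst lint_cmult, subst integral_exp_pos_half_line) (use \<delta> in auto)
    finally show ?thesis by simp
  qed
  \<comment> \<open>The integral over s pairs u of q j with v of q i. The weights sit in the columns
    either way, so only the Cauchy part has to be transposed.\<close>
  have tr: "mdet n (\<lambda>i j. c (q j) / (?u (q j) + ?v (q i))) =
    mdet n (\<lambda>i j. c (q j) / (?u (q i) + ?v (q j)))" for n q
  proof -
    have e: "mdet n (\<lambda>i j. c (q j) / f i j) =
      (\<Prod>j<n. c (q j)) * mdet n (\<lambda>i j. 1 / f i j)" for f :: "nat \<Rightarrow> nat \<Rightarrow> complex"
      using det_scale_rows_cols[of n "\<lambda>_. 1" "\<lambda>i j. 1 / f i j" "\<lambda>j. c (q j)"] by simp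
    show ?thesis unfolding e det_mat_transpose[of n "\<lambda>i j. 1 / (?u (q i) + ?v (q j))"] ..
  qed
  have "(LINT p|PiM {..<n} (\<lambda>_. ?S). mdet n (\<lambda>i j. LINT r|?S. A (p i + r) * B (r + p j))) =
    (LINT q|PiM {..<n} (\<lambda>_. ?Y). mdet n (\<lambda>i j. c (q j) / (?u (q i) + ?v (q j))))" for n
  proof -
    have "(LINT p|PiM {..<n} (\<lambda>_. ?S). mdet n (\<lambda>i j. LINT r|?S. A (p i + r) * B (r + p j))) =
      (LINT p|PiM {..<n} (\<lambda>_. ?S). mdet n (\<lambda>i j. LINT y|?Y. a (p i) y * b y (p j)))"
    proof (rule lint_cong, rule det_mat_cong)
      fix p i j assume "p \<in> space (PiM {..<n} (\<lambda>_. ?S))" "i < n" "j < n"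
      then have "0 < p i" "0 < p j" by (auto simp: space_PiM PiE_iff)
      then show "(LINT r|?S. A (p i + r) * B (r + p j)) = (LINT y|?Y. a (p i) y * b y (p j))" by (rule K)
    qed
    also have "\<dots> = (LINT q|PiM {..<n} (\<lambda>_. ?Y). mdet n (\<lambda>i j. LINT s|?S. b (q i) s * a s (q j)))"
    proof (rule fredholm_term_cyclic[where \<beta> = 1])
      show "sigma_finite_measure ?S" "sigma_finite_measure ?Y" by (fact sigma_finite_pos_half_line, rule sigma_finite_pair_measure[OF sigma_finite_lborel sigma_finite_lborel])
      show "integrable ?Y (a s)" if "s \<in> space ?S" for s
      proof (rule lint_bound[OF ci])
        show "a s \<in> borel_measurable ?Y" unfolding a_def by measurable
        show "AE y in ?Y. norm (a s y) \<le> norm (c y)"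
          using that \<delta> by (intro AE_I2) (simp add: a_def norm_mult mult_left_le)
      qed
      show "integrable ?S (\<lambda>s. a s y)" for y unfolding a_def by (intro integrable_mult_right ex)
      show "(\<lambda>(y, s). b y s) \<in> borel_measurable (?Y \<Otimes>\<^sub>M ?S)" unfolding b_def by measurable
      show "norm (b y s) \<le> 1" if "s \<in> space ?S" for y s using that \<delta> by (simp add: b_def)
      show "integrable (?S \<Otimes>\<^sub>M ?Y) (\<lambda>(s, y). a s y)"
      proof (rule lint_bound)
        show "integrable (?S \<Otimes>\<^sub>M ?Y) (\<lambda>p. exp (- of_real (fst p) * of_real \<delta>) * c (snd p))"
          by (rule integrable_pair_mult(1)[OF sigma_finite_pos_half_line sigma_finite_pair_measure[OF sigma_finite_lborel sigma_finite_lborel] ek ci]) (use \<delta> in simp)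
        show "(\<lambda>(s, y). a s y) \<in> borel_measurable (?S \<Otimes>\<^sub>M ?Y)" unfolding a_def by measurable
        show "AE p in ?S \<Otimes>\<^sub>M ?Y. norm (case p of (s, y) \<Rightarrow> a s y) \<le> norm (exp (- of_real (fst p) * of_real \<delta>) * c (snd p))"
          by (intro AE_I2) (simp add: case_prod_beta a_def norm_mult mult.commute)
      qed
    qed
    also have "\<dots> = (LINT q|PiM {..<n} (\<lambda>_. ?Y). mdet n (\<lambda>i j. c (q j) / (?u (q i) + ?v (q j))))"
      unfolding BA tr ..
    finally show ?thesis .
  qed
  then show ?thesis unfolding fredholm_det_def c_def G_def by simp
qed

section \<open>The gas of the KPZ kernel\<close>

lemma integrable_polynomial_gaussian:
  assumes m: "0 < m" and \<delta>: "0 \<le> \<delta>"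
  shows "integrable lborel (\<lambda>y. (1 + (norm (vline \<delta> y) + norm (vline \<delta> y) ^ 2 + norm (vline \<delta> y) ^ 3)) ^ j * exp (- m * y\<^sup>2))"
proof (rule lint_bound)
  \<comment> \<open>From (1 + |y|)^(3 j) \<le> (3 j)! exp (1 + |y|) and |y| \<le> m y^2 / 2 + 1 / (2
    m); the latter spends half of the Gaussian.\<close>
  let ?C = "(1 + \<delta>) ^ (3 * j) * (fact (3 * j) * exp (1 + 1 / (2 * m)))"
  show "integrable lborel (\<lambda>y. ?C * exp (- (m / 2) * y\<^sup>2))"
    using m by (intro integrable_mult_right integrable_gaussian) simp
  show "(\<lambda>y. (1 + (norm (vline \<delta> y) + norm (vline \<delta> y) ^ 2 + norm (vline \<delta> y) ^ 3)) ^ j * exp (- m * y\<^sup>2)) \<in> borel_measurable lborel"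
    by measurable
  show "AE y in lborel. norm ((1 + (norm (vline \<delta> y) + norm (vline \<delta> y) ^ 2 + norm (vline \<delta> y) ^ 3)) ^ j * exp (- m * y\<^sup>2)) \<le>
     norm (?C * exp (- (m / 2) * y\<^sup>2))"
  proof (rule AE_I2)
    fix y
    let ?n = "norm (vline \<delta> y)"
    have "?n \<le> \<delta> + \<bar>y\<bar>" using cmod_le[of "vline \<delta> y"] \<delta> by simp
    moreover have "0 \<le> \<delta> * \<bar>y\<bar>" using \<delta> by simp
    ultimately have n: "1 + ?n \<le> (1 + \<delta>) * (1 + \<bar>y\<bar>)" unfolding distrib_left distrib_right mult_1 mult_1_right by linarith
    have "1 + (?n + ?n ^ 2 + ?n ^ 3) \<le> (1 + ?n) ^ 3"
      by (simp add: power3_eq_cube power2_eq_square algebra_simps)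
    also have "\<dots> \<le> ((1 + \<delta>) * (1 + \<bar>y\<bar>)) ^ 3" by (intro power_mono n) simp
    finally have "(1 + (?n + ?n ^ 2 + ?n ^ 3)) ^ j \<le> (((1 + \<delta>) * (1 + \<bar>y\<bar>)) ^ 3) ^ j"
      by (intro power_mono) (auto intro!: add_nonneg_nonneg)
    also have "\<dots> = (1 + \<delta>) ^ (3 * j) * (1 + \<bar>y\<bar>) ^ (3 * j)" by (simp add: power_mult power_mult_distrib)
    also have "\<dots> \<le> (1 + \<delta>) ^ (3 * j) * (fact (3 * j) * exp (1 + \<bar>y\<bar>))"
      using power_le_fact_exp[of "1 + \<bar>y\<bar>" 1 "3 * j"] \<delta> by (intro mult_left_mono) auto
    finally have p: "(1 + (?n + ?n ^ 2 + ?n ^ 3)) ^ j \<le> (1 + \<delta>) ^ (3 * j) * (fact (3 * j) * exp (1 + \<bar>y\<bar>))" .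
    have "0 \<le> (m * \<bar>y\<bar> - 1)\<^sup>2 / (2 * m)" using m by simp
    also have "\<dots> = m / 2 * y\<^sup>2 - \<bar>y\<bar> + 1 / (2 * m)" using m by (simp add: power2_diff field_simps power_mult_distrib) (simp add: power2_eq_square)
    finally have "1 + \<bar>y\<bar> - m * y\<^sup>2 \<le> 1 + 1 / (2 * m) - m / 2 * y\<^sup>2" by (simp add: field_simps)
    then have e: "exp (1 + \<bar>y\<bar>) * exp (- m * y\<^sup>2) \<le> exp (1 + 1 / (2 * m)) * exp (- (m / 2) * y\<^sup>2)"
      by (simp add: exp_add[symmetric])
    have "(1 + (?n + ?n ^ 2 + ?n ^ 3)) ^ j * exp (- m * y\<^sup>2) \<le> (1 + \<delta>) ^ (3 * j) * (fact (3 * j) * exp (1 + \<bar>y\<bar>)) * exp (- m * y\<^sup>2)"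
      by (intro mult_right_mono p) simp
    also have "\<dots> = (1 + \<delta>) ^ (3 * j) * fact (3 * j) * (exp (1 + \<bar>y\<bar>) * exp (- m * y\<^sup>2))" by (simp only: mult_ac)
    also have "\<dots> \<le> (1 + \<delta>) ^ (3 * j) * fact (3 * j) * (exp (1 + 1 / (2 * m)) * exp (- (m / 2) * y\<^sup>2))"
      using \<delta> by (intro mult_left_mono e) auto
    also have "\<dots> = ?C * exp (- (m / 2) * y\<^sup>2)" by (simp only: mult_ac)
    finally have f: "(1 + (?n + ?n ^ 2 + ?n ^ 3)) ^ j * exp (- m * y\<^sup>2) \<le> ?C * exp (- (m / 2) * y\<^sup>2)" .
    have "0 \<le> (1 + (?n + ?n ^ 2 + ?n ^ 3)) ^ j * exp (- m * y\<^sup>2)"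
      by (intro mult_nonneg_nonneg zero_le_power add_nonneg_nonneg) auto
    then show "norm ((1 + (?n + ?n ^ 2 + ?n ^ 3)) ^ j * exp (- m * y\<^sup>2)) \<le> norm (?C * exp (- (m / 2) * y\<^sup>2))"
      using f unfolding real_norm_def by linarith
  qed
qed

definition airy_wt :: "real \<Rightarrow> real \<Rightarrow> real \<Rightarrow> real \<Rightarrow> real \<Rightarrow> complex" where
  "airy_wt \<delta> \<tau> \<gamma> x y = exp (airy_phase \<tau> \<gamma> (vline \<delta> y) + of_real x * vline \<delta> y) / of_real (2 * pi)"

text \<open>The first coordinate carries - \<gamma> because A_{-\<gamma>} is the left factor of the
  kernel; the resulting coefficient of \<gamma> in the exponent is (v^2 - u^2) / 2, as for the
  periodic gas.\<close>

definition kpz_c :: "real \<Rightarrow> real \<Rightarrow> real \<Rightarrow> real \<Rightarrow> real \<times> real \<Rightarrow> complex" where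
  "kpz_c \<delta> \<tau> \<gamma> x p = airy_wt \<delta> \<tau> (- \<gamma>) x (fst p) * airy_wt \<delta> \<tau> \<gamma> x (snd p) / (vline \<delta> (fst p) + vline \<delta> (snd p))"

lemma integrable_airy_wt: "0 < \<tau> * \<delta> + \<gamma> / 2 \<Longrightarrow> integrable lborel (airy_wt \<delta> \<tau> \<gamma> x)"
  unfolding airy_wt_def[abs_def] by (intro integrable_divide_zero integrable_airy_line) simp

lemma measurable_airy_wt [measurable]: "airy_wt \<delta> \<tau> \<gamma> x \<in> borel_measurable borel"
  unfolding airy_wt_def[abs_def] by (intro borel_measurable_continuous_onI continuous_intros continuous_on_airy_line) simp

lemma norm_airy_wt_le:
  assumes "\<bar>g\<bar> \<le> \<gamma>" "0 \<le> \<tau>" "0 < \<delta>"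
  shows "norm (airy_wt \<delta> \<tau> g x y) \<le> exp (\<tau> * \<delta> ^ 3 / 3 + \<gamma> * \<delta>\<^sup>2 / 2 - x * \<delta>) * exp (- (\<tau> * \<delta> - \<gamma> / 2) * y\<^sup>2)"
proof -
  have "Re (airy_phase \<tau> g (vline \<delta> y) + of_real x * vline \<delta> y) \<le> (\<tau> * \<delta> ^ 3 / 3 + \<gamma> * \<delta>\<^sup>2 / 2 - x * \<delta>) + (- (\<tau> * \<delta> - \<gamma> / 2) * y\<^sup>2)"
  proof -
    have "g * \<delta>\<^sup>2 \<le> \<gamma> * \<delta>\<^sup>2" "(- g) * y\<^sup>2 \<le> \<gamma> * y\<^sup>2" by (rule mult_right_mono; use assms in auto)+
    then show ?thesis by (simp add: Re_airy_phase_vline algebra_simps)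
  qed
  then have "norm (airy_wt \<delta> \<tau> g x y) \<le> exp ((\<tau> * \<delta> ^ 3 / 3 + \<gamma> * \<delta>\<^sup>2 / 2 - x * \<delta>) + (- (\<tau> * \<delta> - \<gamma> / 2) * y\<^sup>2)) / (2 * pi)"
    unfolding airy_wt_def norm_divide norm_exp_eq_Re by (intro frac_le) (simp_all only: exp_le_cancel_iff, simp_all)
  also have "\<dots> \<le> exp ((\<tau> * \<delta> ^ 3 / 3 + \<gamma> * \<delta>\<^sup>2 / 2 - x * \<delta>) + (- (\<tau> * \<delta> - \<gamma> / 2) * y\<^sup>2)) / 1"
    using pi_ge_two by (intro divide_left_mono) auto
  finally show ?thesis by (simp only: exp_add div_by_1)
qed

text \<open>On a vertical line the cubic growth of u^3 is purely imaginary. The real parts of the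
  wave numbers grow at most quadratically, which the Gaussian decay of the weights can pay
  for.\<close>

lemma wave_re_vline:
  assumes \<delta>: "0 \<le> \<delta>"
  shows "wre (vline \<delta> y) (vline \<delta> y') \<le>
    (2 * \<delta> + \<delta> ^ 3) + ((1 / 2 + \<delta>) * y\<^sup>2 + (1 / 2 + \<delta>) * y'\<^sup>2)"
proof -
  have abs1: "\<bar>(a - b) / 2\<bar> \<le> a / 2 + b / 2" if "0 \<le> a" "0 \<le> b" for a b :: real
    using that by (auto simp: abs_if field_simps)
  have abs2: "\<bar>2 / 3 * d - (a + b)\<bar> \<le> d + (a + b)" if "0 \<le> a" "0 \<le> b" "0 \<le> d" for a b d :: real
    using that by (simp add: abs_if)
  have "\<bar>Re (wave_k (vline \<delta> y) (vline \<delta> y'))\<bar> = 2 * \<delta>" using \<delta> by (simp add: wave_k_def)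
  moreover have "Re (wave_l (vline \<delta> y) (vline \<delta> y')) = (y\<^sup>2 - y'\<^sup>2) / 2"
    by (simp add: wave_l_def power2_eq_square)
  then have "\<bar>Re (wave_l (vline \<delta> y) (vline \<delta> y'))\<bar> \<le> y\<^sup>2 / 2 + y'\<^sup>2 / 2"
    by (simp only: abs1 zero_le_power2)
  moreover have "Re (wave_w (vline \<delta> y) (vline \<delta> y')) = 2 / 3 * \<delta> ^ 3 - (\<delta> * y\<^sup>2 + \<delta> * y'\<^sup>2)"
    by (simp add: wave_w_def power2_eq_square power3_eq_cube field_simps)
  then have "\<bar>Re (wave_w (vline \<delta> y) (vline \<delta> y'))\<bar> \<le> \<delta> ^ 3 + (\<delta> * y\<^sup>2 + \<delta> * y'\<^sup>2)"
    using \<delta> by (simp only: abs2 zero_le_power2 mult_nonneg_nonneg zero_le_power)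
  ultimately show ?thesis unfolding wave_re_def distrib_right by linarith
qed

text \<open>Each weight decays at the Gaussian rate \<tau> \<delta> - |\<gamma>| / 2, and the
  exponential rate r costs r (1 / 2 + \<delta>); the hypothesis leaves a positive rate for the
  polynomial moments.\<close>

lemma kp_gas_KPZ:
  assumes \<tau>: "0 < \<tau>" and \<delta>: "0 < \<delta>" and r: "0 < r" and m: "r * (1 + 2 * \<delta>) < \<tau> * \<delta> - \<bar>\<gamma>\<bar> / 2"
  shows "kp_gas (lborel \<Otimes>\<^sub>M lborel) (kpz_c \<delta> \<tau> \<gamma> x) (\<lambda>p. vline \<delta> (fst p)) (\<lambda>p. vline \<delta> (snd p)) \<delta> r"
proof (rule kp_gas.intro)
  show "sigma_finite_measure (lborel \<Otimes>\<^sub>M lborel :: (real \<times> real) measure)" by (rule sigma_finite_pair_measure[OF sigma_finite_lborel sigma_finite_lborel])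
  show kc [measurable]: "kpz_c \<delta> \<tau> \<gamma> x \<in> borel_measurable (lborel \<Otimes>\<^sub>M lborel)" unfolding kpz_c_def[abs_def] by measurable
  show [measurable]: "(\<lambda>p. vline \<delta> (fst p)) \<in> borel_measurable (lborel \<Otimes>\<^sub>M lborel)" "(\<lambda>p. vline \<delta> (snd p)) \<in> borel_measurable (lborel \<Otimes>\<^sub>M lborel)"
    by measurable
  show "0 < \<delta>" "0 < r" "Re (vline \<delta> (fst p)) \<le> - \<delta>" "Re (vline \<delta> (snd p)) \<le> - \<delta>" for p :: "real \<times> real" using \<delta> r by auto
  let ?u = "\<lambda>p :: real \<times> real. vline \<delta> (fst p)" and ?v = "\<lambda>p :: real \<times> real. vline \<delta> (snd p)"
  fix j :: nat
  define e where "e = \<tau> * \<delta> - \<bar>\<gamma>\<bar> / 2"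
  define e' where "e' = e - r * (1 / 2 + \<delta>)"
  have e': "0 < e'" using m mult_pos_pos[OF r, of "1 / 2 + \<delta>"] \<delta> by (simp add: e'_def e_def algebra_simps)
  define C where "C = exp (\<tau> * \<delta> ^ 3 / 3 + \<bar>\<gamma>\<bar> * \<delta>\<^sup>2 / 2 - x * \<delta>)"
  let ?s = "\<lambda>y. 1 + (norm (vline \<delta> y) + norm (vline \<delta> y) ^ 2 + norm (vline \<delta> y) ^ 3)"
  let ?H = "\<lambda>y. ?s y ^ j * exp (- e' * y\<^sup>2)"
  let ?D = "C * C / (2 * \<delta>) * exp (r * (2 * \<delta> + \<delta> ^ 3))"
  show "integrable (lborel \<Otimes>\<^sub>M lborel) (\<lambda>p. norm (kpz_c \<delta> \<tau> \<gamma> x p) *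
      (1 + wsize (?u p) (?v p)) ^ j *
      exp (r * wre (?u p) (?v p)))"
  proof (rule lint_bound)
    show "integrable (lborel \<Otimes>\<^sub>M lborel) (\<lambda>p::real \<times> real. ?D * (?H (fst p) * ?H (snd p)))"
      by (intro integrable_mult_right integrable_pair_mult(1)[OF sigma_finite_lborel sigma_finite_lborel] integrable_polynomial_gaussian e')
        (use \<delta> in auto)
    show "(\<lambda>p. norm (kpz_c \<delta> \<tau> \<gamma> x p) *
      (1 + wsize (?u p) (?v p)) ^ j *
      exp (r * wre (?u p) (?v p)))
      \<in> borel_measurable (lborel \<Otimes>\<^sub>M lborel)"
      unfolding wave_size_def wave_re_def wave_defs by measurable
    have bound: "norm (kpz_c \<delta> \<tau> \<gamma> x (y, y')) *
      (1 + wsize (vline \<delta> y) (vline \<delta> y')) ^ j *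
      exp (r * wre (vline \<delta> y) (vline \<delta> y')) \<le>
       ?D * (?H y * ?H y')" for y y'
    proof -
      have uv: "2 * \<delta> \<le> norm (vline \<delta> y + vline \<delta> y')" using abs_Re_le_cmod[of "vline \<delta> y + vline \<delta> y'"] by simp
      have c: "norm (kpz_c \<delta> \<tau> \<gamma> x (y, y')) \<le> (C * exp (- e * y\<^sup>2)) * (C * exp (- e * y'\<^sup>2)) / (2 * \<delta>)"
        unfolding kpz_c_def norm_divide norm_mult fst_conv snd_conv C_def e_def using \<delta> uv \<tau>
        by (intro frac_le mult_mono norm_airy_wt_le) auto
      have s: "(1 + wsize (vline \<delta> y) (vline \<delta> y')) ^ j \<le> ?s y ^ j * ?s y' ^ j"
        unfolding power_mult_distrib[symmetric] by (intro power_mono wave_bounds_norm(1)) (simp add: add_nonneg_nonneg)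
      have x: "exp (r * wre (vline \<delta> y) (vline \<delta> y')) \<le>
          exp (r * (2 * \<delta> + \<delta> ^ 3)) * (exp (r * (1 / 2 + \<delta>) * y\<^sup>2) * exp (r * (1 / 2 + \<delta>) * y'\<^sup>2))"
      proof -
        have "r * wre (vline \<delta> y) (vline \<delta> y') \<le>
          r * ((2 * \<delta> + \<delta> ^ 3) + ((1 / 2 + \<delta>) * y\<^sup>2 + (1 / 2 + \<delta>) * y'\<^sup>2))"
          using \<delta> r by (intro mult_left_mono wave_re_vline) auto
        also have "\<dots> = r * (2 * \<delta> + \<delta> ^ 3) + (r * (1 / 2 + \<delta>) * y\<^sup>2 + r * (1 / 2 + \<delta>) * y'\<^sup>2)" by (simp add: algebra_simps)
        finally show ?thesis by (simp only: exp_add[symmetric] exp_le_cancel_iff)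
      qed
      have h: "exp (- e * y\<^sup>2) * exp (r * (1 / 2 + \<delta>) * y\<^sup>2) = exp (- e' * y\<^sup>2)" for y
        by (simp add: exp_add[symmetric] e'_def algebra_simps)
      have "norm (kpz_c \<delta> \<tau> \<gamma> x (y, y')) *
        (1 + wsize (vline \<delta> y) (vline \<delta> y')) ^ j *
        exp (r * wre (vline \<delta> y) (vline \<delta> y')) \<le>
        ((C * exp (- e * y\<^sup>2)) * (C * exp (- e * y'\<^sup>2)) / (2 * \<delta>)) * (?s y ^ j * ?s y' ^ j) *
         (exp (r * (2 * \<delta> + \<delta> ^ 3)) * (exp (r * (1 / 2 + \<delta>) * y\<^sup>2) * exp (r * (1 / 2 + \<delta>) * y'\<^sup>2)))"
        using \<delta> by (intro mult_mono c s x) (auto simp: C_def intro!: mult_nonneg_nonneg divide_nonneg_nonneg zero_le_power add_nonneg_nonneg)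
      also have "\<dots> = ?D * ((?s y ^ j * (exp (- e * y\<^sup>2) * exp (r * (1 / 2 + \<delta>) * y\<^sup>2))) * (?s y' ^ j * (exp (- e * y'\<^sup>2) * exp (r * (1 / 2 + \<delta>) * y'\<^sup>2))))"
        by (simp only: times_divide_eq_left times_divide_eq_right mult_ac)
      finally show ?thesis unfolding h .
    qed
    show "AE p in lborel \<Otimes>\<^sub>M lborel. norm (norm (kpz_c \<delta> \<tau> \<gamma> x p) *
      (1 + wsize (?u p) (?v p)) ^ j *
      exp (r * wre (?u p) (?v p)))
      \<le> norm (?D * (?H (fst p) * ?H (snd p)))"
    proof (rule AE_I2)
      fix p :: "real \<times> real"
      have n: "norm a \<le> norm b" if "0 \<le> a" "a \<le> b" for a b :: real using that by simp
      show "norm (norm (kpz_c \<delta> \<tau> \<gamma> x p) *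
      (1 + wsize (?u p) (?v p)) ^ j *
      exp (r * wre (?u p) (?v p)))
      \<le> norm (?D * (?H (fst p) * ?H (snd p)))"
        using bound[of "fst p" "snd p"] by (intro n) (auto intro!: mult_nonneg_nonneg zero_le_power add_nonneg_nonneg)
    qed
  qed
qed

lemma kpz_c_shift:
  "kpz_c \<delta> \<tau> \<gamma> x p = kpz_c \<delta> \<tau>0 \<gamma>0 x0 p * exp (
     of_real (x - x0) * wave_k (vline \<delta> (fst p)) (vline \<delta> (snd p)) +
     of_real (\<gamma> - \<gamma>0) * wave_l (vline \<delta> (fst p)) (vline \<delta> (snd p)) +
     of_real (\<tau> - \<tau>0) * wave_w (vline \<delta> (fst p)) (vline \<delta> (snd p)))"
proof -
  have "airy_phase \<tau> (- \<gamma>) u + of_real x * u + (airy_phase \<tau> \<gamma> v + of_real x * v) =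
    airy_phase \<tau>0 (- \<gamma>0) u + of_real x0 * u + (airy_phase \<tau>0 \<gamma>0 v + of_real x0 * v) +
    (of_real (x - x0) * wave_k u v + of_real (\<gamma> - \<gamma>0) * wave_l u v + of_real (\<tau> - \<tau>0) * wave_w u v)" for u v
    unfolding airy_phase_def wave_defs by (simp add: field_simps)
  from arg_cong[OF this[of "vline \<delta> (fst p)" "vline \<delta> (snd p)"], of exp]
  show ?thesis unfolding kpz_c_def airy_wt_def exp_add[of "airy_phase \<tau> (- \<gamma>) _ + _"] exp_add[of "airy_phase \<tau>0 (- \<gamma>0) _ + _"]
    exp_add[of "(airy_phase \<tau>0 (- \<gamma>0) _ + _) + _"]
    by (simp add: field_simps)
qed

theorem KPZ_gas_representation:
  assumes \<theta>: "\<theta>1 \<in> {pi/2<..<5*pi/6}" "\<theta>2 \<in> {pi/2<..<5*pi/6}" and \<tau>0: "0 < \<tau>0"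
  shows "\<exists>(M :: (real \<times> real) measure) c u v \<delta> r. kp_gas M c u v \<delta> r \<and>
      (\<forall>\<tau> \<gamma> x. \<bar>\<tau> - \<tau>0\<bar> < r / 2 \<and> \<bar>\<gamma> - \<gamma>0\<bar> < r / 2 \<and> \<bar>x - x0\<bar> < r / 2 \<longrightarrow>
        D_KPZ \<theta>1 \<theta>2 \<tau> \<gamma> x = kp_gas.F M c u v 0 0 0 (x - x0) (\<gamma> - \<gamma>0) (\<tau> - \<tau>0))"
proof -
  obtain \<kappa> where \<kappa>: "0 < \<kappa>" "\<kappa> \<le> 3" and Airy: "\<And>\<tau> \<gamma> \<delta> s. 0 < \<tau> \<Longrightarrow> 0 < \<delta> \<Longrightarrow> 6 * \<bar>\<gamma>\<bar> < \<tau> * \<kappa> * \<delta> \<Longrightarrow>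
     Airy_gamma \<theta>1 \<theta>2 \<tau> \<gamma> s = of_real (1 / (2 * pi)) * (LINT y|lborel. exp (airy_phase \<tau> \<gamma> (vline \<delta> y) + of_real s * vline \<delta> y))"
    using Airy_gamma_vline[OF \<theta>] by auto
  \<comment> \<open>Then \<tau>0 \<kappa> \<delta> = 12 |\<gamma>0| + 12, so 6 |\<gamma>| < \<tau>
    \<kappa> \<delta> holds for all \<tau> > \<tau>0 / 2 and |\<gamma>| \<le> |\<gamma>0| +
    1.\<close>
  define \<delta> where "\<delta> = (12 * \<bar>\<gamma>0\<bar> + 12) / (\<tau>0 * \<kappa>)"
  have \<delta>: "0 < \<delta>" using \<kappa> \<tau>0 by (simp add: \<delta>_def add_nonneg_pos)
  have t\<delta>: "\<tau>0 * \<kappa> * \<delta> = 12 * \<bar>\<gamma>0\<bar> + 12" using \<kappa> \<tau>0 by (simp add: \<delta>_def)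
  define m where "m = \<tau>0 * \<delta> - \<bar>\<gamma>0\<bar> / 2"
  have le3: "t * \<kappa> * \<delta> \<le> 3 * (t * \<delta>)" if "0 < t" for t
  proof -
    have "\<kappa> * (t * \<delta>) \<le> 3 * (t * \<delta>)" using \<kappa> \<delta> that by (intro mult_right_mono) auto
    then show ?thesis by (simp add: mult_ac)
  qed
  have m: "0 < m" using le3[OF \<tau>0] t\<delta> unfolding m_def by linarith
  \<comment> \<open>The entries 1 and \<tau>0 keep the box within |\<gamma>| \<le> |\<gamma>0| + 1
    and \<tau> > \<tau>0 / 2; the third one yields the hypothesis of
    \<open>kp_gas_KPZ\<close>.\<close>
  define r where "r = min 1 (min \<tau>0 (m / (2 * (1 + 2 * \<delta>))))"
  have r: "0 < r" "r \<le> 1" "r \<le> \<tau>0" "r \<le> m / (2 * (1 + 2 * \<delta>))" using \<tau>0 m \<delta> by (auto simp: r_def)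
  have "r * (2 * (1 + 2 * \<delta>)) \<le> m" using r(4) \<delta> by (simp add: pos_le_divide_eq)
  then have rm: "r * (1 + 2 * \<delta>) < m" using m by linarith
  have g: "kp_gas (lborel \<Otimes>\<^sub>M lborel) (kpz_c \<delta> \<tau>0 \<gamma>0 x0) (\<lambda>p. vline \<delta> (fst p)) (\<lambda>p. vline \<delta> (snd p)) \<delta> r"
    using rm by (intro kp_gas_KPZ \<tau>0 \<delta> r(1)) (simp add: m_def)
  interpret kp_gas "lborel \<Otimes>\<^sub>M lborel" "kpz_c \<delta> \<tau>0 \<gamma>0 x0" "\<lambda>p. vline \<delta> (fst p)" "\<lambda>p. vline \<delta> (snd p)" \<delta> r by (rule g)
  have "D_KPZ \<theta>1 \<theta>2 \<tau> \<gamma> x = F 0 0 0 (x - x0) (\<gamma> - \<gamma>0) (\<tau> - \<tau>0)" if "\<bar>\<tau> - \<tau>0\<bar> < r / 2" "\<bar>\<gamma> - \<gamma>0\<bar> < r / 2" for \<tau> \<gamma> x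
  proof -
    have \<tau>: "\<tau>0 / 2 < \<tau>" "0 < \<tau>" using that \<tau>0 r by linarith+
    have "\<tau>0 / 2 * (\<kappa> * \<delta>) < \<tau> * (\<kappa> * \<delta>)" using \<tau>(1) \<kappa> \<delta> by (intro mult_strict_right_mono) auto
    then have bnd: "6 * \<bar>\<gamma>\<bar> < \<tau> * \<kappa> * \<delta>" using t\<delta> that(2) r by (simp add: mult.assoc abs_if split: if_splits)
    have i: "integrable lborel (airy_wt \<delta> \<tau> g x)" if "\<bar>g\<bar> = \<bar>\<gamma>\<bar>" for g
    proof (rule integrable_airy_wt)
      show "0 < \<tau> * \<delta> + g / 2" using bnd le3[OF \<tau>(2)] that abs_ge_minus_self[of g] by linarith
    qed
    have A: "Airy_gamma \<theta>1 \<theta>2 \<tau> g (s + x) = (LINT y|lborel. airy_wt \<delta> \<tau> g x y * exp (of_real s * vline \<delta> y))" if "\<bar>g\<bar> = \<bar>\<gamma>\<bar>" for g s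
    proof -
      have "Airy_gamma \<theta>1 \<theta>2 \<tau> g (s + x) = (LINT y|lborel. of_real (1 / (2 * pi)) * exp (airy_phase \<tau> g (vline \<delta> y) + of_real (s + x) * vline \<delta> y))"
        using bnd that by (subst Airy[OF \<tau>(2) \<delta>]) auto
      also have "\<dots> = (LINT y|lborel. airy_wt \<delta> \<tau> g x y * exp (of_real s * vline \<delta> y))"
        by (intro lint_cong) (simp add: airy_wt_def exp_add[symmetric] algebra_simps)
      finally show ?thesis .
    qed
    have "D_KPZ \<theta>1 \<theta>2 \<tau> \<gamma> x = fredholm_det pos_half_line (\<lambda>s t. LINT r|pos_half_line.
        Airy_gamma \<theta>1 \<theta>2 \<tau> (- \<gamma>) ((s + r) + x) * Airy_gamma \<theta>1 \<theta>2 \<tau> \<gamma> ((r + t) + x))"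
      unfolding D_KPZ_def K_KPZ_def kernel_comp_def[abs_def] A_kernel_def by (simp add: add_ac)
    also have "\<dots> = (\<Sum>n. (-1) ^ n / fact n * (LINT q|PiM {..<n} (\<lambda>_. lborel \<Otimes>\<^sub>M lborel).
      Determinant.det (Matrix.mat n n (\<lambda>(i, j).
       airy_wt \<delta> \<tau> (- \<gamma>) x (fst (q j)) * airy_wt \<delta> \<tau> \<gamma> x (snd (q j)) / (vline \<delta> (fst (q j)) + vline \<delta> (snd (q j))) /
        (vline \<delta> (fst (q i)) + vline \<delta> (snd (q j)))))))"
      by (rule fredholm_det_laplace_product[OF \<delta> i i A A, of "- \<gamma>" \<gamma>]) auto
    also have "\<dots> = F 0 0 0 (x - x0) (\<gamma> - \<gamma>0) (\<tau> - \<tau>0)"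
      unfolding F_eq_series kk_def ll_def ww_def kpz_c_shift[symmetric] by (simp only: kpz_c_def)
    finally show ?thesis .
  qed
  then show ?thesis using g by blast
qed

section \<open>Fredholm minors\<close>

lemma det_mat_permute_both:
  assumes p: "p permutes {..<n}"
  shows "mdet n (\<lambda>i j. f (p i) (p j)) = mdet n (\<lambda>i j. f i j)"
proof -
  have p': "p permutes {0..<n}" using p by (simp add: atLeast0LessThan)
  have rows: "mdet n (\<lambda>i j. g (p i) j) = signof p * mdet n (\<lambda>i j. g i j)" for g :: "nat \<Rightarrow> nat \<Rightarrow> 'a"
  proof -
    have "p i < n" if "i < n" for i using permutes_in_image[OF p, of i] that by simp
    then have "mdet n (\<lambda>i j. g (p i) j) =
      mdet n (\<lambda>i j. Matrix.mat n n (\<lambda>(i, j). g i j) $$ (p i, j))"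
      by (intro det_mat_cong) simp
    also have "\<dots> = signof p * mdet n (\<lambda>i j. g i j)"
      by (rule det_permute_rows[OF mat_carrier p'])
    finally show ?thesis .
  qed
  have s: "signof p * (signof p * x) = x" for x :: 'a by (simp add: sign_def)
  have "mdet n (\<lambda>i j. f (p i) (p j)) = signof p * mdet n (\<lambda>i j. f i (p j))"
    by (rule rows[of "\<lambda>i j. f i (p j)"])
  also have "mdet n (\<lambda>i j. f i (p j)) = mdet n (\<lambda>i j. f j (p i))"
    by (rule det_mat_transpose[symmetric])
  also have "\<dots> = signof p * mdet n (\<lambda>i j. f j i)"
    by (rule rows[of "\<lambda>i j. f j i"])
  also have "mdet n (\<lambda>i j. f j i) = mdet n (\<lambda>i j. f i j)"
    by (rule det_mat_transpose)
  finally show ?thesis unfolding s .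
qed

text \<open>Laplace expansion along the last row. Putting column n in the place of the deleted
  column j, instead of shifting the columns in between, turns the alternating sign into - 1.\<close>

lemma det_bordered:
  fixes f :: "nat \<Rightarrow> nat \<Rightarrow> 'a::comm_ring_1"
  shows "mdet (Suc n) (\<lambda>i j. f i j) =
    f n n * mdet n (\<lambda>i j. f i j) -
    (\<Sum>j<n. f n j * mdet n (\<lambda>i l. f i (if l = j then n else l)))"
proof -
  let ?A = "Matrix.mat (Suc n) (Suc n) (\<lambda>(i, j). f i j)"
  have del: "mat_delete B n n = Matrix.mat n n (\<lambda>(i, j). B $$ (i, j))" if "B \<in> carrier_mat (Suc n) (Suc n)" for B :: "'a mat"
    using that unfolding mat_delete_def by (intro eq_matI) auto
  have last: "cofactor ?A n n = mdet n (\<lambda>i j. f i j)"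
  proof -
    have "mat_delete ?A n n = Matrix.mat n n (\<lambda>(i, j). f i j)" unfolding del[OF mat_carrier] by (intro eq_matI) auto
    then show ?thesis by (simp add: cofactor_def)
  qed
  have cof: "cofactor ?A n j = - mdet n (\<lambda>i l. f i (if l = j then n else l))" if j: "j < n" for j
  proof -
    \<comment> \<open>Replacing the last row by a unit vector exhibits the cofactor as a
      determinant, in which the columns j and n can be swapped.\<close>
    let ?B = "Matrix.mat (Suc n) (Suc n) (\<lambda>(i, l). if i < n then f i l else if l = j then 1 else 0)"
    let ?C = "swapcols j n ?B"
    have "Determinant.det ?B = (\<Sum>l<Suc n. ?B $$ (n, l) * cofactor ?B n l)"
      by (rule laplace_expansion_row[OF mat_carrier]) simp
    also have "\<dots> = (\<Sum>l<Suc n. if l = j then cofactor ?B n l else 0)"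
      by (intro sum.cong refl) auto
    also have "\<dots> = cofactor ?B n j" using j by (simp add: sum.delta)
    also have "\<dots> = cofactor ?A n j"
      unfolding cofactor_def mat_delete_def by (intro arg_cong2[where f = "(*)"] arg_cong[where f = Determinant.det] refl eq_matI) auto
    finally have B: "cofactor ?A n j = Determinant.det ?B" ..
    have C: "?C \<in> carrier_mat (Suc n) (Suc n)" by (rule carrier_matI) auto
    have "Determinant.det ?C = (\<Sum>l<Suc n. ?C $$ (n, l) * cofactor ?C n l)"
      by (rule laplace_expansion_row[OF C]) simp
    also have "\<dots> = (\<Sum>l<Suc n. if l = n then cofactor ?C n l else 0)"
      using j by (intro sum.cong refl) auto
    also have "\<dots> = cofactor ?C n n" by (simp add: sum.delta)
    also have "\<dots> = Determinant.det (mat_delete ?C n n)" by (simp add: cofactor_def)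
    also have "mat_delete ?C n n = Matrix.mat n n (\<lambda>(i, l). f i (if l = j then n else l))"
      unfolding del[OF C] using j by (intro eq_matI) auto
    finally have "Determinant.det ?C = mdet n (\<lambda>i l. f i (if l = j then n else l))" .
    moreover have "Determinant.det ?C = - Determinant.det ?B"
      using j by (intro det_swapcols[where n = "Suc n"]) auto
    ultimately have e: "- Determinant.det ?B = mdet n (\<lambda>i l. f i (if l = j then n else l))" by simp
    show ?thesis unfolding B e[symmetric] by simp
  qed
  have "Determinant.det ?A = (\<Sum>j<Suc n. ?A $$ (n, j) * cofactor ?A n j)"
    by (rule laplace_expansion_row[OF mat_carrier]) simp
  also have "\<dots> = (\<Sum>j<n. f n j * cofactor ?A n j) + f n n * cofactor ?A n n" by simp
  also have "(\<Sum>j<n. f n j * cofactor ?A n j) = - (\<Sum>j<n. f n j * mdet n (\<lambda>i l. f i (if l = j then n else l)))"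
    unfolding sum_negf[symmetric] using cof by (intro sum.cong refl) simp
  finally show ?thesis unfolding last by simp
qed

lemma summable_hadamard_Suc:
  assumes y: "0 \<le> (y::real)"
  shows "summable (\<lambda>n. y ^ n * (sqrt (real (Suc n)) ^ Suc n / fact n))"
proof (rule summable_comparison_test')
  \<comment> \<open>The factor 2 absorbs n + 1 \<le> 2^n, which relates 1 / n! to 1 / (n + 1)!; the
    summand 1 makes the base at least 1, so that a further power may be added.\<close>
  let ?x = "2 * y + 1"
  have "summable (\<lambda>n. (1 * sqrt (real n)) ^ n / fact n * ?x ^ n)" using y by (intro summable_hadamard) auto
  then show "summable (\<lambda>n. sqrt (real (Suc n)) ^ Suc n / fact (Suc n) * ?x ^ Suc n)"
    by (subst (asm) summable_Suc_iff[symmetric]) simp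
  fix n :: nat
  have "real (Suc n) \<le> 2 ^ n" by (induction n) auto
  then have "real (Suc n) * y ^ n \<le> 2 ^ n * y ^ n" using y by (intro mult_right_mono) auto
  also have "\<dots> = (2 * y) ^ n" by (simp add: power_mult_distrib)
  also have "\<dots> \<le> ?x ^ n" using y by (intro power_mono) auto
  also have "\<dots> \<le> ?x ^ Suc n" using y by (intro power_increasing) auto
  finally have "real (Suc n) * y ^ n * (sqrt (real (Suc n)) ^ Suc n / fact (Suc n)) \<le> ?x ^ Suc n * (sqrt (real (Suc n)) ^ Suc n / fact (Suc n))"
    by (rule mult_right_mono) simp
  moreover have "real (Suc n) * y ^ n * (q / fact (Suc n)) = y ^ n * (q / fact n)" for q :: real
    unfolding fact_Suc by (simp del: of_nat_Suc)
  ultimately have "y ^ n * (sqrt (real (Suc n)) ^ Suc n / fact n) \<le> sqrt (real (Suc n)) ^ Suc n / fact (Suc n) * ?x ^ Suc n"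
    by (simp only: mult.commute)
  then show "norm (y ^ n * (sqrt (real (Suc n)) ^ Suc n / fact n)) \<le> sqrt (real (Suc n)) ^ Suc n / fact (Suc n) * ?x ^ Suc n"
    using y by (subst real_norm_def, subst abs_of_nonneg) auto
qed

text \<open>A product bound fits Hadamard's inequality: dividing row i and column j by the values of
  h leaves entries of modulus at most 1, and the extracted factors multiply to squares of h, which
  are integrable.\<close>

locale fredholm_kernel = sigma_finite_measure M for M :: "'a measure" +
  fixes K :: "'a \<Rightarrow> 'a \<Rightarrow> complex" and h :: "'a \<Rightarrow> real"
  assumes K_measurable: "(\<lambda>(s, t). K s t) \<in> borel_measurable (M \<Otimes>\<^sub>M M)"
    and h_measurable [measurable]: "h \<in> borel_measurable M"
    and h_pos: "s \<in> space M \<Longrightarrow> 0 < h s"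
    and K_bound: "s \<in> space M \<Longrightarrow> t \<in> space M \<Longrightarrow> norm (K s t) \<le> h s * h t"
    and h_square: "integrable M (\<lambda>s. (h s)\<^sup>2)"
begin

sublocale PM: product_sigma_finite "\<lambda>_::nat. M"
  by standard

abbreviation P where "P n \<equiv> PiM {..<n::nat} (\<lambda>_. M)"

definition c where "c = (LINT s|M. (h s)\<^sup>2)"

lemma c_nonneg: "0 \<le> c" unfolding c_def by (rule Bochner_Integration.integral_nonneg) simp

lemma measurable_K: "f \<in> measurable N M \<Longrightarrow> g \<in> measurable N M \<Longrightarrow> (\<lambda>\<omega>. K (f \<omega>) (g \<omega>)) \<in> borel_measurable N"
  using measurable_compose[OF measurable_Pair K_measurable, of f N g] by simp

lemma measurable_det_K:
  assumes "\<And>i. i < n \<Longrightarrow> a i \<in> measurable N M" "\<And>i. i < n \<Longrightarrow> b i \<in> measurable N M"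
  shows "(\<lambda>\<omega>. mdet n (\<lambda>i j. K (a i \<omega>) (b j \<omega>))) \<in> borel_measurable N"
  unfolding det_mat_leibniz
proof (intro borel_measurable_sum borel_measurable_times borel_measurable_const borel_measurable_prod measurable_K)
  fix p i assume "p \<in> {p. p permutes {..<n}}" "i \<in> {..<n}"
  then have "p i < n" using permutes_in_image[of p "{..<n}" i] by auto
  then show "b (p i) \<in> measurable N M" by (rule assms)
  show "a i \<in> measurable N M" using \<open>i \<in> {..<n}\<close> by (simp add: assms)
qed

lemma norm_det_K_le:
  assumes "\<And>i. i < n \<Longrightarrow> a i \<in> space M" "\<And>i. i < n \<Longrightarrow> b i \<in> space M"
  shows "norm (mdet n (\<lambda>i j. K (a i) (b j))) \<le> (\<Prod>i<n. h (a i)) * (\<Prod>j<n. h (b j)) * sqrt (real n) ^ n"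
proof -
  let ?f = "\<lambda>i j. K (a i) (b j) / of_real (h (a i) * h (b j))"
  have pos: "0 < h (a i)" "0 < h (b i)" if "i < n" for i using assms that h_pos by auto
  have "mdet n (\<lambda>i j. K (a i) (b j)) =
    mdet n (\<lambda>i j. of_real (h (a i)) * ?f i j * of_real (h (b j)))"
  proof (rule det_mat_cong)
    fix i j assume "i < n" "j < n"
    then show "K (a i) (b j) = of_real (h (a i)) * ?f i j * of_real (h (b j))" using pos(1)[of i] pos(2)[of j] by simp
  qed
  also have "\<dots> = (\<Prod>i<n. of_real (h (a i))) * (\<Prod>j<n. of_real (h (b j))) * mdet n (\<lambda>i j. ?f i j)"
    by (rule det_scale_rows_cols)
  also have "norm \<dots> = (\<Prod>i<n. h (a i)) * (\<Prod>j<n. h (b j)) * norm (mdet n (\<lambda>i j. ?f i j))"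
    using pos by (simp add: norm_mult prod_norm[symmetric] less_imp_le)
  also have "\<dots> \<le> (\<Prod>i<n. h (a i)) * (\<Prod>j<n. h (b j)) * (1 * sqrt (real n)) ^ n"
  proof (intro mult_left_mono hadamard_det_bound mult_nonneg_nonneg prod_nonneg ballI)
    fix i j assume ij: "i < n" "j < n"
    have "norm (?f i j) = norm (K (a i) (b j)) / (h (a i) * h (b j))"
      using pos(1)[OF ij(1)] pos(2)[OF ij(2)] by (simp add: norm_divide norm_mult)
    also have "\<dots> \<le> 1" using K_bound[of "a i" "b j"] assms(1)[OF ij(1)] assms(2)[OF ij(2)] pos(1)[OF ij(1)] pos(2)[OF ij(2)]
      by (simp add: divide_le_eq_1)
    finally show "norm (?f i j) \<le> 1" .
  qed (use pos in \<open>auto intro: less_imp_le\<close>)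
  finally show ?thesis by simp
qed

text \<open>The determinant of K on p bordered by a row s and a column t. Up to (-1)^n / n!,
  \<open>dl\<close> and \<open>nu\<close> are the coefficients of Fredholm's determinant and of his
  first minor.\<close>

definition bd where
  "bd n s t p = mdet (Suc n) (\<lambda>i j. K (if i < n then p i else s) (if j < n then p j else t))"

definition dl where "dl n = (LINT p|P n. mdet n (\<lambda>i j. K (p i) (p j)))"

definition nu where "nu n s t = (LINT p|P n. bd n s t p)"

definition had :: "nat \<Rightarrow> real" where "had n = sqrt (real (Suc n)) ^ Suc n"

lemma space_P: "p \<in> space (P n) \<Longrightarrow> i < n \<Longrightarrow> p i \<in> space M"
  by (auto simp: space_PiM PiE_iff)

lemma measurable_bd:
  assumes f: "f \<in> measurable N M" and g: "g \<in> measurable N M" and q: "q \<in> measurable N (P n)"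
  shows "(\<lambda>\<omega>. bd n (f \<omega>) (g \<omega>) (q \<omega>)) \<in> borel_measurable N"
proof -
  have q': "(\<lambda>\<omega>. q \<omega> i) \<in> measurable N M" if "i < n" for i
    using measurable_compose[OF q measurable_component_singleton, of i] that by simp
  show ?thesis
    unfolding bd_def
  proof (rule measurable_det_K[where a = "\<lambda>i \<omega>. if i < n then q \<omega> i else f \<omega>" and b = "\<lambda>i \<omega>. if i < n then q \<omega> i else g \<omega>"])
    show "(\<lambda>\<omega>. if i < n then q \<omega> i else f \<omega>) \<in> measurable N M" "(\<lambda>\<omega>. if i < n then q \<omega> i else g \<omega>) \<in> measurable N M" for i
      by (cases "i < n"; simp add: q' f g)+
  qed
qed

lemma norm_bd_le:
  assumes s: "s \<in> space M" "t \<in> space M" and p: "p \<in> space (P n)"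
  shows "norm (bd n s t p) \<le> h s * h t * had n * (\<Prod>i<n. (h (p i))\<^sup>2)"
proof -
  have "norm (bd n s t p) \<le> (\<Prod>i<Suc n. h (if i < n then p i else s)) * (\<Prod>i<Suc n. h (if i < n then p i else t)) * sqrt (real (Suc n)) ^ Suc n"
    unfolding bd_def by (rule norm_det_K_le) (use s space_P[OF p] in auto)
  moreover have e: "(\<Prod>i<Suc n. h (if i < n then p i else s)) = (\<Prod>i<n. h (p i)) * h s" for s by (simp cong: prod.cong_simp)
  ultimately show ?thesis unfolding e had_def power2_eq_square prod.distrib by (simp only: mult_ac)
qed

lemma integrable_prod_h: "integrable (P n) (\<lambda>p. \<Prod>i<n. (h (p i))\<^sup>2)"
  by (rule PM.product_integrable_prod) (simp_all add: h_square)

lemma integral_prod_h: "(LINT p|P n. (\<Prod>i<n. (h (p i))\<^sup>2)) = c ^ n"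
  by (subst PM.product_integral_prod) (simp_all add: h_square c_def)

lemma integrable_P_bounded:
  fixes G :: "(nat \<Rightarrow> 'a) \<Rightarrow> complex"
  assumes "G \<in> borel_measurable (P n)" "\<And>p. p \<in> space (P n) \<Longrightarrow> norm (G p) \<le> b * (\<Prod>i<n. (h (p i))\<^sup>2)"
  shows "integrable (P n) G"
    and "norm (integral\<^sup>L (P n) G) \<le> b * c ^ n"
proof -
  have i: "integrable (P n) (\<lambda>p. b * (\<Prod>i<n. (h (p i))\<^sup>2))" by (intro integrable_mult_right integrable_prod_h)
  show G: "integrable (P n) G"
    by (rule lint_bound[OF i assms(1)]) (auto intro!: AE_I2 order_trans[OF assms(2) abs_ge_self])
  have "norm (integral\<^sup>L (P n) G) \<le> (LINT p|P n. b * (\<Prod>i<n. (h (p i))\<^sup>2))"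
    by (rule order_trans[OF integral_norm_bound]) (intro Bochner_Integration.integral_mono integrable_norm G i assms(2))
  then show "norm (integral\<^sup>L (P n) G) \<le> b * c ^ n" by (simp add: integral_prod_h)
qed

lemma norm_nu_le: "s \<in> space M \<Longrightarrow> t \<in> space M \<Longrightarrow> norm (nu n s t) \<le> h s * h t * had n * c ^ n"
  unfolding nu_def by (rule integrable_P_bounded(2)[OF measurable_bd norm_bd_le]) simp_all

lemma measurable_nu:
  assumes "f \<in> measurable N M" "g \<in> measurable N M"
  shows "(\<lambda>\<omega>. nu n (f \<omega>) (g \<omega>)) \<in> borel_measurable N"
proof -
  interpret Pn: finite_product_sigma_finite "\<lambda>_::nat. M" "{..<n}" by standard simp
  show ?thesis unfolding nu_def
  proof (rule Pn.borel_measurable_lebesgue_integral)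
    show "(\<lambda>(\<omega>, p). bd n (f \<omega>) (g \<omega>) p) \<in> borel_measurable (N \<Otimes>\<^sub>M P n)"
      using measurable_bd[OF measurable_compose[OF measurable_fst assms(1)] measurable_compose[OF measurable_fst assms(2)] measurable_snd, of n]
      by (simp add: case_prod_beta)
  qed
qed

lemma measurable_minor: "(\<lambda>p. mdet n (\<lambda>i j. K (p i) (p j))) \<in> borel_measurable (P n)"
  by (rule measurable_det_K) (auto intro!: measurable_component_singleton)

lemma norm_minor_le:
  assumes p: "p \<in> space (P n)"
  shows "norm (mdet n (\<lambda>i j. K (p i) (p j))) \<le> had n * (\<Prod>i<n. (h (p i))\<^sup>2)"
proof -
  have "norm (mdet n (\<lambda>i j. K (p i) (p j))) \<le> (\<Prod>i<n. h (p i)) * (\<Prod>j<n. h (p j)) * sqrt (real n) ^ n"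
    by (rule norm_det_K_le) (use space_P[OF p] in auto)
  also have "\<dots> = sqrt (real n) ^ n * (\<Prod>i<n. (h (p i))\<^sup>2)" by (simp add: power2_eq_square prod.distrib)
  also have "\<dots> \<le> had n * (\<Prod>i<n. (h (p i))\<^sup>2)"
  proof (rule mult_right_mono)
    have "sqrt (real n) ^ n \<le> sqrt (real (Suc n)) ^ n" by (intro power_mono) auto
    also have "\<dots> \<le> sqrt (real (Suc n)) ^ Suc n" by (intro power_increasing) auto
    finally show "sqrt (real n) ^ n \<le> had n" unfolding had_def .
  qed (auto intro!: prod_nonneg)
  finally show ?thesis .
qed

lemma norm_dl_le: "norm (dl n) \<le> had n * c ^ n"
  unfolding dl_def by (rule integrable_P_bounded(2)[OF measurable_minor norm_minor_le])

lemma integral_P_Suc: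
  fixes G :: "(nat \<Rightarrow> 'a) \<Rightarrow> complex"
  assumes G [measurable]: "G \<in> borel_measurable (P (Suc n))"
    and b: "\<And>p. p \<in> space (P (Suc n)) \<Longrightarrow> norm (G p) \<le> b * (\<Prod>i<Suc n. (h (p i))\<^sup>2)"
  shows "(LINT p|P (Suc n). G p) = (LINT r|M. LINT p|P n. G (p(n := r)))"
proof -
  interpret Pn: finite_product_sigma_finite "\<lambda>_::nat. M" "{..<n}" by standard simp
  interpret PP: pair_sigma_finite "P n" M ..
  have i: "insert n {..<n} = {..<Suc n}" by auto
  have m: "(\<lambda>(p, r). p(n := r)) \<in> measurable (P n \<Otimes>\<^sub>M M) (P (Suc n))"
    using measurable_add_dim[of n "{..<n}" "\<lambda>_. M"] unfolding i .
  have "(LINT p|P (Suc n). G p) = (LINT p|P n. LINT r|M. G (p(n := r)))"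
    using PM.product_integral_insert[of "{..<n}" n G] integrable_P_bounded(1)[OF G b] unfolding i by simp
  also have "\<dots> = (LINT r|M. LINT p|P n. G (p(n := r)))"
  proof (rule PP.Fubini_integral[symmetric])
    show "integrable (P n \<Otimes>\<^sub>M M) (\<lambda>(p, r). G (p(n := r)))"
    proof (rule lint_bound)
      show "integrable (P n \<Otimes>\<^sub>M M) (\<lambda>q. b * ((\<Prod>i<n. (h (fst q i))\<^sup>2) * (h (snd q))\<^sup>2))"
        by (intro integrable_mult_right integrable_pair_mult(1) Pn.sigma_finite_measure_axioms sigma_finite_measure_axioms integrable_prod_h h_square)
      show "(\<lambda>(p, r). G (p(n := r))) \<in> borel_measurable (P n \<Otimes>\<^sub>M M)"
        using measurable_compose[OF m G] by (simp add: case_prod_beta)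
      show "AE q in P n \<Otimes>\<^sub>M M. norm (case q of (p, r) \<Rightarrow> G (p(n := r))) \<le> norm (b * ((\<Prod>i<n. (h (fst q i))\<^sup>2) * (h (snd q))\<^sup>2))"
      proof (rule AE_I2)
        fix q assume q: "q \<in> space (P n \<Otimes>\<^sub>M M)"
        have "(fst q)(n := snd q) \<in> space (P (Suc n))" using measurable_space[OF m q] by (simp add: case_prod_beta)
        have e: "(\<Prod>i<n. (h (((fst q)(n := snd q)) i))\<^sup>2) = (\<Prod>i<n. (h (fst q i))\<^sup>2)"
          by (intro prod.cong refl) auto
        from b[OF \<open>(fst q)(n := snd q) \<in> space (P (Suc n))\<close>]
        have "norm (G ((fst q)(n := snd q))) \<le> b * ((\<Prod>i<n. (h (fst q i))\<^sup>2) * (h (snd q))\<^sup>2)"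
          unfolding prod.lessThan_Suc e by simp
        from order_trans[OF this abs_ge_self] show "norm (case q of (p, r) \<Rightarrow> G (p(n := r))) \<le> norm (b * ((\<Prod>i<n. (h (fst q i))\<^sup>2) * (h (snd q))\<^sup>2))"
          by (simp add: case_prod_beta)
      qed
    qed
  qed
  finally show ?thesis .
qed

lemma bd_eq_minor: "bd n r r p = mdet (Suc n) (\<lambda>i j. K ((p(n := r)) i) ((p(n := r)) j))"
  unfolding bd_def by (rule det_mat_cong) (auto simp: less_Suc_eq)

text \<open>When the bordering row and column carry the same variable, the bordered determinant is a
  principal minor with one more point.\<close>

lemma trace_nu: "(LINT s|M. nu n s s) = dl (Suc n)"
proof -
  have "dl (Suc n) = (LINT r|M. LINT p|P n. mdet (Suc n) (\<lambda>i j. K ((p(n := r)) i) ((p(n := r)) j)))"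
    unfolding dl_def
  by (rule integral_P_Suc[OF measurable_minor norm_minor_le])
  moreover have "nu n r r = (LINT p|P n. mdet (Suc n) (\<lambda>i j. K ((p(n := r)) i) ((p(n := r)) j)))" for r
    unfolding nu_def by (intro lint_cong bd_eq_minor)
  ultimately show ?thesis by simp
qed

lemma dl_0: "dl 0 = 1" and nu_0: "nu 0 s t = K s t"
proof -
  interpret E: prob_space "PiM {} (\<lambda>_::nat. M)" by (rule prob_spaceI) (simp add: PiM_empty emeasure_count_space_finite)
  show "dl 0 = 1" unfolding dl_def by (simp add: E.prob_space)
  show "nu 0 s t = K s t" unfolding nu_def bd_def by (simp add: det_mat_leibniz E.prob_space permutes_sing lessThan_Suc)
qed

text \<open>Expand along the bordering row. The corner entry yields \<open>dl\<close>, and the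
  remaining Suc n terms have equal integrals because they differ only by a relabelling of the
  integration variables.\<close>

lemma nu_Suc:
  assumes s: "s \<in> space M" and t: "t \<in> space M"
  shows "nu (Suc n) s t = dl (Suc n) * K s t - of_nat (Suc n) * (LINT r|M. K s r * nu n r t)"
proof -
  let ?C = "\<lambda>j p. mdet (Suc n) (\<lambda>i l. K (p i) (if l = j then t else p l))"
  let ?F = "\<lambda>j p. K s (p j) * ?C j p"
  have comp: "(\<lambda>p. p i) \<in> measurable (P (Suc n)) M" if "i < Suc n" for i
    using that by (intro measurable_component_singleton) simp
  have Fm: "?F j \<in> borel_measurable (P (Suc n))" if "j < Suc n" for j
    by (intro borel_measurable_times measurable_K measurable_det_K[where b = "\<lambda>l p. if l = j then t else p l"] measurable_const)
      (use comp that s t in auto)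
  have Fb: "norm (?F j p) \<le> h s * h t * had n * (\<Prod>i<Suc n. (h (p i))\<^sup>2)" if j: "j < Suc n" and p: "p \<in> space (P (Suc n))" for j p
  proof -
    have pj: "p i \<in> space M" if "i < Suc n" for i by (rule space_P[OF p that])
    have "norm (?C j p) \<le> (\<Prod>i<Suc n. h (p i)) * (\<Prod>l<Suc n. h (if l = j then t else p l)) * sqrt (real (Suc n)) ^ Suc n"
      by (rule norm_det_K_le) (use pj t in auto)
    then have "norm (?F j p) \<le> (h s * h (p j)) * ((\<Prod>i<Suc n. h (p i)) * (\<Prod>l<Suc n. h (if l = j then t else p l)) * had n)"
      unfolding norm_mult had_def using h_pos[OF s] h_pos[OF pj[OF j]] by (intro mult_mono K_bound s pj j) auto
    also have "(\<Prod>l<Suc n. h (if l = j then t else p l)) = h t * (\<Prod>l\<in>{..<Suc n} - {j}. h (p l))"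
      using j by (subst prod.remove[of _ j]) (auto intro!: prod.cong)
    also have "(h s * h (p j)) * ((\<Prod>i<Suc n. h (p i)) * (h t * (\<Prod>l\<in>{..<Suc n} - {j}. h (p l))) * had n) =
      h s * h t * had n * ((\<Prod>i<Suc n. h (p i)) * (h (p j) * (\<Prod>l\<in>{..<Suc n} - {j}. h (p l))))" by (simp only: mult_ac)
    also have "h (p j) * (\<Prod>l\<in>{..<Suc n} - {j}. h (p l)) = (\<Prod>i<Suc n. h (p i))"
      using j by (subst prod.remove[of "{..<Suc n}" j "\<lambda>i. h (p i)"]) auto
    finally show ?thesis unfolding power2_eq_square prod.distrib .
  qed
  have F: "(LINT p|P (Suc n). ?F j p) = (LINT r|M. K s r * nu n r t)" if j: "j < Suc n" for j
  proof -
    \<comment> \<open>Swapping the coordinates j and n reduces to the term j = n, in which the last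
      coordinate plays the role of r.\<close>
    define \<pi> where "\<pi> = Transposition.transpose j n"
    have \<pi>: "\<pi> permutes {..<Suc n}" unfolding \<pi>_def using j by (intro permutes_swap_id) auto
    have bij: "bij_betw \<pi> {..<Suc n} {..<Suc n}" using \<pi> by (rule permutes_imp_bij)
    have meas: "(\<lambda>p. \<lambda>i\<in>{..<Suc n}. p (\<pi> i)) \<in> measurable (P (Suc n)) (P (Suc n))"
      using permutes_in_image[OF \<pi>] by (intro measurable_restrict measurable_component_singleton) auto
    have d: "distr (P (Suc n)) (P (Suc n)) (\<lambda>p. \<lambda>i\<in>{..<Suc n}. p (\<pi> i)) = P (Suc n)"
      using PM.distr_PiM_reindex_finite[OF bij] by simp
    have "(LINT p|P (Suc n). ?F n p) = (LINT p|distr (P (Suc n)) (P (Suc n)) (\<lambda>p. \<lambda>i\<in>{..<Suc n}. p (\<pi> i)). ?F n p)"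
      unfolding d ..
    also have "\<dots> = (LINT p|P (Suc n). ?F n (\<lambda>i\<in>{..<Suc n}. p (\<pi> i)))"
      by (rule integral_distr[OF meas Fm]) simp
    also have "\<dots> = (LINT p|P (Suc n). ?F j p)"
    proof (intro lint_cong)
      fix p
      have "?C n (\<lambda>i\<in>{..<Suc n}. p (\<pi> i)) = mdet (Suc n) (\<lambda>i l. K (p (\<pi> i)) (if \<pi> l = j then t else p (\<pi> l)))"
        by (rule det_mat_cong) (auto simp: \<pi>_def Transposition.transpose_def)
      also have "\<dots> = ?C j p" by (rule det_mat_permute_both[OF \<pi>])
      finally show "?F n (\<lambda>i\<in>{..<Suc n}. p (\<pi> i)) = ?F j p" by (simp add: \<pi>_def)
    qed
    finally have "(LINT p|P (Suc n). ?F j p) = (LINT p|P (Suc n). ?F n p)" ..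
    also have "\<dots> = (LINT r|M. LINT p|P n. ?F n (p(n := r)))"
      by (rule integral_P_Suc[OF Fm Fb]) auto
    also have "\<dots> = (LINT r|M. K s r * nu n r t)"
    proof (intro lint_cong)
      fix r
      have "?C n (p(n := r)) = bd n r t p" for p
        unfolding bd_def by (rule det_mat_cong) (auto simp: less_Suc_eq)
      then show "(LINT p|P n. ?F n (p(n := r))) = K s r * nu n r t" unfolding nu_def by simp
    qed
    finally show ?thesis .
  qed
  have exp: "bd (Suc n) s t p = K s t * mdet (Suc n) (\<lambda>i j. K (p i) (p j)) - (\<Sum>j<Suc n. ?F j p)" for p
  proof -
    let ?f = "\<lambda>i j. K (if i < Suc n then p i else s) (if j < Suc n then p j else t)"
    have "mdet (Suc n) (\<lambda>i l. ?f i (if l = j then Suc n else l)) = ?C j p" if "j < Suc n" for j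
      by (rule det_mat_cong) auto
    moreover have "mdet (Suc n) (\<lambda>i j. ?f i j) = mdet (Suc n) (\<lambda>i j. K (p i) (p j))"
      by (rule det_mat_cong) auto
    ultimately show ?thesis unfolding bd_def det_bordered[of "Suc n" ?f] by simp
  qed
  have di: "integrable (P (Suc n)) (\<lambda>p. mdet (Suc n) (\<lambda>i j. K (p i) (p j)))"
    by (rule integrable_P_bounded(1)[OF measurable_minor norm_minor_le])
  have Fi: "integrable (P (Suc n)) (?F j)" if "j < Suc n" for j
    by (rule integrable_P_bounded(1)[OF Fm[OF that] Fb[OF that]])
  have "nu (Suc n) s t = (LINT p|P (Suc n). K s t * mdet (Suc n) (\<lambda>i j. K (p i) (p j))) - (LINT p|P (Suc n). (\<Sum>j<Suc n. ?F j p))"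
    unfolding nu_def exp by (intro Bochner_Integration.integral_diff integrable_mult_right di Bochner_Integration.integrable_sum Fi) auto
  also have "(LINT p|P (Suc n). (\<Sum>j<Suc n. ?F j p)) = (\<Sum>j<Suc n. (LINT p|P (Suc n). ?F j p))"
    by (intro Bochner_Integration.integral_sum Fi) auto
  also have "\<dots> = of_nat (Suc n) * (LINT r|M. K s r * nu n r t)"
    using F by (simp add: algebra_simps)
  finally show ?thesis unfolding dl_def by (simp add: mult.commute)
qed

text \<open>A common majorant of the coefficients; the factor 4^n in \<open>summable_w\<close> pays
  for the binomial coefficients that arise on expanding about 1.\<close>

definition w :: "nat \<Rightarrow> real" where "w n = had n / fact n * c ^ n"

lemma w_nonneg: "0 \<le> w n"
  unfolding w_def had_def using c_nonneg by (intro mult_nonneg_nonneg divide_nonneg_nonneg zero_le_power) auto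

lemma summable_w: "summable (\<lambda>n. 4 ^ n * w n)"
proof -
  have "summable (\<lambda>n. (4 * c) ^ n * (sqrt (real (Suc n)) ^ Suc n / fact n))" by (rule summable_hadamard_Suc) (simp add: c_nonneg)
  then show ?thesis unfolding w_def had_def power_mult_distrib by (simp only: mult_ac times_divide_eq_left times_divide_eq_right)
qed

lemma binomial_le_power4: "real (n choose k) \<le> 4 ^ n" "real (Suc n choose k) \<le> 2 * 4 ^ n"
proof -
  have b: "real (n choose k) \<le> 2 ^ n" for n k
  proof (cases "k \<le> n")
    case True
    then show ?thesis using binomial_le_pow2[of n k] by (metis of_nat_le_iff of_nat_numeral of_nat_power)
  qed (simp add: binomial_eq_0)
  have "(2::real) ^ n \<le> 4 ^ n" by (intro power_mono) auto
  then show "real (n choose k) \<le> 4 ^ n" "real (Suc n choose k) \<le> 2 * 4 ^ n"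
    using b[of n k] b[of "Suc n" k] unfolding power_Suc by linarith+
qed

text \<open>The k-th Taylor coefficient at \<lambda> = 1 of (- \<lambda>)^n / n!. Accordingly
  \<open>d k\<close> and \<open>N k\<close> are the Taylor coefficients at 1 of the determinant
  D(\<lambda>) = det (1 - \<lambda> K) and of the first minor N(\<lambda>).\<close>

definition cf :: "nat \<Rightarrow> nat \<Rightarrow> complex" where "cf k n = of_nat (n choose k) * ((-1) ^ n / fact n)"

definition d where "d k = (\<Sum>n. cf k n * dl n)"

definition N where "N k s t = (\<Sum>n. cf k n * nu n s t)"

lemma norm_cf_mult_le:
  assumes "norm z \<le> b * (had n * c ^ n)" "0 \<le> b"
  shows "norm (cf k n * z) \<le> b * (4 ^ n * w n)"
proof -
  have "norm (cf k n * z) = real (n choose k) * (norm z / fact n)" by (simp add: cf_def norm_mult norm_divide norm_power)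
  also have "\<dots> \<le> 4 ^ n * (b * (had n * c ^ n) / fact n)"
    using assms by (intro mult_mono divide_right_mono binomial_le_power4) auto
  finally show ?thesis by (simp add: w_def mult_ac)
qed

lemma summable_cf_mult:
  assumes "\<And>n. norm (z n) \<le> b * (had n * c ^ n)" "0 \<le> b"
  shows "summable (\<lambda>n. cf k n * z n)"
  by (rule summable_comparison_test'[where N = 0, OF summable_mult[OF summable_w, of b]]) (rule norm_cf_mult_le[OF assms])

lemma integral_cf_series:
  assumes z [measurable]: "\<And>n. z n \<in> borel_measurable M"
    and b: "\<And>n r. r \<in> space M \<Longrightarrow> norm (z n r) \<le> (b * (h r)\<^sup>2) * (had n * c ^ n)" and b0: "0 \<le> b"
  shows "(LINT r|M. (\<Sum>n. cf k n * z n r)) = (\<Sum>n. cf k n * (LINT r|M. z n r))"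
    and "norm (LINT r|M. z n r) \<le> b * c * (had n * c ^ n)"
proof -
  have i: "integrable M (z n)" for n
  proof (rule lint_bound[OF integrable_mult_right[OF h_square, of "b * (had n * c ^ n)"]])
    show "AE r in M. norm (z n r) \<le> norm (b * (had n * c ^ n) * (h r)\<^sup>2)"
    proof (rule AE_I2)
      fix r assume "r \<in> space M"
      from order_trans[OF b[OF this, of n] abs_ge_self] show "norm (z n r) \<le> norm (b * (had n * c ^ n) * (h r)\<^sup>2)" by (simp add: mult_ac)
    qed
  qed simp
  have bi: "norm (cf k n * z n r) \<le> (b * (4 ^ n * w n)) * (h r)\<^sup>2" if "r \<in> space M" for n r
    using norm_cf_mult_le[OF b[OF that], of k n] b0 by (simp add: mult_ac)
  show "(LINT r|M. (\<Sum>n. cf k n * z n r)) = (\<Sum>n. cf k n * (LINT r|M. z n r))"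
  proof (subst integral_suminf)
    show "integrable M (\<lambda>r. cf k n * z n r)" for n by (intro integrable_mult_right i)
    show "AE r in M. summable (\<lambda>n. norm (cf k n * z n r))"
    proof (rule AE_I2)
      fix r assume r: "r \<in> space M"
      show "summable (\<lambda>n. norm (cf k n * z n r))"
        by (rule summable_comparison_test'[where N = 0, OF summable_mult2[OF summable_mult[OF summable_w, of b], of "(h r)\<^sup>2"]])
          (simp only: real_norm_def abs_norm_cancel bi[OF r])
    qed
    show "summable (\<lambda>n. LINT r|M. norm (cf k n * z n r))"
    proof (rule summable_comparison_test'[where N = 0, OF summable_mult2[OF summable_mult[OF summable_w, of b], of c]])
      fix n
      have "(LINT r|M. norm (cf k n * z n r)) \<le> (LINT r|M. (b * (4 ^ n * w n)) * (h r)\<^sup>2)"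
        by (intro Bochner_Integration.integral_mono integrable_norm integrable_mult_right i h_square bi)
      then show "norm (LINT r|M. norm (cf k n * z n r)) \<le> (b * (4 ^ n * w n)) * c"
        by (simp add: c_def Bochner_Integration.integral_nonneg)
    qed
    show "(\<Sum>n. LINT r|M. cf k n * z n r) = (\<Sum>n. cf k n * (LINT r|M. z n r))" by simp
  qed
  have "norm (LINT r|M. z n r) \<le> (LINT r|M. (b * (had n * c ^ n)) * (h r)\<^sup>2)"
    by (rule order_trans[OF integral_norm_bound], intro Bochner_Integration.integral_mono integrable_norm i integrable_mult_right h_square)
      (use b in \<open>simp add: mult_ac\<close>)
  then show "norm (LINT r|M. z n r) \<le> b * c * (had n * c ^ n)" by (simp add: c_def mult_ac)
qed

lemma norm_nu_le': "s \<in> space M \<Longrightarrow> t \<in> space M \<Longrightarrow> norm (nu n s t) \<le> (h s * h t) * (had n * c ^ n)"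
  using norm_nu_le[of s t n] by (simp add: mult_ac)

lemma h_nonneg: "s \<in> space M \<Longrightarrow> 0 \<le> h s" using h_pos by (simp add: less_imp_le)

lemma K_nu_bound:
  assumes "s \<in> space M" "t \<in> space M" "r \<in> space M"
  shows "norm (K s r * nu n r t) \<le> ((h s * h t) * (h r)\<^sup>2) * (had n * c ^ n)"
proof -
  have "norm (K s r * nu n r t) \<le> (h s * h r) * ((h r * h t) * (had n * c ^ n))"
    unfolding norm_mult using assms by (intro mult_mono K_bound norm_nu_le' mult_nonneg_nonneg h_nonneg) auto
  then show ?thesis by (simp add: power2_eq_square mult_ac)
qed

definition J where "J k s t = (LINT r|M. K s r * N k r t)"

lemma J_eq:
  assumes s: "s \<in> space M" and t: "t \<in> space M"
  shows "J k s t = (\<Sum>n. cf k n * (LINT r|M. K s r * nu n r t))"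
proof -
  have "J k s t = (LINT r|M. (\<Sum>n. cf k n * (K s r * nu n r t)))"
    unfolding J_def
  proof (intro lint_cong)
    fix r assume r: "r \<in> space M"
    have "K s r * N k r t = (\<Sum>n. K s r * (cf k n * nu n r t))" unfolding N_def
      by (rule suminf_mult[symmetric], rule summable_cf_mult[OF norm_nu_le'[OF r t]]) (simp add: h_nonneg r t)
    then show "K s r * N k r t = (\<Sum>n. cf k n * (K s r * nu n r t))" by (simp add: mult_ac)
  qed
  also have "\<dots> = (\<Sum>n. cf k n * (LINT r|M. K s r * nu n r t))"
    by (rule integral_cf_series(1)[where b = "h s * h t"]) (use s t in \<open>auto intro!: K_nu_bound mult_nonneg_nonneg h_nonneg measurable_K measurable_nu borel_measurable_times\<close>)
  finally show ?thesis .
qed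

text \<open>The Taylor coefficients at 1 of Fredholm's equation N(\<lambda>) = D(\<lambda>) K +
  \<lambda> K N(\<lambda>). Writing \<lambda> = 1 + (\<lambda> - 1) in the last term produces the
  two summands with J.\<close>

lemma N_rec:
  assumes s: "s \<in> space M" and t: "t \<in> space M"
  shows "N 0 s t = d 0 * K s t + J 0 s t" and "N (Suc k) s t = d (Suc k) * K s t + (J (Suc k) s t + J k s t)"
proof -
  let ?I = "\<lambda>n. LINT r|M. K s r * nu n r t"
  have Ib: "norm (?I n) \<le> (h s * h t * c) * (had n * c ^ n)" for n
    by (rule integral_cf_series(2)) (use s t in \<open>auto intro!: K_nu_bound mult_nonneg_nonneg h_nonneg measurable_K measurable_nu borel_measurable_times\<close>)
  have b0: "0 \<le> h s * h t" "0 \<le> h s * h t * c" using s t by (simp_all add: h_nonneg c_nonneg)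
  have sI: "summable (\<lambda>n. cf k n * ?I n)" for k by (rule summable_cf_mult[OF Ib b0(2)])
  have sN: "summable (\<lambda>n. cf k n * nu n s t)" for k by (rule summable_cf_mult[OF norm_nu_le'[OF s t] b0(1)])
  have sd: "summable (\<lambda>n. cf k n * dl n)" for k by (rule summable_cf_mult[where b = 1]) (use norm_dl_le in auto)
  have cf1: "cf k (Suc n) * (of_nat (Suc n) * z) = - (of_nat (Suc n choose k) * ((-1) ^ n / fact n)) * z" for k n z
    unfolding cf_def fact_Suc by (simp del: of_nat_Suc binomial_Suc_Suc add: field_simps)
  have step: "cf k (Suc n) * nu (Suc n) s t = cf k (Suc n) * dl (Suc n) * K s t + of_nat (Suc n choose k) * ((-1) ^ n / fact n) * ?I n" for k n
  proof -
    have "cf k (Suc n) * nu (Suc n) s t = cf k (Suc n) * dl (Suc n) * K s t - cf k (Suc n) * (of_nat (Suc n) * ?I n)"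
      unfolding nu_Suc[OF s t] by (simp only: right_diff_distrib mult.assoc)
    then show ?thesis unfolding cf1 by simp
  qed
  have main: "N k s t = d k * K s t + R" if R: "(\<lambda>n. of_nat (Suc n choose k) * ((-1) ^ n / fact n) * ?I n) sums R" for k R
  proof -
    have "(\<lambda>n. cf k (Suc n) * dl (Suc n)) sums (d k - cf k 0 * dl 0)"
      using sd[of k] unfolding d_def by (subst sums_Suc_iff) (simp add: summable_sums)
    then have "(\<lambda>n. cf k (Suc n) * nu (Suc n) s t) sums ((d k - cf k 0 * dl 0) * K s t + R)"
      unfolding step by (intro sums_add sums_mult2 R)
    moreover have "(\<lambda>n. cf k (Suc n) * nu (Suc n) s t) sums (N k s t - cf k 0 * nu 0 s t)"
      using sN[of k] unfolding N_def by (subst sums_Suc_iff) (simp add: summable_sums)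
    ultimately have "N k s t - cf k 0 * nu 0 s t = (d k - cf k 0 * dl 0) * K s t + R" by (rule sums_unique2[rotated])
    then show ?thesis by (simp add: dl_0 nu_0 algebra_simps)
  qed
  have sJ: "(\<lambda>n. cf k n * ?I n) sums J k s t" for k unfolding J_eq[OF s t] by (rule summable_sums[OF sI])
  show "N 0 s t = d 0 * K s t + J 0 s t" using sJ[of 0] by (intro main) (simp add: cf_def)
  have "(\<lambda>n. cf (Suc k) n * ?I n + cf k n * ?I n) sums (J (Suc k) s t + J k s t)" by (intro sums_add sJ)
  then show "N (Suc k) s t = d (Suc k) * K s t + (J (Suc k) s t + J k s t)"
    by (intro main) (simp add: cf_def algebra_simps)
qed

text \<open>The Taylor coefficients at 1 of the identity tr N(\<lambda>) = - D'(\<lambda>).\<close>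

lemma trace_N: "(LINT s|M. N k s s) = - of_nat (Suc k) * d (Suc k)"
proof -
  have "(LINT s|M. N k s s) = (\<Sum>n. cf k n * (LINT s|M. nu n s s))"
    unfolding N_def
    by (rule integral_cf_series(1)[where b = 1]) (use norm_nu_le' in \<open>auto intro!: measurable_nu simp: power2_eq_square\<close>)
  also have "\<dots> = (\<Sum>n. - of_nat (Suc k) * (cf (Suc k) (Suc n) * dl (Suc n)))"
  proof (intro suminf_cong)
    fix n
    have "of_nat (Suc k) * of_nat (Suc n choose Suc k) = (of_nat (Suc n) * of_nat (n choose k) :: complex)"
      unfolding of_nat_mult[symmetric] Suc_times_binomial ..
    moreover have "of_nat (Suc k) * cf (Suc k) (Suc n) = - (of_nat (Suc k) * of_nat (Suc n choose Suc k)) * ((-1) ^ n / (of_nat (Suc n) * fact n))"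
      unfolding cf_def fact_Suc by (simp del: of_nat_Suc binomial_Suc_Suc)
    ultimately have "of_nat (Suc k) * cf (Suc k) (Suc n) = - cf k n"
      unfolding cf_def by (simp del: of_nat_Suc binomial_Suc_Suc)
    then have "- of_nat (Suc k) * cf (Suc k) (Suc n) = cf k n" by (simp only: mult_minus_left minus_minus)
    then show "cf k n * (LINT s|M. nu n s s) = - of_nat (Suc k) * (cf (Suc k) (Suc n) * dl (Suc n))"
      unfolding trace_nu by (simp only: mult.assoc[symmetric])
  qed
  also have "\<dots> = - of_nat (Suc k) * (\<Sum>n. cf (Suc k) (Suc n) * dl (Suc n))"
  proof (rule suminf_mult)
    have "summable (\<lambda>n. cf (Suc k) n * dl n)" by (rule summable_cf_mult[where b = 1]) (use norm_dl_le in auto)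
    then show "summable (\<lambda>n. cf (Suc k) (Suc n) * dl (Suc n))" by (subst summable_Suc_iff)
  qed
  also have "(\<Sum>n. cf (Suc k) (Suc n) * dl (Suc n)) = d (Suc k)"
  proof -
    have "summable (\<lambda>n. cf (Suc k) n * dl n)" by (rule summable_cf_mult[where b = 1]) (use norm_dl_le in auto)
    from suminf_split_head[OF this] show ?thesis unfolding d_def by (simp add: cf_def)
  qed
  finally show ?thesis .
qed

text \<open>
  The \<open>d k\<close> are the Taylor coefficients at \<open>1\<close> of the entire function \<open>\<lambda> \<mapsto> det (1 - \<lambda> K)\<close>, whose value at
  \<open>0\<close> is \<open>1\<close>.
\<close>

lemma ex_d_nonzero: "\<exists>k. d k \<noteq> 0"
proof (rule ccontr)
  assume "\<nexists>k. d k \<noteq> 0"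
  then have d0: "d k = 0" for k by simp
  define a where "a n = (-1) ^ n / fact n * dl n" for n
  have a_le: "norm (a n) \<le> w n" for n
    using norm_dl_le[of n] by (simp add: a_def w_def norm_mult norm_divide norm_power divide_right_mono)
  have sums: "summable (\<lambda>n. of_nat (n choose k) * a n)" for k
  proof -
    have "summable (\<lambda>n. cf k n * dl n)" by (rule summable_cf_mult[where b = 1]) (use norm_dl_le in auto)
    then show ?thesis by (simp add: cf_def a_def mult_ac)
  qed
  have da: "d k = (\<Sum>n. of_nat (n choose k) * a n)" for k unfolding d_def cf_def a_def by (simp add: mult_ac)
  obtain L where L: "norm (\<Sum>i. 4 ^ (i + L) * w (i + L)) < 1"
    using suminf_exist_split[of 1 "\<lambda>n. 4 ^ n * w n"] summable_w by auto
  \<comment> \<open>The coefficient of a n in the Taylor polynomial of order L about 1, evaluated at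
    0. For n < L the alternating binomial sum is complete, so only a 0 = 1 survives, and the terms
    from L on are smaller than 1 in sum.\<close>
  define b where "b n = (\<Sum>k\<le>L. (-1) ^ k * (of_nat (n choose k) :: complex))" for n
  have b1: "b n = (if n = 0 then 1 else 0)" if "n < L" for n
  proof -
    have "b n = (\<Sum>k\<le>n. (-1) ^ k * of_nat (n choose k))"
      unfolding b_def using that by (intro sum.mono_neutral_right) auto
    also have "\<dots> = (if n = 0 then 1 else 0)" using choose_alternating_sum[of n, where ?'a = complex] by auto
    finally show ?thesis .
  qed
  have b2: "norm (b n) \<le> 2 ^ n" for n
  proof -
    have "norm (b n) \<le> (\<Sum>k\<le>L. norm ((-1) ^ k * (of_nat (n choose k) :: complex)))" unfolding b_def by (rule norm_sum)
    also have "\<dots> = (\<Sum>k\<le>L. real (n choose k))" by (simp add: norm_mult norm_power)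
    also have "\<dots> \<le> (\<Sum>k\<le>max L n. real (n choose k))" by (intro sum_mono2) auto
    also have "\<dots> = (\<Sum>k\<le>n. real (n choose k))" by (intro sum.mono_neutral_right) auto
    also have "\<dots> = real (2 ^ n)" unfolding of_nat_sum[symmetric] choose_row_sum ..
    finally show ?thesis by simp
  qed
  have ba: "norm (b n * a n) \<le> 4 ^ n * w n" for n
  proof -
    have "norm (b n * a n) \<le> 4 ^ n * w n" unfolding norm_mult
      by (intro mult_mono a_le order_trans[OF b2] power_mono) auto
    then show ?thesis .
  qed
  have sba: "summable (\<lambda>n. b n * a n)" by (rule summable_comparison_test'[where N = 0, OF summable_w]) (rule ba)
  have "0 = (\<Sum>k\<le>L. (-1) ^ k * d k)" by (simp add: d0)
  also have "\<dots> = (\<Sum>k\<le>L. (\<Sum>n. (-1) ^ k * (of_nat (n choose k) * a n)))"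
    unfolding da by (intro sum.cong refl suminf_mult[symmetric] sums)
  also have "\<dots> = (\<Sum>n. \<Sum>k\<le>L. (-1) ^ k * (of_nat (n choose k) * a n))"
    by (intro suminf_sum[symmetric] summable_mult sums)
  also have "\<dots> = (\<Sum>n. b n * a n)" by (simp only: b_def sum_distrib_right mult.assoc)
  also have "\<dots> = (\<Sum>n. b (n + L) * a (n + L)) + (\<Sum>n<L. b n * a n)" by (rule suminf_split_initial_segment[OF sba])
  finally have e: "(\<Sum>n<L. b n * a n) = - (\<Sum>n. b (n + L) * a (n + L))" by (simp add: eq_neg_iff_add_eq_0 add.commute)
  have s': "summable (\<lambda>i. 4 ^ (i + L) * w (i + L))" using summable_w by (subst summable_iff_shift)
  have "norm (\<Sum>n. b (n + L) * a (n + L)) \<le> (\<Sum>i. 4 ^ (i + L) * w (i + L))" by (rule norm_suminf_le[OF ba s'])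
  then have lt: "norm (\<Sum>n<L. b n * a n) < 1" using L unfolding e by simp
  show False
  proof (cases "L = 0")
    case True
    then have "norm (\<Sum>i. 4 ^ i * w i) < 1" using L by simp
    moreover have "w 0 \<le> (\<Sum>i. 4 ^ i * w i)" using sum_le_suminf[OF summable_w, of "{0}"] w_nonneg by simp
    moreover have "1 \<le> w 0" using a_le[of 0] by (simp add: a_def dl_0)
    ultimately show False by simp
  next
    case False
    have "(\<Sum>n<L. b n * a n) = (\<Sum>n<L. if n = 0 then a n else 0)" using b1 by (intro sum.cong refl) auto
    also have "\<dots> = a 0" using False by simp
    finally show False using lt by (simp add: a_def dl_0)
  qed
qed

text \<open>Let k be the order of the zero of D at 1. By \<open>trace_N\<close> the coefficient of
  N(\<lambda>) of order k - 1 is not zero. For the first nonvanishing coefficient j, both d j and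
  the lower order term in \<open>N_rec\<close> vanish, leaving N j = K N j; a column of it is the
  eigenfunction.\<close>

theorem eigenfunction:
  assumes "fredholm_det M K = 0"
  shows "\<exists>g C. g \<in> borel_measurable M \<and> (\<forall>s\<in>space M. norm (g s) \<le> C * h s) \<and> (\<exists>s\<in>space M. g s \<noteq> 0) \<and>
    (\<forall>s\<in>space M. g s = (LINT r|M. K s r * g r))"
proof -
  have d0: "d 0 = 0" using assms unfolding fredholm_det_def d_def cf_def dl_def by simp
  define k where "k = (LEAST k. d k \<noteq> 0)"
  have k: "d k \<noteq> 0" unfolding k_def using ex_d_nonzero by (rule LeastI_ex)
  have kl: "d j = 0" if "j < k" for j using not_less_Least[of j "\<lambda>k. d k \<noteq> 0"] that unfolding k_def by blast
  obtain m where m: "k = Suc m" using k d0 by (cases k) auto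
  let ?Q = "\<lambda>j. \<exists>s\<in>space M. \<exists>t\<in>space M. N j s t \<noteq> 0"
  have Qm: "?Q m"
  proof (rule ccontr)
    assume "\<not> ?Q m"
    then have "(LINT s|M. N m s s) = (LINT s|M. 0)" by (intro lint_cong) auto
    then show False using k m trace_N[of m] by (simp del: of_nat_Suc)
  qed
  define j where "j = (LEAST j. ?Q j)"
  have j: "?Q j" unfolding j_def by (rule LeastI[of ?Q, OF Qm])
  have jm: "j \<le> m" unfolding j_def by (rule Least_le[of ?Q, OF Qm])
  have eq: "N j s t = J j s t" if "s \<in> space M" "t \<in> space M" for s t
  proof (cases j)
    case 0
    then show ?thesis using N_rec(1)[OF that] d0 by simp
  next
    case (Suc i)
    have "\<not> ?Q i" using not_less_Least[of i ?Q] Suc unfolding j_def[symmetric] by simp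
    then have "J i s t = (LINT r|M. 0)" unfolding J_def using that by (intro lint_cong) auto
    then show ?thesis using N_rec(2)[OF that, of i] kl[of "Suc i"] jm m Suc by simp
  qed
  obtain s t where st: "s \<in> space M" "t \<in> space M" "N j s t \<noteq> 0" using j by blast
  have "(\<lambda>r. N j r t) \<in> borel_measurable M"
    unfolding N_def by (intro borel_measurable_suminf borel_measurable_times borel_measurable_const measurable_nu) (use st in auto)
  moreover have "norm (N j r t) \<le> (h t * (\<Sum>n. 4 ^ n * w n)) * h r" if r: "r \<in> space M" for r
  proof -
    have "norm (N j r t) \<le> (\<Sum>n. (h r * h t) * (4 ^ n * w n))" unfolding N_def
      using st r by (intro norm_suminf_le norm_cf_mult_le norm_nu_le' summable_mult summable_w) (auto simp: h_nonneg)
    also have "\<dots> = (h r * h t) * (\<Sum>n. 4 ^ n * w n)" by (rule suminf_mult[OF summable_w])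
    finally show ?thesis by (simp add: mult_ac)
  qed
  moreover have "\<forall>s\<in>space M. N j s t = (LINT r|M. K s r * N j r t)" using eq st(2) unfolding J_def by blast
  ultimately show ?thesis using st by (intro exI[of _ "\<lambda>r. N j r t"] exI[of _ "h t * (\<Sum>n. 4 ^ n * w n)"]) blast
qed

end

section \<open>Nonvanishing of the KPZ determinant\<close>

abbreviation l2sq :: "(real \<Rightarrow> complex) \<Rightarrow> ennreal" where
  "l2sq f \<equiv> \<integral>\<^sup>+t. ennreal ((norm (f t))\<^sup>2) \<partial>lborel"

abbreviation lap :: "(real \<Rightarrow> complex) \<Rightarrow> real \<Rightarrow> real \<Rightarrow> complex" where
  "lap f \<delta> y \<equiv> LINT t|lborel. f t * exp (of_real t * vline \<delta> y)"

lemma one_pos: "0 < (1::real)"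
  by simp

section \<open>Plancherel's inequality by Gaussian regularisation\<close>

lemma fourier_gaussian:
  assumes \<epsilon>: "0 < \<epsilon>"
  shows "(LINT s|lborel. exp (- (\<epsilon> * s)\<^sup>2 / 2) *\<^sub>R iexp (d * s)) = of_real (2 * pi * normal_density 0 \<epsilon> d)"
proof -
  let ?f = "\<lambda>r. std_normal_density r *\<^sub>R iexp (d / \<epsilon> * r)"
  have "of_real (exp (- (d / \<epsilon>)\<^sup>2 / 2)) = char std_normal_distribution (d / \<epsilon>)"
    by (simp add: char_std_normal_distribution)
  also have "\<dots> = (LINT r|lborel. ?f r)"
    unfolding char_def by (subst integral_density) auto
  also have "\<dots> = \<epsilon> *\<^sub>R (LINT s|lborel. ?f (0 + \<epsilon> * s))"
    using lborel_integral_real_affine[of \<epsilon> ?f 0] \<epsilon> by simp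
  also have "(LINT s|lborel. ?f (0 + \<epsilon> * s)) = (LINT s|lborel. (1 / sqrt (2 * pi)) *\<^sub>R (exp (- (\<epsilon> * s)\<^sup>2 / 2) *\<^sub>R iexp (d * s)))"
    using \<epsilon> by (intro lint_cong) (simp add: normal_density_def)
  also have "\<dots> = (1 / sqrt (2 * pi)) *\<^sub>R (LINT s|lborel. exp (- (\<epsilon> * s)\<^sup>2 / 2) *\<^sub>R iexp (d * s))"
    by (rule Bochner_Integration.integral_scaleR_right)
  finally have "(sqrt (2 * pi) / \<epsilon>) *\<^sub>R of_real (exp (- (d / \<epsilon>)\<^sup>2 / 2)) = (LINT s|lborel. exp (- (\<epsilon> * s)\<^sup>2 / 2) *\<^sub>R iexp (d * s))"
    using \<epsilon> by simp
  moreover have "sqrt (2 * pi) / \<epsilon> * exp (- (d / \<epsilon>)\<^sup>2 / 2) = 2 * pi * normal_density 0 \<epsilon> d"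
  proof -
    have "2 * pi = sqrt (2 * pi) * sqrt (2 * pi)" by simp
    then have "2 * pi / sqrt (2 * pi * \<epsilon>\<^sup>2) = sqrt (2 * pi) / \<epsilon>"
      using \<epsilon> by (simp add: real_sqrt_mult field_simps)
    moreover have "2 * pi * normal_density 0 \<epsilon> d = 2 * pi / sqrt (2 * pi * \<epsilon>\<^sup>2) * exp (- (d / \<epsilon>)\<^sup>2 / 2)"
      by (simp add: normal_density_def power_divide)
    ultimately show ?thesis by (simp only:)
  qed
  ultimately show ?thesis by (simp only: scaleR_conv_of_real of_real_mult[symmetric])
qed

lemma nn_integral_normal_density: "0 < \<sigma> \<Longrightarrow> (\<integral>\<^sup>+y. ennreal (normal_density \<mu> \<sigma> y) \<partial>lborel) = 1"
  by (subst nn_integral_eq_integral) (auto simp: normal_density_nonneg)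

text \<open>Bound a(y) a(y') by half the sum of the squares; in each half the density integrates to
  1 over the other variable.\<close>

lemma gaussian_convolution_bound:
  fixes a :: "real \<Rightarrow> real"
  assumes a [measurable]: "a \<in> borel_measurable borel" and a0: "\<And>y. 0 \<le> a y" and \<epsilon>: "0 < \<epsilon>"
  shows "(\<integral>\<^sup>+p. ennreal (a (fst p) * a (snd p) * normal_density 0 \<epsilon> (fst p - snd p)) \<partial>(lborel \<Otimes>\<^sub>M lborel)) \<le> (\<integral>\<^sup>+y. ennreal ((a y)\<^sup>2) \<partial>lborel)"
proof -
  let ?n = "\<lambda>p. normal_density 0 \<epsilon> (fst p - snd p)"
  let ?I = "\<integral>\<^sup>+y. ennreal ((a y)\<^sup>2) \<partial>lborel"
  have half_sum: "ennreal (1/2) * (ennreal A * ennreal N) + ennreal (1/2) * (ennreal B * ennreal N) = ennreal ((1/2 * A + 1/2 * B) * N)"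
    if "0 \<le> A" "0 \<le> B" "0 \<le> N" for A B N :: real
  proof -
    have "0 \<le> (1/2 :: real)" by simp
    then show ?thesis by (simp only: ennreal_mult[symmetric] ennreal_plus[symmetric] mult_nonneg_nonneg that distrib_right mult.assoc)
  qed
  have "(\<integral>\<^sup>+p. ennreal (a (fst p) * a (snd p) * ?n p) \<partial>(lborel \<Otimes>\<^sub>M lborel)) \<le>
    (\<integral>\<^sup>+p. ennreal (1/2) * (ennreal ((a (fst p))\<^sup>2) * ennreal (?n p)) + ennreal (1/2) * (ennreal ((a (snd p))\<^sup>2) * ennreal (?n p)) \<partial>(lborel \<Otimes>\<^sub>M lborel))"
  proof (rule nn_integral_mono)
    fix p :: "real \<times> real"
    have "0 \<le> (a (fst p) - a (snd p))\<^sup>2" by simp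
    then have "a (fst p) * a (snd p) \<le> 1/2 * (a (fst p))\<^sup>2 + 1/2 * (a (snd p))\<^sup>2" by (simp add: power2_diff)
    then have "a (fst p) * a (snd p) * ?n p \<le> (1/2 * (a (fst p))\<^sup>2 + 1/2 * (a (snd p))\<^sup>2) * ?n p"
      by (rule mult_right_mono) (rule normal_density_nonneg)
    then show "ennreal (a (fst p) * a (snd p) * ?n p) \<le> ennreal (1/2) * (ennreal ((a (fst p))\<^sup>2) * ennreal (?n p)) + ennreal (1/2) * (ennreal ((a (snd p))\<^sup>2) * ennreal (?n p))"
      unfolding half_sum[OF zero_le_power2 zero_le_power2 normal_density_nonneg] by (rule ennreal_leI)
  qed
  also have "\<dots> = ennreal (1/2) * (\<integral>\<^sup>+p. ennreal ((a (fst p))\<^sup>2) * ennreal (?n p) \<partial>(lborel \<Otimes>\<^sub>M lborel)) +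
    ennreal (1/2) * (\<integral>\<^sup>+p. ennreal ((a (snd p))\<^sup>2) * ennreal (?n p) \<partial>(lborel \<Otimes>\<^sub>M lborel))"
    by (simp add: nn_integral_add nn_integral_cmult)
  also have "(\<integral>\<^sup>+p. ennreal ((a (fst p))\<^sup>2) * ennreal (?n p) \<partial>(lborel \<Otimes>\<^sub>M lborel)) = ?I"
  proof -
    have "(\<integral>\<^sup>+p. ennreal ((a (fst p))\<^sup>2) * ennreal (?n p) \<partial>(lborel \<Otimes>\<^sub>M lborel)) =
      (\<integral>\<^sup>+y. \<integral>\<^sup>+y'. ennreal ((a y)\<^sup>2) * ennreal (normal_density y \<epsilon> y') \<partial>lborel \<partial>lborel)"
      by (subst lborel.nn_integral_fst[symmetric]) (simp_all add: normal_density_def power2_commute)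
    also have "\<dots> = ?I" using \<epsilon> by (simp add: nn_integral_cmult nn_integral_normal_density)
    finally show ?thesis .
  qed
  also have "(\<integral>\<^sup>+p. ennreal ((a (snd p))\<^sup>2) * ennreal (?n p) \<partial>(lborel \<Otimes>\<^sub>M lborel)) = ?I"
  proof -
    have "(\<integral>\<^sup>+p. ennreal ((a (snd p))\<^sup>2) * ennreal (?n p) \<partial>(lborel \<Otimes>\<^sub>M lborel)) =
      (\<integral>\<^sup>+y'. \<integral>\<^sup>+y. ennreal ((a y')\<^sup>2) * ennreal (normal_density y' \<epsilon> y) \<partial>lborel \<partial>lborel)"
      by (subst lborel_pair.nn_integral_snd[symmetric]) (simp_all add: normal_density_def)
    also have "\<dots> = ?I" using \<epsilon> by (simp add: nn_integral_cmult nn_integral_normal_density)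
    finally show ?thesis .
  qed
  also have "ennreal (1/2) * ?I + ennreal (1/2) * ?I = ?I"
  proof -
    have "0 \<le> (1/2 :: real)" by simp
    then have "ennreal (1/2) + ennreal (1/2) = ennreal (1/2 + 1/2)" by (simp only: ennreal_plus)
    then show ?thesis unfolding distrib_right[symmetric] by simp
  qed
  finally show ?thesis .
qed

text \<open>With a Gaussian factor in s, Fubini turns the left hand side into a double integral of
  f(y) cnj f(y') against 2 pi times a normal density in y - y', bounded by
  \<open>gaussian_convolution_bound\<close> uniformly in the width. The inequality suffices below,
  so f need not be approximated.\<close>

lemma plancherel_le:
  fixes f :: "real \<Rightarrow> complex"
  assumes f: "integrable lborel f"
  shows "(\<integral>\<^sup>+s. ennreal ((norm (LINT y|lborel. f y * iexp (s * y)))\<^sup>2) \<partial>lborel) \<le>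
    ennreal (2 * pi) * l2sq f"
proof -
  let ?L = "lborel \<Otimes>\<^sub>M lborel :: (real \<times> real) measure"
  have [measurable]: "f \<in> borel_measurable borel" using f by auto
  define W where "W s = (LINT y|lborel. f y * iexp (s * y))" for s
  let ?R = "ennreal (2 * pi) * l2sq f"
  have W [measurable]: "W \<in> borel_measurable borel"
    unfolding W_def[abs_def] by (rule lborel.borel_measurable_lebesgue_integral) measurable
  have fi: "integrable lborel (\<lambda>y. f y * iexp (s * y))" for s
    by (rule lint_bound[OF f]) (auto simp: norm_mult)
  define B where "B = (LINT y|lborel. norm (f y))"
  have WB: "norm (W s) \<le> B" for s
    using integral_norm_bound[of lborel "\<lambda>y. f y * iexp (s * y)"] by (simp add: W_def B_def norm_mult)
  have reg: "(\<integral>\<^sup>+s. ennreal (exp (- (\<epsilon> * s)\<^sup>2 / 2) * (norm (W s))\<^sup>2) \<partial>lborel) \<le> ?R" if \<epsilon>: "0 < \<epsilon>" for \<epsilon>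
  proof -
    let ?e = "\<lambda>s. exp (- (\<epsilon> * s)\<^sup>2 / 2)"
    have ei: "integrable lborel ?e"
      using integrable_gaussian[of "\<epsilon>\<^sup>2 / 2"] \<epsilon> by (simp add: power_mult_distrib mult.commute)
    have i: "integrable lborel (\<lambda>s. ?e s * (norm (W s))\<^sup>2)"
    proof (rule lint_bound[OF integrable_mult_left[OF ei, of "B\<^sup>2"]])
      show "AE s in lborel. norm (?e s * (norm (W s))\<^sup>2) \<le> norm (?e s * B\<^sup>2)"
        using WB by (intro AE_I2) (simp add: power_mono)
    qed simp
    have sq: "of_real ((norm (W s))\<^sup>2) = (LINT p|?L. f (fst p) * cnj (f (snd p)) * iexp ((fst p - snd p) * s))" for s
    proof -
      have "of_real ((norm (W s))\<^sup>2) = W s * cnj (W s)" by (simp only: complex_norm_square)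
      also have "cnj (W s) = (LINT y|lborel. cnj (f y * iexp (s * y)))" unfolding W_def
        by (rule Bochner_Integration.integral_cnj[symmetric])
      also have "W s * \<dots> = (LINT p|?L. (f (fst p) * iexp (s * fst p)) * cnj (f (snd p) * iexp (s * snd p)))"
        unfolding W_def by (rule integrable_pair_mult(2)[symmetric]) (rule sigma_finite_lborel, rule sigma_finite_lborel, rule fi, rule integrable_bounded_linear[OF bounded_linear_cnj fi])
      also have "\<dots> = (LINT p|?L. f (fst p) * cnj (f (snd p)) * iexp ((fst p - snd p) * s))"
        by (intro lint_cong) (simp add: exp_cnj exp_diff exp_minus field_simps)
      finally show ?thesis .
    qed
    interpret Q: pair_sigma_finite "lborel :: real measure" ?L
      by (intro pair_sigma_finite.intro sigma_finite_lborel sigma_finite_pair_measure)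
    let ?H = "\<lambda>s p. ?e s *\<^sub>R (f (fst p) * cnj (f (snd p)) * iexp ((fst p - snd p) * s))"
    have "of_real (LINT s|lborel. ?e s * (norm (W s))\<^sup>2) = (LINT s|lborel. complex_of_real (?e s * (norm (W s))\<^sup>2))"
      by (rule integral_complex_of_real[symmetric])
    also have "\<dots> = (LINT s|lborel. LINT p|?L. ?H s p)"
      unfolding of_real_mult sq by (intro lint_cong) (simp add: scaleR_conv_of_real)
    also have "\<dots> = (LINT p|?L. LINT s|lborel. ?H s p)"
    proof (rule Q.Fubini_integral[symmetric], rule lint_bound)
      have "integrable ?L (\<lambda>p. norm (f (fst p)) * norm (f (snd p)))"
        by (intro integrable_pair_mult(1) sigma_finite_lborel integrable_norm f)
      then show "integrable (lborel \<Otimes>\<^sub>M ?L) (\<lambda>q. ?e (fst q) * (norm (f (fst (snd q))) * norm (f (snd (snd q)))))"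
        by (intro integrable_pair_mult(1)[of _ _ _ "\<lambda>p. norm (f (fst p)) * norm (f (snd p))"] sigma_finite_lborel sigma_finite_pair_measure ei)
      have [measurable]: "(\<lambda>y. cnj (f y)) \<in> borel_measurable borel"
        by (rule measurable_compose[OF _ borel_measurable_continuous_onI[OF continuous_on_cnj[OF continuous_on_id]]]) simp
      have [measurable]: "iexp \<in> borel_measurable borel" by (intro borel_measurable_continuous_onI continuous_intros)
      have [measurable]: "(\<lambda>q. iexp ((fst (snd q) - snd (snd q)) * fst q)) \<in> borel_measurable (lborel \<Otimes>\<^sub>M ?L)"
        by (rule measurable_compose[where g = iexp and N = borel]) measurable
      show "(\<lambda>(s, p). ?H s p) \<in> borel_measurable (lborel \<Otimes>\<^sub>M ?L)" unfolding case_prod_beta by measurable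
      show "AE q in lborel \<Otimes>\<^sub>M ?L. norm (case q of (s, p) \<Rightarrow> ?H s p) \<le> norm (?e (fst q) * (norm (f (fst (snd q))) * norm (f (snd (snd q)))))"
        by (intro AE_I2) (simp add: case_prod_beta norm_mult)
    qed
    also have "\<dots> = (LINT p|?L. f (fst p) * cnj (f (snd p)) * of_real (2 * pi * normal_density 0 \<epsilon> (fst p - snd p)))"
    proof (intro lint_cong)
      fix p :: "real \<times> real"
      have "(LINT s|lborel. ?H s p) = (LINT s|lborel. f (fst p) * cnj (f (snd p)) * (?e s *\<^sub>R iexp ((fst p - snd p) * s)))"
        by (intro lint_cong) (simp only: mult_scaleR_right)
      also have "\<dots> = f (fst p) * cnj (f (snd p)) * (LINT s|lborel. ?e s *\<^sub>R iexp ((fst p - snd p) * s))"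
        by (rule lint_cmult)
      finally show "(LINT s|lborel. ?H s p) = f (fst p) * cnj (f (snd p)) * of_real (2 * pi * normal_density 0 \<epsilon> (fst p - snd p))"
        unfolding fourier_gaussian[OF \<epsilon>] .
    qed
    finally have e: "of_real (LINT s|lborel. ?e s * (norm (W s))\<^sup>2) = (LINT p|?L. f (fst p) * cnj (f (snd p)) * of_real (2 * pi * normal_density 0 \<epsilon> (fst p - snd p)))" .
    let ?X = "\<lambda>p. f (fst p) * cnj (f (snd p)) * of_real (2 * pi * normal_density 0 \<epsilon> (fst p - snd p))"
    have "(\<integral>\<^sup>+s. ennreal (?e s * (norm (W s))\<^sup>2) \<partial>lborel) = ennreal (LINT s|lborel. ?e s * (norm (W s))\<^sup>2)"
      by (rule nn_integral_eq_integral[OF i]) simp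
    also have "(LINT s|lborel. ?e s * (norm (W s))\<^sup>2) \<le> norm (integral\<^sup>L ?L ?X)"
      unfolding e[symmetric] norm_of_real by simp
    also have "ennreal (norm (integral\<^sup>L ?L ?X)) \<le> (\<integral>\<^sup>+p. ennreal (norm (?X p)) \<partial>?L)"
      by (cases "integrable ?L ?X") (auto intro: integral_norm_bound_ennreal simp: not_integrable_integral_eq)
    also have "\<dots> = (\<integral>\<^sup>+p. ennreal (2 * pi) * ennreal (norm (f (fst p)) * norm (f (snd p)) * normal_density 0 \<epsilon> (fst p - snd p)) \<partial>?L)"
      by (intro nn_integral_cong) (simp add: norm_mult ennreal_mult[symmetric] normal_density_nonneg mult_ac)
    also have "\<dots> = ennreal (2 * pi) * (\<integral>\<^sup>+p. ennreal (norm (f (fst p)) * norm (f (snd p)) * normal_density 0 \<epsilon> (fst p - snd p)) \<partial>?L)"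
      by (rule nn_integral_cmult) measurable
    also have "\<dots> \<le> ?R" by (intro mult_left_mono gaussian_convolution_bound \<epsilon>) auto
    finally show ?thesis by (simp add: ennreal_leI)
  qed
  \<comment> \<open>The Gaussian factor is removed by Fatou's lemma along \<epsilon> = 1 / (n +
    1).\<close>
  let ?u = "\<lambda>n s. ennreal (exp (- (1 / real (Suc n) * s)\<^sup>2 / 2) * (norm (W s))\<^sup>2)"
  have "(\<integral>\<^sup>+s. ennreal ((norm (W s))\<^sup>2) \<partial>lborel) = (\<integral>\<^sup>+s. liminf (\<lambda>n. ?u n s) \<partial>lborel)"
  proof (intro nn_integral_cong)
    fix s
    have "(\<lambda>n. exp (- (1 / real (Suc n) * s)\<^sup>2 / 2) * (norm (W s))\<^sup>2) \<longlonglongrightarrow> exp (- (0 * s)\<^sup>2 / 2) * (norm (W s))\<^sup>2"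
      by (intro tendsto_intros LIMSEQ_Suc[OF lim_1_over_n]) simp
    then have "(\<lambda>n. ?u n s) \<longlonglongrightarrow> ennreal ((norm (W s))\<^sup>2)" by (intro tendsto_ennrealI) simp
    then show "ennreal ((norm (W s))\<^sup>2) = liminf (\<lambda>n. ?u n s)" by (intro lim_imp_Liminf[symmetric]) auto
  qed
  also have "\<dots> \<le> liminf (\<lambda>n. \<integral>\<^sup>+s. ?u n s \<partial>lborel)" by (rule nn_integral_liminf) measurable
  also have "\<dots> \<le> limsup (\<lambda>n. \<integral>\<^sup>+s. ?u n s \<partial>lborel)" by (rule Liminf_le_Limsup) simp
  also have "\<dots> \<le> ?R" by (intro Limsup_bounded always_eventually allI reg) simp
  finally show ?thesis unfolding W_def .
qed

section \<open>The Airy transform on the whole line\<close>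

lemma integrable_decay: "0 < k \<Longrightarrow> integrable lborel (\<lambda>t. indicator {0<..} t * exp (- k * t) :: real)"
proof -
  assume k: "0 < k"
  have "integrable pos_half_line (\<lambda>r. exp (of_real r * of_real (- k) :: complex))" using k by (intro integrable_exp_pos_half_line) simp
  then have "integrable lborel (\<lambda>r. indicator {0<..} r *\<^sub>R exp (of_real r * of_real (- k) :: complex))"
    by (subst (asm) integrable_restrict_space) auto
  from integrable_norm[OF this] show ?thesis by (simp add: mult.commute)
qed

text \<open>Functions on the half line extended by 0. The class lies in L^1 and L^2 and is preserved
  by the Airy transform followed by restriction, see \<open>decaying_T\<close>.\<close>

definition decaying :: "(real \<Rightarrow> complex) \<Rightarrow> bool" where
  "decaying f \<longleftrightarrow> f \<in> borel_measurable borel \<and> (\<exists>C\<ge>0. \<forall>t. norm (f t) \<le> C * (indicator {0<..} t * exp (- t)))"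

lemma decaying_eq_0: "decaying f \<Longrightarrow> \<not> 0 < t \<Longrightarrow> f t = 0"
  unfolding decaying_def by (metis indicator_simps(2) greaterThan_iff mult_zero_left mult_zero_right norm_le_zero_iff)

lemma decaying_integrable:
  assumes "decaying f"
  shows "integrable lborel f" "l2sq f < \<infinity>"
proof -
  obtain C where f [measurable]: "f \<in> borel_measurable borel" and C: "0 \<le> C" "\<And>t. norm (f t) \<le> C * (indicator {0<..} t * exp (- t))"
    using assms unfolding decaying_def by blast
  have i: "integrable lborel (\<lambda>t. C * (indicator {0<..} t * exp (- t)))" using integrable_decay[of 1] by (intro integrable_mult_right) simp
  show "integrable lborel f"
    by (rule lint_bound[OF i]) (auto intro!: AE_I2 order_trans[OF C(2) abs_ge_self])
  have i2: "integrable lborel (\<lambda>t. C\<^sup>2 * (indicator {0<..} t * exp (- 2 * t)))" using integrable_decay[of 2] by (intro integrable_mult_right) simp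
  have "l2sq f \<le> (\<integral>\<^sup>+t. ennreal (C\<^sup>2 * (indicator {0<..} t * exp (- 2 * t))) \<partial>lborel)"
  proof (intro nn_integral_mono ennreal_leI)
    fix t :: real
    have "(norm (f t))\<^sup>2 \<le> (C * (indicator {0<..} t * exp (- t)))\<^sup>2" by (intro power_mono C(2)) simp
    also have "\<dots> = C\<^sup>2 * (indicator {0<..} t * exp (- 2 * t))"
      by (simp add: power_mult_distrib power2_eq_square indicator_def exp_add[symmetric])
    finally show "(norm (f t))\<^sup>2 \<le> C\<^sup>2 * (indicator {0<..} t * exp (- 2 * t))" .
  qed
  also have "\<dots> < \<infinity>" using i2 by (subst nn_integral_eq_integral) auto
  finally show "l2sq f < \<infinity>" .
qed

text \<open>The Gaussian makes exp (R |u|) integrable for every R, so the exponential may be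
  expanded under the integral; the result is a power series that converges everywhere.\<close>

lemma exp_transform_entire:
  fixes \<Omega> :: "real \<Rightarrow> complex"
  assumes \<Omega> [measurable]: "\<Omega> \<in> borel_measurable borel" and b: "\<And>y. norm (\<Omega> y) \<le> C * exp (- m * y\<^sup>2)" and m: "0 < m" and C: "0 \<le> C"
  shows "(\<lambda>z. LINT y|lborel. \<Omega> y * exp (z * vline \<delta> y)) holomorphic_on UNIV"
proof -
  let ?u = "\<lambda>y. vline \<delta> y"
  have dom: "integrable lborel (\<lambda>y. norm (\<Omega> y) * exp (R * norm (?u y)))" if R: "0 \<le> R" for R
  proof (rule lint_bound)
    show "integrable lborel (\<lambda>y. C * exp (R * \<bar>\<delta>\<bar> + R\<^sup>2 / (2 * m)) * exp (- (m / 2) * y\<^sup>2))"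
      using m by (intro integrable_mult_right integrable_gaussian) simp
    show "AE y in lborel. norm (norm (\<Omega> y) * exp (R * norm (?u y))) \<le> norm (C * exp (R * \<bar>\<delta>\<bar> + R\<^sup>2 / (2 * m)) * exp (- (m / 2) * y\<^sup>2))"
    proof (rule AE_I2)
      fix y
      have "norm (?u y) \<le> \<bar>\<delta>\<bar> + \<bar>y\<bar>" using cmod_le[of "?u y"] by simp
      then have "R * norm (?u y) \<le> R * (\<bar>\<delta>\<bar> + \<bar>y\<bar>)" using R by (rule mult_left_mono)
      moreover have "R * \<bar>y\<bar> \<le> m / 2 * y\<^sup>2 + R\<^sup>2 / (2 * m)"
      proof -
        have "0 \<le> (m * \<bar>y\<bar> - R)\<^sup>2 / (2 * m)" using m by simp
        also have "\<dots> = m / 2 * y\<^sup>2 - R * \<bar>y\<bar> + R\<^sup>2 / (2 * m)" using m by (simp add: power2_diff field_simps power_mult_distrib) (simp add: power2_eq_square)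
        finally show ?thesis by simp
      qed
      ultimately have "- m * y\<^sup>2 + R * norm (?u y) \<le> R * \<bar>\<delta>\<bar> + R\<^sup>2 / (2 * m) + - (m / 2) * y\<^sup>2" by (simp add: distrib_left)
      then have "exp (- m * y\<^sup>2) * exp (R * norm (?u y)) \<le> exp (R * \<bar>\<delta>\<bar> + R\<^sup>2 / (2 * m)) * exp (- (m / 2) * y\<^sup>2)"
        unfolding exp_add[symmetric] by simp
      then have "C * (exp (- m * y\<^sup>2) * exp (R * norm (?u y))) \<le> C * (exp (R * \<bar>\<delta>\<bar> + R\<^sup>2 / (2 * m)) * exp (- (m / 2) * y\<^sup>2))"
        by (rule mult_left_mono[OF _ C])
      moreover have "norm (\<Omega> y) * exp (R * norm (?u y)) \<le> C * exp (- m * y\<^sup>2) * exp (R * norm (?u y))" by (intro mult_right_mono b) simp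
      ultimately have "norm (\<Omega> y) * exp (R * norm (?u y)) \<le> C * (exp (R * \<bar>\<delta>\<bar> + R\<^sup>2 / (2 * m)) * exp (- (m / 2) * y\<^sup>2))"
        by (simp only: mult.assoc)
      then show "norm (norm (\<Omega> y) * exp (R * norm (?u y))) \<le> norm (C * exp (R * \<bar>\<delta>\<bar> + R\<^sup>2 / (2 * m)) * exp (- (m / 2) * y\<^sup>2))"
        using C by (simp add: abs_mult mult.assoc)
    qed
  qed measurable
  define a where "a n = (LINT y|lborel. \<Omega> y * (?u y ^ n / fact n))" for n
  have part: "(\<Sum>i<n. R ^ i * (r ^ i / fact i)) \<le> exp (R * r)" if "0 \<le> R" "0 \<le> r" for R r :: real and n
  proof -
    have "(\<Sum>i<n. (R * r) ^ i /\<^sub>R fact i) \<le> (\<Sum>i. (R * r) ^ i /\<^sub>R fact i)"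
      using that by (intro sum_le_suminf summable_exp_generic) auto
    then show ?thesis by (simp add: exp_def power_mult_distrib field_simps scaleR_conv_of_real)
  qed
  have sums: "(\<lambda>n. a n * (z - 0) ^ n) sums (LINT y|lborel. \<Omega> y * exp (z * ?u y))" for z
  proof -
    let ?t = "\<lambda>n y. \<Omega> y * (z ^ n * (?u y ^ n / fact n))"
    have tn: "norm (?t n y) = norm (\<Omega> y) * (norm z ^ n * (norm (?u y) ^ n / fact n))" for n y
      by (simp add: norm_mult norm_divide norm_power)
    have tb: "(\<Sum>i<n. norm (?t i y)) \<le> norm (\<Omega> y) * exp (norm z * norm (?u y))" for n y
      unfolding tn sum_distrib_left[symmetric] by (intro mult_left_mono part) auto
    have ti: "integrable lborel (?t n)" for n
    proof (rule lint_bound[OF dom[of "norm z"]])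
      show "AE y in lborel. norm (?t n y) \<le> norm (norm (\<Omega> y) * exp (norm z * norm (?u y)))"
      proof (rule AE_I2)
        fix y
        have "norm (?t n y) \<le> (\<Sum>i<Suc n. norm (?t i y))" by (rule member_le_sum) auto
        from order_trans[OF this tb] show "norm (?t n y) \<le> norm (norm (\<Omega> y) * exp (norm z * norm (?u y)))" by simp
      qed
    qed auto
    have s1: "AE y in lborel. summable (\<lambda>n. norm (?t n y))"
    proof (rule AE_I2)
      show "summable (\<lambda>n. norm (?t n y))" for y by (rule summableI_nonneg_bounded) (rule norm_ge_zero, rule tb)
    qed
    have s2: "summable (\<lambda>n. LINT y|lborel. norm (?t n y))"
    proof (rule summableI_nonneg_bounded)
      fix n
      have "(\<Sum>i<n. LINT y|lborel. norm (?t i y)) = (LINT y|lborel. (\<Sum>i<n. norm (?t i y)))"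
        by (rule Bochner_Integration.integral_sum[symmetric]) (intro integrable_norm ti)
      also have "\<dots> \<le> (LINT y|lborel. norm (\<Omega> y) * exp (norm z * norm (?u y)))"
        by (intro Bochner_Integration.integral_mono Bochner_Integration.integrable_sum integrable_norm ti dom tb) auto
      finally show "(\<Sum>i<n. LINT y|lborel. norm (?t i y)) \<le> (LINT y|lborel. norm (\<Omega> y) * exp (norm z * norm (?u y)))" .
    qed (auto intro: Bochner_Integration.integral_nonneg)
    have "(\<lambda>n. integral\<^sup>L lborel (?t n)) sums (\<Sum>n. integral\<^sup>L lborel (?t n))"
      by (rule summable_sums[OF summable_integral[OF ti s1 s2]])
    moreover have "(\<Sum>n. integral\<^sup>L lborel (?t n)) = (LINT y|lborel. (\<Sum>n. ?t n y))"
      by (rule integral_suminf[OF ti s1 s2, symmetric])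
    moreover have "(\<Sum>n. ?t n y) = \<Omega> y * exp (z * ?u y)" for y
    proof -
      have "(\<lambda>n. (z * ?u y) ^ n /\<^sub>R fact n) sums exp (z * ?u y)" by (rule exp_converges)
      then have "(\<lambda>n. z ^ n * (?u y ^ n / fact n)) sums exp (z * ?u y)"
        by (simp add: scaleR_conv_of_real power_mult_distrib field_simps)
      from sums_mult[OF this] show ?thesis by (rule sums_unique[symmetric])
    qed
    moreover have "integral\<^sup>L lborel (?t n) = a n * (z - 0) ^ n" for n
    proof -
      have "integral\<^sup>L lborel (?t n) = (LINT y|lborel. z ^ n * (\<Omega> y * (?u y ^ n / fact n)))"
        by (intro lint_cong) (simp add: mult_ac)
      then show ?thesis by (simp add: a_def mult.commute)
    qed
    ultimately show ?thesis by simp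
  qed
  have "(\<lambda>z. LINT y|lborel. \<Omega> y * exp (z * ?u y)) holomorphic_on ball 0 r" for r
    by (rule power_series_holomorphic[of 0 r a]) (rule sums)
  then have "(\<lambda>z. LINT y|lborel. \<Omega> y * exp (z * ?u y)) field_differentiable at z" for z
    by (rule holomorphic_on_imp_differentiable_at[of _ "ball 0 (norm z + 1)"]) auto
  then show ?thesis by (simp add: holomorphic_on_def field_differentiable_at_within)
qed

context
  fixes B :: "real \<Rightarrow> complex" and \<tau> x :: real
  assumes \<tau>: "0 < \<tau>"
    and B: "\<And>\<delta> s. 0 < \<delta> \<Longrightarrow> B s = (LINT y|lborel. airy_wt \<delta> \<tau> 0 x y * exp (of_real s * vline \<delta> y))"
begin

lemma measurable_B [measurable]: "B \<in> borel_measurable borel"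
proof -
  have "B = (\<lambda>s. LINT y|lborel. airy_wt 1 \<tau> 0 x y * exp (of_real s * vline 1 y))" using B[of 1] by auto
  also have "\<dots> \<in> borel_measurable borel" by (rule lborel.borel_measurable_lebesgue_integral) measurable
  finally show ?thesis .
qed

lemma integrable_wt: "0 < \<delta> \<Longrightarrow> integrable lborel (airy_wt \<delta> \<tau> 0 x)"
  using \<tau> by (intro integrable_airy_wt) simp

lemma norm_wt: "0 < \<delta> \<Longrightarrow> norm (airy_wt \<delta> \<tau> 0 x y) \<le> exp (\<tau> * \<delta> ^ 3 / 3 - x * \<delta>) / (2 * pi)"
  unfolding airy_wt_def norm_divide norm_exp_eq_Re using \<tau>
  by (intro frac_le) (simp_all add: Re_airy_phase_vline)

lemma norm_exp_vline: "norm (exp (of_real s * vline \<delta> y)) = exp (- (\<delta> * s))"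
  by (simp add: mult.commute)

text \<open>The line at \<delta> = 1 gives the decay exp (- s). The summand 1 makes the constant
  positive, so that \<open>CB\<close> exp (- s) can serve as the strictly positive weight of a
  \<open>fredholm_kernel\<close>.\<close>

definition CB where "CB = (LINT y|lborel. norm (airy_wt 1 \<tau> 0 x y)) + 1"

lemma CB_pos: "0 < CB"
  unfolding CB_def by (rule add_nonneg_pos[OF Bochner_Integration.integral_nonneg]) auto

lemma norm_B: "norm (B s) \<le> CB * exp (- s)"
proof -
  have "norm (B s) \<le> (LINT y|lborel. norm (airy_wt 1 \<tau> 0 x y * exp (of_real s * vline 1 y)))"
    unfolding B[OF one_pos] by (rule integral_norm_bound)
  also have "\<dots> = (LINT y|lborel. norm (airy_wt 1 \<tau> 0 x y)) * exp (- s)" by (simp add: norm_mult)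
  also have "\<dots> \<le> CB * exp (- s)" by (intro mult_right_mono) (auto simp: CB_def)
  finally show ?thesis .
qed

text \<open>For f supported on the half line, the Hankel operator of B evaluated at all real s; the
  values at s \<le> 0 record what restriction to the half line loses.\<close>

definition T where "T f s = (LINT t|lborel. B (s + t) * f t)"

lemma norm_B_mult_le:
  assumes "decaying f"
  shows "norm (B (s + t) * f t) \<le> CB * exp (- s) * norm (f t)"
proof (cases "0 < t")
  case True
  have "norm (B (s + t)) \<le> CB * exp (- (s + t))" by (rule norm_B)
  also have "\<dots> \<le> CB * exp (- s)" using True CB_pos by simp
  finally show ?thesis unfolding norm_mult by (rule mult_right_mono) simp
next
  case False
  then have "f t = 0" by (simp add: decaying_eq_0[OF assms])
  then show ?thesis by simp
qed

lemma integrable_B_mult: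
  assumes f: "decaying f"
  shows "integrable lborel (\<lambda>t. B (s + t) * f t)"
proof (rule lint_bound)
  show "integrable lborel (\<lambda>t. CB * exp (- s) * norm (f t))" by (intro integrable_mult_right integrable_norm decaying_integrable f)
  show "AE t in lborel. norm (B (s + t) * f t) \<le> norm (CB * exp (- s) * norm (f t))"
    by (intro AE_I2 order_trans[OF norm_B_mult_le[OF f] abs_ge_self[THEN order_trans]]) simp
  have [measurable]: "f \<in> borel_measurable borel" using f by (simp add: decaying_def)
  show "(\<lambda>t. B (s + t) * f t) \<in> borel_measurable lborel" by measurable
qed

text \<open>B is a superposition of exponentials, so T acts as multiplication by
  \<open>airy_wt\<close> on the Laplace transform of f, along any line with \<delta> > 0.\<close>

lemma T_representation:
  assumes f: "decaying f" and \<delta>: "0 < \<delta>"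
  shows "T f s = (LINT y|lborel. airy_wt \<delta> \<tau> 0 x y * lap f \<delta> y * exp (of_real s * vline \<delta> y))"
proof -
  have [measurable]: "f \<in> borel_measurable borel" using f by (simp add: decaying_def)
  let ?H = "\<lambda>t y. airy_wt \<delta> \<tau> 0 x y * exp (of_real (s + t) * vline \<delta> y) * f t"
  have "T f s = (LINT t|lborel. LINT y|lborel. ?H t y)" unfolding T_def B[OF \<delta>] by simp
  also have "\<dots> = (LINT y|lborel. LINT t|lborel. ?H t y)"
  proof (rule lborel_pair.Fubini_integral[symmetric], rule lint_bound)
    show "integrable (lborel \<Otimes>\<^sub>M lborel) (\<lambda>p. norm (f (fst p)) * (exp (- (\<delta> * s)) * norm (airy_wt \<delta> \<tau> 0 x (snd p))))"
      by (intro integrable_pair_mult(1) sigma_finite_lborel integrable_norm decaying_integrable f integrable_mult_right integrable_wt \<delta>)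
    show "(\<lambda>(t, y). ?H t y) \<in> borel_measurable (lborel \<Otimes>\<^sub>M lborel)" by measurable
    show "AE p in lborel \<Otimes>\<^sub>M lborel. norm (case p of (t, y) \<Rightarrow> ?H t y) \<le> norm (norm (f (fst p)) * (exp (- (\<delta> * s)) * norm (airy_wt \<delta> \<tau> 0 x (snd p))))"
    proof (rule AE_I2)
      fix p :: "real \<times> real"
      obtain t y where p: "p = (t, y)" by (cases p)
      show "norm (case p of (t, y) \<Rightarrow> ?H t y) \<le> norm (norm (f (fst p)) * (exp (- (\<delta> * s)) * norm (airy_wt \<delta> \<tau> 0 x (snd p))))"
      proof (cases "0 < t")
        case True
        have "exp (- (\<delta> * (s + t))) \<le> exp (- (\<delta> * s))" using True \<delta> by simp
        then have "norm (airy_wt \<delta> \<tau> 0 x y) * exp (- (\<delta> * (s + t))) * norm (f t) \<le> norm (airy_wt \<delta> \<tau> 0 x y) * exp (- (\<delta> * s)) * norm (f t)"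
          by (intro mult_right_mono mult_left_mono) auto
        then show ?thesis unfolding p prod.case fst_conv snd_conv norm_mult norm_exp_vline
          by (simp only: real_norm_def abs_mult abs_exp_cancel abs_norm_cancel mult_ac)
      next
        case False
        then have "f t = 0" by (simp add: decaying_eq_0[OF f])
        then show ?thesis unfolding p by simp
      qed
    qed
  qed
  also have "\<dots> = (LINT y|lborel. airy_wt \<delta> \<tau> 0 x y * lap f \<delta> y * exp (of_real s * vline \<delta> y))"
  proof (intro lint_cong)
    fix y
    have "(LINT t|lborel. ?H t y) = (LINT t|lborel. (airy_wt \<delta> \<tau> 0 x y * exp (of_real s * vline \<delta> y)) * (f t * exp (of_real t * vline \<delta> y)))"
      by (intro lint_cong) (simp add: exp_add distrib_left distrib_right mult_ac)
    also have "\<dots> = (airy_wt \<delta> \<tau> 0 x y * exp (of_real s * vline \<delta> y)) * lap f \<delta> y"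
      by (rule lint_cmult)
    finally show "(LINT t|lborel. ?H t y) = airy_wt \<delta> \<tau> 0 x y * lap f \<delta> y * exp (of_real s * vline \<delta> y)"
      by (simp only: mult_ac)
  qed
  finally show ?thesis .
qed

lemma transform_bound:
  assumes f: "decaying f" and \<delta>: "0 < \<delta>"
  shows "norm (lap f \<delta> y) \<le> (LINT t|lborel. norm (f t))"
    and "(\<lambda>y. lap f \<delta> y) \<in> borel_measurable borel"
    and "(\<integral>\<^sup>+y. ennreal ((norm (lap f \<delta> y))\<^sup>2) \<partial>lborel) \<le> ennreal (2 * pi) * l2sq f"
proof -
  have [measurable]: "f \<in> borel_measurable borel" using f by (simp add: decaying_def)
  have le: "norm (f t) * exp (- (\<delta> * t)) \<le> norm (f t)" for t
  proof (cases "0 < t")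
    case True
    then show ?thesis using \<delta> by (intro mult_left_le) auto
  next
    case False
    then have "f t = 0" by (simp add: decaying_eq_0[OF f])
    then show ?thesis by simp
  qed
  have fi: "integrable lborel f" by (rule decaying_integrable(1)[OF f])
  have di: "integrable lborel (\<lambda>t. f t * of_real (exp (- (\<delta> * t))))"
    by (rule lint_bound[OF fi]) (auto simp: norm_mult intro!: AE_I2 le)
  have "norm (lap f \<delta> y) \<le> (LINT t|lborel. norm (f t * exp (of_real t * vline \<delta> y)))"
    by (rule integral_norm_bound)
  also have "\<dots> = (LINT t|lborel. norm (f t * of_real (exp (- (\<delta> * t)))))"
    by (simp only: norm_mult norm_exp_vline norm_of_real abs_exp_cancel)
  also have "\<dots> \<le> (LINT t|lborel. norm (f t))"
    by (intro Bochner_Integration.integral_mono integrable_norm di fi) (simp add: norm_mult le)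
  finally show "norm (lap f \<delta> y) \<le> (LINT t|lborel. norm (f t))" .
  show "(\<lambda>y. lap f \<delta> y) \<in> borel_measurable borel"
    by (rule lborel.borel_measurable_lebesgue_integral) measurable
  have "lap f \<delta> y = (LINT t|lborel. (f t * of_real (exp (- (\<delta> * t)))) * iexp (y * t))" for y
    by (intro lint_cong) (simp add: vline_eq exp_of_real[symmetric] exp_add[symmetric] algebra_simps)
  then have "(\<integral>\<^sup>+y. ennreal ((norm (lap f \<delta> y))\<^sup>2) \<partial>lborel) \<le>
    ennreal (2 * pi) * (\<integral>\<^sup>+t. ennreal ((norm (f t * of_real (exp (- (\<delta> * t)))))\<^sup>2) \<partial>lborel)"
    using plancherel_le[OF di] by simp
  also have "\<dots> \<le> ennreal (2 * pi) * l2sq f"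
    by (intro mult_left_mono nn_integral_mono ennreal_leI power_mono) (auto simp: norm_mult le)
  finally show "(\<integral>\<^sup>+y. ennreal ((norm (lap f \<delta> y))\<^sup>2) \<partial>lborel) \<le> ennreal (2 * pi) * l2sq f" .
qed

lemma measurable_T: "decaying f \<Longrightarrow> T f \<in> borel_measurable borel"
proof -
  assume "decaying f"
  then have [measurable]: "f \<in> borel_measurable borel" by (simp add: decaying_def)
  show ?thesis unfolding T_def[abs_def] by (rule lborel.borel_measurable_lebesgue_integral) measurable
qed

text \<open>Plancherel twice, once for f and once for T f; the two factors 2 pi cancel the square of
  the 1 / (2 pi) in \<open>airy_wt\<close>. The weight exp (\<delta> s) compensates for working on a
  line to the left of the imaginary axis.\<close>

lemma T_weighted_contraction:
  assumes f: "decaying f" and \<delta>: "0 < \<delta>"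
  shows "(\<integral>\<^sup>+s. ennreal ((norm (T f s) * exp (\<delta> * s))\<^sup>2) \<partial>lborel) \<le>
    ennreal ((exp (\<tau> * \<delta> ^ 3 / 3 - x * \<delta>))\<^sup>2) * l2sq f"
proof -
  let ?h = "\<lambda>y. lap f \<delta> y"
  let ?E = "exp (\<tau> * \<delta> ^ 3 / 3 - x * \<delta>)"
  note [measurable] = transform_bound(2)[OF f \<delta>]
  have wi: "integrable lborel (\<lambda>y. airy_wt \<delta> \<tau> 0 x y * ?h y)"
  proof (rule lint_bound[OF integrable_mult_right[OF integrable_wt[OF \<delta>], of "of_real (LINT t|lborel. norm (f t))"]])
    show "AE y in lborel. norm (airy_wt \<delta> \<tau> 0 x y * ?h y) \<le> norm (complex_of_real (LINT t|lborel. norm (f t)) * airy_wt \<delta> \<tau> 0 x y)"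
      unfolding norm_mult norm_of_real
      by (intro AE_I2, subst mult.commute) (intro mult_right_mono order_trans[OF transform_bound(1)[OF f \<delta>] abs_ge_self] norm_ge_zero)
  qed measurable
  have "norm (T f s) * exp (\<delta> * s) = norm (LINT y|lborel. (airy_wt \<delta> \<tau> 0 x y * ?h y) * iexp (s * y))" for s
  proof -
    have "T f s * of_real (exp (\<delta> * s)) = (LINT y|lborel. (airy_wt \<delta> \<tau> 0 x y * ?h y * exp (of_real s * vline \<delta> y)) * of_real (exp (\<delta> * s)))"
      unfolding T_representation[OF f \<delta>] by simp
    also have "\<dots> = (LINT y|lborel. (airy_wt \<delta> \<tau> 0 x y * ?h y) * iexp (s * y))"
    proof (intro lint_cong)
      fix y
      have "exp (of_real s * vline \<delta> y) * of_real (exp (\<delta> * s)) = iexp (s * y)"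
        by (simp add: vline_eq exp_of_real[symmetric] exp_add[symmetric] algebra_simps)
      then show "(airy_wt \<delta> \<tau> 0 x y * ?h y * exp (of_real s * vline \<delta> y)) * of_real (exp (\<delta> * s)) = (airy_wt \<delta> \<tau> 0 x y * ?h y) * iexp (s * y)"
        by (simp only: mult.assoc)
    qed
    finally have "norm (T f s * of_real (exp (\<delta> * s))) = norm (LINT y|lborel. (airy_wt \<delta> \<tau> 0 x y * ?h y) * iexp (s * y))" by (rule arg_cong)
    then show ?thesis by (simp add: norm_mult)
  qed
  then have "(\<integral>\<^sup>+s. ennreal ((norm (T f s) * exp (\<delta> * s))\<^sup>2) \<partial>lborel) \<le> ennreal (2 * pi) * (\<integral>\<^sup>+y. ennreal ((norm (airy_wt \<delta> \<tau> 0 x y * ?h y))\<^sup>2) \<partial>lborel)"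
    using plancherel_le[OF wi] by simp
  also have "\<dots> \<le> ennreal (2 * pi) * (\<integral>\<^sup>+y. ennreal ((?E / (2 * pi))\<^sup>2) * ennreal ((norm (?h y))\<^sup>2) \<partial>lborel)"
  proof (intro mult_left_mono nn_integral_mono)
    fix y
    have "(norm (airy_wt \<delta> \<tau> 0 x y * ?h y))\<^sup>2 \<le> (?E / (2 * pi) * norm (?h y))\<^sup>2"
      unfolding norm_mult by (intro power_mono mult_right_mono norm_wt \<delta>) auto
    then show "ennreal ((norm (airy_wt \<delta> \<tau> 0 x y * ?h y))\<^sup>2) \<le> ennreal ((?E / (2 * pi))\<^sup>2) * ennreal ((norm (?h y))\<^sup>2)"
      by (simp only: ennreal_mult[symmetric] zero_le_power2 power_mult_distrib[symmetric] ennreal_leI)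
  qed simp
  also have "\<dots> = ennreal (2 * pi) * (ennreal ((?E / (2 * pi))\<^sup>2) * (\<integral>\<^sup>+y. ennreal ((norm (?h y))\<^sup>2) \<partial>lborel))"
    by (subst nn_integral_cmult) auto
  also have "\<dots> \<le> ennreal (2 * pi) * (ennreal ((?E / (2 * pi))\<^sup>2) * (ennreal (2 * pi) * l2sq f))"
    by (intro mult_left_mono transform_bound(3) f \<delta>) auto
  also have "\<dots> = ennreal (2 * pi * ((?E / (2 * pi))\<^sup>2 * (2 * pi))) * l2sq f"
    by (subst ennreal_mult, simp, simp, subst ennreal_mult, simp, simp, simp only: mult.assoc)
  also have "2 * pi * ((?E / (2 * pi))\<^sup>2 * (2 * pi)) = ?E\<^sup>2" by (simp add: power2_eq_square)
  finally show ?thesis .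
qed

text \<open>On the imaginary axis the symbol has modulus 1 up to the factor 1 / (2 pi), but its
  integral there is not absolutely convergent; the axis is reached by \<delta> \<rightarrow> 0 and
  Fatou's lemma.\<close>

lemma T_contraction:
  assumes f: "decaying f"
  shows "(\<integral>\<^sup>+s. ennreal ((norm (T f s))\<^sup>2) \<partial>lborel) \<le> l2sq f"
proof -
  let ?F = "\<integral>\<^sup>+t. ennreal ((norm (f t))\<^sup>2) \<partial>lborel"
  let ?d = "\<lambda>n. 1 / real (Suc n)"
  let ?E = "\<lambda>n. (exp (\<tau> * ?d n ^ 3 / 3 - x * ?d n))\<^sup>2"
  note [measurable] = measurable_T[OF f]
  have d0: "?d \<longlonglongrightarrow> 0" using LIMSEQ_Suc[OF lim_1_over_n] by simp
  have "(\<integral>\<^sup>+s. ennreal ((norm (T f s))\<^sup>2) \<partial>lborel) = (\<integral>\<^sup>+s. liminf (\<lambda>n. ennreal ((norm (T f s) * exp (?d n * s))\<^sup>2)) \<partial>lborel)"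
  proof (intro nn_integral_cong)
    fix s
    have "(\<lambda>n. (norm (T f s) * exp (?d n * s))\<^sup>2) \<longlonglongrightarrow> (norm (T f s) * exp (0 * s))\<^sup>2" by (intro tendsto_intros d0)
    then have "(\<lambda>n. ennreal ((norm (T f s) * exp (?d n * s))\<^sup>2)) \<longlonglongrightarrow> ennreal ((norm (T f s))\<^sup>2)" by (intro tendsto_ennrealI) simp
    then show "ennreal ((norm (T f s))\<^sup>2) = liminf (\<lambda>n. ennreal ((norm (T f s) * exp (?d n * s))\<^sup>2))" by (intro lim_imp_Liminf[symmetric]) auto
  qed
  also have "\<dots> \<le> liminf (\<lambda>n. \<integral>\<^sup>+s. ennreal ((norm (T f s) * exp (?d n * s))\<^sup>2) \<partial>lborel)" by (rule nn_integral_liminf) measurable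
  also have "\<dots> \<le> liminf (\<lambda>n. ennreal (?E n) * ?F)"
    by (intro Liminf_mono always_eventually allI T_weighted_contraction f) simp
  also have "\<dots> = ?F"
  proof (rule lim_imp_Liminf)
    obtain F where F: "?F = ennreal F" "0 \<le> F" using decaying_integrable(2)[OF f] by (cases ?F) auto
    have "(\<lambda>n. ?E n * F) \<longlonglongrightarrow> (exp (\<tau> * 0 ^ 3 / 3 - x * 0))\<^sup>2 * F" by (intro tendsto_intros d0) simp
    then have "(\<lambda>n. ennreal (?E n * F)) \<longlonglongrightarrow> ennreal F" by (intro tendsto_ennrealI) simp
    then show "(\<lambda>n. ennreal (?E n) * ?F) \<longlonglongrightarrow> ?F" unfolding F(1) using F(2) by (simp add: ennreal_mult[symmetric])
  qed simp
  finally show ?thesis .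
qed

text \<open>
  If \<open>f\<close> is an eigenfunction with eigenvalue \<open>\<plusminus>1\<close>, the contraction property forces \<open>T f\<close> to vanish on the
  negative half line; being entire, it vanishes identically.
\<close>

lemma no_eigenfunction:
  assumes f: "decaying f" and \<sigma>: "norm \<sigma> = 1" and eig: "\<And>s. 0 < s \<Longrightarrow> T f s = \<sigma> * f s"
  shows "f s = 0"
proof -
  have [measurable]: "f \<in> borel_measurable borel" using f by (simp add: decaying_def)
  note [measurable] = measurable_T[OF f] transform_bound(2)[OF f one_pos]
  have f0: "f t = 0" if "t \<le> 0" for t using that by (simp add: decaying_eq_0[OF f])
  let ?F = "\<integral>\<^sup>+t. ennreal ((norm (f t))\<^sup>2) \<partial>lborel"
  let ?N = "\<integral>\<^sup>+s. ennreal (indicator {..0} s * (norm (T f s))\<^sup>2) \<partial>lborel"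
  \<comment> \<open>On the positive half line |T f| = |f|, which already exhausts the norm of f;
    since \<open>?F\<close> is finite, it can be cancelled and nothing is left for s \<le>
    0.\<close>
  have "?F + ?N = (\<integral>\<^sup>+s. ennreal ((norm (f s))\<^sup>2) + ennreal (indicator {..0} s * (norm (T f s))\<^sup>2) \<partial>lborel)"
    by (rule nn_integral_add[symmetric]) auto
  also have "\<dots> = (\<integral>\<^sup>+s. ennreal ((norm (T f s))\<^sup>2) \<partial>lborel)"
  proof (intro nn_integral_cong)
    fix s
    show "ennreal ((norm (f s))\<^sup>2) + ennreal (indicator {..0} s * (norm (T f s))\<^sup>2) = ennreal ((norm (T f s))\<^sup>2)"
      using f0[of s] eig[of s] \<sigma> by (cases "0 < s") (simp_all add: norm_mult)
  qed
  also have "\<dots> \<le> ?F" by (rule T_contraction[OF f])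
  finally have "?F + ?N \<le> ?F + 0" by simp
  then have "?N = 0" using decaying_integrable(2)[OF f] by (auto simp: ennreal_add_left_cancel_le)
  then have ae: "AE s in lborel. ennreal (indicator {..0} s * (norm (T f s))\<^sup>2) = 0"
    by (subst (asm) nn_integral_0_iff_AE) auto
  let ?h = "\<lambda>y. lap f 1 y"
  let ?\<Omega> = "\<lambda>y. airy_wt 1 \<tau> 0 x y * ?h y"
  define H where "H z = (LINT y|lborel. ?\<Omega> y * exp (z * vline 1 y))" for z
  have TH: "T f s = H (of_real s)" for s unfolding T_representation[OF f one_pos] H_def ..
  let ?c = "exp (\<tau> * 1 ^ 3 / 3 + 0 * 1\<^sup>2 / 2 - x * 1)" and ?I = "LINT t|lborel. norm (f t)"
  have I0: "0 \<le> ?I" by (rule Bochner_Integration.integral_nonneg) simp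
  have holo: "H holomorphic_on UNIV"
    unfolding H_def[abs_def]
  proof (rule exp_transform_entire[where C = "?c * ?I" and m = \<tau>])
    fix y
    have "norm (airy_wt 1 \<tau> 0 x y) \<le> ?c * exp (- (\<tau> * 1 - 0 / 2) * y\<^sup>2)" using \<tau> by (intro norm_airy_wt_le) auto
    then have "norm (?\<Omega> y) \<le> (?c * exp (- (\<tau> * 1 - 0 / 2) * y\<^sup>2)) * ?I"
      unfolding norm_mult by (intro mult_mono transform_bound(1) f) auto
    then show "norm (?\<Omega> y) \<le> ?c * ?I * exp (- \<tau> * y\<^sup>2)" by (simp add: mult_ac)
  qed (use \<tau> I0 in auto)
  have cont: "isCont H z" for z
    using holomorphic_on_imp_continuous_on[OF holo] by (simp add: continuous_on_eq_continuous_at)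
  have neg: "H (of_real s) = 0" if s: "s < 0" for s
  proof (rule ccontr)
    assume nz: "H (of_real s) \<noteq> 0"
    have "isCont (\<lambda>r. H (of_real r)) s" by (rule isCont_o2[OF _ cont]) (intro continuous_intros)
    then have "\<forall>\<^sub>F r in at s. H (of_real r) \<noteq> 0" using nz by (intro tendsto_imp_eventually_ne) (simp_all add: isCont_def)
    then obtain e where e: "0 < e" "\<And>r. r \<noteq> s \<Longrightarrow> dist r s < e \<Longrightarrow> H (of_real r) \<noteq> 0" unfolding eventually_at by auto
    have "AE r in lborel. r \<notin> {s - e<..<s}"
      using ae
    proof eventually_elim
      case (elim r)
      then show ?case using e(2)[of r] s unfolding TH by (auto simp: dist_real_def ennreal_eq_0_iff)
    qed
    then have "{s - e<..<s} \<in> null_sets lborel" by (subst AE_iff_null_sets) auto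
    then show False using e(1) by (simp add: null_sets_def)
  qed
  have "H (of_real s) = 0" for s
  proof (rule analytic_continuation[OF holo open_UNIV connected_UNIV subset_UNIV UNIV_I _ _ UNIV_I])
    show "(- 1 :: complex) islimpt (of_real ` {..<0})"
      unfolding islimpt_approachable
    proof (intro allI impI)
      fix e :: real assume e: "0 < e"
      have "dist (complex_of_real (- 1 - e / 2)) (- 1) = norm (complex_of_real (- (e / 2)))" by (simp add: dist_norm)
      also have "\<dots> < e" using e by (simp only: norm_of_real)
      finally show "\<exists>x'\<in>of_real ` {..<0}. x' \<noteq> (- 1 :: complex) \<and> dist x' (- 1) < e"
        using e by (intro bexI[of _ "complex_of_real (- 1 - e / 2)"] conjI) (auto simp: complex_eq_iff)
    qed
    show "H z = 0" if "z \<in> of_real ` {..<0}" for z using that neg by auto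
  qed
  then have "T f s = 0" for s unfolding TH .
  then show "f s = 0" using eig[of s] f0[of s] \<sigma> by (cases "0 < s") auto
qed

lemma decaying_T:
  assumes f: "decaying f"
  shows "decaying (\<lambda>s. indicator {0<..} s * T f s)"
proof -
  note [measurable] = measurable_T[OF f]
  let ?I = "LINT t|lborel. norm (f t)"
  have I0: "0 \<le> ?I" by (rule Bochner_Integration.integral_nonneg) simp
  have "norm (T f s) \<le> CB * ?I * exp (- s)" for s
  proof -
    have "norm (T f s) \<le> (LINT t|lborel. norm (B (s + t) * f t))" unfolding T_def by (rule integral_norm_bound)
    also have "\<dots> \<le> (LINT t|lborel. CB * exp (- s) * norm (f t))"
      by (intro Bochner_Integration.integral_mono integrable_norm integrable_B_mult f integrable_mult_right decaying_integrable norm_B_mult_le)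
    finally show ?thesis by (simp add: mult_ac)
  qed
  then have "norm (indicator {0<..} s * T f s) \<le> CB * ?I * (indicator {0<..} s * exp (- s))" for s
    by (simp add: indicator_def)
  then show ?thesis unfolding decaying_def using CB_pos I0 by (intro conjI exI[of _ "CB * ?I"]) auto
qed

lemma decaying_add: "decaying f \<Longrightarrow> decaying g \<Longrightarrow> decaying (\<lambda>s. f s + g s)"
  and decaying_diff: "decaying f \<Longrightarrow> decaying g \<Longrightarrow> decaying (\<lambda>s. f s - g s)"
proof -
  assume "decaying f" "decaying g"
  then obtain C D where [measurable]: "f \<in> borel_measurable borel" "g \<in> borel_measurable borel"
    and C: "0 \<le> C" "\<And>t. norm (f t) \<le> C * (indicator {0<..} t * exp (- t))"
    and D: "0 \<le> D" "\<And>t. norm (g t) \<le> D * (indicator {0<..} t * exp (- t))"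
    unfolding decaying_def by blast
  have "norm (f t + g t) \<le> (C + D) * (indicator {0<..} t * exp (- t))" "norm (f t - g t) \<le> (C + D) * (indicator {0<..} t * exp (- t))" for t
    using norm_triangle_ineq[of "f t" "g t"] norm_triangle_ineq4[of "f t" "g t"] C(2)[of t] D(2)[of t]
    unfolding distrib_right by linarith+
  then show "decaying (\<lambda>s. f s + g s)" "decaying (\<lambda>s. f s - g s)"
    unfolding decaying_def using C(1) D(1) by (auto intro!: exI[of _ "C + D"])
qed

definition KB where "KB s t = (LINT r|pos_half_line. B (s + r) * B (r + t))"

lemma KB_eq: "KB s t = (LINT r|pos_half_line. B (s + r) * B (r + t))"
  by (fact KB_def)

lemma norm_KB_integrand:
  assumes "0 < r" "0 < s" "0 < t"
  shows "norm (B (s + r) * B (r + t)) \<le> (CB * exp (- s)) * (CB * exp (- t)) * exp (- 2 * r)"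
proof -
  have "norm (B (s + r) * B (r + t)) \<le> (CB * exp (- (s + r))) * (CB * exp (- (r + t)))"
    unfolding norm_mult using CB_pos by (intro mult_mono norm_B) auto
  also have "\<dots> = (CB * exp (- s)) * (CB * exp (- t)) * exp (- 2 * r)"
  proof -
    have "(CB * exp (- (s + r))) * (CB * exp (- (r + t))) = CB * CB * (exp (- (s + r)) * exp (- (r + t)))" by (simp only: mult_ac)
    also have "exp (- (s + r)) * exp (- (r + t)) = exp (- s) * exp (- t) * exp (- 2 * r)" by (simp add: exp_add[symmetric])
    also have "CB * CB * \<dots> = (CB * exp (- s)) * (CB * exp (- t)) * exp (- 2 * r)" by (simp only: mult_ac)
    finally show ?thesis .
  qed
  finally show ?thesis .
qed

lemma fredholm_kernel_KB: "fredholm_kernel pos_half_line KB (\<lambda>s. CB * exp (- s))"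
proof -
  note [measurable] = measurable_pos_half_line_id
  interpret S: sigma_finite_measure pos_half_line by (rule sigma_finite_pos_half_line)
  have e2: "integrable pos_half_line (\<lambda>r. exp (- 2 * r) :: real)"
    using integrable_decay[of 2] by (subst integrable_restrict_space) (auto simp: mult.commute)
  have v2: "(LINT r|pos_half_line. exp (- 2 * r) :: real) \<le> 1"
  proof -
    have "of_real (LINT r|pos_half_line. exp (- 2 * r) :: real) = (LINT r|pos_half_line. complex_of_real (exp (- 2 * r)))"
      by (rule integral_complex_of_real[symmetric])
    also have "\<dots> = (LINT r|pos_half_line. exp (of_real r * (- 2)))"
      by (intro lint_cong) (simp add: exp_of_real[symmetric] mult.commute)
    also have "\<dots> = - 1 / (- 2)" by (rule integral_exp_pos_half_line) simp
    also have "\<dots> = of_real (1 / 2)" by simp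
    finally show ?thesis by (simp only: of_real_eq_iff)
  qed
  show ?thesis
  proof (intro fredholm_kernel.intro fredholm_kernel_axioms.intro sigma_finite_pos_half_line)
    show "(\<lambda>(s, t). KB s t) \<in> borel_measurable (pos_half_line \<Otimes>\<^sub>M pos_half_line)"
      unfolding KB_def case_prod_beta
    proof (rule S.borel_measurable_lebesgue_integral)
      show "(\<lambda>(p, r). B (fst p + r) * B (r + snd p)) \<in> borel_measurable ((pos_half_line \<Otimes>\<^sub>M pos_half_line) \<Otimes>\<^sub>M pos_half_line)"
      proof -
        have 1: "(\<lambda>q. fst (fst q)) \<in> borel_measurable ((pos_half_line \<Otimes>\<^sub>M pos_half_line) \<Otimes>\<^sub>M pos_half_line)"
          "(\<lambda>q. snd (fst q)) \<in> borel_measurable ((pos_half_line \<Otimes>\<^sub>M pos_half_line) \<Otimes>\<^sub>M pos_half_line)"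
          by (rule measurable_compose[OF measurable_fst], rule measurable_pos_half_line_id)+
        have 2: "(\<lambda>q. snd q) \<in> borel_measurable ((pos_half_line \<Otimes>\<^sub>M pos_half_line) \<Otimes>\<^sub>M pos_half_line)"
          by (rule measurable_pos_half_line_id)
        have "(\<lambda>q. B (fst (fst q) + snd q)) \<in> borel_measurable ((pos_half_line \<Otimes>\<^sub>M pos_half_line) \<Otimes>\<^sub>M pos_half_line)"
          "(\<lambda>q. B (snd q + snd (fst q))) \<in> borel_measurable ((pos_half_line \<Otimes>\<^sub>M pos_half_line) \<Otimes>\<^sub>M pos_half_line)"
          by (rule measurable_compose[OF borel_measurable_add measurable_B], (rule 1 2)+)+
        then show ?thesis unfolding case_prod_beta by (rule borel_measurable_times)
      qed
    qed
    show "(\<lambda>s. CB * exp (- s)) \<in> borel_measurable pos_half_line" by (rule measurable_pos_half_line) measurable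
    show "0 < CB * exp (- s)" for s :: real using CB_pos by simp
    show "norm (KB s t) \<le> CB * exp (- s) * (CB * exp (- t))" if "s \<in> space pos_half_line" "t \<in> space pos_half_line" for s t
    proof -
      have st: "0 < s" "0 < t" using that by auto
      have i: "integrable pos_half_line (\<lambda>r. (CB * exp (- s)) * (CB * exp (- t)) * exp (- 2 * r))" by (rule integrable_mult_right[OF e2])
      have "integrable pos_half_line (\<lambda>r. B (s + r) * B (r + t))"
      proof (rule lint_bound[OF i])
        show "(\<lambda>r. B (s + r) * B (r + t)) \<in> borel_measurable pos_half_line" by (rule measurable_pos_half_line) measurable
        show "AE r in pos_half_line. norm (B (s + r) * B (r + t)) \<le> norm ((CB * exp (- s)) * (CB * exp (- t)) * exp (- 2 * r))"
          by (intro AE_I2 order_trans[OF norm_KB_integrand[OF _ st] abs_ge_self[THEN order_trans]]) auto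
      qed
      then have "norm (KB s t) \<le> (LINT r|pos_half_line. (CB * exp (- s)) * (CB * exp (- t)) * exp (- 2 * r))"
        unfolding KB_def by (intro order_trans[OF integral_norm_bound] Bochner_Integration.integral_mono integrable_norm i norm_KB_integrand st) auto
      also have "\<dots> = (CB * exp (- s)) * (CB * exp (- t)) * (LINT r|pos_half_line. exp (- 2 * r))" by (rule lint_cmult)
      also have "\<dots> \<le> (CB * exp (- s)) * (CB * exp (- t)) * 1" using CB_pos by (intro mult_left_mono v2) auto
      finally show ?thesis by simp
    qed
    show "integrable pos_half_line (\<lambda>s. (CB * exp (- s))\<^sup>2)"
    proof -
      have "(CB * exp (- s))\<^sup>2 = CB\<^sup>2 * exp (- 2 * s)" for s :: real by (simp add: power_mult_distrib power2_eq_square exp_add[symmetric])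
      then show ?thesis using integrable_mult_right[OF e2, of "CB\<^sup>2"] by simp
    qed
  qed
qed

text \<open>The kernel is the square of the Hankel operator on the half line; the indicator is the
  restriction between the two applications of \<open>T\<close>.\<close>

lemma KB_eq_T_T:
  assumes f: "decaying f" and s: "0 < s"
  shows "(LINT t|pos_half_line. KB s t * f t) = T (\<lambda>r. indicator {0<..} r * T f r) s"
proof -
  let ?S = "pos_half_line"
  obtain C where fm [measurable]: "f \<in> borel_measurable borel" and C: "0 \<le> C" "\<And>t. norm (f t) \<le> C * (indicator {0<..} t * exp (- t))"
    using f unfolding decaying_def by blast
  have f0: "f t = 0" if "\<not> 0 < t" for t using C(2)[of t] that by simp
  interpret S: sigma_finite_measure ?S by (rule sigma_finite_pos_half_line)
  interpret SS: pair_sigma_finite ?S ?S ..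
  have e: "integrable ?S (\<lambda>r. exp (- k * r) :: real)" if "0 < k" for k
    using integrable_decay[OF that] by (subst integrable_restrict_space) (auto simp: mult.commute)
  have Tr: "(LINT t|?S. B (r + t) * f t) = T f r" for r
    unfolding T_def by (subst integral_restrict_space, simp, intro lint_cong) (auto simp: indicator_def f0)
  have "(LINT t|?S. KB s t * f t) = (LINT t|?S. LINT r|?S. B (s + r) * B (r + t) * f t)"
    unfolding KB_def by simp
  also have "\<dots> = (LINT r|?S. LINT t|?S. B (s + r) * B (r + t) * f t)"
  proof (rule SS.Fubini_integral, rule lint_bound)
    show "integrable (?S \<Otimes>\<^sub>M ?S) (\<lambda>p. (CB * exp (- s) * CB * C) * (exp (- 2 * fst p) * exp (- 1 * snd p)))"
      by (intro integrable_mult_right integrable_pair_mult(1) sigma_finite_pos_half_line e) auto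
    show "(\<lambda>(r, t). B (s + r) * B (r + t) * f t) \<in> borel_measurable (?S \<Otimes>\<^sub>M ?S)"
    proof -
      note [measurable] = measurable_pos_half_line_id
      show ?thesis by measurable
    qed
    show "AE p in ?S \<Otimes>\<^sub>M ?S. norm (case p of (r, t) \<Rightarrow> B (s + r) * B (r + t) * f t) \<le> norm ((CB * exp (- s) * CB * C) * (exp (- 2 * fst p) * exp (- 1 * snd p)))"
    proof (rule AE_I2)
      fix p assume "p \<in> space (?S \<Otimes>\<^sub>M ?S)"
      then obtain r t where p: "p = (r, t)" and rt: "0 < r" "0 < t" by (auto simp: space_pair_measure)
      have "norm (B (s + r) * B (r + t)) * norm (f t) \<le> ((CB * exp (- s)) * (CB * exp (- t)) * exp (- 2 * r)) * (C * exp (- t))"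
        using C(2)[of t] rt CB_pos by (intro mult_mono norm_KB_integrand s) auto
      also have "\<dots> \<le> ((CB * exp (- s)) * (CB * 1) * exp (- 2 * r)) * (C * exp (- t))"
        using rt CB_pos C(1) by (intro mult_mono) auto
      finally have "norm (B (s + r) * B (r + t)) * norm (f t) \<le> (CB * exp (- s) * CB * C) * (exp (- 2 * r) * exp (- 1 * t))" by (simp add: mult_ac)
      from order_trans[OF this abs_ge_self]
      show "norm (case p of (r, t) \<Rightarrow> B (s + r) * B (r + t) * f t) \<le> norm ((CB * exp (- s) * CB * C) * (exp (- 2 * fst p) * exp (- 1 * snd p)))"
        unfolding p prod.case fst_conv snd_conv norm_mult[of _ "f t"] real_norm_def .
    qed
  qed
  also have "\<dots> = (LINT r|?S. B (s + r) * T f r)"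
  proof (intro lint_cong)
    fix r
    have "(LINT t|?S. B (s + r) * B (r + t) * f t) = (LINT t|?S. B (s + r) * (B (r + t) * f t))" by (simp only: mult.assoc)
    then show "(LINT t|?S. B (s + r) * B (r + t) * f t) = B (s + r) * T f r" by (simp add: Tr)
  qed
  also have "\<dots> = T (\<lambda>r. indicator {0<..} r * T f r) s"
    unfolding T_def[of "\<lambda>r. indicator {0<..} r * T f r"]
    by (subst integral_restrict_space, simp, intro lint_cong) (auto simp: indicator_def)
  finally show ?thesis .
qed

text \<open>1 - T^2 = (1 - T) (1 + T): for a fixed function g of the square, T g + g and g - T g are
  eigenfunctions of T on the half line with eigenvalues 1 and - 1, so both vanish by
  \<open>no_eigenfunction\<close>, and with them g.\<close>

theorem fredholm_det_KB_nonzero: "fredholm_det pos_half_line KB \<noteq> 0"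
proof
  assume "fredholm_det pos_half_line KB = 0"
  from fredholm_kernel.eigenfunction[OF fredholm_kernel_KB this]
  obtain g C where g: "g \<in> borel_measurable pos_half_line" and C: "\<And>s. 0 < s \<Longrightarrow> norm (g s) \<le> C * (CB * exp (- s))"
    and nz: "\<exists>s>0. g s \<noteq> 0" and eig: "\<And>s. 0 < s \<Longrightarrow> g s = (LINT r|pos_half_line. KB s r * g r)"
    unfolding space_pos_half_line greaterThan_iff Ball_def Bex_def by blast
  define f where "f s = indicator {0<..} s *\<^sub>R g s" for s
  have f: "decaying f"
    unfolding decaying_def
  proof (intro conjI exI[of _ "\<bar>C\<bar> * CB"] allI)
    show "f \<in> borel_measurable borel"
      using g unfolding f_def[abs_def] by (subst (asm) borel_measurable_restrict_space_iff) auto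
    show "0 \<le> \<bar>C\<bar> * CB" using CB_pos by simp
    show "norm (f t) \<le> \<bar>C\<bar> * CB * (indicator {0<..} t * exp (- t))" for t
    proof (cases "0 < t")
      case True
      have "C * (CB * exp (- t)) \<le> \<bar>C\<bar> * (CB * exp (- t))" using CB_pos by (intro mult_right_mono) auto
      then show ?thesis using C[OF True] True by (simp add: f_def mult_ac)
    qed (simp add: f_def)
  qed
  define f' where "f' s = indicator {0<..} s * T f s" for s
  have f': "decaying f'" unfolding f'_def[abs_def] by (rule decaying_T[OF f])
  have Tf: "T f s = f' s" if "0 < s" for s using that by (simp add: f'_def)
  have Tf': "T f' s = f s" if s: "0 < s" for s
  proof -
    have "f s = (LINT r|pos_half_line. KB s r * g r)" using eig[OF s] s by (simp add: f_def)
    also have "\<dots> = (LINT r|pos_half_line. KB s r * f r)"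
      by (intro lint_cong) (simp add: f_def)
    also have "\<dots> = T f' s" unfolding f'_def[abs_def] by (rule KB_eq_T_T[OF f s])
    finally show ?thesis ..
  qed
  have "f s + f' s = 0" for s
  proof (rule no_eigenfunction[OF decaying_add[OF f f'], where \<sigma> = 1])
    show "T (\<lambda>s. f s + f' s) s = 1 * (f s + f' s)" if "0 < s" for s
      unfolding T_def[of "\<lambda>s. f s + f' s"] distrib_left
      using Bochner_Integration.integral_add[OF integrable_B_mult[OF f] integrable_B_mult[OF f'], of s s] Tf[OF that] Tf'[OF that]
      by (simp add: T_def)
  qed simp
  moreover have "f s - f' s = 0" for s
  proof (rule no_eigenfunction[OF decaying_diff[OF f f'], where \<sigma> = "- 1"])
    show "T (\<lambda>s. f s - f' s) s = - 1 * (f s - f' s)" if "0 < s" for s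
      unfolding T_def[of "\<lambda>s. f s - f' s"] right_diff_distrib
      using Bochner_Integration.integral_diff[OF integrable_B_mult[OF f] integrable_B_mult[OF f'], of s s] Tf[OF that] Tf'[OF that]
      by (simp add: T_def)
  qed simp
  ultimately have "(f s + f' s) + (f s - f' s) = 0" for s by simp
  then have f0: "f s = 0" for s by simp
  obtain s where "0 < s" "g s \<noteq> 0" using nz by blast
  then show False using f0[of s] by (simp add: f_def)
qed

end

text \<open>The substitution u = w + a removes the quadratic term of the phase and moves the line
  from \<delta> to \<delta> + a.\<close>

lemma airy_phase_shift:
  fixes a :: real
  shows "airy_phase \<tau> (2 * \<tau> * a) (vline \<delta> y) + of_real s * vline \<delta> y =
    of_real (a * s + 2 / 3 * \<tau> * a ^ 3) + (airy_phase \<tau> 0 (vline (\<delta> + a) y) + of_real (s + \<tau> * a\<^sup>2) * vline (\<delta> + a) y)"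
proof -
  have v: "vline \<delta> y = vline (\<delta> + a) y + of_real a" by (simp add: vline_eq)
  show ?thesis unfolding v airy_phase_def by (simp add: field_simps power2_eq_square power3_eq_cube)
qed

text \<open>
  Completing the cube in the phase removes \<open>\<gamma>\<close> up to an exponential factor, by which the kernel gets
  conjugated.
\<close>

lemma Airy_gamma_shift:
  assumes \<theta>: "\<theta>1 \<in> {pi/2<..<5*pi/6}" "\<theta>2 \<in> {pi/2<..<5*pi/6}" and \<tau>: "0 < \<tau>"
  shows "Airy_gamma \<theta>1 \<theta>2 \<tau> (2 * \<tau> * a) s = of_real (exp (a * s + 2 / 3 * \<tau> * a ^ 3)) * Airy_gamma \<theta>1 \<theta>2 \<tau> 0 (s + \<tau> * a\<^sup>2)"
proof -
  obtain \<kappa> where \<kappa>: "0 < \<kappa>" and Airy: "\<And>\<tau> \<gamma> \<delta> s. 0 < \<tau> \<Longrightarrow> 0 < \<delta> \<Longrightarrow> 6 * \<bar>\<gamma>\<bar> < \<tau> * \<kappa> * \<delta> \<Longrightarrow>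
     Airy_gamma \<theta>1 \<theta>2 \<tau> \<gamma> s = of_real (1 / (2 * pi)) * (LINT y|lborel. exp (airy_phase \<tau> \<gamma> (vline \<delta> y) + of_real s * vline \<delta> y))"
    using Airy_gamma_vline[OF \<theta>] by auto
  \<comment> \<open>The quotient is large enough for \<gamma> = 2 \<tau> a on the line at \<delta>;
    the summand |a| keeps the shifted line at \<delta> + a in the left half plane.\<close>
  define \<delta> where "\<delta> = (6 * \<bar>2 * \<tau> * a\<bar> + 1) / (\<tau> * \<kappa>) + \<bar>a\<bar>"
  have p: "0 < (6 * \<bar>2 * \<tau> * a\<bar> + 1) / (\<tau> * \<kappa>)" using \<tau> \<kappa> by (intro divide_pos_pos add_nonneg_pos) auto
  have \<delta>: "0 < \<delta>" "0 < \<delta> + a" using p unfolding \<delta>_def by linarith+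
  have "\<tau> * \<kappa> * (X / (\<tau> * \<kappa>) + \<bar>a\<bar>) = X + \<tau> * \<kappa> * \<bar>a\<bar>" for X using \<tau> \<kappa> by (simp add: distrib_left)
  then have "\<tau> * \<kappa> * \<delta> = 6 * \<bar>2 * \<tau> * a\<bar> + 1 + \<tau> * \<kappa> * \<bar>a\<bar>" unfolding \<delta>_def .
  moreover have "0 \<le> \<tau> * \<kappa> * \<bar>a\<bar>" using \<tau> \<kappa> by simp
  ultimately have b: "6 * \<bar>2 * \<tau> * a\<bar> < \<tau> * \<kappa> * \<delta>" by linarith
  have b0: "6 * \<bar>0::real\<bar> < \<tau> * \<kappa> * (\<delta> + a)" using \<tau> \<kappa> \<delta> by simp
  show ?thesis
    unfolding Airy[OF \<tau> \<delta>(1) b] Airy[OF \<tau> \<delta>(2) b0] airy_phase_shift exp_add[of "of_real (a * s + 2 / 3 * \<tau> * a ^ 3)"]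
    unfolding exp_of_real lint_cmult by (rule mult.left_commute)
qed

text \<open>The two Airy factors use a and - a: they share the shift \<tau> a^2, their cubic
  constants cancel, and the factors exp (- a s) and exp (a t) conjugate the kernel, which leaves all
  principal minors unchanged. For a = \<gamma> / (2 \<tau>) the shift is \<gamma>^2 / (4
  \<tau>).\<close>

lemma D_KPZ_shift:
  assumes \<theta>: "\<theta>1 \<in> {pi/2<..<5*pi/6}" "\<theta>2 \<in> {pi/2<..<5*pi/6}" and \<tau>: "0 < \<tau>"
  shows "D_KPZ \<theta>1 \<theta>2 \<tau> (2 * \<tau> * a) x = D_KPZ \<theta>1 \<theta>2 \<tau> 0 (x + \<tau> * a\<^sup>2)"
proof -
  have K: "K_KPZ \<theta>1 \<theta>2 \<tau> (2 * \<tau> * a) x s t = of_real (exp (- (a * s))) * K_KPZ \<theta>1 \<theta>2 \<tau> 0 (x + \<tau> * a\<^sup>2) s t * of_real (exp (a * t))" for s t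
  proof -
    let ?A = "Airy_gamma \<theta>1 \<theta>2 \<tau> 0"
    have m: "Airy_gamma \<theta>1 \<theta>2 \<tau> (- (2 * \<tau> * a)) u = of_real (exp (- a * u - 2 / 3 * \<tau> * a ^ 3)) * ?A (u + \<tau> * a\<^sup>2)" for u
      using Airy_gamma_shift[OF \<theta> \<tau>, of "- a" u] by simp
    have "K_KPZ \<theta>1 \<theta>2 \<tau> (2 * \<tau> * a) x s t = (LINT r|pos_half_line. of_real (exp (a * (t - s))) * (?A (s + (x + \<tau> * a\<^sup>2) + r) * ?A (r + (x + \<tau> * a\<^sup>2) + t)))"
      unfolding K_KPZ_def kernel_comp_def A_kernel_def m Airy_gamma_shift[OF \<theta> \<tau>]
    proof (intro lint_cong)
      fix r
      have "exp (- a * (s + x + r) - 2 / 3 * \<tau> * a ^ 3) * exp (a * (r + x + t) + 2 / 3 * \<tau> * a ^ 3) = exp (a * (t - s))"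
        unfolding exp_add[symmetric] by (simp add: algebra_simps)
      then have e1: "complex_of_real (exp (- a * (s + x + r) - 2 / 3 * \<tau> * a ^ 3)) * of_real (exp (a * (r + x + t) + 2 / 3 * \<tau> * a ^ 3)) = of_real (exp (a * (t - s)))"
        unfolding of_real_mult[symmetric] by (rule arg_cong)
      have e2: "s + x + r + \<tau> * a\<^sup>2 = s + (x + \<tau> * a\<^sup>2) + r" "r + x + t + \<tau> * a\<^sup>2 = r + (x + \<tau> * a\<^sup>2) + t" by simp_all
      have e3: "(e1 * A1) * (e2 * A2) = e * (A1 * A2)" if "e1 * e2 = e" for e1 e2 e A1 A2 :: complex
        unfolding that[symmetric] by (simp only: mult_ac)
      show "of_real (exp (- a * (s + x + r) - 2 / 3 * \<tau> * a ^ 3)) * ?A (s + x + r + \<tau> * a\<^sup>2) *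
          (of_real (exp (a * (r + x + t) + 2 / 3 * \<tau> * a ^ 3)) * ?A (r + x + t + \<tau> * a\<^sup>2)) =
        of_real (exp (a * (t - s))) * (?A (s + (x + \<tau> * a\<^sup>2) + r) * ?A (r + (x + \<tau> * a\<^sup>2) + t))"
        unfolding e2 by (rule e3[OF e1])
    qed
    also have "\<dots> = of_real (exp (a * (t - s))) * K_KPZ \<theta>1 \<theta>2 \<tau> 0 (x + \<tau> * a\<^sup>2) s t"
      unfolding K_KPZ_def kernel_comp_def A_kernel_def minus_zero by (rule lint_cmult)
    also have "exp (a * (t - s)) = exp (- (a * s)) * exp (a * t)" unfolding exp_add[symmetric] by (simp add: algebra_simps)
    finally show ?thesis by (simp add: mult_ac)
  qed
  have "mdet n (\<lambda>i j. K_KPZ \<theta>1 \<theta>2 \<tau> (2 * \<tau> * a) x (p i) (p j)) =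
    mdet n (\<lambda>i j. K_KPZ \<theta>1 \<theta>2 \<tau> 0 (x + \<tau> * a\<^sup>2) (p i) (p j))" for n p
  proof -
    have one: "(\<Prod>i<n. complex_of_real (exp (- (a * p i)))) * (\<Prod>j<n. of_real (exp (a * p j))) = 1"
      unfolding prod.distrib[symmetric] of_real_mult[symmetric] exp_add[symmetric] by simp
    show ?thesis unfolding K
      using det_scale_rows_cols[of n "\<lambda>i. complex_of_real (exp (- (a * p i)))" "\<lambda>i j. K_KPZ \<theta>1 \<theta>2 \<tau> 0 (x + \<tau> * a\<^sup>2) (p i) (p j)" "\<lambda>j. of_real (exp (a * p j))"]
      unfolding one by simp
  qed
  then show ?thesis unfolding D_KPZ_def fredholm_det_def by simp
qed

theorem D_KPZ_nonzero:
  assumes \<theta>: "\<theta>1 \<in> {pi/2<..<5*pi/6}" "\<theta>2 \<in> {pi/2<..<5*pi/6}" and \<tau>: "0 < \<tau>"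
  shows "D_KPZ \<theta>1 \<theta>2 \<tau> \<gamma> x \<noteq> 0"
proof -
  define a where "a = \<gamma> / (2 * \<tau>)"
  have \<gamma>: "\<gamma> = 2 * \<tau> * a" using \<tau> by (simp add: a_def)
  define x' where "x' = x + \<tau> * a\<^sup>2"
  obtain \<kappa> where \<kappa>: "0 < \<kappa>" and Airy: "\<And>\<tau> \<gamma> \<delta> s. 0 < \<tau> \<Longrightarrow> 0 < \<delta> \<Longrightarrow> 6 * \<bar>\<gamma>\<bar> < \<tau> * \<kappa> * \<delta> \<Longrightarrow>
     Airy_gamma \<theta>1 \<theta>2 \<tau> \<gamma> s = of_real (1 / (2 * pi)) * (LINT y|lborel. exp (airy_phase \<tau> \<gamma> (vline \<delta> y) + of_real s * vline \<delta> y))"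
    using Airy_gamma_vline[OF \<theta>] by auto
  define B where "B s = Airy_gamma \<theta>1 \<theta>2 \<tau> 0 (s + x')" for s
  have B: "B s = (LINT y|lborel. airy_wt \<delta> \<tau> 0 x' y * exp (of_real s * vline \<delta> y))" if \<delta>: "0 < \<delta>" for \<delta> s
  proof -
    have "B s = (LINT y|lborel. of_real (1 / (2 * pi)) * exp (airy_phase \<tau> 0 (vline \<delta> y) + of_real (s + x') * vline \<delta> y))"
      unfolding B_def using \<tau> \<kappa> \<delta> by (subst Airy[OF \<tau> \<delta>]) auto
    also have "\<dots> = (LINT y|lborel. airy_wt \<delta> \<tau> 0 x' y * exp (of_real s * vline \<delta> y))"
      by (intro lint_cong) (simp add: airy_wt_def exp_add[symmetric] algebra_simps)
    finally show ?thesis .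
  qed
  have "D_KPZ \<theta>1 \<theta>2 \<tau> \<gamma> x = D_KPZ \<theta>1 \<theta>2 \<tau> 0 x'" unfolding \<gamma> x'_def by (rule D_KPZ_shift[OF \<theta> \<tau>])
  also have "\<dots> = fredholm_det pos_half_line (KB B)"
  proof -
    have "K_KPZ \<theta>1 \<theta>2 \<tau> 0 x' = KB B"
    proof (intro ext)
      fix s t
      have shift: "s + x' + r = s + r + x'" "r + x' + t = r + t + x'" for r by simp_all
      have "KB B s t = (LINT r|pos_half_line. B (s + r) * B (r + t))" by (rule KB_eq[OF \<tau>]) (rule B)
      then show "K_KPZ \<theta>1 \<theta>2 \<tau> 0 x' s t = KB B s t"
        unfolding K_KPZ_def kernel_comp_def A_kernel_def minus_zero B_def by (simp only: shift)
    qed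
    then show ?thesis unfolding D_KPZ_def by (rule arg_cong)
  qed
  also have "\<dots> \<noteq> 0" by (rule fredholm_det_KB_nonzero[OF \<tau>]) (rule B)
  finally show ?thesis .
qed

theorem corollary1p3:
  shows
    "(\<forall>z::complex. 0 < norm z \<and> norm z < 1 \<longrightarrow>
        (\<forall>\<tau> \<gamma> x. 0 < \<tau> \<and> D_per z \<tau> \<gamma> x \<noteq> 0 \<longrightarrow>
           has_dxx_log (D_per z \<tau> \<gamma>) (U_per z \<tau> \<gamma> x) x) \<and>
        KPII_solution_on {(\<tau>, \<gamma>, x). 0 < \<tau> \<and> D_per z \<tau> \<gamma> x \<noteq> 0} (U_per z)) \<and>
     (\<forall>\<theta>1\<in>{pi/2<..<5*pi/6}. \<forall>\<theta>2\<in>{pi/2<..<5*pi/6}.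
        (\<forall>\<tau> \<gamma> x. 0 < \<tau> \<longrightarrow>
           has_dxx_log (D_KPZ \<theta>1 \<theta>2 \<tau> \<gamma>) (U_KPZ \<theta>1 \<theta>2 \<tau> \<gamma> x) x) \<and>
        KPII_solution_on {(\<tau>, \<gamma>, x). 0 < \<tau>} (U_KPZ \<theta>1 \<theta>2))"
proof (intro conjI)
  show "\<forall>z::complex. 0 < norm z \<and> norm z < 1 \<longrightarrow>
      (\<forall>\<tau> \<gamma> x. 0 < \<tau> \<and> D_per z \<tau> \<gamma> x \<noteq> 0 \<longrightarrow> has_dxx_log (D_per z \<tau> \<gamma>) (U_per z \<tau> \<gamma> x) x) \<and>
      KPII_solution_on {(\<tau>, \<gamma>, x). 0 < \<tau> \<and> D_per z \<tau> \<gamma> x \<noteq> 0} (U_per z)"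
  proof (intro allI impI)
    fix z :: complex assume z: "0 < norm z \<and> norm z < 1"
    have U: "U_per z = (\<lambda>\<tau> \<gamma> x. dxx_log (D_per z \<tau> \<gamma>) x)" by (intro ext) (rule U_per_def)
    note gas = per_gas_representation[OF conjunct1[OF z] conjunct2[OF z]]
    show "(\<forall>\<tau> \<gamma> x. 0 < \<tau> \<and> D_per z \<tau> \<gamma> x \<noteq> 0 \<longrightarrow> has_dxx_log (D_per z \<tau> \<gamma>) (U_per z \<tau> \<gamma> x) x) \<and>
      KPII_solution_on {(\<tau>, \<gamma>, x). 0 < \<tau> \<and> D_per z \<tau> \<gamma> x \<noteq> 0} (U_per z)"
      unfolding U using KPII_from_gas[OF gas] by blast
  qed
  show "\<forall>\<theta>1\<in>{pi/2<..<5*pi/6}. \<forall>\<theta>2\<in>{pi/2<..<5*pi/6}.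
      (\<forall>\<tau> \<gamma> x. 0 < \<tau> \<longrightarrow> has_dxx_log (D_KPZ \<theta>1 \<theta>2 \<tau> \<gamma>) (U_KPZ \<theta>1 \<theta>2 \<tau> \<gamma> x) x) \<and>
      KPII_solution_on {(\<tau>, \<gamma>, x). 0 < \<tau>} (U_KPZ \<theta>1 \<theta>2)"
  proof (intro ballI)
    fix \<theta>1 \<theta>2 :: real assume \<theta>: "\<theta>1 \<in> {pi/2<..<5*pi/6}" "\<theta>2 \<in> {pi/2<..<5*pi/6}"
    have U: "U_KPZ \<theta>1 \<theta>2 = (\<lambda>\<tau> \<gamma> x. dxx_log (D_KPZ \<theta>1 \<theta>2 \<tau> \<gamma>) x)" by (intro ext) (rule U_KPZ_def)
    have dom: "{(\<tau>, \<gamma>, x). 0 < \<tau>} = {(\<tau>, \<gamma>, x). 0 < \<tau> \<and> D_KPZ \<theta>1 \<theta>2 \<tau> \<gamma> x \<noteq> 0}"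
      using D_KPZ_nonzero[OF \<theta>] by auto
    note gas = KPZ_gas_representation[OF \<theta>]
    show "(\<forall>\<tau> \<gamma> x. 0 < \<tau> \<longrightarrow> has_dxx_log (D_KPZ \<theta>1 \<theta>2 \<tau> \<gamma>) (U_KPZ \<theta>1 \<theta>2 \<tau> \<gamma> x) x) \<and>
      KPII_solution_on {(\<tau>, \<gamma>, x). 0 < \<tau>} (U_KPZ \<theta>1 \<theta>2)"
      unfolding U dom using KPII_from_gas[OF gas] D_KPZ_nonzero[OF \<theta>] by blast
  qed
qed

end
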